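(* Let $\alpha$ be an arbitrary real number with $\alpha<1/3$. There exist $c<5/6$ and $\eta>0$ such that for all $Q<X^\alpha$, with $r=QX^{\eta-1/6}$, we have $$X^{5/6}\sum_{q\in[Q,2Q]}\ \sum_{0\neq f\in V(\mathbb Z)\cap rB}|\widehat{\Phi_q}(f)|\ \ll\ X^{c},$$ where $q$ runs through squarefree integers and the implied constant may depend on $\alpha$, $c$ and $\eta$ (but not on $Q$ or $X$).
   Context: For a ring $R$, $V(R)$ is the set of binary quartic forms $f=a_0x^4+a_1x^3y+a_2x^2y^2+a_3xy^3+a_4y^4$ with $a_i\in R$. With $I(f)=12a_0a_4-3a_1a_3+a_2^2$ and $J(f)=72a_0a_2a_4+9a_1a_2a_3-27(a_0a_3^2+a_1^2a_4)-2a_2^3$, the discriminant is $\mathrm{Disc}(f)=(4I(f)^3-J(f)^2)/27$, an integer polynomial in the $a_i$. $B\subset V(\mathbb R)$ is the box of side length $2$ centered at the origin, so $rB$ is the set of forms all of whose coefficients have absolute value at most $r$. For squarefree $q\ge1$, $\Phi_q\colon V(\mathbb Z/q\mathbb Z)\to\{0,1\}$ is the indicator function of those $f$ with $\mathrm{Disc}(f)=0$ in $\mathbb Z/q\mathbb Z$. For $q$ squarefree and coprime to $6$, and $f\in V(\mathbb Z)$, $$\widehat{\Phi_q}(f)=q^{-5}\sum_{h\in V(\mathbb Z/q\mathbb Z)}\Phi_q(h)e^{2\pi i[h,f]/q},\qquad [h,f]=b_0a_0+\tfrac{b_1a_1}{4}+\tfrac{b_2a_2}{6}+\tfrac{b_3a_3}{4}+b_4a_4\in\mathbb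 Z/q\mathbb Z,$$ where $a_i$, $b_i$ are the coefficients of $f$, $h$. For general squarefree $q$ one defines $\widehat{\Phi_q}(f):=\widehat{\Phi_{q/\gcd(q,6)}}(f)$. Here $Q>0$, and the estimate $\ll$ is understood for all sufficiently large $X$, uniformly in $Q$. *)

theory Defs
  imports
    "HOL-Analysis.Analysis"
    "HOL-Computational_Algebra.Squarefree"
    "HOL-Number_Theory.Modular_Inverse"
begin

text \<open>
  The binary quartic form \<open>a0 x^4 + a1 x^3 y + a2 x^2 y^2 + a3 x y^3 + a4 y^4\<close> is given by its
  coefficients, so \<^typ>\<open>'a\<close> is the ring \<open>R\<close> of \<open>V(R)\<close>.
\<close>

datatype 'a quartic =
  Quartic (coeff0: 'a) (coeff1: 'a) (coeff2: 'a) (coeff3: 'a) (coeff4: 'a)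

instantiation quartic :: (zero) zero
begin

definition zero_quartic :: "'a quartic" where
  "0 = Quartic 0 0 0 0 0"

instance ..

end

fun quartic_I :: "'a::comm_ring_1 quartic \<Rightarrow> 'a" where
  "quartic_I (Quartic a0 a1 a2 a3 a4) = 12 * a0 * a4 - 3 * a1 * a3 + a2\<^sup>2"

fun quartic_J :: "'a::comm_ring_1 quartic \<Rightarrow> 'a" where
  "quartic_J (Quartic a0 a1 a2 a3 a4) =
     72 * a0 * a2 * a4 + 9 * a1 * a2 * a3 - 27 * (a0 * a3\<^sup>2 + a1\<^sup>2 * a4) - 2 * a2 ^ 3"

text \<open>The division is exact, by \<open>Disc_mult_27\<close> below.\<close>

definition Disc :: "int quartic \<Rightarrow> int" where
  "Disc f = (4 * quartic_I f ^ 3 - quartic_J f ^ 2) div 27"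

lemma Disc_explicit:
  "Disc (Quartic a b c d e) =
     256*a^3*e^3 - 192*a^2*b*d*e^2 - 128*a^2*c^2*e^2 + 144*a^2*c*d^2*e - 27*a^2*d^4
     + 144*a*b^2*c*e^2 - 6*a*b^2*d^2*e - 80*a*b*c^2*d*e + 18*a*b*c*d^3 + 16*a*c^4*e
     - 4*a*c^3*d^2 - 27*b^4*e^2 + 18*b^3*c*d*e - 4*b^3*d^3 - 4*b^2*c^3*e + b^2*c^2*d^2"
  (is "_ = ?D")
proof -
  have "4 * quartic_I (Quartic a b c d e) ^ 3 - quartic_J (Quartic a b c d e) ^ 2 = 27 * ?D"
    by simp algebra
  then show ?thesis
    by (simp add: Disc_def del: quartic_I.simps quartic_J.simps)
qed

lemma Disc_mult_27: "27 * Disc f = 4 * quartic_I f ^ 3 - quartic_J f ^ 2"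
proof (cases f)
  case (Quartic a b c d e)
  show ?thesis unfolding Quartic Disc_explicit by simp algebra
qed

text \<open>
  \<open>V(\<int>/q\<int>)\<close> is represented by the integral forms with coefficients in \<open>{0..<q}\<close>. The
  discriminant of a form over \<open>\<int>/q\<int>\<close> is that of any integral lift (\<open>Disc_cong\<close>); in
  particular no division by 27 in \<open>\<int>/q\<int>\<close> is involved.
\<close>

definition quartics_mod :: "nat \<Rightarrow> int quartic set" where
  "quartics_mod q = {h. set_quartic h \<subseteq> {0..<int q}}"

lemma Disc_cong:
  assumes "rel_quartic (\<lambda>a b. [a = b] (mod m)) f g"
  shows "[Disc f = Disc g] (mod m)"
proof (cases f; cases g)
  fix a b c d e a' b' c' d' e'
  assume fg: "f = Quartic a b c d e" "g = Quartic a' b' c' d' e'"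
  show ?thesis
    using assms unfolding fg Disc_explicit
    by (auto intro!: cong_add cong_diff cong_mult cong_pow)
qed

definition Phi :: "nat \<Rightarrow> int quartic \<Rightarrow> real" where
  "Phi q f = (if [Disc f = 0] (mod int q) then 1 else 0)"

text \<open>
  The pairing \<open>[h, f]\<close> in \<open>\<int>/q\<int>\<close>, as its representative in \<open>{0..<q}\<close>; \<open>1/4\<close> and \<open>1/6\<close> are
  inverses modulo \<open>q\<close>, so this is only meaningful for \<open>q\<close> coprime to 6.
\<close>

fun pairing_mod :: "nat \<Rightarrow> int quartic \<Rightarrow> int quartic \<Rightarrow> int" where
  "pairing_mod q (Quartic b0 b1 b2 b3 b4) (Quartic a0 a1 a2 a3 a4) =
     (b0 * a0 + b1 * a1 * modular_inverse (int q) 4 + b2 * a2 * modular_inverse (int q) 6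
      + b3 * a3 * modular_inverse (int q) 4 + b4 * a4) mod int q"

definition Phi_hat_coprime :: "nat \<Rightarrow> int quartic \<Rightarrow> complex" where
  "Phi_hat_coprime q f =
     1 / of_nat q ^ 5 *
     (\<Sum>h\<in>quartics_mod q.
        of_real (Phi q h) * exp (2 * of_real pi * \<i> * of_int (pairing_mod q h f) / of_nat q))"

definition Phi_hat :: "nat \<Rightarrow> int quartic \<Rightarrow> complex" where
  "Phi_hat q f = Phi_hat_coprime (q div gcd q 6) f"

text \<open>\<open>V(\<int>) \<inter> rB\<close>\<close>

definition quartic_box :: "real \<Rightarrow> int quartic set" where
  "quartic_box r = {f. \<forall>a\<in>set_quartic f. \<bar>real_of_int a\<bar> \<le> r}"

text \<open>The index sets are finite, so no sum over them collapses to 0 by convention.\<close>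

lemma finite_quartics_coeffs:
  assumes "finite A"
  shows "finite {f. set_quartic f \<subseteq> A}"
proof (rule finite_subset)
  show "{f. set_quartic f \<subseteq> A} \<subseteq>
      (\<lambda>(a, b, c, d, e). Quartic a b c d e) ` (A \<times> A \<times> A \<times> A \<times> A)"
  proof
    fix f assume "f \<in> {f. set_quartic f \<subseteq> A}"
    then show "f \<in> (\<lambda>(a, b, c, d, e). Quartic a b c d e) ` (A \<times> A \<times> A \<times> A \<times> A)"
      by (cases f) (auto simp: image_iff)
  qed
  show "finite ((\<lambda>(a, b, c, d, e). Quartic a b c d e) ` (A \<times> A \<times> A \<times> A \<times> A))"
    using assms by simp
qed

lemma finite_quartics_mod: "finite (quartics_mod q)"
  unfolding quartics_mod_def by (rule finite_quartics_coeffs) simp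

lemma finite_quartic_box: "finite (quartic_box r)"
proof (rule finite_subset)
  show "quartic_box r \<subseteq> {f. set_quartic f \<subseteq> {- \<lfloor>r\<rfloor>..\<lfloor>r\<rfloor>}}"
    by (fastforce simp: quartic_box_def le_floor_iff abs_le_iff minus_le_iff)
qed (rule finite_quartics_coeffs, simp)

lemma finite_modulus_range: "finite {q::nat. squarefree q \<and> Q \<le> real q \<and> real q \<le> 2 * Q}"
  by (rule finite_subset[of _ "{..nat \<lfloor>2 * Q\<rfloor>}"]) (auto simp: le_nat_floor)

end

theory Submission
  imports
    Defs
    "HOL-Computational_Algebra.Polynomial_Factorial"
    "HOL-Number_Theory.Euler_Criterion"
begin

text \<open>
For \<open>q\<close> coprime to 6, \<open>q^5\<close> times the Fourier coefficient at \<open>f\<close> is, up to the unit 12 in the pairing, the exponential sum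
of the pairing with \<open>f\<close> over the singular forms modulo \<open>q\<close> (\<open>Phi_hat_coprime_eq\<close>). It is multiplicative in \<open>q\<close>, so the
arithmetic input concerns a prime \<open>p \<ge> 5\<close>, and the rest is a count of forms.

A singular form over the prime field has a double root there or is a constant times the square of a
quadratic form \<open>g\<close>, and its number of double roots is 1 except that \<open>c * g\<^sup>2\<close> has \<open>1 + chi (disc g)\<close>. Hence the indicator of
the singular forms is the number of double roots, corrected by \<open>chi (disc g)\<close> on the scaled squares and by \<open>p\<close> at 0
(\<open>singular_indicator_identity\<close>). The forms with a fixed double root are a linear space of dimension three, so the first
part transforms into \<open>p^3\<close> times a number of triple roots of \<open>f\<close>, which is zero unless \<open>p\<close> divides both invariants. The
correction transforms into sums of \<open>chi (y\<^sup>2 - 4 x z)\<close> against a ternary quadratic form attached to \<open>f\<close>. Writing \<open>chi\<close> as a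
sum of additive characters produces ternary Gauss sums for a pencil of quadratic forms, whose determinant is the
resolvent cubic of \<open>f\<close>; they leave the character sum of \<open>J u^3 + 3 I u\<^sup>2 - 1\<close>. Its square-root cancellation
(\<open>cubic_character_sum_bound\<close>) is proved by Stepanov's method. For generic \<open>f\<close> the exponential sum is therefore
\<open>O(p powr (3/2))\<close>, and the losses for special \<open>f\<close> are recorded by \<open>weight\<close>: a factor \<open>p powr (1/2)\<close> if \<open>p\<close> divides
\<open>quartic_K f\<close>, in place of which \<open>p powr (3/2)\<close> occurs if \<open>p\<close> divides both invariants and \<open>p powr (5/2)\<close> if it divides \<open>f\<close>.

It remains to sum products of gcds over the forms with coefficients up to \<open>N\<close> and the moduli up to \<open>M\<close>
(\<open>weight_sum\<close>). A common factor of \<open>q\<close> and \<open>f\<close> can be divided out, and the gcds are then bounded on average by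
divisor functions, provided that the integers involved are not zero. The exceptions lie on hypersurfaces, or have both
invariants zero; the latter forms have a triple root, and only about \<open>N\<^sup>2\<close> of them exist. Up to divisor functions the total is
\<open>N^5 M + N^4 M powr (3/2) + N\<^sup>2 M powr (5/2)\<close>.

Let \<open>M\<close> be about \<open>Q\<close> and \<open>N\<close> about \<open>r\<close>. The normalised exponential sums are of size \<open>Q powr (-7/2)\<close>, so if
\<open>r\<^sup>2 \<le> Q\<close> all three terms are \<open>O(r\<^sup>2 / Q)\<close>. For \<open>r = Q * X powr (\<eta> - 1/6)\<close> this quotient is \<open>Q * X powr (2 \<eta> - 1/3)\<close>, a
negative power of \<open>X\<close> as soon as \<open>Q < X powr \<alpha>\<close> with \<open>\<alpha> < 1/3\<close> and \<open>\<eta>\<close> is small.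
\<close>

hide_const (open) up_ring.coeff up_ring.monom module.smult

section \<open>Integer polynomials modulo a prime\<close>

lemma prime_elem_const_int:
  assumes "prime p" shows "prime_elem [:int p:]"
  using assms by (simp add: prime_elem_const_poly_iff)

lemma const_dvd_iff: "[:c:] dvd (f :: int poly) \<longleftrightarrow> (\<forall>n. c dvd coeff f n)"
  by (rule const_poly_dvd_iff)

lemma const_dvd_mult_iff:
  assumes "prime p"
  shows "[:int p:] dvd f * g \<longleftrightarrow> [:int p:] dvd f \<or> [:int p:] dvd (g :: int poly)"
  using prime_elem_dvd_mult_iff[OF prime_elem_const_int[OF assms]] .

lemma const_not_dvd_linear:
  assumes "prime p" shows "\<not> [:int p:] dvd [:a, 1:]"
proof
  assume "[:int p:] dvd [:a, 1:]"
  then have "int p dvd coeff [:a, 1:] 1" unfolding const_dvd_iff by blast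
  then show False using assms by (simp add: not_prime_unit)
qed

lemma const_dvd_poly: "[:c:] dvd (f :: int poly) \<Longrightarrow> c dvd poly f x"
  by (auto elim!: dvdE)

lemma linear_factor_mod:
  assumes "p dvd poly (u :: int poly) x"
  shows "[:p:] dvd u - [:-x, 1:] * synthetic_div u x"
proof -
  have "u - [:-x, 1:] * synthetic_div u x = [:poly u x:]"
    using synthetic_div_correct'[of x u] by (simp add: algebra_simps)
  then show ?thesis using assms by simp
qed

lemma diff_swap_aux: "(a :: int poly) - b = c - b - (c - a)"
  by simp

lemma exchange_factor: "X * (r1 - Y * v1) = (r - Y * v) - (r - X * r1) + Y * (v - X * v1)"
  for X :: "'a :: comm_ring_1"
  by (simp add: algebra_simps)

lemma pcompose_1': "pcompose (1 :: int poly) q = 1"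
  by (simp add: one_pCons)

lemma pcompose_monom_1: "pcompose (monom 1 l) q = q ^ l" for q :: "int poly"
  by (induction l) (simp_all add: monom_Suc pcompose_pCons pcompose_1')

text \<open>A polynomial over a field has at most its degree many zeros, counted with multiplicity; here the
field is \<open>\<int>/p\<int>\<close>, and an order of vanishing is a congruence \<open>r = (X - x)^n u\<close> modulo \<open>p\<close> between integer
polynomials, so that no second coefficient ring is involved. The induction splits off one factor
\<open>X - x\<close>; the congruences at the other points survive because \<open>X - x\<close> does not vanish there.\<close>

lemma sum_orders_le_degree:
  fixes r :: "int poly"
  assumes p: "prime p" and S: "finite S"
    and dist: "\<And>x y. x \<in> S \<Longrightarrow> y \<in> S \<Longrightarrow> int p dvd x - y \<Longrightarrow> x = y"
    and nz: "\<not> [:int p:] dvd r"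
    and ord: "\<And>x. x \<in> S \<Longrightarrow> \<exists>u. [:int p:] dvd r - [:-x, 1:] ^ n x * u"
  shows "(\<Sum>x\<in>S. n x) \<le> degree r"
  using nz ord
proof (induction "degree r" arbitrary: r n rule: less_induct)
  case less
  show ?case
  proof (cases "\<exists>x\<in>S. n x > 0")
    case False
    then show ?thesis by simp
  next
    case True
    then obtain x where x: "x \<in> S" "n x > 0" by blast
    obtain u where u: "[:int p:] dvd r - [:-x, 1:] ^ n x * u" using less.prems(2) x by blast
    have "int p dvd poly (r - [:-x, 1:] ^ n x * u) x" using const_dvd_poly[OF u] .
    then have px: "int p dvd poly r x" using x(2) by (simp add: zero_power)
    define r1 where "r1 = synthetic_div r x"
    have r1: "[:int p:] dvd r - [:-x, 1:] * r1"
      using linear_factor_mod[OF px] unfolding r1_def .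
    have r1nz: "\<not> [:int p:] dvd r1"
    proof
      assume "[:int p:] dvd r1"
      then have "[:int p:] dvd (r - [:-x, 1:] * r1) + [:-x, 1:] * r1"
        using r1 by (intro dvd_add dvd_mult)
      then show False using less.prems(1) by simp
    qed
    have "degree r \<noteq> 0"
    proof
      assume "degree r = 0"
      then have "r1 = 0" unfolding r1_def using synthetic_div_eq_0_iff by blast
      then show False using r1nz by simp
    qed
    moreover have dr1: "degree r1 = degree r - 1"
      unfolding r1_def by (rule degree_synthetic_div)
    ultimately have lt: "degree r1 < degree r" by simp
    define n' where "n' = n(x := n x - 1)"
    have "\<exists>u. [:int p:] dvd r1 - [:-y, 1:] ^ n' y * u" if y: "y \<in> S" for y
    proof (cases "y = x")
      case True
      have "[:-x, 1:] ^ n x = [:-x, 1:] * [:-x, 1:] ^ n' x"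
        using x(2) unfolding n'_def by (simp flip: power_Suc)
      then have "[:-x, 1:] * (r1 - [:-x, 1:] ^ n' x * u)
          = (r - [:-x, 1:] ^ n x * u) - (r - [:-x, 1:] * r1)"
        by (simp only: right_diff_distrib mult.assoc diff_swap_aux)
      then have "[:int p:] dvd [:-x, 1:] * (r1 - [:-x, 1:] ^ n' x * u)"
        using dvd_diff[OF u r1] by (simp only:)
      then show ?thesis
        using const_dvd_mult_iff[OF p] const_not_dvd_linear[OF p] True by blast
    next
      case False
      obtain v where v: "[:int p:] dvd r - [:-y, 1:] ^ n y * v" using less.prems(2) y by blast
      have "int p dvd poly (r - [:-y, 1:] ^ n y * v) x" using const_dvd_poly[OF v] .
      then have "int p dvd poly r x - poly (r - [:-y, 1:] ^ n y * v) x"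
        using px by (rule dvd_diff[rotated])
      then have "int p dvd (x - y) ^ n y * poly v x" by simp
      moreover have "\<not> int p dvd (x - y)" using dist[OF x(1) y] False by auto
      ultimately have "int p dvd poly v x"
        using p by (meson prime_dvd_mult_iff prime_dvd_power prime_nat_int_transfer)
      then have v1: "[:int p:] dvd v - [:-x, 1:] * synthetic_div v x"
        by (rule linear_factor_mod)
      have "[:-x, 1:] * (r1 - [:-y, 1:] ^ n y * synthetic_div v x) =
          (r - [:-y, 1:] ^ n y * v) - (r - [:-x, 1:] * r1)
          + [:-y, 1:] ^ n y * (v - [:-x, 1:] * synthetic_div v x)"
        by (rule exchange_factor)
      then have "[:int p:] dvd [:-x, 1:] * (r1 - [:-y, 1:] ^ n y * synthetic_div v x)"
        using dvd_add[OF dvd_diff[OF v r1] dvd_mult[OF v1, of "[:-y, 1:] ^ n y"]] by (simp only:)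
      then show ?thesis
        using const_dvd_mult_iff[OF p] const_not_dvd_linear[OF p] False unfolding n'_def fun_upd_other[OF False] by blast
    qed
    then have "(\<Sum>x\<in>S. n' x) \<le> degree r1" using less.hyps[OF lt r1nz] by blast
    moreover have "(\<Sum>x\<in>S. n x) = (\<Sum>x\<in>S. n' x) + 1"
      using x S unfolding n'_def by (simp add: sum.remove)
    ultimately show ?thesis using lt by linarith
  qed
qed

lemma higher_pderiv_shift:
  "(pderiv ^^ k) (pcompose r [:x, 1:]) = pcompose ((pderiv ^^ k) r) [:x, 1:]"
  for r :: "int poly"
  by (induction k) (simp_all add: pderiv_pcompose pderiv_pCons)

text \<open>The \<open>k\<close>-th Taylor coefficient at \<open>x\<close> is the \<open>k\<close>-th derivative divided by \<open>k!\<close>, and \<open>k!\<close> is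
prime to \<open>p\<close> for \<open>k < p\<close>: this is why the order is limited to \<open>l \<le> p\<close>.\<close>

lemma order_from_derivatives:
  fixes r :: "int poly"
  assumes p: "prime p" and l: "l \<le> p"
    and der: "\<And>k. k < l \<Longrightarrow> int p dvd poly ((pderiv ^^ k) r) x"
  shows "\<exists>u. [:int p:] dvd r - [:-x, 1:] ^ l * u"
proof -
  define q where "q = pcompose r [:x, 1:]"
  have cq: "int p dvd coeff q k" if "k < l" for k
  proof -
    have "poly ((pderiv ^^ k) q) 0 = poly ((pderiv ^^ k) r) x"
      unfolding q_def higher_pderiv_shift by (simp add: poly_pcompose)
    moreover have "poly ((pderiv ^^ k) q) 0 = fact k * coeff q k"
      by (simp add: poly_0_coeff_0 coeff_higher_pderiv pochhammer_fact)
    ultimately have "int p dvd fact k * coeff q k" using der[OF that] by simp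
    moreover have "\<not> int p dvd fact k"
    proof -
      have "\<not> p dvd fact k" using prime_dvd_fact_iff[OF p, of k] that l by simp
      then show ?thesis by (metis of_nat_dvd_iff of_nat_fact)
    qed
    ultimately show ?thesis using p by (meson prime_dvd_mult_iff prime_nat_int_transfer)
  qed
  have split: "q = poly_cutoff l q + monom 1 l * poly_shift l q"
    by (rule poly_eqI) (simp add: coeff_poly_cutoff coeff_monom_mult coeff_poly_shift)
  have "[:int p:] dvd poly_cutoff l q"
    unfolding const_dvd_iff by (simp add: coeff_poly_cutoff cq)
  then obtain w where w: "poly_cutoff l q = [:int p:] * w" by (elim dvdE)
  have "r = pcompose q [:-x, 1:]"
    unfolding q_def by (simp add: pcompose_pCons flip: pcompose_assoc)
  also have "\<dots> = pcompose (poly_cutoff l q) [:-x, 1:]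
       + [:-x, 1:] ^ l * pcompose (poly_shift l q) [:-x, 1:]"
    by (subst split) (simp add: pcompose_add pcompose_mult pcompose_monom_1)
  finally have "r - [:-x, 1:] ^ l * pcompose (poly_shift l q) [:-x, 1:]
      = [:int p:] * pcompose w [:-x, 1:]"
    unfolding w by (simp add: pcompose_mult pcompose_smult)
  then show ?thesis by (metis dvd_triv_left)
qed

text \<open>The cofactor that remains when \<open>f ^ (e - k)\<close> is taken out of the \<open>k\<close>-th derivative of \<open>f ^ e * r\<close>.\<close>

primrec dnum :: "int poly \<Rightarrow> nat \<Rightarrow> nat \<Rightarrow> int poly \<Rightarrow> int poly" where
  "dnum f e 0 r = r"
| "dnum f e (Suc k) r = f * pderiv (dnum f e k r) + of_nat (e - k) * pderiv f * dnum f e k r"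

lemma higher_pderiv_power_mult:
  assumes "k \<le> e"
  shows "(pderiv ^^ k) (f ^ e * r) = f ^ (e - k) * dnum f e k r"
  using assms
proof (induction k)
  case (Suc k)
  then obtain m where m: "e - k = Suc m" by (metis Suc_diff_Suc Suc_le_lessD)
  then have m': "e - Suc k = m" by simp
  have "(pderiv ^^ Suc k) (f ^ e * r) = pderiv (f ^ Suc m * dnum f e k r)"
    using Suc m by simp
  also have "\<dots> = f ^ m * dnum f e (Suc k) r"
    unfolding dnum.simps m pderiv_mult pderiv_power_Suc
    by (simp add: of_nat_poly algebra_simps)
  finally show ?case using m' by simp
qed simp

lemma dnum_diff: "dnum f e k (r - r') = dnum f e k r - dnum f e k r'"
proof (induction k)
  case (Suc k)
  show ?case unfolding dnum.simps Suc pderiv_diff right_diff_distrib by simp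
qed simp

lemma degree_dnum_le:
  assumes "degree f \<le> Suc m"
  shows "degree (dnum f e k r) \<le> degree r + m * k"
proof (induction k)
  case (Suc k)
  have "degree (f * pderiv (dnum f e k r)) \<le> degree r + m * Suc k"
  proof (cases "degree (dnum f e k r) = 0")
    case True
    then have "pderiv (dnum f e k r) = 0" by (simp add: pderiv_eq_0_iff)
    then show ?thesis by simp
  next
    case False
    then show ?thesis
      using degree_mult_le[of f "pderiv (dnum f e k r)"] assms Suc degree_pderiv[of "dnum f e k r"]
      by simp
  qed
  moreover have "degree (of_nat (e - k) * pderiv f * dnum f e k r) \<le> degree r + m * Suc k"
  proof -
    have "degree (of_nat (e - k) * pderiv f) \<le> degree (pderiv f)"
      using degree_mult_le[of "of_nat (e - k)" "pderiv f"] by simp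
    also have "\<dots> \<le> m" using assms by (simp add: degree_pderiv)
    finally show ?thesis
      using degree_mult_le[of "of_nat (e - k) * pderiv f" "dnum f e k r"] Suc by simp
  qed
  ultimately show ?case by (simp add: degree_add_le)
qed simp

text \<open>Powers of \<open>X ^ p\<close> are constants for differentiation modulo \<open>p\<close>. A polynomial in \<open>X\<close> and \<open>X ^ p\<close> can
therefore have huge degree while its derivatives, at points of \<open>\<int>/p\<int>\<close>, agree with those of a polynomial of small degree.\<close>

lemma higher_pderiv_mult_monom:
  "[:int p:] dvd (pderiv ^^ k) (g * monom 1 (p * j)) - (pderiv ^^ k) g * monom 1 (p * j)"
proof (induction k)
  case (Suc k)
  let ?G = "(pderiv ^^ k) g" and ?M = "monom 1 (p * j) :: int poly"
  obtain w where w: "(pderiv ^^ k) (g * ?M) = ?G * ?M + [:int p:] * w"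
    using Suc by (metis add.commute diff_add_cancel dvdE)
  have M: "pderiv ?M = [:int p:] * monom (int j) (p * j - 1)"
    by (simp add: pderiv_monom smult_monom)
  have "(pderiv ^^ Suc k) (g * ?M) - (pderiv ^^ Suc k) g * ?M
      = pderiv ((pderiv ^^ k) (g * ?M)) - pderiv ?G * ?M" by simp
  also have "\<dots> = [:int p:] * (?G * monom (int j) (p * j - 1) + pderiv w)"
    unfolding w pderiv_add pderiv_mult M by (simp add: algebra_simps smult_add_right)
  finally show ?case by (metis dvd_triv_left)
qed simp

lemma prime_dvd_power_add:
  fixes a b :: "'a :: comm_ring_1"
  assumes "prime p"
  shows "of_nat p dvd (a + b) ^ p - a ^ p - b ^ p"
proof -
  have p0: "p > 0" using assms prime_gt_0_nat by blast
  have "(a + b) ^ p = (\<Sum>k\<le>p. of_nat (p choose k) * a ^ k * b ^ (p - k))"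
    by (rule binomial_ring)
  also have "{..p} = insert 0 (insert p {0<..<p})" using p0 by auto
  also have "(\<Sum>k\<in>\<dots>. of_nat (p choose k) * a ^ k * b ^ (p - k)) =
      b ^ p + a ^ p + (\<Sum>k\<in>{0<..<p}. of_nat (p choose k) * a ^ k * b ^ (p - k))"
    using p0 by simp
  finally have "(a + b) ^ p - a ^ p - b ^ p
      = (\<Sum>k\<in>{0<..<p}. of_nat (p choose k) * a ^ k * b ^ (p - k))" by simp
  also have "of_nat p dvd \<dots>"
  proof (rule dvd_sum)
    fix k assume "k \<in> {0<..<p}"
    then have "p dvd (p choose k)" using assms by (intro dvd_choose_prime) auto
    then show "of_nat p dvd (of_nat (p choose k) * a ^ k * b ^ (p - k) :: 'a)"
      by (auto elim!: dvdE simp: mult.assoc)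
  qed
  finally show ?thesis .
qed

section \<open>Square-root cancellation for cubic character sums\<close>

lemma fermat_little_int:
  assumes "prime p" shows "[a ^ p = a] (mod int p)"
proof (cases "int p dvd a")
  case True
  then have "int p dvd a ^ p" using assms by (metis dvd_power dvd_trans prime_gt_0_nat)
  then show ?thesis using True by (metis cong_0_iff cong_sym cong_trans)
next
  case False
  define b where "b = nat (a mod int p)"
  have p0: "p > 0" using assms prime_gt_0_nat by blast
  have ib: "int b = a mod int p" unfolding b_def using p0 by simp
  have "\<not> p dvd b" using False ib by (metis dvd_mod_iff dvd_refl int_dvd_int_iff)
  then have "[b ^ (p - 1) = 1] (mod p)" using fermat_theorem[OF assms] by blast
  then have "[int b ^ (p - 1) = 1] (mod int p)" by (metis cong_int_iff of_nat_1 of_nat_power)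
  moreover have "[int b = a] (mod int p)" unfolding ib by simp
  ultimately have "[a ^ (p - 1) = 1] (mod int p)" by (meson cong_pow cong_sym cong_trans)
  then have "[a * a ^ (p - 1) = a * 1] (mod int p)" by (intro cong_mult cong_refl)
  moreover have "a * a ^ (p - 1) = a ^ p" using p0 by (metis power_minus_mult mult.commute)
  ultimately show ?thesis by simp
qed

lemma reduced_representative:
  fixes r :: "int poly"
  assumes "p > 0"
  shows "\<exists>r'. [:int p:] dvd r - r' \<and> (r' = 0 \<or> \<not> int p dvd lead_coeff r')"
proof -
  define r' where "r' = map_poly (\<lambda>a. a mod int p) r"
  have c: "coeff r' i = coeff r i mod int p" for i
    unfolding r'_def by (rule coeff_map_poly) simp
  have "[:int p:] dvd r - r'"
    unfolding const_dvd_iff c coeff_diff by (simp add: minus_mod_eq_mult_div)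
  moreover have "\<not> int p dvd lead_coeff r'" if "r' \<noteq> 0"
  proof
    assume "int p dvd lead_coeff r'"
    then have "lead_coeff r' = 0" unfolding c by (simp add: mod_mod_trivial dvd_eq_mod_eq_0)
    then show False using that by simp
  qed
  ultimately show ?thesis by blast
qed

text \<open>If \<open>r\<close> and \<open>s\<close> were both nonzero modulo \<open>p\<close>, then \<open>f * r\<^sup>2\<close> would have odd and \<open>a * s\<^sup>2\<close> even degree. Reduced
representatives are used because only their degree is the degree modulo \<open>p\<close>.\<close>

lemma odd_degree_not_square_mod:
  fixes f r s :: "int poly"
  assumes p: "prime p" and odd: "odd (degree f)" and lc: "\<not> int p dvd lead_coeff f"
    and f0: "\<not> int p dvd a" and dvd: "[:int p:] dvd f * r\<^sup>2 - smult a (s\<^sup>2)"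
  shows "[:int p:] dvd r \<and> [:int p:] dvd s"
proof -
  have p0: "p > 0" using p prime_gt_0_nat by blast
  have pint: "prime (int p)" using p by simp
  obtain r' where r': "[:int p:] dvd r - r'" "r' = 0 \<or> \<not> int p dvd lead_coeff r'"
    using reduced_representative[OF p0] by blast
  obtain s' where s': "[:int p:] dvd s - s'" "s' = 0 \<or> \<not> int p dvd lead_coeff s'"
    using reduced_representative[OF p0] by blast
  have "f * r'\<^sup>2 - smult a (s'\<^sup>2) = (f * r\<^sup>2 - smult a (s\<^sup>2)) - (r - r') * (f * (r + r'))
      + (s - s') * (smult a (s + s'))"
    by (simp add: algebra_simps power2_eq_square smult_diff_right smult_add_right)
  then have D: "[:int p:] dvd f * r'\<^sup>2 - smult a (s'\<^sup>2)"
    using dvd_add[OF dvd_diff[OF dvd dvd_mult2[OF r'(1), of "f * (r + r')"]]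
        dvd_mult2[OF s'(1), of "smult a (s + s')"]] by (simp only:)
  have a0: "a \<noteq> 0" and fne: "f \<noteq> 0" using f0 lc by auto
  have "r' = 0 \<and> s' = 0"
  proof (rule ccontr)
    assume nz: "\<not> (r' = 0 \<and> s' = 0)"
    let ?A = "f * r'\<^sup>2" and ?B = "smult a (s'\<^sup>2)"
    have lA: "lead_coeff ?A = lead_coeff f * (lead_coeff r')\<^sup>2"
      by (simp add: lead_coeff_mult lead_coeff_power)
    have lB: "lead_coeff ?B = a * (lead_coeff s')\<^sup>2" by (simp add: lead_coeff_power)
    have nA: "\<not> int p dvd lead_coeff ?A" if "r' \<noteq> 0"
      using that r'(2) lc pint unfolding lA by (simp add: prime_dvd_mult_iff prime_dvd_power_iff)
    have nB: "\<not> int p dvd lead_coeff ?B" if "s' \<noteq> 0"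
      using that s'(2) f0 pint unfolding lB by (simp add: prime_dvd_mult_iff prime_dvd_power_iff)
    have dA: "odd (degree ?A)" if "r' \<noteq> 0"
      using that odd fne by (simp add: degree_mult_eq degree_power_eq)
    have dB: "even (degree ?B)" using a0
      by (cases "s' = 0") (simp_all add: degree_power_eq)
    have DD: "int p dvd coeff ?A i - coeff ?B i" for i
      using D unfolding const_dvd_iff by simp
    consider "s' = 0" "r' \<noteq> 0" | "r' = 0" "s' \<noteq> 0" | "r' \<noteq> 0" "s' \<noteq> 0" using nz by blast
    then show False
    proof cases
      case 1
      then show False using DD[of "degree ?A"] nA by simp
    next
      case 2
      then show False using DD[of "degree ?B"] nB by simp
    next
      case 3
      then have "degree ?A \<noteq> degree ?B" using dA dB by metis
      then consider "degree ?A < degree ?B" | "degree ?B < degree ?A" by linarith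
      then show False
      proof cases
        case 1
        then show False using DD[of "degree ?B"] nB[OF 3(2)] coeff_eq_0[OF 1] by (simp only: diff_0 dvd_minus_iff)
      next
        case 2
        then show False using DD[of "degree ?A"] nA[OF 3(1)] coeff_eq_0[OF 2] by (simp only: diff_0_right)
      qed
    qed
  qed
  then show ?thesis using r'(1) s'(1) by simp
qed

lemma diff_diff_aux: "x - y - z = (x - w - z) + (w - y)" for x y z w :: "int poly"
  by simp

lemma square_mod_M: "(R + M * x)\<^sup>2 = R\<^sup>2 + M * (2 * R * x + M * x\<^sup>2)" for M :: "'a :: comm_ring_1"
  by (simp add: algebra_simps power2_eq_square)
lemma split_low_part:
  fixes f A R S M F w x y :: "'a :: comm_ring_1"
  shows "f * R\<^sup>2 - A * S\<^sup>2 + M * (f * (2 * R * x + M * x\<^sup>2) - A * (2 * S * y + M * y\<^sup>2) - w * (S + M * y)\<^sup>2)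
    = (f * (R + M * x)\<^sup>2 - F * (S + M * y)\<^sup>2) + (F - A - M * w) * (S + M * y)\<^sup>2"
proof -
  have "f * R2 - A * S2 + M * (f * U - A * V - w * H) = (f * (R2 + M * U) - F * H) + (F - A - M * w) * H"
    if "H = S2 + M * V" for R2 S2 U V H
  proof -
    have "A * H = A * S2 + A * (M * V)" using that by (simp add: algebra_simps)
    then show ?thesis by (simp add: algebra_simps)
  qed
  from this[OF square_mod_M[of S M y]] show ?thesis unfolding square_mod_M[of R] .
qed

text \<open>Let \<open>j\<close> be the least index at which \<open>r j\<close> or \<open>s j\<close> is nonzero modulo \<open>p\<close>. If the sum vanished, then
after division by \<open>X ^ (p * j)\<close> it would give \<open>r j + f ^ c * s j = 0\<close> modulo \<open>p\<close> and \<open>X ^ p\<close>. Squaring and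
\<open>f * (f ^ c)\<^sup>2 = f ^ p\<close> remove the large power of \<open>f\<close>, as \<open>f ^ p = f 0\<close> modulo \<open>p\<close> and \<open>X ^ p\<close>. What is left,
\<open>f * (r j)\<^sup>2 = f 0 * (s j)\<^sup>2\<close> modulo \<open>X ^ p\<close>, has degree below \<open>p\<close> on both sides and hence holds exactly, against the
odd degree of \<open>f\<close>.\<close>

lemma stepanov_nonvanishing:
  fixes f :: "int poly" and r s :: "nat \<Rightarrow> int poly"
  assumes p: "prime p" and c: "2 * c + 1 = p"
    and odd: "odd (degree f)" and lc: "\<not> int p dvd lead_coeff f" and f0: "\<not> int p dvd coeff f 0"
    and dr: "\<And>j. 2 * degree (r j) + degree f < p" and ds: "\<And>j. 2 * degree (s j) + degree f < p"
    and j: "j < J" "\<not> ([:int p:] dvd r j \<and> [:int p:] dvd s j)"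
  shows "\<not> [:int p:] dvd (\<Sum>j<J. (r j + f ^ c * s j) * monom 1 (p * j))"
proof
  assume R: "[:int p:] dvd (\<Sum>j<J. (r j + f ^ c * s j) * monom 1 (p * j))"
  have p0: "p > 0" using p prime_gt_0_nat by blast
  define P where "P = [:int p:]"
  define k where "k = (LEAST j. \<not> (P dvd r j \<and> P dvd s j))"
  have k: "\<not> (P dvd r k \<and> P dvd s k)" unfolding k_def P_def by (rule LeastI) (rule j(2))
  have kmin: "P dvd r i" "P dvd s i" if "i < k" for i
    using not_less_Least[of i "\<lambda>j. \<not> (P dvd r j \<and> P dvd s j)"] that unfolding k_def by blast+
  have kJ: "k < J" using Least_le[of "\<lambda>j. \<not> (P dvd r j \<and> P dvd s j)" j] j
    unfolding k_def P_def by linarith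
  have Pmult: "P dvd u * v \<longleftrightarrow> P dvd u \<or> P dvd v" for u v
    unfolding P_def by (rule const_dvd_mult_iff[OF p])
  define M where "M = (monom 1 p :: int poly)"
  have Mp: "monom 1 (p * i) = M ^ i" for i unfolding M_def by (simp add: monom_power)
  have nM: "\<not> P dvd M ^ i" for i
  proof
    assume "P dvd M ^ i"
    then have "int p dvd coeff (monom 1 (p * i)) (p * i)"
      unfolding P_def const_dvd_iff Mp[symmetric] by blast
    then show False using p by (simp add: not_prime_unit)
  qed
  let ?g = "\<lambda>j. r j + f ^ c * s j"
  define h0' where "h0' = (\<Sum>i<J - k - 1. r (Suc (k + i)) * M ^ i)"
  define h1' where "h1' = (\<Sum>i<J - k - 1. s (Suc (k + i)) * M ^ i)"
  define h0 where "h0 = r k + M * h0'"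
  define h1 where "h1 = s k + M * h1'"
  have "(\<Sum>j<J. ?g j * M ^ j) = (\<Sum>j<k. ?g j * M ^ j) + (\<Sum>i<J - k. ?g (k + i) * M ^ (k + i))"
  proof -
    have "{..<J} = {..<k} \<union> {k..<J}" using kJ by auto
    then have "(\<Sum>j<J. ?g j * M ^ j) = (\<Sum>j<k. ?g j * M ^ j) + (\<Sum>j\<in>{k..<J}. ?g j * M ^ j)"
      by (metis (no_types, lifting) finite_lessThan finite_atLeastLessThan sum.union_disjoint ivl_disj_int_one(2))
    also have "(\<Sum>j\<in>{k..<J}. ?g j * M ^ j) = (\<Sum>i<J - k. ?g (k + i) * M ^ (k + i))"
      using sum.shift_bounds_nat_ivl[of "\<lambda>j. ?g j * M ^ j" 0 k "J - k"] kJ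
      by (simp add: lessThan_atLeast0 add.commute)
    finally show ?thesis .
  qed
  also have "(\<Sum>i<J - k. ?g (k + i) * M ^ (k + i)) = M ^ k * (\<Sum>i<J - k. ?g (k + i) * M ^ i)"
    by (simp add: sum_distrib_left power_add mult_ac)
  also have "(\<Sum>i<J - k. ?g (k + i) * M ^ i) = h0 + f ^ c * h1"
  proof -
    obtain n where n: "J - k = Suc n" using kJ by (metis Suc_diff_Suc)
    have n': "J - k - 1 = n" using n by simp
    show ?thesis
      unfolding h0_def h1_def h0'_def h1'_def n' n
      by (simp add: sum.lessThan_Suc_shift sum_distrib_left algebra_simps sum.distrib del: sum.lessThan_Suc)
  qed
  finally have eq: "(\<Sum>j<J. ?g j * M ^ j) = (\<Sum>j<k. ?g j * M ^ j) + M ^ k * (h0 + f ^ c * h1)" .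
  have "P dvd (\<Sum>j<k. ?g j * M ^ j)"
    by (intro dvd_sum dvd_mult2 dvd_add dvd_mult) (auto simp: kmin)
  moreover have "P dvd (\<Sum>j<J. ?g j * M ^ j)" using R unfolding P_def Mp .
  ultimately have "P dvd M ^ k * (h0 + f ^ c * h1)" unfolding eq by (simp add: dvd_add_right_iff)
  then have H: "P dvd h0 + f ^ c * h1" using Pmult nM by blast
  have fp: "f ^ p = f * (f ^ c)\<^sup>2" 
  proof -
    have "f ^ (2 * c + 1) = f * (f ^ c)\<^sup>2" by (simp add: power_even_eq)
    then show ?thesis unfolding c .
  qed
  have "f * h0\<^sup>2 - f ^ p * h1\<^sup>2 = (h0 + f ^ c * h1) * (f * (h0 - f ^ c * h1))"
    unfolding fp by (simp add: algebra_simps power2_eq_square)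
  then have H2: "P dvd f * h0\<^sup>2 - f ^ p * h1\<^sup>2" using H by simp
  obtain a v where f: "f = pCons a v" by (cases f) auto
  have a: "coeff f 0 = a" using f by simp
  have f': "f = [:a:] + monom 1 1 * v" unfolding f by (simp add: monom_Suc)
  have P': "P = of_nat p" unfolding P_def by (simp add: of_nat_poly)
  have "P dvd f ^ p - [:a:] ^ p - (monom 1 1 * v) ^ p"
    unfolding P' by (subst f') (rule prime_dvd_power_add[OF p])
  moreover have "(monom 1 1 * v) ^ p = M * v ^ p"
    unfolding M_def by (simp add: power_mult_distrib monom_power)
  moreover have "P dvd [:a:] ^ p - [:a:]"
  proof -
    have "[a ^ p = a] (mod int p)"
      using fermat_little_int[OF p] by simp
    then have "int p dvd a ^ p - a" by (simp add: cong_iff_dvd_diff)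
    moreover have "[:a:] ^ p - [:a:] = [:a ^ p - a:]" by (simp add: poly_const_pow)
    ultimately show ?thesis unfolding P_def by simp
  qed
  moreover have "f ^ p - [:a:] - M * v ^ p = (f ^ p - [:a:] ^ p - M * v ^ p) + ([:a:] ^ p - [:a:])"
    by (rule diff_diff_aux)
  ultimately have fpa: "P dvd f ^ p - [:a:] - M * v ^ p"
    by (simp only: dvd_add)
  have "f * (r k)\<^sup>2 - smult a ((s k)\<^sup>2)
      + M * (f * (2 * r k * h0' + M * h0'\<^sup>2) - [:a:] * (2 * s k * h1' + M * h1'\<^sup>2) - v ^ p * h1\<^sup>2)
      = (f * h0\<^sup>2 - f ^ p * h1\<^sup>2) + (f ^ p - [:a:] - M * v ^ p) * h1\<^sup>2"
  proof -
    have "smult a ((s k)\<^sup>2) = [:a:] * (s k)\<^sup>2" by simp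
    then show ?thesis
      unfolding h0_def h1_def by (simp only:) (rule split_low_part)
  qed
  then have "P dvd f * (r k)\<^sup>2 - smult a ((s k)\<^sup>2)
      + M * (f * (2 * r k * h0' + M * h0'\<^sup>2) - [:a:] * (2 * s k * h1' + M * h1'\<^sup>2) - v ^ p * h1\<^sup>2)"
    using dvd_add[OF H2 dvd_mult2[OF fpa, of "h1\<^sup>2"]] by (simp only:)
  then have low: "int p dvd coeff (f * (r k)\<^sup>2 - smult a ((s k)\<^sup>2)) i" if "i < p" for i
    using that unfolding P_def const_dvd_iff M_def by (auto simp: coeff_monom_mult dest: spec[of _ i])
  have "degree (f * (r k)\<^sup>2 - smult a ((s k)\<^sup>2)) < p"
  proof (rule degree_diff_less)
    show "degree (f * (r k)\<^sup>2) < p"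
      using degree_mult_le[of f "(r k)\<^sup>2"] degree_power_le[of "r k" 2] dr[of k] by linarith
    show "degree (smult a ((s k)\<^sup>2)) < p"
      using degree_smult_le[of a "(s k)\<^sup>2"] degree_power_le[of "s k" 2] ds[of k] by linarith
  qed
  then have "int p dvd coeff (f * (r k)\<^sup>2 - smult a ((s k)\<^sup>2)) i" for i
    using low[of i] coeff_eq_0[of "f * (r k)\<^sup>2 - smult a ((s k)\<^sup>2)" i] by (cases "i < p") (simp_all only:, simp)
  then have "[:int p:] dvd f * (r k)\<^sup>2 - smult a ((s k)\<^sup>2)"
    unfolding const_dvd_iff by blast
  from odd_degree_not_square_mod[OF p odd lc _ this] f0 k show False
    unfolding a P_def by simp
qed

lemma card_roots_mod_le:
  fixes g :: "int poly"
  assumes p: "prime p" and g: "\<not> [:int p:] dvd g"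
  shows "card {x \<in> {0..<int p}. int p dvd poly g x} \<le> degree g"
proof -
  let ?S = "{x \<in> {0..<int p}. int p dvd poly g x}"
  have "(\<Sum>x\<in>?S. 1) \<le> degree g"
  proof (rule sum_orders_le_degree[OF p _ _ g])
    show "x = y" if "x \<in> ?S" "y \<in> ?S" "int p dvd x - y" for x y
      using that by (simp add: mod_eq_dvd_iff[symmetric])
    show "\<exists>u. [:int p:] dvd g - [:- x, 1:] ^ 1 * u" if "x \<in> ?S" for x
      using linear_factor_mod[of "int p" g x] that by auto
    show "finite ?S" by (rule finite_subset[of _ "{0..<int p}"]) auto
  qed
  then show ?thesis by simp
qed

text \<open>The unknowns of the linear system: \<open>v (j, i, b)\<close> is the coefficient of \<open>X ^ i\<close> in \<open>r j\<close> or \<open>s j\<close>,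
according to \<open>b\<close>.\<close>

definition coeff_poly :: "(nat \<times> nat \<times> bool \<Rightarrow> int) \<Rightarrow> nat \<Rightarrow> bool \<Rightarrow> nat \<Rightarrow> int poly" where
  "coeff_poly v L b j = (\<Sum>i<L. monom (v (j, i, b)) i)"

lemma coeff_coeff_poly: "coeff (coeff_poly v L b j) i = (if i < L then v (j, i, b) else 0)"
  unfolding coeff_poly_def coeff_sum by (simp add: sum.delta' if_distrib cong: if_cong)

lemma degree_coeff_poly: "L > 0 \<Longrightarrow> degree (coeff_poly v L b j) \<le> L - 1"
  by (rule degree_le) (auto simp: coeff_coeff_poly)

lemma coeff_poly_diff:
  "coeff_poly (\<lambda>i. v i - v' i) L b j = coeff_poly v L b j - coeff_poly v' L b j"
  by (rule poly_eqI) (simp add: coeff_coeff_poly)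

text \<open>At a point \<open>x\<close> with \<open>f x ^ c = a\<close>, and where \<open>x ^ p = x\<close>, the \<open>k\<close>-th derivative of the auxiliary polynomial
\<open>f ^ l * (\<Sum>j<J. (r j + f ^ c * s j) * X ^ (p * j))\<close> is \<open>f x ^ (l - k)\<close> times the value of this polynomial at \<open>x\<close>.
Its degree is small, so that asking it to vanish modulo \<open>p\<close> identically is cheap.\<close>

definition sigma_poly where
  "sigma_poly f a l c L J k v = (\<Sum>j<J. (dnum f l k (coeff_poly v L False j)
      + smult a (dnum f (l + c) k (coeff_poly v L True j))) * monom 1 j)"

lemma sigma_poly_diff:
  "sigma_poly f a l c L J k (\<lambda>i. v i - v' i)
    = sigma_poly f a l c L J k v - sigma_poly f a l c L J k v'"
  unfolding sigma_poly_def coeff_poly_diff dnum_diff sum_subtractf[symmetric]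
  by (rule sum.cong) (simp_all add: algebra_simps smult_diff_right)

lemma degree_sigma_poly:
  assumes "degree f \<le> 3" "L > 0" "J > 0"
  shows "degree (sigma_poly f a l c L J k v) < L + 2 * k + J"
proof -
  have "degree ((dnum f l k (coeff_poly v L False j)
      + smult a (dnum f (l + c) k (coeff_poly v L True j))) * monom 1 j) \<le> L - 1 + 2 * k + (J - 1)"
    if "j < J" for j
  proof -
    have d: "degree (dnum f e k (coeff_poly v L b j)) \<le> L - 1 + 2 * k" for e b
      using degree_dnum_le[of f 2 e k "coeff_poly v L b j"] degree_coeff_poly[OF assms(2), of v b j]
        assms(1) by simp
    have "degree (dnum f l k (coeff_poly v L False j)
      + smult a (dnum f (l + c) k (coeff_poly v L True j))) \<le> L - 1 + 2 * k"
      by (rule degree_add_le) (rule d, rule order_trans[OF degree_smult_le d])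
    then show ?thesis
      using degree_mult_le[of "dnum f l k (coeff_poly v L False j)
        + smult a (dnum f (l + c) k (coeff_poly v L True j))" "monom 1 j"]
        degree_monom_le[of "1::int" j] that by linarith
  qed
  then have "degree (sigma_poly f a l c L J k v) \<le> L - 1 + 2 * k + (J - 1)"
    unfolding sigma_poly_def by (intro degree_sum_le) auto
  then show ?thesis using assms by simp
qed

text \<open>There are \<open>2 * J * L\<close> unknowns and fewer linear conditions modulo \<open>p\<close>. By the pigeonhole principle two
coefficient vectors give the same values, and their difference is a solution.\<close>

lemma exists_auxiliary_coefficients:
  fixes f :: "int poly"
  assumes p: "prime p" and f: "degree f \<le> 3" and L: "L > 0" "J > 0"
    and few: "(\<Sum>k<l. L + 2 * k + J) < 2 * J * L"
  shows "\<exists>d. (\<exists>j<J. \<exists>i<L. \<exists>b. \<not> int p dvd d (j, i, b)) \<and>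
    (\<forall>k<l. [:int p:] dvd sigma_poly f a l c L J k d)"
proof -
  define Ix where "Ix = {..<J} \<times> {..<L} \<times> (UNIV :: bool set)"
  define Cs where "Cs = (SIGMA k:{..<l}. {..<L + 2 * k + J})"
  define F where "F v = (\<lambda>(k, n)\<in>Cs. coeff (sigma_poly f a l c L J k v) n mod int p)" for v
  have p1: "p > 1" using p prime_gt_1_nat by blast
  have fin: "finite Ix" "finite Cs" unfolding Ix_def Cs_def by auto
  have cI: "card Ix = 2 * J * L" unfolding Ix_def by (simp add: card_cartesian_product)
  have cC: "card Cs = (\<Sum>k<l. L + 2 * k + J)" unfolding Cs_def by (subst card_SigmaI) auto
  let ?V = "Ix \<rightarrow>\<^sub>E {0..<int p}"
  have "F ` ?V \<subseteq> Cs \<rightarrow>\<^sub>E {0..<int p}" unfolding F_def using p1 by auto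
  then have "card (F ` ?V) \<le> card (Cs \<rightarrow>\<^sub>E {0..<int p})"
    using fin by (intro card_mono finite_PiE) auto
  also have "\<dots> = p ^ card Cs" using fin by (simp add: card_PiE)
  also have "\<dots> < p ^ card Ix" unfolding cI cC using few p1 by simp
  also have "\<dots> = card ?V" using fin by (simp add: card_PiE)
  finally have "\<not> inj_on F ?V" by (rule pigeonhole)
  then obtain v v' where v: "v \<in> ?V" "v' \<in> ?V" "F v = F v'" "v \<noteq> v'" unfolding inj_on_def by blast
  define d where "d i = v i - v' i" for i
  obtain i where i: "i \<in> Ix" "v i \<noteq> v' i" using PiE_ext[OF v(1,2)] v(4) by blast
  have "\<not> int p dvd d i"
  proof
    assume "int p dvd d i"
    then have "v i mod int p = v' i mod int p" unfolding d_def by (simp add: mod_eq_dvd_iff)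
    moreover have "v i \<in> {0..<int p}" "v' i \<in> {0..<int p}" using v i by auto
    ultimately show False using i by simp
  qed
  then have 1: "\<exists>j<J. \<exists>i<L. \<exists>b. \<not> int p dvd d (j, i, b)"
    using i(1) unfolding Ix_def by (cases i) auto
  have 2: "[:int p:] dvd sigma_poly f a l c L J k d" if k: "k < l" for k
    unfolding const_dvd_iff
  proof
    fix n
    show "int p dvd coeff (sigma_poly f a l c L J k d) n"
    proof (cases "n < L + 2 * k + J")
      case True
      then have "(k, n) \<in> Cs" unfolding Cs_def using k by auto
      then have "coeff (sigma_poly f a l c L J k v) n mod int p
          = coeff (sigma_poly f a l c L J k v') n mod int p"
        using fun_cong[OF v(3), of "(k, n)"] unfolding F_def by simp
      then show ?thesis unfolding d_def sigma_poly_diff coeff_diff by (simp add: mod_eq_dvd_iff)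
    next
      case False
      then show ?thesis using degree_sigma_poly[OF f L, of a l c k d] by (simp add: coeff_eq_0)
    qed
  qed
  show ?thesis using 1 2 by blast
qed

lemma auxiliary_poly_derivatives_vanish:
  fixes f :: "int poly"
  assumes p: "prime p" and k: "k < l"
    and sig: "[:int p:] dvd sigma_poly f a l c L J k d"
    and x: "[poly f x ^ c = a] (mod int p)"
  defines "r \<equiv> coeff_poly d L False" and "s \<equiv> coeff_poly d L True"
  shows "int p dvd poly ((pderiv ^^ k) (f ^ l * (\<Sum>j<J. (r j + f ^ c * s j) * monom 1 (p * j)))) x"
proof -
  let ?A = "\<lambda>j. dnum f l k (r j)" and ?B = "\<lambda>j. dnum f (l + c) k (s j)"
  have "f ^ l * (\<Sum>j<J. (r j + f ^ c * s j) * monom 1 (p * j))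
      = (\<Sum>j<J. (f ^ l * r j) * monom 1 (p * j) + (f ^ (l + c) * s j) * monom 1 (p * j))"
    unfolding sum_distrib_left by (rule sum.cong) (simp_all add: algebra_simps power_add)
  then have E1: "poly ((pderiv ^^ k) (f ^ l * (\<Sum>j<J. (r j + f ^ c * s j) * monom 1 (p * j)))) x
    = (\<Sum>j<J. poly ((pderiv ^^ k) ((f ^ l * r j) * monom 1 (p * j))) x
        + poly ((pderiv ^^ k) ((f ^ (l + c) * s j) * monom 1 (p * j))) x)"
    by (simp add: higher_pderiv_sum higher_pderiv_add poly_sum)
  have E2: "[(\<Sum>j<J. poly ((pderiv ^^ k) ((f ^ l * r j) * monom 1 (p * j))) x
        + poly ((pderiv ^^ k) ((f ^ (l + c) * s j) * monom 1 (p * j))) x)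
      = (\<Sum>j<J. poly f x ^ (l - k) * (poly (?A j) x * x ^ j)
        + poly f x ^ (l - k) * (a * poly (?B j) x * x ^ j))] (mod int p)"
  proof (rule cong_sum, rule cong_add)
    fix j
    have xp: "[x ^ (p * j) = x ^ j] (mod int p)"
      using cong_pow[OF fermat_little_int[OF p, of x], of j] by (simp add: power_mult)
    have main: "[poly ((pderiv ^^ k) ((f ^ e * g) * monom 1 (p * j))) x
        = poly f x ^ (e - k) * poly (dnum f e k g) x * x ^ (p * j)] (mod int p)" if "k \<le> e" for e g
      using const_dvd_poly[OF higher_pderiv_mult_monom[of p k "f ^ e * g" j], of x]
      unfolding higher_pderiv_power_mult[OF that]
      by (simp add: cong_iff_dvd_diff poly_monom)
    have "[poly ((pderiv ^^ k) ((f ^ l * r j) * monom 1 (p * j))) x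
        = poly f x ^ (l - k) * poly (?A j) x * x ^ (p * j)] (mod int p)"
      using main[of l "r j"] k by simp
    moreover have "[poly f x ^ (l - k) * poly (?A j) x * x ^ (p * j)
        = poly f x ^ (l - k) * poly (?A j) x * x ^ j] (mod int p)"
      by (intro cong_mult cong_refl xp)
    ultimately show "[poly ((pderiv ^^ k) ((f ^ l * r j) * monom 1 (p * j))) x
        = poly f x ^ (l - k) * (poly (?A j) x * x ^ j)] (mod int p)"
      using cong_trans by (simp add: mult.assoc)
    have "[poly ((pderiv ^^ k) ((f ^ (l + c) * s j) * monom 1 (p * j))) x
        = poly f x ^ (l + c - k) * poly (?B j) x * x ^ (p * j)] (mod int p)"
      using main[of "l + c" "s j"] k by simp
    also have "poly f x ^ (l + c - k) = poly f x ^ (l - k) * poly f x ^ c"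
      using k by (simp flip: power_add)
    also have "[poly f x ^ (l - k) * poly f x ^ c * poly (?B j) x * x ^ (p * j)
        = poly f x ^ (l - k) * a * poly (?B j) x * x ^ j] (mod int p)"
      by (intro cong_mult cong_refl xp x)
    also have "poly f x ^ (l - k) * a * poly (?B j) x * x ^ j
        = poly f x ^ (l - k) * (a * poly (?B j) x * x ^ j)"
      by (simp only: mult.assoc)
    finally show "[poly ((pderiv ^^ k) ((f ^ (l + c) * s j) * monom 1 (p * j))) x
        = poly f x ^ (l - k) * (a * poly (?B j) x * x ^ j)] (mod int p)" .
  qed
  have E3: "(\<Sum>j<J. poly f x ^ (l - k) * (poly (?A j) x * x ^ j)
        + poly f x ^ (l - k) * (a * poly (?B j) x * x ^ j))
      = poly f x ^ (l - k) * poly (sigma_poly f a l c L J k d) x"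
    unfolding sigma_poly_def r_def s_def poly_sum sum_distrib_left
    by (rule sum.cong[OF refl]) (simp only: poly_mult poly_add poly_smult poly_monom
        distrib_left distrib_right mult_1)
  have "int p dvd poly f x ^ (l - k) * poly (sigma_poly f a l c L J k d) x"
    using const_dvd_poly[OF sig] by (rule dvd_mult)
  then show ?thesis
    unfolding E1 using E2 unfolding E3 by (simp only: cong_dvd_iff)
qed

text \<open>The auxiliary polynomial has a zero of order \<open>l = 2 * m\<close> at every point counted, so the count times
\<open>l\<close> is at most its degree, which is about \<open>p * J\<close>. The number of unknowns \<open>2 * J * L\<close>, with \<open>L\<close> close to \<open>p / 2\<close>,
exceeds the number of conditions, about \<open>l * p / 2\<close>, once \<open>J\<close> exceeds \<open>m\<close> by a constant. Hence the count is \<open>p / 2\<close>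
up to \<open>O(p / m)\<close>, and \<open>m\<close> may be as large as \<open>sqrt p / 2\<close>.\<close>

lemma stepanov_count_aux:
  fixes f :: "int poly"
  assumes p: "prime p" and c: "2 * c + 1 = p" and f: "degree f = 3"
    and lc: "\<not> int p dvd lead_coeff f" and f0: "\<not> int p dvd coeff f 0"
    and m: "m \<ge> 2" "4 * m\<^sup>2 \<le> p"
  shows "card {x \<in> {0..<int p}. [poly f x ^ c = a] (mod int p)} * (2 * m) \<le> 6 * m + 2 * p + p * (m + 3)"
proof -
  \<comment> \<open>Small enough that twice the degree of r j, at most L - 1, plus 3 stays below p.\<close>
  define L where "L = c - 2"
  define J where "J = m + 4"
  define l where "l = 2 * m"
  have m2: "m\<^sup>2 \<ge> 2 * m" using m(1) by (simp add: power2_eq_square)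
  have pL: "p = 2 * L + 5" and L0: "L > 0" using c m m2 unfolding L_def by linarith+
  have J0: "J > 0" unfolding J_def by simp
  have lp: "l \<le> p" using m m2 unfolding l_def by linarith
  have s: "(\<Sum>k<n. L + 2 * k + J) + n = n * (L + J) + n * n" for n
    by (induction n) (simp_all add: algebra_simps)
  have few: "(\<Sum>k<l. L + 2 * k + J) < 2 * J * L"
  proof -
    have "l * (L + J) + l * l = 2 * (m * L) + 6 * m\<^sup>2 + 8 * m"
      unfolding l_def J_def by (simp add: algebra_simps power2_eq_square)
    moreover have "2 * J * L = 2 * (m * L) + 8 * L" unfolding J_def by (simp add: algebra_simps)
    ultimately show ?thesis using s[of l] m m2 pL unfolding l_def by linarith
  qed
  obtain d where d: "\<exists>j<J. \<exists>i<L. \<exists>b. \<not> int p dvd d (j, i, b)"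
    and sig: "\<And>k. k < l \<Longrightarrow> [:int p:] dvd sigma_poly f a l c L J k d"
    using exists_auxiliary_coefficients[OF p _ L0 J0 few, of f a c] f by auto
  define r where "r = coeff_poly d L False"
  define s where "s = coeff_poly d L True"
  define R where "R = f ^ l * (\<Sum>j<J. (r j + f ^ c * s j) * monom 1 (p * j))"
  have dr: "degree (r j) \<le> L - 1" and ds: "degree (s j) \<le> L - 1" for j
    unfolding r_def s_def by (rule degree_coeff_poly[OF L0])+
  obtain j i b where j: "j < J" "i < L" "\<not> int p dvd d (j, i, b)" using d by blast
  have nd: "\<not> ([:int p:] dvd r j \<and> [:int p:] dvd s j)"
  proof
    assume "[:int p:] dvd r j \<and> [:int p:] dvd s j"
    then have "int p dvd coeff (r j) i" "int p dvd coeff (s j) i" unfolding const_dvd_iff by auto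
    then show False using j unfolding r_def s_def coeff_coeff_poly by (cases b) simp_all
  qed
  have "\<not> [:int p:] dvd (\<Sum>j<J. (r j + f ^ c * s j) * monom 1 (p * j))"
  proof (rule stepanov_nonvanishing[where r = r and s = s, OF p c _ lc f0 _ _ j(1) nd])
    show "odd (degree f)" using f by simp
    show "2 * degree (r j) + degree f < p" "2 * degree (s j) + degree f < p" for j
      using dr[of j] ds[of j] f pL L0 by linarith+
  qed
  moreover have "\<not> [:int p:] dvd f ^ l"
  proof
    assume "[:int p:] dvd f ^ l"
    then have "[:int p:] dvd f" using prime_elem_dvd_power[OF prime_elem_const_int[OF p]] by blast
    then show False using f0 unfolding const_dvd_iff by blast
  qed
  ultimately have Rnz: "\<not> [:int p:] dvd R" unfolding R_def const_dvd_mult_iff[OF p] by blast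
  let ?S = "{x \<in> {0..<int p}. [poly f x ^ c = a] (mod int p)}"
  have "(\<Sum>x\<in>?S. l) \<le> degree R"
  proof (rule sum_orders_le_degree[OF p _ _ Rnz])
    show "x = y" if "x \<in> ?S" "y \<in> ?S" "int p dvd x - y" for x y
      using that by (simp add: mod_eq_dvd_iff[symmetric])
    show "\<exists>u. [:int p:] dvd R - [:- x, 1:] ^ l * u" if "x \<in> ?S" for x
      unfolding R_def r_def s_def
      by (rule order_from_derivatives[OF p lp],
          rule auxiliary_poly_derivatives_vanish[OF p _ sig]) (use that in auto)
    show "finite ?S" by (rule finite_subset[of _ "{0..<int p}"]) auto
  qed
  also have "degree R \<le> 3 * l + (L - 1 + 3 * c + p * (J - 1))"
  proof -
    have "degree ((r j + f ^ c * s j) * monom 1 (p * j)) \<le> L - 1 + 3 * c + p * (J - 1)"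
      if "j < J" for j
    proof -
      have "degree (f ^ c * s j) \<le> L - 1 + 3 * c"
        using degree_mult_le[of "f ^ c" "s j"] degree_power_le[of f c] f ds[of j] by simp
      then have "degree (r j + f ^ c * s j) \<le> L - 1 + 3 * c"
        using dr[of j] by (intro degree_add_le) auto
      moreover have "p * j \<le> p * (J - 1)" using that by (intro mult_le_mono2) simp
      ultimately show ?thesis
        using degree_mult_le[of "r j + f ^ c * s j" "monom 1 (p * j)"]
          degree_monom_le[of "1::int" "p * j"] by linarith
    qed
    then have "degree (\<Sum>j<J. (r j + f ^ c * s j) * monom 1 (p * j)) \<le> L - 1 + 3 * c + p * (J - 1)"
      by (intro degree_sum_le) auto
    moreover have "degree (f ^ l) \<le> 3 * l" using degree_power_le[of f l] f by simp
    ultimately show ?thesis unfolding R_def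
      using degree_mult_le[of "f ^ l" "\<Sum>j<J. (r j + f ^ c * s j) * monom 1 (p * j)"] by linarith
  qed
  also have "\<dots> \<le> 6 * m + 2 * p + p * (m + 3)"
    using c pL unfolding l_def J_def L_def by (simp add: algebra_simps)
  finally show ?thesis unfolding l_def by simp
qed

lemma stepanov_count:
  fixes f :: "int poly"
  assumes p: "prime p" "p \<ge> 17" and c: "2 * c + 1 = p" and f: "degree f = 3"
    and lc: "\<not> int p dvd lead_coeff f" and f0: "\<not> int p dvd coeff f 0"
  shows "real (card {x \<in> {0..<int p}. [poly f x ^ c = a] (mod int p)}) \<le> p / 2 + 10 * sqrt p + 3"
proof -
  let ?N = "card {x \<in> {0..<int p}. [poly f x ^ c = a] (mod int p)}"
  define m where "m = nat \<lfloor>sqrt p / 2\<rfloor>"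
  have s4: "sqrt p > 4" using p(2) by (intro real_less_rsqrt) simp
  have m1: "real m \<le> sqrt p / 2" and m2: "sqrt p / 2 < real m + 1"
    unfolding m_def using s4 by linarith+
  have "m \<ge> 2" using s4 unfolding m_def by (simp add: le_nat_iff le_floor_iff)
  moreover have "4 * m\<^sup>2 \<le> p"
  proof -
    have "(2 * real m)\<^sup>2 \<le> (sqrt p)\<^sup>2" using m1 by (intro power_mono) auto
    then have "real (4 * m\<^sup>2) \<le> real p" by (simp add: power_mult_distrib)
    then show ?thesis using of_nat_le_iff by blast
  qed
  ultimately have "?N * (2 * m) \<le> 6 * m + 2 * p + p * (m + 3)"
    by (rule stepanov_count_aux[OF p(1) c f lc f0])
  then have "real (?N * (2 * m)) \<le> real (6 * m + 2 * p + p * (m + 3))" using of_nat_le_iff by blast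
  then have *: "real ?N * (2 * real m) \<le> 6 * m + 5 * p + p * real m" by (simp add: algebra_simps)
  have m0: "real m > 0" using \<open>m \<ge> 2\<close> by simp
  have m4: "real m \<ge> sqrt p / 4" using m2 s4 by linarith
  have "real ?N \<le> (6 * m + 5 * p + p * real m) / (2 * real m)"
    using * m0 by (simp add: field_simps)
  also have "\<dots> = p / 2 + 3 + 5 * p / (2 * real m)" using m0 by (simp add: field_simps)
  also have "5 * p / (2 * real m) \<le> 5 * p / (2 * (sqrt p / 4))"
    using m4 m0 s4 p(2) by (intro divide_left_mono mult_left_mono mult_pos_pos) auto
  also have "5 * p / (2 * (sqrt p / 4)) = 10 * sqrt p"
    using real_div_sqrt[of "real p"] by simp
  finally show ?thesis by simp
qed

lemma abs_Legendre_le: "\<bar>real_of_int (Legendre a q)\<bar> \<le> 1"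
  by (simp add: Legendre_def)

lemma Legendre_values: "Legendre a q \<in> {-1, 0, 1}"
  by (simp add: Legendre_def)

text \<open>The values with \<open>f x\<close> a nonzero square and those with \<open>f x\<close> a nonsquare are each at most \<open>p / 2 + O(sqrt p)\<close> in number.
Together with at most three zeros of \<open>f\<close> they exhaust \<open>\<int>/p\<int>\<close>, so both bounds are sharp up to \<open>O(sqrt p)\<close> and the
difference of the two counts is \<open>O(sqrt p)\<close>.\<close>

lemma cubic_character_sum_bound:
  fixes f :: "int poly"
  assumes p: "prime p" "p > 2" and f: "degree f = 3"
    and lc: "\<not> int p dvd lead_coeff f" and f0: "\<not> int p dvd coeff f 0"
  shows "\<bar>\<Sum>x\<in>{0..<int p}. real_of_int (Legendre (poly f x) (int p))\<bar> \<le> 23 * sqrt p"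
proof (cases "p \<ge> 17")
  case False
  have "\<bar>\<Sum>x\<in>{0..<int p}. real_of_int (Legendre (poly f x) (int p))\<bar> \<le> (\<Sum>x\<in>{0..<int p}. 1)"
    by (rule order_trans[OF sum_abs], rule sum_mono) (rule abs_Legendre_le)
  also have "\<dots> = sqrt p * sqrt p" by simp
  also have "\<dots> \<le> 23 * sqrt p"
  proof (rule mult_right_mono)
    have "sqrt p \<le> sqrt (23\<^sup>2)" using False by (intro real_sqrt_le_mono) simp
    then show "sqrt p \<le> 23" by simp
  qed simp
  finally show ?thesis .
next
  case True
  obtain c where c: "2 * c + 1 = p"
    using prime_odd_nat[OF p(1)] p(2) by (metis oddE)
  have c': "(p - 1) div 2 = c" using c by simp
  have eul: "[Legendre a (int p) = a ^ c] (mod int p)" for a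
    using euler_criterion[of p a] p c' by simp
  define N where "N e = {x \<in> {0..<int p}. Legendre (poly f x) (int p) = e}" for e
  have sub: "N e \<subseteq> {x \<in> {0..<int p}. [poly f x ^ c = e] (mod int p)}" for e
    unfolding N_def using eul cong_sym by blast
  \<comment> \<open>By the criterion of Euler, N e consists of points with f x ^ c = e.\<close>
  have B: "real (card (N e)) \<le> p / 2 + 10 * sqrt p + 3" for e
  proof -
    have "card (N e) \<le> card {x \<in> {0..<int p}. [poly f x ^ c = e] (mod int p)}"
      by (rule card_mono[OF finite_subset[of _ "{0..<int p}"] sub]) auto
    then show ?thesis using stepanov_count[OF p(1) True c f lc f0, of e] by linarith
  qed
  have N0: "card (N 0) \<le> 3"
  proof -
    have "\<not> [:int p:] dvd f" using f0 unfolding const_dvd_iff by blast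
    moreover have "N 0 = {x \<in> {0..<int p}. int p dvd poly f x}"
      unfolding N_def Legendre_def by (auto simp: cong_0_iff)
    ultimately show ?thesis using card_roots_mod_le[OF p(1), of f] f by simp
  qed
  have U: "{0..<int p} = N 0 \<union> (N 1 \<union> N (-1))"
    unfolding N_def using Legendre_values by fastforce
  have fin: "finite (N e)" for e unfolding N_def by (rule finite_subset[of _ "{0..<int p}"]) auto
  have disj: "N 0 \<inter> (N 1 \<union> N (-1)) = {}" "N 1 \<inter> N (-1) = {}" unfolding N_def by auto
  have "card {0..<int p} = card (N 0) + (card (N 1) + card (N (-1)))"
    unfolding U by (subst card_Un_disjoint, use fin disj in auto)+
  then have tot: "real p = real (card (N 0)) + real (card (N 1)) + real (card (N (-1)))" by simp
  have "(\<Sum>x\<in>{0..<int p}. real_of_int (Legendre (poly f x) (int p))) =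
     (\<Sum>x\<in>N 0. real_of_int (Legendre (poly f x) (int p))) +
     ((\<Sum>x\<in>N 1. real_of_int (Legendre (poly f x) (int p))) +
     (\<Sum>x\<in>N (-1). real_of_int (Legendre (poly f x) (int p))))"
    unfolding U by (subst sum.union_disjoint, use fin disj in auto)+
  also have "\<dots> = real (card (N 1)) - real (card (N (-1)))"
    by (simp add: N_def)
  finally have S: "(\<Sum>x\<in>{0..<int p}. real_of_int (Legendre (poly f x) (int p)))
      = real (card (N 1)) - real (card (N (-1)))" .
  have "sqrt p > 4" using True by (intro real_less_rsqrt) simp
  then show ?thesis unfolding S using tot B[of 1] B[of "-1"] N0 by linarith
qed

section \<open>Additive characters and Gauss sums\<close>

definition add_char :: "nat \<Rightarrow> int \<Rightarrow> complex" where
  "add_char n x = exp (2 * of_real pi * \<i> * of_int x / of_nat n)"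

lemma add_char_cis: "add_char n x = cis (2 * pi * of_int x / of_nat n)"
  unfolding add_char_def cis_conv_exp by (simp add: mult_ac)

lemma add_char_0 [simp]: "add_char n 0 = 1"
  by (simp add: add_char_def)

lemma add_char_add: "add_char n (x + y) = add_char n x * add_char n y"
  unfolding add_char_cis by (simp add: cis_mult ring_distribs add_divide_distrib)

lemma norm_add_char [simp]: "cmod (add_char n x) = 1"
  unfolding add_char_cis by simp

lemma cnj_add_char: "cnj (add_char n x) = add_char n (- x)"
  unfolding add_char_cis by (simp add: cis_cnj)

lemma add_char_multiple: "n > 0 \<Longrightarrow> add_char n (int n * k) = 1"
proof -
  assume "n > 0"
  then have "2 * pi * of_int (int n * k) / of_nat n = 2 * pi * of_int k" by simp
  then show ?thesis unfolding add_char_cis by (simp add: cis_multiple_2pi)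
qed

lemma add_char_cong:
  assumes "n > 0" "[x = y] (mod int n)" shows "add_char n x = add_char n y"
proof -
  obtain k where "x = y + int n * k"
    using assms(2) by (metis cong_iff_lin cong_sym)
  then show ?thesis using add_char_multiple[OF assms(1), of k] by (simp add: add_char_add)
qed

lemma add_char_power: "add_char n (a * int k) = add_char n a ^ k"
  by (induction k) (simp_all add: algebra_simps add_char_add)

lemma add_char_eq_1:
  assumes "n > 0" "add_char n a = 1" shows "int n dvd a"
proof -
  have "cis (2 * pi * of_int a / of_nat n) = cis 0" using assms(2) unfolding add_char_cis by simp
  then have "exp (\<i> * of_real (2 * pi * of_int a / of_nat n)) = 1"
    unfolding cis_conv_exp by simp
  then obtain m :: int where "2 * pi * of_int a / of_nat n = of_int (2 * m) * pi"
    by (auto simp: exp_eq_1)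
  then have "real_of_int a = of_int (m * int n)" using assms(1) by (simp add: field_simps)
  then have "a = m * int n" by (simp only: of_int_eq_iff)
  then show ?thesis by simp
qed

lemma sum_int_interval: "(\<Sum>x\<in>{0..<int n}. F x) = (\<Sum>k<n. F (int k))"
  by (rule sum.reindex_bij_witness[of _ int nat]) auto

lemma sum_add_char:
  assumes "n > 0"
  shows "(\<Sum>x\<in>{0..<int n}. add_char n (a * x)) = (if int n dvd a then of_nat n else 0)"
proof (cases "int n dvd a")
  case True
  then have "add_char n (a * x) = 1" for x
    using add_char_cong[OF assms, of "a * x" 0] by (simp add: cong_0_iff)
  then show ?thesis using True by simp
next
  case False
  let ?w = "add_char n a"
  have "(\<Sum>x\<in>{0..<int n}. add_char n (a * x)) = (\<Sum>k<n. ?w ^ k)"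
    unfolding sum_int_interval add_char_power ..
  also have "\<dots> = (1 - ?w ^ n) / (1 - ?w)"
    using add_char_eq_1[OF assms, of a] False by (intro sum_gp_strict[THEN trans]) auto
  also have "?w ^ n = 1"
    using add_char_multiple[OF assms, of a] by (simp add: mult.commute flip: add_char_power)
  finally show ?thesis using False by simp
qed

lemma residue_sum_reindex:
  fixes F :: "int \<Rightarrow> 'a :: comm_monoid_add"
  assumes n: "n > 0" and F: "\<And>x y. [x = y] (mod int n) \<Longrightarrow> F x = F y"
    and s: "\<And>x y. [\<sigma> x = \<sigma> y] (mod int n) \<Longrightarrow> [x = y] (mod int n)"
  shows "(\<Sum>x\<in>{0..<int n}. F (\<sigma> x)) = (\<Sum>x\<in>{0..<int n}. F x)"
proof -
  let ?S = "{0..<int n}" and ?t = "\<lambda>x. \<sigma> x mod int n"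
  have inj: "inj_on ?t ?S"
  proof (rule inj_onI)
    fix x y assume xy: "x \<in> ?S" "y \<in> ?S" "?t x = ?t y"
    have "[\<sigma> x = \<sigma> y] (mod int n)" unfolding cong_def by (rule xy(3))
    then have "x mod int n = y mod int n" using s unfolding cong_def by blast
    then show "x = y" using xy(1,2) by simp
  qed
  have sub: "?t ` ?S \<subseteq> ?S" using n by auto
  have "?t ` ?S = ?S" by (rule endo_inj_surj[OF _ sub inj]) simp
  then have "(\<Sum>x\<in>?S. F x) = (\<Sum>x\<in>?S. F (?t x))"
    using sum.reindex[OF inj, of F] by (simp only: comp_def)
  also have "\<dots> = (\<Sum>x\<in>?S. F (\<sigma> x))"
  proof (rule sum.cong[OF refl])
    fix x
    have "[?t x = \<sigma> x] (mod int n)" by simp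
    then show "F (?t x) = F (\<sigma> x)" by (rule F)
  qed
  finally show ?thesis ..
qed

lemma residue_sum_shift:
  assumes "n > 0" "\<And>x y. [x = y] (mod int n) \<Longrightarrow> F x = F y"
  shows "(\<Sum>x\<in>{0..<int n}. F (x + b)) = (\<Sum>x\<in>{0..<int n}. F x)"
  by (rule residue_sum_reindex[OF assms]) (simp_all add: cong_add_rcancel)

lemma residue_sum_scale:
  assumes "n > 0" "\<And>x y. [x = y] (mod int n) \<Longrightarrow> F x = F y" "coprime a (int n)"
  shows "(\<Sum>x\<in>{0..<int n}. F (a * x)) = (\<Sum>x\<in>{0..<int n}. F x)"
  by (rule residue_sum_reindex[OF assms(1,2)]) (simp_all add: cong_mult_lcancel[OF assms(3)])

locale odd_prime =
  fixes p :: nat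
  assumes prime: "prime p" and gt2: "p > 2"
begin

abbreviation "P \<equiv> int p"
abbreviation "Zp \<equiv> {0..<P}"
abbreviation "ee \<equiv> add_char p"
abbreviation chi :: "int \<Rightarrow> complex" where "chi a \<equiv> of_int (Legendre a P)"

lemma p0: "p > 0" using gt2 by simp
lemma primeP: "prime P" using prime by simp
lemma dvd_mult_iff: "P dvd a * b \<longleftrightarrow> P dvd a \<or> P dvd b"
  using primeP by (rule prime_dvd_mult_iff)
lemma dvd_power_iff': "k > 0 \<Longrightarrow> P dvd a ^ k \<longleftrightarrow> P dvd a"
  using primeP by (simp add: prime_dvd_power_iff)
lemma coprime_iff: "coprime a P \<longleftrightarrow> \<not> P dvd a"
  using primeP by (metis coprime_commute prime_imp_coprime not_prime_unit coprime_common_divisor dvd_refl)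
lemma not_dvd_2: "\<not> P dvd 2" using gt2 by (auto dest: zdvd_imp_le)
lemma not_dvd_1: "\<not> P dvd 1" using gt2 by auto

lemma ee_cong: "[x = y] (mod P) \<Longrightarrow> ee x = ee y" by (rule add_char_cong[OF p0])

lemma Legendre_cong: "[a = b] (mod P) \<Longrightarrow> Legendre a P = Legendre b P"
proof -
  assume ab: "[a = b] (mod P)"
  then have "[a = 0] (mod P) \<longleftrightarrow> [b = 0] (mod P)" by (meson cong_sym cong_trans)
  moreover have "QuadRes P a \<longleftrightarrow> QuadRes P b" unfolding QuadRes_def using ab by (meson cong_sym cong_trans)
  ultimately show ?thesis unfolding Legendre_def by simp
qed

lemma chi_cong: "[a = b] (mod P) \<Longrightarrow> chi a = chi b"
  using Legendre_cong by simp

lemma Legendre_0_iff: "Legendre a P = 0 \<longleftrightarrow> P dvd a"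
  unfolding Legendre_def by (simp add: cong_0_iff)

lemma Legendre_mult: "Legendre (a * b) P = Legendre a P * Legendre b P"
proof -
  let ?c = "(p - 1) div 2"
  have eul: "[Legendre x P = x ^ ?c] (mod P)" for x by (rule euler_criterion[OF prime gt2])
  have "[Legendre a P * Legendre b P = a ^ ?c * b ^ ?c] (mod P)" by (intro cong_mult eul)
  then have "[Legendre (a * b) P = Legendre a P * Legendre b P] (mod P)"
    using eul[of "a * b"] by (metis cong_sym cong_trans power_mult_distrib)
  then have d: "P dvd Legendre (a * b) P - Legendre a P * Legendre b P" by (simp add: cong_iff_dvd_diff)
  have "\<bar>Legendre (a * b) P - Legendre a P * Legendre b P\<bar> \<le> 2"
    using Legendre_values[of a P] Legendre_values[of b P] Legendre_values[of "a * b" P] by auto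
  moreover have "P \<le> \<bar>Legendre (a * b) P - Legendre a P * Legendre b P\<bar>"
    if "Legendre (a * b) P - Legendre a P * Legendre b P \<noteq> 0"
    using dvd_imp_le_int[OF that d] by simp
  ultimately show ?thesis using gt2 by fastforce
qed

lemma chi_mult: "chi (a * b) = chi a * chi b"
  by (simp add: Legendre_mult)

lemma Legendre_square: "\<not> P dvd a \<Longrightarrow> Legendre (a\<^sup>2) P = 1"
proof -
  assume a: "\<not> P dvd a"
  have "QuadRes P (a\<^sup>2)" unfolding QuadRes_def by (rule exI[of _ a]) simp
  then show "Legendre (a\<^sup>2) P = 1" using a unfolding Legendre_def by (simp add: cong_0_iff dvd_power_iff')
qed

lemma chi_square: "\<not> P dvd a \<Longrightarrow> chi (a\<^sup>2) = 1"
  using Legendre_square by simp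

lemma norm_chi_le: "cmod (chi a) \<le> 1"
  using abs_Legendre_le[of a P] by (simp flip: of_int_abs)

lemma chi_0: "P dvd a \<Longrightarrow> chi a = 0" using Legendre_0_iff by simp

lemma card_square_roots: "int (card {y \<in> Zp. [y\<^sup>2 = d] (mod P)}) = 1 + Legendre d P"
proof -
  consider "P dvd d" | "\<not> P dvd d" "\<not> QuadRes P d" | "\<not> P dvd d" "QuadRes P d" by blast
  then show ?thesis
  proof cases
    case 1
    have "{y \<in> Zp. [y\<^sup>2 = d] (mod P)} = {0}"
    proof -
      have "[y\<^sup>2 = d] (mod P) \<longleftrightarrow> P dvd y" for y
      proof -
        have "[d = 0] (mod P)" using 1 by (simp add: cong_0_iff)
        then have "[y\<^sup>2 = d] (mod P) \<longleftrightarrow> [y\<^sup>2 = 0] (mod P)" by (meson cong_sym cong_trans)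
        then show ?thesis using dvd_power_iff'[of 2 y] by (simp add: cong_0_iff)
      qed
      then show ?thesis using p0 by (auto dest: zdvd_imp_le)
    qed
    then show ?thesis using 1 Legendre_0_iff by simp
  next
    case 2
    then have e: "{y \<in> Zp. [y\<^sup>2 = d] (mod P)} = {}" unfolding QuadRes_def by auto
    show ?thesis unfolding e using 2 by (simp add: Legendre_def cong_0_iff)
  next
    case 3
    then obtain z where z: "[z\<^sup>2 = d] (mod P)" unfolding QuadRes_def by blast
    have nz: "\<not> P dvd z"
      using z 3 by (metis cong_dvd_iff dvd_power_iff' zero_less_numeral)
    define y0 where "y0 = z mod P"
    define y1 where "y1 = (- z) mod P"
    have eq: "[y\<^sup>2 = d] (mod P) \<longleftrightarrow> [y = z] (mod P) \<or> [y = - z] (mod P)" for y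
    proof -
      have "[y\<^sup>2 = d] (mod P) \<longleftrightarrow> [y\<^sup>2 = z\<^sup>2] (mod P)" using z by (meson cong_sym cong_trans)
      also have "\<dots> \<longleftrightarrow> P dvd (y - z) * (y + z)"
        by (simp add: cong_iff_dvd_diff power2_eq_square algebra_simps)
      also have "\<dots> \<longleftrightarrow> [y = z] (mod P) \<or> [y = - z] (mod P)"
        by (simp add: dvd_mult_iff cong_iff_dvd_diff)
      finally show ?thesis .
    qed
    have e: "{y \<in> Zp. [y\<^sup>2 = d] (mod P)} = {y0, y1}"
      unfolding eq y0_def y1_def using p0 by (auto simp: cong_def)
    have "y0 \<noteq> y1"
    proof
      assume "y0 = y1"
      then have "P dvd z - (- z)" unfolding y0_def y1_def by (simp add: mod_eq_dvd_iff)
      then have "P dvd 2 * z" by simp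
      then show False using nz not_dvd_2 dvd_mult_iff by blast
    qed
    then show ?thesis unfolding e using 3 by (simp add: Legendre_def cong_0_iff)
  qed
qed

lemma sum_over_squares:
  fixes F :: "int \<Rightarrow> complex"
  assumes F: "\<And>x y. [x = y] (mod P) \<Longrightarrow> F x = F y"
  shows "(\<Sum>x\<in>Zp. F (x\<^sup>2)) = (\<Sum>d\<in>Zp. (1 + chi d) * F d)"
proof -
  have "(\<Sum>x\<in>Zp. F (x\<^sup>2)) = (\<Sum>d\<in>Zp. \<Sum>x | x \<in> Zp \<and> x\<^sup>2 mod P = d. F (x\<^sup>2))"
    by (rule sum.group[symmetric]) (use p0 in auto)
  also have "\<dots> = (\<Sum>d\<in>Zp. (1 + chi d) * F d)"
  proof (rule sum.cong[OF refl])
    fix d assume d: "d \<in> Zp"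
    have e: "{x. x \<in> Zp \<and> x\<^sup>2 mod P = d} = {y \<in> Zp. [y\<^sup>2 = d] (mod P)}"
      using d by (auto simp: cong_def)
    have "(\<Sum>x | x \<in> Zp \<and> x\<^sup>2 mod P = d. F (x\<^sup>2)) = (\<Sum>x | x \<in> Zp \<and> x\<^sup>2 mod P = d. F d)"
      by (rule sum.cong[OF refl]) (use F d in \<open>auto simp: cong_def\<close>)
    also have "\<dots> = of_int (int (card {x. x \<in> Zp \<and> x\<^sup>2 mod P = d})) * F d" by simp
    also have "\<dots> = (1 + chi d) * F d"
      unfolding e card_square_roots by simp
    finally show "(\<Sum>x | x \<in> Zp \<and> x\<^sup>2 mod P = d. F (x\<^sup>2)) = (1 + chi d) * F d" .
  qed
  finally show ?thesis .
qed

definition "gauss_sum = (\<Sum>x\<in>Zp. ee (x\<^sup>2))"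

lemma sum_chi: "(\<Sum>d\<in>Zp. chi d) = 0"
  using sum_over_squares[of "\<lambda>_. 1"] by (simp add: sum.distrib)

lemma gauss_sum_chi: "gauss_sum = (\<Sum>d\<in>Zp. chi d * ee d)"
proof -
  have "(\<Sum>d\<in>Zp. ee (1 * d)) = 0" using sum_add_char[OF p0, of 1] not_dvd_1 by simp
  then show ?thesis
    unfolding gauss_sum_def using sum_over_squares[of ee] ee_cong by (simp add: ring_distribs sum.distrib)
qed

lemma chi_gauss_sum: "chi a * gauss_sum = (\<Sum>t\<in>Zp. chi t * ee (t * a))"
proof (cases "P dvd a")
  case True
  then have "ee (t * a) = 1" for t using ee_cong[of "t * a" 0] by (simp add: cong_0_iff)
  then show ?thesis using sum_chi chi_0[OF True] by simp
next
  case False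
  then have a2: "chi a * chi a = 1" using chi_square[OF False] by (simp add: power2_eq_square Legendre_mult)
  have "gauss_sum = (\<Sum>t\<in>Zp. chi (a * t) * ee (a * t))"
    unfolding gauss_sum_chi
    by (rule residue_sum_scale[OF p0, symmetric]) (use ee_cong chi_cong coprime_iff False in metis)+
  then have "gauss_sum = chi a * (\<Sum>t\<in>Zp. chi t * ee (t * a))"
    by (simp add: chi_mult sum_distrib_left mult_ac Legendre_mult)
  then show ?thesis using a2 by (simp flip: mult.assoc)
qed

lemma norm_gauss_sum: "cmod gauss_sum = sqrt p"
proof -
  have per: "[x\<^sup>2 = y\<^sup>2] (mod P)" if "[x = y] (mod P)" for x y :: int using that by (rule cong_pow)
  have "gauss_sum * cnj gauss_sum = (\<Sum>y\<in>Zp. \<Sum>x\<in>Zp. ee (x\<^sup>2) * ee (- y\<^sup>2))"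
    unfolding gauss_sum_def by (subst sum.swap) (simp add: sum_product cnj_add_char)
  also have "\<dots> = (\<Sum>y\<in>Zp. \<Sum>h\<in>Zp. ee ((h + y)\<^sup>2) * ee (- y\<^sup>2))"
    by (rule sum.cong[OF refl], rule residue_sum_shift[OF p0, symmetric])
       (use ee_cong per in metis)
  also have "\<dots> = (\<Sum>h\<in>Zp. ee (h\<^sup>2) * (\<Sum>y\<in>Zp. ee ((2 * h) * y)))"
    by (subst sum.swap) (simp add: sum_distrib_left flip: add_char_add, simp add: power2_eq_square algebra_simps)
  also have "\<dots> = (\<Sum>h\<in>Zp. if h = 0 then of_nat p else 0)"
  proof (rule sum.cong[OF refl])
    fix h assume h: "h \<in> Zp"
    have "P dvd 2 * h \<longleftrightarrow> h = 0"
      using h not_dvd_2 by (auto simp: dvd_mult_iff dest: zdvd_imp_le)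
    then show "ee (h\<^sup>2) * (\<Sum>y\<in>Zp. ee ((2 * h) * y)) = (if h = 0 then of_nat p else 0)"
      unfolding sum_add_char[OF p0] by simp
  qed
  also have "\<dots> = of_nat p" using p0 by simp
  finally have "complex_of_real ((cmod gauss_sum)\<^sup>2) = complex_of_real (real p)"
    using complex_norm_square[of gauss_sum] by (simp only: of_real_of_nat_eq)
  then have "(cmod gauss_sum)\<^sup>2 = real p" by (simp only: of_real_eq_iff)
  then show ?thesis by (metis norm_ge_zero real_sqrt_unique)
qed

lemma gauss_sum_scaled:
  assumes "\<not> P dvd a" shows "(\<Sum>x\<in>Zp. ee (a * x\<^sup>2)) = chi a * gauss_sum"
proof -
  have "(\<Sum>x\<in>Zp. ee (a * x\<^sup>2)) = (\<Sum>d\<in>Zp. (1 + chi d) * ee (a * d))"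
    by (rule sum_over_squares) (intro ee_cong cong_mult cong_refl)
  also have "\<dots> = (\<Sum>d\<in>Zp. ee (a * d)) + (\<Sum>d\<in>Zp. chi d * ee (d * a))"
    by (simp add: ring_distribs sum.distrib mult.commute)
  also have "(\<Sum>d\<in>Zp. ee (a * d)) = 0" unfolding sum_add_char[OF p0] using assms by simp
  finally show ?thesis by (simp add: chi_gauss_sum)
qed

lemma quadratic_gauss_sum:
  assumes a: "[a * a' = 1] (mod P)"
  shows "(\<Sum>x\<in>Zp. ee (a * x\<^sup>2 + 2 * b * x)) = chi a * gauss_sum * ee (- (a' * b\<^sup>2))"
proof -
  have na: "\<not> P dvd a"
    using a not_dvd_1 by (metis cong_dvd_iff dvd_mult2)
  have per: "[x\<^sup>2 = y\<^sup>2] (mod P)" if "[x = y] (mod P)" for x y :: int using that by (rule cong_pow)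
  have "(\<Sum>x\<in>Zp. ee (a * x\<^sup>2 + 2 * b * x)) = (\<Sum>x\<in>Zp. ee (a * (x + a' * b)\<^sup>2) * ee (- (a' * b\<^sup>2)))"
  proof (rule sum.cong[OF refl])
    fix x
    have "(a * (x + a' * b)\<^sup>2 + - (a' * b\<^sup>2)) - (a * x\<^sup>2 + 2 * b * x)
        = (a * a' - 1) * (2 * b * x + a' * b\<^sup>2)" by (simp add: algebra_simps power2_eq_square)
    moreover have "P dvd a * a' - 1" using a by (simp add: cong_iff_dvd_diff)
    ultimately have "[a * (x + a' * b)\<^sup>2 + - (a' * b\<^sup>2) = a * x\<^sup>2 + 2 * b * x] (mod P)"
      by (simp add: cong_iff_dvd_diff)
    from ee_cong[OF this] show "ee (a * x\<^sup>2 + 2 * b * x) = ee (a * (x + a' * b)\<^sup>2) * ee (- (a' * b\<^sup>2))"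
      unfolding add_char_add by simp
  qed
  also have "\<dots> = (\<Sum>x\<in>Zp. ee (a * (x + a' * b)\<^sup>2)) * ee (- (a' * b\<^sup>2))"
    by (simp add: sum_distrib_right)
  also have "(\<Sum>x\<in>Zp. ee (a * (x + a' * b)\<^sup>2)) = (\<Sum>x\<in>Zp. ee (a * x\<^sup>2))"
    by (rule residue_sum_shift[OF p0]) (intro ee_cong cong_mult cong_refl per)
  finally show ?thesis unfolding gauss_sum_scaled[OF na] .
qed

lemma norm_quadratic_gauss_sum:
  assumes "\<not> P dvd a" shows "cmod (\<Sum>x\<in>Zp. ee (a * x\<^sup>2 + 2 * b * x)) \<le> sqrt p"
proof -
  obtain a' where a': "[a * a' = 1] (mod P)"
    using cong_modular_inverse1[of a P] assms coprime_iff by blast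
  show ?thesis
    unfolding quadratic_gauss_sum[OF a'] norm_mult norm_gauss_sum norm_add_char
    using mult_right_mono[OF norm_chi_le[of a], of "sqrt p"] by simp
qed

end

section \<open>Discriminant-twisted sums of ternary quadratic forms\<close>

context odd_prime
begin

lemma inverse_exists: "\<not> P dvd a \<Longrightarrow> \<exists>a'. [a * a' = 1] (mod P)"
  using cong_modular_inverse1[of a P] coprime_iff by blast

text \<open>Completing the square in \<open>z\<close>: the inner sum is a quadratic Gauss sum, and the binary form that
remains is the Schur complement of \<open>C\<close>.\<close>

lemma ternary_gauss_pivot:
  assumes C: "[C * C' = 1] (mod P)"
  shows "(\<Sum>x\<in>Zp. \<Sum>y\<in>Zp. \<Sum>z\<in>Zp. ee (A * x\<^sup>2 + B * y\<^sup>2 + C * z\<^sup>2 + 2 * D * x * y + 2 * E * y * z + 2 * F * x * z))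
    = chi C * gauss_sum * (\<Sum>x\<in>Zp. \<Sum>y\<in>Zp.
        ee ((A - C' * F\<^sup>2) * x\<^sup>2 + 2 * (D - C' * E * F) * x * y + (B - C' * E\<^sup>2) * y\<^sup>2))"
proof -
  have "(\<Sum>z\<in>Zp. ee (A * x\<^sup>2 + B * y\<^sup>2 + C * z\<^sup>2 + 2 * D * x * y + 2 * E * y * z + 2 * F * x * z))
      = chi C * gauss_sum * ee ((A - C' * F\<^sup>2) * x\<^sup>2 + 2 * (D - C' * E * F) * x * y + (B - C' * E\<^sup>2) * y\<^sup>2)"
    for x y
  proof -
    have 1: "A * x\<^sup>2 + B * y\<^sup>2 + C * z\<^sup>2 + 2 * D * x * y + 2 * E * y * z + 2 * F * x * z
        = (C * z\<^sup>2 + 2 * (E * y + F * x) * z) + (A * x\<^sup>2 + B * y\<^sup>2 + 2 * D * x * y)" for z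
      by (simp add: algebra_simps)
    have 2: "(A - C' * F\<^sup>2) * x\<^sup>2 + 2 * (D - C' * E * F) * x * y + (B - C' * E\<^sup>2) * y\<^sup>2
        = - (C' * (E * y + F * x)\<^sup>2) + (A * x\<^sup>2 + B * y\<^sup>2 + 2 * D * x * y)"
      by (simp add: algebra_simps power2_eq_square)
    show ?thesis
      unfolding 1 2 add_char_add[of p "C * _ + _"] add_char_add[of p "- _"] sum_distrib_right[symmetric]
        quadratic_gauss_sum[OF C] by (simp add: mult.assoc)
  qed
  then show ?thesis by (simp only: sum_distrib_left)
qed

lemma binary_gauss_exact:
  assumes A: "[A * A' = 1] (mod P)" and B: "\<not> P dvd B - A' * D\<^sup>2"
  shows "(\<Sum>x\<in>Zp. \<Sum>y\<in>Zp. ee (A * x\<^sup>2 + 2 * D * x * y + B * y\<^sup>2))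
    = chi A * chi (B - A' * D\<^sup>2) * gauss_sum\<^sup>2"
proof -
  have "(\<Sum>x\<in>Zp. ee (A * x\<^sup>2 + 2 * D * x * y + B * y\<^sup>2)) = chi A * gauss_sum * ee ((B - A' * D\<^sup>2) * y\<^sup>2)" for y
  proof -
    have 1: "A * x\<^sup>2 + 2 * D * x * y + B * y\<^sup>2 = (A * x\<^sup>2 + 2 * (D * y) * x) + B * y\<^sup>2" for x
      by (simp add: algebra_simps)
    have 2: "(B - A' * D\<^sup>2) * y\<^sup>2 = - (A' * (D * y)\<^sup>2) + B * y\<^sup>2"
      by (simp add: algebra_simps power2_eq_square)
    show ?thesis
      unfolding 1 2 add_char_add[of p "A * _ + _"] add_char_add[of p "- _"] sum_distrib_right[symmetric]
        quadratic_gauss_sum[OF A] by (simp add: mult.assoc)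
  qed
  then have "(\<Sum>x\<in>Zp. \<Sum>y\<in>Zp. ee (A * x\<^sup>2 + 2 * D * x * y + B * y\<^sup>2))
      = chi A * gauss_sum * (\<Sum>y\<in>Zp. ee ((B - A' * D\<^sup>2) * y\<^sup>2))"
    by (subst sum.swap) (simp only: sum_distrib_left)
  then show ?thesis unfolding gauss_sum_scaled[OF B] by (simp add: power2_eq_square)
qed

lemma norm_sum_Zp_le:
  fixes K :: real
  assumes "\<And>x. cmod (F x) \<le> K" shows "cmod (\<Sum>x\<in>Zp. F x) \<le> p * K"
  using sum_norm_bound[of Zp F K] assms by simp

text \<open>One variable is summed by a Gauss sum whenever a square occurs, and the other one is estimated
trivially. If no square occurs, the form is a multiple of \<open>x * y\<close>, and the sum over \<open>y\<close> is orthogonality.\<close>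

lemma binary_gauss_bound:
  assumes "\<not> (P dvd A \<and> P dvd B \<and> P dvd D)"
  shows "cmod (\<Sum>x\<in>Zp. \<Sum>y\<in>Zp. ee (A * x\<^sup>2 + 2 * D * x * y + B * y\<^sup>2)) \<le> p * sqrt p"
proof -
  have pivot: "cmod (\<Sum>x\<in>Zp. ee (a * x\<^sup>2 + 2 * D * x * y + b * y\<^sup>2)) \<le> sqrt p" if "\<not> P dvd a" for a b y
  proof -
    have 1: "a * x\<^sup>2 + 2 * D * x * y + b * y\<^sup>2 = (a * x\<^sup>2 + 2 * (D * y) * x) + b * y\<^sup>2" for x
      by (simp add: algebra_simps)
    show ?thesis
      unfolding 1 add_char_add[of p "a * _ + _"] sum_distrib_right[symmetric] norm_mult norm_add_char
      using norm_quadratic_gauss_sum[OF that] by simp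
  qed
  consider "\<not> P dvd A" | "\<not> P dvd B" | "P dvd A" "P dvd B" "\<not> P dvd D" using assms by blast
  then show ?thesis
  proof cases
    case 1
    have "cmod (\<Sum>y\<in>Zp. \<Sum>x\<in>Zp. ee (A * x\<^sup>2 + 2 * D * x * y + B * y\<^sup>2)) \<le> p * sqrt p"
      by (rule norm_sum_Zp_le) (rule pivot[OF 1])
    then show ?thesis by (subst sum.swap)
  next
    case 2
    have "cmod (\<Sum>x\<in>Zp. \<Sum>y\<in>Zp. ee (B * y\<^sup>2 + 2 * D * y * x + A * x\<^sup>2)) \<le> p * sqrt p"
      by (rule norm_sum_Zp_le) (rule pivot[OF 2])
    moreover have "A * x\<^sup>2 + 2 * D * x * y + B * y\<^sup>2 = B * y\<^sup>2 + 2 * D * y * x + A * x\<^sup>2" for x y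
      by (simp add: algebra_simps)
    ultimately show ?thesis by presburger
  next
    case 3
    have "(\<Sum>y\<in>Zp. ee (A * x\<^sup>2 + 2 * D * x * y + B * y\<^sup>2)) = (if P dvd x then of_nat p else 0)" for x
    proof -
      have "ee (A * x\<^sup>2 + 2 * D * x * y + B * y\<^sup>2) = ee ((2 * D * x) * y)" for y
        by (rule ee_cong) (use 3 in \<open>simp add: cong_iff_dvd_diff\<close>)
      then show ?thesis using sum_add_char[OF p0, of "2 * D * x"] 3 not_dvd_2 by (simp add: dvd_mult_iff)
    qed
    moreover have "(\<Sum>x\<in>Zp. if P dvd x then of_nat p else 0) = (of_nat p :: complex)"
    proof -
      have "(if P dvd x then of_nat p else 0) = (if x = 0 then of_nat p else (0 :: complex))" if "x \<in> Zp" for x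
        using that by (auto dest: zdvd_imp_le)
      then show ?thesis using p0 by simp
    qed
    ultimately have "cmod (\<Sum>x\<in>Zp. \<Sum>y\<in>Zp. ee (A * x\<^sup>2 + 2 * D * x * y + B * y\<^sup>2)) = real p * 1"
      by simp
    also have "\<dots> \<le> real p * sqrt p" using p0 by (intro mult_left_mono) auto
    finally show ?thesis .
  qed
qed

lemma sum_reindex_inverse:
  fixes F :: "int \<Rightarrow> complex"
  shows "(\<Sum>t\<in>{1..<P}. F (modular_inverse P t)) = (\<Sum>t\<in>{1..<P}. F t)"
proof -
  have cop: "coprime t P" if "t \<in> {1..<P}" for t
    using that zdvd_imp_le[of P t] unfolding coprime_iff by auto
  have inv: "modular_inverse P t \<in> {1..<P}" if "t \<in> {1..<P}" for t
  proof -
    have "\<not> P dvd modular_inverse P t"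
      using coprime_modular_inverse[OF cop[OF that]] unfolding coprime_iff .
    then have "modular_inverse P t \<noteq> 0" by auto
    then show ?thesis
      using modular_inverse_int_nonneg[of P t] modular_inverse_int_less[of P t] p0 by auto
  qed
  have invinv: "modular_inverse P (modular_inverse P t) = t" if "t \<in> {1..<P}" for t
  proof (rule modular_inverse_int_eqI)
    show "t \<in> {0..<P}" using that by auto
    show "[modular_inverse P t * t = 1] (mod P)" by (rule cong_modular_inverse2[OF cop[OF that]])
  qed
  have "bij_betw (modular_inverse P) {1..<P} {1..<P}"
    by (rule bij_betw_byWitness[of _ "modular_inverse P"]) (use inv invinv in blast)+
  then show ?thesis by (rule sum.reindex_bij_betw)
qed

text \<open>With \<open>t = 1 / u\<close>, multiplication by the square \<open>u ^ 4\<close> turns \<open>t * (- (t ^ 3) + 3 * I * t + J)\<close>, a quartic in \<open>t\<close> that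
vanishes at 0, into the cubic \<open>J * u ^ 3 + 3 * I * u\<^sup>2 - 1\<close>. It has odd degree and a constant term prime to \<open>p\<close>.\<close>

lemma resolvent_character_sum:
  fixes I J :: int
  assumes J: "\<not> P dvd J"
  shows "cmod (\<Sum>t\<in>Zp. chi t * chi (4 * (- (t ^ 3) + 3 * I * t + J))) \<le> 23 * sqrt p + 1"
proof -
  let ?g = "[:- 1, 0, 3 * I, J:]"
  have J0: "J \<noteq> 0" using J by auto
  have Z: "Zp = insert 0 {1..<P}" using p0 by auto
  have eq: "chi t * chi (4 * (- (t ^ 3) + 3 * I * t + J)) = chi (poly ?g (modular_inverse P t))"
    if t: "t \<in> {1..<P}" for t
  proof -
    define u where "u = modular_inverse P t"
    have nt: "\<not> P dvd t" using t by (auto dest: zdvd_imp_le)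
    then have tu: "P dvd t * u - 1"
      using cong_modular_inverse1[of t P] coprime_iff unfolding u_def by (simp add: cong_iff_dvd_diff)
    have nu: "\<not> P dvd u"
    proof
      assume "P dvd u"
      then have "P dvd t * u" by simp
      then have "P dvd t * u - (t * u - 1)" using tu by (rule dvd_diff)
      moreover have "t * u - (t * u - 1) = 1" by simp
      ultimately show False using not_dvd_1 by (simp only:)
    qed
    have "(2 * u\<^sup>2)\<^sup>2 * (t * (- (t ^ 3) + 3 * I * t + J)) - 2\<^sup>2 * poly ?g u
      = (t * u - 1) * (4 * (- (t * u + 1) * ((t * u)\<^sup>2 + 1) + 3 * I * u\<^sup>2 * (t * u + 1) + J * u ^ 3))"
      by (simp add: algebra_simps power2_eq_square power3_eq_cube)
    then have "[(2 * u\<^sup>2)\<^sup>2 * (t * (- (t ^ 3) + 3 * I * t + J)) = 2\<^sup>2 * poly ?g u] (mod P)"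
      using tu by (simp add: cong_iff_dvd_diff)
    then have "chi ((2 * u\<^sup>2)\<^sup>2 * (t * (- (t ^ 3) + 3 * I * t + J))) = chi (2\<^sup>2 * poly ?g u)"
      by (rule chi_cong)
    moreover have "chi ((2 * u\<^sup>2)\<^sup>2) = 1"
      by (rule chi_square) (simp add: dvd_mult_iff dvd_power_iff' nu not_dvd_2)
    moreover have c2: "chi (2\<^sup>2) = 1" by (rule chi_square) (rule not_dvd_2)
    ultimately have "chi (t * (- (t ^ 3) + 3 * I * t + J)) = chi (poly ?g u)"
      unfolding chi_mult[of "(2 * u\<^sup>2)\<^sup>2"] chi_mult[of "2\<^sup>2"] by (simp only: mult_1)
    moreover have "chi (4 * (- (t ^ 3) + 3 * I * t + J)) = chi (- (t ^ 3) + 3 * I * t + J)"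
    proof -
      have "chi (4 * y) = chi y" for y using c2 chi_mult[of 4 y] by simp
      then show ?thesis .
    qed
    ultimately show ?thesis unfolding u_def chi_mult[of t] by (simp only:)
  qed
  have "(\<Sum>t\<in>Zp. chi t * chi (4 * (- (t ^ 3) + 3 * I * t + J)))
      = (\<Sum>t\<in>{1..<P}. chi (poly ?g (modular_inverse P t)))"
    unfolding Z using eq chi_0[of 0] by simp
  also have "\<dots> = (\<Sum>u\<in>{1..<P}. chi (poly ?g u))" by (rule sum_reindex_inverse)
  also have "\<dots> = (\<Sum>u\<in>Zp. chi (poly ?g u)) - chi (- 1)" unfolding Z by simp
  finally have "cmod (\<Sum>t\<in>Zp. chi t * chi (4 * (- (t ^ 3) + 3 * I * t + J)))
      \<le> cmod (\<Sum>u\<in>Zp. chi (poly ?g u)) + cmod (chi (- 1))"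
    by (simp only: norm_triangle_ineq4)
  moreover have "cmod (\<Sum>u\<in>Zp. chi (poly ?g u)) \<le> 23 * sqrt p"
  proof -
    have "(\<Sum>u\<in>Zp. chi (poly ?g u)) = of_real (\<Sum>u\<in>Zp. real_of_int (Legendre (poly ?g u) P))"
      by simp
    then have "cmod (\<Sum>u\<in>Zp. chi (poly ?g u)) = \<bar>\<Sum>u\<in>Zp. real_of_int (Legendre (poly ?g u) P)\<bar>"
      by (simp only: norm_of_real)
    also have "\<dots> \<le> 23 * sqrt p"
      by (rule cubic_character_sum_bound[OF prime gt2]) (use J J0 not_dvd_1 in auto)
    finally show ?thesis .
  qed
  ultimately show ?thesis using norm_chi_le[of "- 1"] by linarith
qed

text \<open>Twelve times the pairing of the form with coefficients \<open>a0,\<dots>,a4\<close> with the square of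
\<open>x X\<^sup>2 + y X Y + z Y\<^sup>2\<close>, as a ternary quadratic form in \<open>x\<close>, \<open>y\<close>, \<open>z\<close>.\<close>

definition conic_form :: "int \<Rightarrow> int \<Rightarrow> int \<Rightarrow> int \<Rightarrow> int \<Rightarrow> int \<Rightarrow> int \<Rightarrow> int \<Rightarrow> int" where
  "conic_form a0 a1 a2 a3 a4 x y z =
     12 * a0 * x\<^sup>2 + 6 * a1 * x * y + 2 * a2 * (y\<^sup>2 + 2 * x * z) + 6 * a3 * y * z + 12 * a4 * z\<^sup>2"

definition disc_twisted_sum :: "int \<Rightarrow> int \<Rightarrow> int \<Rightarrow> int \<Rightarrow> int \<Rightarrow> complex" where
  "disc_twisted_sum a0 a1 a2 a3 a4 =
     (\<Sum>x\<in>Zp. \<Sum>y\<in>Zp. \<Sum>z\<in>Zp. chi (y\<^sup>2 - 4 * x * z) * ee (conic_form a0 a1 a2 a3 a4 x y z))"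

lemma gauss_sum_mult_twisted_sum:
  "gauss_sum * disc_twisted_sum a0 a1 a2 a3 a4 = (\<Sum>t\<in>Zp. chi t *
     (\<Sum>x\<in>Zp. \<Sum>y\<in>Zp. \<Sum>z\<in>Zp. ee ((12 * a0) * x\<^sup>2 + (t + 2 * a2) * y\<^sup>2 + (12 * a4) * z\<^sup>2
        + 2 * (3 * a1) * x * y + 2 * (3 * a3) * y * z + 2 * (2 * a2 - 2 * t) * x * z)))"
proof -
  have e: "ee ((12 * a0) * x\<^sup>2 + (t + 2 * a2) * y\<^sup>2 + (12 * a4) * z\<^sup>2
        + 2 * (3 * a1) * x * y + 2 * (3 * a3) * y * z + 2 * (2 * a2 - 2 * t) * x * z)
      = ee (t * (y\<^sup>2 - 4 * x * z)) * ee (conic_form a0 a1 a2 a3 a4 x y z)" for t x y z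
    unfolding add_char_add[symmetric] conic_form_def by (rule arg_cong[of _ _ ee]) (simp add: algebra_simps)
  have g: "gauss_sum * (chi d * w) = (\<Sum>t\<in>Zp. chi t * (ee (t * d) * w))" for d w
  proof -
    have "gauss_sum * (chi d * w) = (chi d * gauss_sum) * w" by simp
    then show ?thesis unfolding chi_gauss_sum sum_distrib_right by (simp only: mult.assoc)
  qed
  have "gauss_sum * disc_twisted_sum a0 a1 a2 a3 a4 = (\<Sum>x\<in>Zp. \<Sum>y\<in>Zp. \<Sum>z\<in>Zp. \<Sum>t\<in>Zp.
      chi t * (ee (t * (y\<^sup>2 - 4 * x * z)) * ee (conic_form a0 a1 a2 a3 a4 x y z)))"
    unfolding disc_twisted_sum_def sum_distrib_left g ..
  also have "\<dots> = (\<Sum>x\<in>Zp. \<Sum>y\<in>Zp. \<Sum>t\<in>Zp. \<Sum>z\<in>Zp.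
      chi t * (ee (t * (y\<^sup>2 - 4 * x * z)) * ee (conic_form a0 a1 a2 a3 a4 x y z)))"
    by (rule sum.cong[OF refl], rule sum.cong[OF refl], rule sum.swap)
  also have "\<dots> = (\<Sum>x\<in>Zp. \<Sum>t\<in>Zp. \<Sum>y\<in>Zp. \<Sum>z\<in>Zp.
      chi t * (ee (t * (y\<^sup>2 - 4 * x * z)) * ee (conic_form a0 a1 a2 a3 a4 x y z)))"
    by (rule sum.cong[OF refl], rule sum.swap)
  also have "\<dots> = (\<Sum>t\<in>Zp. \<Sum>x\<in>Zp. \<Sum>y\<in>Zp. \<Sum>z\<in>Zp.
      chi t * (ee (t * (y\<^sup>2 - 4 * x * z)) * ee (conic_form a0 a1 a2 a3 a4 x y z)))"
    by (rule sum.swap)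
  finally show ?thesis unfolding e sum_distrib_left .
qed

text \<open>Expanding the quadratic character through Gauss sums gives, for every \<open>t\<close>, a Gauss sum of the
ternary form \<open>conic_form + t * (y\<^sup>2 - 4 * x * z)\<close>. The determinant of this pencil is four times the resolvent cubic
\<open>- t^3 + 3 I t + J\<close> of the quartic form. Unless \<open>t\<close> is among five exceptional values, the Gauss sum is the cube of the
one-dimensional one times the quadratic character of the determinant, and the sum over \<open>t\<close> becomes the character sum of
\<open>resolvent_character_sum\<close>. When the discriminant is not zero the resolvent has no double root, hence the pencil never
drops to rank one, and an exceptional \<open>t\<close> contributes at most \<open>p\<^sup>2\<close>.\<close>

lemma disc_twisted_sum_bound:
  assumes p5: "p \<ge> 5" and a4: "\<not> P dvd a4"
    and J: "\<not> P dvd quartic_J (Quartic a0 a1 a2 a3 a4)"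
    and Disc: "\<not> P dvd Disc (Quartic a0 a1 a2 a3 a4)"
  shows "cmod (disc_twisted_sum a0 a1 a2 a3 a4) \<le> 34 * (p * sqrt p)"
proof -
  define I where "I = quartic_I (Quartic a0 a1 a2 a3 a4)"
  define J where "J = quartic_J (Quartic a0 a1 a2 a3 a4)"
  define A where "A = 12 * a0"
  define C where "C = 12 * a4"
  define D where "D = 3 * a1"
  define E where "E = 3 * a3"
  define B where "B t = t + 2 * a2" for t
  define F where "F t = 2 * a2 - 2 * t" for t
  define dt where "dt t = 4 * (- (t ^ 3) + 3 * I * t + J)" for t
  define T where "T t = (\<Sum>x\<in>Zp. \<Sum>y\<in>Zp. \<Sum>z\<in>Zp. ee (A * x\<^sup>2 + B t * y\<^sup>2 + C * z\<^sup>2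
        + 2 * D * x * y + 2 * E * y * z + 2 * F t * x * z))" for t
  note defs = A_def B_def C_def D_def E_def F_def
  have nd3: "\<not> P dvd 3"
    using p5 by (auto dest: zdvd_imp_le)
  have nd12: "\<not> P dvd 12"
  proof -
    have "\<not> P dvd 2 * 2 * 3" using nd3 not_dvd_2 by (simp only: dvd_mult_iff) simp
    then show ?thesis by simp
  qed
  have nd27: "\<not> P dvd 27"
  proof -
    have "\<not> P dvd 3 * 3 * 3" using nd3 by (simp only: dvd_mult_iff) simp
    then show ?thesis by simp
  qed
  have nd4: "\<not> P dvd 4"
  proof -
    have "\<not> P dvd 2 * 2" using not_dvd_2 by (simp only: dvd_mult_iff) simp
    then show ?thesis by simp
  qed
  have nJ: "\<not> P dvd J" using J unfolding J_def .
  have nC: "\<not> P dvd C" unfolding C_def dvd_mult_iff using nd12 a4 by blast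
  obtain C' where C': "[C * C' = 1] (mod P)" using inverse_exists[OF nC] by blast
  have c: "P dvd C * C' - 1" using C' by (simp add: cong_iff_dvd_diff)
  define A1 where "A1 t = A - C' * (F t)\<^sup>2" for t
  define B1 where "B1 t = B t - C' * E\<^sup>2" for t
  define D1 where "D1 t = D - C' * E * F t" for t
  have T: "T t = chi C * gauss_sum * (\<Sum>x\<in>Zp. \<Sum>y\<in>Zp. ee (A1 t * x\<^sup>2 + 2 * D1 t * x * y + B1 t * y\<^sup>2))" for t
    unfolding T_def A1_def B1_def D1_def by (rule ternary_gauss_pivot[OF C'])
  \<comment> \<open>The determinant of the symmetric matrix of the pencil.\<close>
  have det: "A * B t * C + 2 * D * E * F t - A * E\<^sup>2 - B t * (F t)\<^sup>2 - C * D\<^sup>2 = dt t" for t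
    unfolding defs dt_def I_def J_def by (simp add: algebra_simps power2_eq_square power3_eq_cube)
  have CA1: "P dvd C * A1 t - (A * C - (F t)\<^sup>2)" for t
  proof -
    have "C * A1 t - (A * C - (F t)\<^sup>2) = (C * C' - 1) * (- (F t)\<^sup>2)"
      unfolding A1_def by (simp add: algebra_simps)
    then show ?thesis using c by simp
  qed
  have CAB: "P dvd C * (A1 t * B1 t - (D1 t)\<^sup>2) - dt t" for t
  proof -
    have "C * (A1 t * B1 t - (D1 t)\<^sup>2) - dt t = (C * C' - 1) * (2 * D * E * F t - A * E\<^sup>2 - B t * (F t)\<^sup>2)"
      unfolding det[symmetric] A1_def B1_def D1_def by (simp add: algebra_simps power2_eq_square)
    then show ?thesis using c by simp
  qed
  define Bad where "Bad = {t \<in> Zp. P dvd A1 t \<or> P dvd dt t}"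
  have good: "T t = chi (dt t) * gauss_sum ^ 3" if t: "\<not> P dvd A1 t" "\<not> P dvd dt t" for t
  proof -
    obtain A' where A': "[A1 t * A' = 1] (mod P)" using inverse_exists[OF t(1)] by blast
    then have a: "P dvd A1 t * A' - 1" by (simp add: cong_iff_dvd_diff)
    have "C * A1 t * (B1 t - A' * (D1 t)\<^sup>2) - dt t
        = (C * (A1 t * B1 t - (D1 t)\<^sup>2) - dt t) + (A1 t * A' - 1) * (- C * (D1 t)\<^sup>2)"
      by (simp add: algebra_simps)
    then have "P dvd C * A1 t * (B1 t - A' * (D1 t)\<^sup>2) - dt t"
      using dvd_add[OF CAB[of t] dvd_mult2[OF a, of "- C * (D1 t)\<^sup>2"]] by (simp only:)
    then have eq: "[C * A1 t * (B1 t - A' * (D1 t)\<^sup>2) = dt t] (mod P)" by (simp only: cong_iff_dvd_diff)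
    then have "\<not> P dvd C * A1 t * (B1 t - A' * (D1 t)\<^sup>2)" using t(2) cong_dvd_iff by blast
    then have nB: "\<not> P dvd B1 t - A' * (D1 t)\<^sup>2" using dvd_mult by blast
    have "chi C * chi (A1 t) * chi (B1 t - A' * (D1 t)\<^sup>2) = chi (dt t)"
      using chi_cong[OF eq] unfolding chi_mult .
    moreover have "T t = (chi C * chi (A1 t) * chi (B1 t - A' * (D1 t)\<^sup>2)) * gauss_sum ^ 3"
      unfolding T binary_gauss_exact[OF A' nB] by (simp add: power2_eq_square power3_eq_cube)
    ultimately show ?thesis by (simp only:)
  qed
  \<comment> \<open>Rank one would give I = t^2 and J = - 2 t^3, so a vanishing discriminant.\<close>
  have rank: "\<not> (P dvd A1 t \<and> P dvd B1 t \<and> P dvd D1 t)" for t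
  proof
    assume "P dvd A1 t \<and> P dvd B1 t \<and> P dvd D1 t"
    then have d: "P dvd A1 t" "P dvd B1 t" "P dvd D1 t" by auto
    have "P dvd C * (A1 t * B1 t - (D1 t)\<^sup>2)"
      unfolding power2_eq_square by (intro dvd_mult dvd_diff[OF dvd_mult2[OF d(1)] dvd_mult2[OF d(3)]])
    moreover have "dt t = C * (A1 t * B1 t - (D1 t)\<^sup>2) - (C * (A1 t * B1 t - (D1 t)\<^sup>2) - dt t)" by simp
    ultimately have "P dvd dt t" using CAB[of t] dvd_diff by metis
    then have k: "P dvd - (t ^ 3) + 3 * I * t + J" unfolding dt_def dvd_mult_iff using nd4 by blast
    have "A * C - (F t)\<^sup>2 = C * A1 t - (C * A1 t - (A * C - (F t)\<^sup>2))" by simp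
    then have m1: "P dvd A * C - (F t)\<^sup>2" using CA1[of t] d(1) dvd_diff dvd_mult by metis
    have "D * E - B t * F t = D1 t * E - B1 t * F t"
      unfolding D1_def B1_def by (simp add: algebra_simps power2_eq_square)
    then have m2: "P dvd D * E - B t * F t" using d by simp
    have "12 * (I - t\<^sup>2) = (A * C - (F t)\<^sup>2) - 4 * (D * E - B t * F t)"
      unfolding I_def defs by (simp add: algebra_simps power2_eq_square)
    then have "P dvd 12 * (I - t\<^sup>2)" using dvd_diff[OF m1 dvd_mult[OF m2, of 4]] by (simp only:)
    then have It: "P dvd I - t\<^sup>2" unfolding dvd_mult_iff using nd12 by blast
    have "J + 2 * t ^ 3 = (- (t ^ 3) + 3 * I * t + J) - (I - t\<^sup>2) * (3 * t)"
      by (simp add: algebra_simps power2_eq_square power3_eq_cube)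
    then have Jt: "P dvd J + 2 * t ^ 3" using dvd_diff[OF k dvd_mult2[OF It, of "3 * t"]] by (simp only:)
    have "27 * Disc (Quartic a0 a1 a2 a3 a4) = 4 * I ^ 3 - J\<^sup>2"
      unfolding I_def J_def by (rule Disc_mult_27)
    also have "\<dots> = (I - t\<^sup>2) * (4 * (I\<^sup>2 + I * t\<^sup>2 + t ^ 4)) - (J + 2 * t ^ 3) * (J - 2 * t ^ 3)"
      by (simp add: algebra_simps power2_eq_square power3_eq_cube power4_eq_xxxx)
    also have "P dvd \<dots>" by (rule dvd_diff[OF dvd_mult2[OF It] dvd_mult2[OF Jt]])
    finally show False unfolding dvd_mult_iff using nd27 Disc by blast
  qed
  have sp: "sqrt p * sqrt p = real p" by simp
  have Tbound: "cmod (T t) \<le> (real p)\<^sup>2" for t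
  proof -
    have "cmod (T t) \<le> 1 * sqrt p * (p * sqrt p)"
      unfolding T norm_mult norm_gauss_sum
      by (intro mult_mono norm_chi_le binary_gauss_bound rank) auto
    also have "\<dots> = (real p)\<^sup>2" using sp by (simp add: power2_eq_square)
    finally show ?thesis .
  qed
  have cardBad: "card Bad \<le> 5"
  proof -
    let ?g1 = "[:144 * a0 * a4 - 4 * a2\<^sup>2, 8 * a2, - 4:]" and ?g2 = "[:4 * J, 12 * I, 0, - 4:]"
    have n4: "\<not> P dvd - 4" using nd4 by simp
    have g1: "\<not> [:P:] dvd ?g1" and g2: "\<not> [:P:] dvd ?g2"
    proof -
      have "coeff ?g1 2 = - 4" "coeff ?g2 3 = - 4" by (simp_all add: numeral_2_eq_2 numeral_3_eq_3)
      then show "\<not> [:P:] dvd ?g1" "\<not> [:P:] dvd ?g2" using n4 unfolding const_dvd_iff by metis+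
    qed
    have sub: "Bad \<subseteq> {x \<in> Zp. P dvd poly ?g1 x} \<union> {x \<in> Zp. P dvd poly ?g2 x}"
    proof
      fix t assume t: "t \<in> Bad"
      have "P dvd poly ?g1 t" if "P dvd A1 t"
      proof -
        have "poly ?g1 t = A * C - (F t)\<^sup>2" unfolding defs by (simp add: algebra_simps power2_eq_square)
        also have "\<dots> = C * A1 t - (C * A1 t - (A * C - (F t)\<^sup>2))" by simp
        finally show ?thesis using CA1[of t] that dvd_diff dvd_mult by metis
      qed
      moreover have "poly ?g2 t = dt t"
        unfolding dt_def by (simp add: algebra_simps power3_eq_cube)
      ultimately show "t \<in> {x \<in> Zp. P dvd poly ?g1 x} \<union> {x \<in> Zp. P dvd poly ?g2 x}"
        using t unfolding Bad_def by (metis (mono_tags, lifting) UnI1 UnI2 mem_Collect_eq)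
    qed
    have fin: "finite {x \<in> Zp. P dvd poly g x}" for g by (rule finite_subset[of _ Zp]) auto
    have "card Bad \<le> card {x \<in> Zp. P dvd poly ?g1 x} + card {x \<in> Zp. P dvd poly ?g2 x}"
      using card_mono[OF _ sub] card_Un_le[of "{x \<in> Zp. P dvd poly ?g1 x}" "{x \<in> Zp. P dvd poly ?g2 x}"] fin
      by (meson finite_UnI le_trans)
    also have "\<dots> \<le> degree ?g1 + degree ?g2"
      by (intro add_mono card_roots_mod_le prime g1 g2)
    also have "\<dots> = 5" by simp
    finally show ?thesis .
  qed
  have subBad: "Bad \<subseteq> Zp" unfolding Bad_def by blast
  have bad_sum: "cmod (\<Sum>t\<in>Bad. G t) \<le> 5 * K" if "\<And>t. cmod (G t) \<le> K" "K \<ge> 0" for G and K :: real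
  proof -
    have "cmod (\<Sum>t\<in>Bad. G t) \<le> real (card Bad) * K" using sum_norm_bound[of Bad G K] that by simp
    also have "\<dots> \<le> 5 * K" using cardBad that(2) by (intro mult_right_mono) auto
    finally show ?thesis .
  qed
  let ?S = "\<Sum>t\<in>Zp. chi t * chi (dt t)"
  have "gauss_sum * disc_twisted_sum a0 a1 a2 a3 a4 = (\<Sum>t\<in>Zp. chi t * T t)"
    unfolding gauss_sum_mult_twisted_sum T_def defs ..
  also have "\<dots> = (\<Sum>t\<in>Zp - Bad. chi t * T t) + (\<Sum>t\<in>Bad. chi t * T t)"
    by (rule sum.subset_diff[OF subBad]) simp
  also have "(\<Sum>t\<in>Zp - Bad. chi t * T t) = (\<Sum>t\<in>Zp - Bad. chi t * chi (dt t)) * gauss_sum ^ 3"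
    unfolding sum_distrib_right
    by (rule sum.cong[OF refl]) (auto simp: good Bad_def)
  also have "(\<Sum>t\<in>Zp - Bad. chi t * chi (dt t)) = ?S - (\<Sum>t\<in>Bad. chi t * chi (dt t))"
    using sum.subset_diff[OF subBad, of "\<lambda>t. chi t * chi (dt t)"] by simp
  finally have main: "gauss_sum * disc_twisted_sum a0 a1 a2 a3 a4
     = (?S - (\<Sum>t\<in>Bad. chi t * chi (dt t))) * gauss_sum ^ 3 + (\<Sum>t\<in>Bad. chi t * T t)" .
  have b1: "cmod (\<Sum>t\<in>Bad. chi t * chi (dt t)) \<le> 5 * 1"
    by (rule bad_sum) (auto simp: norm_mult simp del: norm_of_int intro!: mult_le_one norm_chi_le)
  have b2: "cmod (\<Sum>t\<in>Bad. chi t * T t) \<le> 5 * (real p)\<^sup>2"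
  proof (rule bad_sum)
    show "cmod (chi t * T t) \<le> (real p)\<^sup>2" for t
      using mult_mono[OF norm_chi_le[of t] Tbound[of t]] unfolding norm_mult by simp
  qed simp
  have b3: "cmod ?S \<le> 23 * sqrt p + 1" unfolding dt_def by (rule resolvent_character_sum[OF nJ])
  have "cmod (?S - (\<Sum>t\<in>Bad. chi t * chi (dt t))) \<le> 23 * sqrt p + 6"
    using norm_triangle_ineq4[of ?S "\<Sum>t\<in>Bad. chi t * chi (dt t)"] b1 b3 by linarith
  then have "cmod ((?S - (\<Sum>t\<in>Bad. chi t * chi (dt t))) * gauss_sum ^ 3) \<le> (23 * sqrt p + 6) * sqrt p ^ 3"
    unfolding norm_mult norm_power norm_gauss_sum by (intro mult_right_mono) auto
  then have "cmod (gauss_sum * disc_twisted_sum a0 a1 a2 a3 a4) \<le> (23 * sqrt p + 6) * sqrt p ^ 3 + 5 * (real p)\<^sup>2"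
    unfolding main
    using norm_triangle_ineq[of "(?S - (\<Sum>t\<in>Bad. chi t * chi (dt t))) * gauss_sum ^ 3" "\<Sum>t\<in>Bad. chi t * T t"] b2
    by linarith
  also have "\<dots> = sqrt p * (23 * (p * sqrt p) + 6 * p + 5 * (p * sqrt p))"
  proof -
    have "sqrt p ^ 3 = p * sqrt p" using sp by (simp add: power3_eq_cube)
    moreover have "(real p)\<^sup>2 = sqrt p * (p * sqrt p)" using sp by (simp add: power2_eq_square)
    ultimately show ?thesis by (simp add: algebra_simps)
  qed
  also have "\<dots> \<le> sqrt p * (34 * (p * sqrt p))"
  proof (rule mult_left_mono)
    have "real p * 1 \<le> real p * sqrt p" using p0 by (intro mult_left_mono) auto
    then show "23 * (p * sqrt p) + 6 * p + 5 * (p * sqrt p) \<le> 34 * (p * sqrt p)" by linarith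
  qed simp
  finally show ?thesis using p0 unfolding norm_mult norm_gauss_sum by simp
qed

end

section \<open>Singular quartic forms modulo a prime\<close>

lemma quartic_scale:
  "quartic_I (Quartic (c * a0) (c * a1) (c * a2) (c * a3) (c * a4)) = c\<^sup>2 * quartic_I (Quartic a0 a1 a2 a3 a4)"
  "quartic_J (Quartic (c * a0) (c * a1) (c * a2) (c * a3) (c * a4)) = c ^ 3 * quartic_J (Quartic a0 a1 a2 a3 a4)"
  for c a0 a1 a2 a3 a4 :: int
  by (simp_all add: algebra_simps power2_eq_square power3_eq_cube)

lemma Disc_scale:
  "Disc (Quartic (c * a0) (c * a1) (c * a2) (c * a3) (c * a4)) = c ^ 6 * Disc (Quartic a0 a1 a2 a3 a4)"
proof -
  have "27 * Disc (Quartic (c * a0) (c * a1) (c * a2) (c * a3) (c * a4))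
      = c ^ 6 * (4 * quartic_I (Quartic a0 a1 a2 a3 a4) ^ 3 - quartic_J (Quartic a0 a1 a2 a3 a4) ^ 2)"
    unfolding Disc_mult_27 quartic_scale power_mult_distrib power_mult[symmetric]
    by (simp add: right_diff_distrib del: quartic_I.simps quartic_J.simps)
  also have "\<dots> = 27 * (c ^ 6 * Disc (Quartic a0 a1 a2 a3 a4))"
    unfolding Disc_mult_27[symmetric] by simp
  finally show ?thesis by simp
qed

locale prime_ge_5 = odd_prime +
  assumes ge5: "p \<ge> 5"
begin

lemma not_dvd_3: "\<not> P dvd 3" using ge5 by (auto dest: zdvd_imp_le)

lemma not_dvd_smooth:
  "\<not> P dvd 4" "\<not> P dvd 12" "\<not> P dvd 27" "\<not> P dvd 64" "\<not> P dvd 48" "\<not> P dvd 3072" "\<not> P dvd 16" "\<not> P dvd 6"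
proof -
  have *: "\<not> P dvd 2 ^ k * 3 ^ l" for k l
    using not_dvd_2 not_dvd_3 primeP by (metis prime_dvd_mult_iff prime_dvd_power)
  show "\<not> P dvd 4" "\<not> P dvd 12" "\<not> P dvd 27" "\<not> P dvd 64" "\<not> P dvd 48" "\<not> P dvd 3072"
    "\<not> P dvd 16" "\<not> P dvd 6"
    using *[of 2 0] *[of 2 1] *[of 0 3] *[of 6 0] *[of 4 1] *[of 10 1] *[of 4 0] *[of 1 1] by simp_all
qed

text \<open>The form, dehomogenised at \<open>Y = 1\<close>, and its derivative vanish at \<open>s\<close>. A double root at the point at infinity
is the condition that \<open>b0\<close> and \<open>b1\<close> vanish, and is treated separately throughout.\<close>

definition double_root :: "int \<Rightarrow> int \<Rightarrow> int \<Rightarrow> int \<Rightarrow> int \<Rightarrow> int \<Rightarrow> bool" where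
  "double_root b0 b1 b2 b3 b4 s \<longleftrightarrow>
     P dvd b0 * s ^ 4 + b1 * s ^ 3 + b2 * s\<^sup>2 + b3 * s + b4 \<and>
     P dvd 4 * b0 * s ^ 3 + 3 * b1 * s\<^sup>2 + 2 * b2 * s + b3"

text \<open>The form is \<open>c * (x X\<^sup>2 + y X Y + z Y\<^sup>2)\<^sup>2\<close>. Such a form is singular even when the quadratic is irreducible, and
these are the only singular forms without a double root over the prime field.\<close>

definition scaled_square :: "int \<Rightarrow> int \<Rightarrow> int \<Rightarrow> int \<Rightarrow> int \<Rightarrow> bool" where
  "scaled_square b0 b1 b2 b3 b4 \<longleftrightarrow> (\<exists>c x y z. \<not> P dvd c \<and> P dvd b0 - c * x\<^sup>2 \<and> P dvd b1 - 2 * c * x * y \<and>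
     P dvd b2 - c * (y\<^sup>2 + 2 * x * z) \<and> P dvd b3 - 2 * c * y * z \<and> P dvd b4 - c * z\<^sup>2)"

lemma dvd_by_eq: "a = b \<Longrightarrow> P dvd b \<Longrightarrow> P dvd a" by simp

text \<open>The form is \<open>(X - s Y)\<^sup>2 * (b0 X\<^sup>2 + \<beta> X Y + \<gamma> Y\<^sup>2)\<close>; the two remaining coefficients are compared.\<close>

lemma double_root_factor:
  assumes "double_root b0 b1 b2 b3 b4 s"
  defines "\<beta> \<equiv> b1 + 2 * s * b0"
  defines "\<gamma> \<equiv> b2 + 2 * s * \<beta> - s\<^sup>2 * b0"
  shows "P dvd b3 - (s\<^sup>2 * \<beta> - 2 * s * \<gamma>)" "P dvd b4 - s\<^sup>2 * \<gamma>"
proof -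
  let ?h = "b0 * s ^ 4 + b1 * s ^ 3 + b2 * s\<^sup>2 + b3 * s + b4"
  let ?h' = "4 * b0 * s ^ 3 + 3 * b1 * s\<^sup>2 + 2 * b2 * s + b3"
  have h: "P dvd ?h" "P dvd ?h'" using assms(1) unfolding double_root_def by auto
  have "b3 - (s\<^sup>2 * \<beta> - 2 * s * \<gamma>) = ?h'"
    unfolding \<beta>_def \<gamma>_def by (simp add: algebra_simps power2_eq_square power3_eq_cube)
  then show "P dvd b3 - (s\<^sup>2 * \<beta> - 2 * s * \<gamma>)" using h(2) by (simp only:)
  have "b4 - s\<^sup>2 * \<gamma> = ?h - s * ?h'"
    unfolding \<beta>_def \<gamma>_def by (simp add: algebra_simps power2_eq_square power3_eq_cube power4_eq_xxxx)
  then show "P dvd b4 - s\<^sup>2 * \<gamma>" using dvd_diff[OF h(1) dvd_mult[OF h(2), of s]] by (simp only:)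
qed

lemma Disc_dvdI:
  assumes I: "P dvd quartic_I h - g\<^sup>2" and J: "P dvd quartic_J h + 2 * g ^ 3"
  shows "P dvd Disc h"
proof -
  have "27 * Disc h = (quartic_I h - g\<^sup>2) * (4 * ((quartic_I h)\<^sup>2 + quartic_I h * g\<^sup>2 + g ^ 4))
      - (quartic_J h + 2 * g ^ 3) * (quartic_J h - 2 * g ^ 3)"
    unfolding Disc_mult_27 by (simp add: algebra_simps power2_eq_square power3_eq_cube power4_eq_xxxx)
  then have "P dvd 27 * Disc h" using dvd_diff[OF dvd_mult2[OF I] dvd_mult2[OF J]] by (simp only:)
  then show ?thesis unfolding dvd_mult_iff using not_dvd_smooth by blast
qed

lemma double_root_imp_Disc:
  assumes "double_root b0 b1 b2 b3 b4 s"
  shows "P dvd Disc (Quartic b0 b1 b2 b3 b4)"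
proof -
  define \<beta> where "\<beta> = b1 + 2 * s * b0"
  define \<gamma> where "\<gamma> = b2 + 2 * s * \<beta> - s\<^sup>2 * b0"
  define g where "g = b0 * s\<^sup>2 + \<beta> * s + \<gamma>"
  define e3 where "e3 = b3 - (s\<^sup>2 * \<beta> - 2 * s * \<gamma>)"
  define e4 where "e4 = b4 - s\<^sup>2 * \<gamma>"
  have e: "P dvd e3" "P dvd e4"
    using double_root_factor[OF assms] unfolding e3_def e4_def \<beta>_def \<gamma>_def by auto
  have b: "b1 = \<beta> - 2 * s * b0" "b2 = \<gamma> - 2 * s * \<beta> + s\<^sup>2 * b0" "b3 = s\<^sup>2 * \<beta> - 2 * s * \<gamma> + e3"
      "b4 = s\<^sup>2 * \<gamma> + e4"
    unfolding e3_def e4_def \<beta>_def \<gamma>_def by simp_all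
  have "quartic_I (Quartic b0 b1 b2 b3 b4) - g\<^sup>2 = e4 * (12 * b0) - e3 * (3 * b1)"
    unfolding b g_def by (simp add: algebra_simps power2_eq_square)
  then have 1: "P dvd quartic_I (Quartic b0 b1 b2 b3 b4) - g\<^sup>2"
    using e by (simp del: quartic_I.simps)
  have "quartic_J (Quartic b0 b1 b2 b3 b4) + 2 * g ^ 3
     = e4 * (72 * b0 * b2 - 27 * b1\<^sup>2) + e3 * (9 * b1 * b2 - 27 * b0 * (2 * (s\<^sup>2 * \<beta> - 2 * s * \<gamma>) + e3))"
    unfolding b g_def by (simp add: algebra_simps power2_eq_square power3_eq_cube)
  then have 2: "P dvd quartic_J (Quartic b0 b1 b2 b3 b4) + 2 * g ^ 3"
    using e by (simp del: quartic_J.simps)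
  show ?thesis by (rule Disc_dvdI[OF 1 2])
qed

lemma double_root_infinity_imp_Disc:
  assumes "P dvd b0" "P dvd b1"
  shows "P dvd Disc (Quartic b0 b1 b2 b3 b4)"
proof (rule Disc_dvdI[where g = b2])
  have "quartic_I (Quartic b0 b1 b2 b3 b4) - b2\<^sup>2 = b0 * (12 * b4) - b1 * (3 * b3)" by simp
  then show "P dvd quartic_I (Quartic b0 b1 b2 b3 b4) - b2\<^sup>2"
    using dvd_diff[OF dvd_mult2[OF assms(1)] dvd_mult2[OF assms(2)]] by (simp only:)
  have "quartic_J (Quartic b0 b1 b2 b3 b4) + 2 * b2 ^ 3
      = b0 * (72 * b2 * b4 - 27 * b3\<^sup>2) + b1 * (9 * b2 * b3 - 27 * b1 * b4)"
    by (simp add: algebra_simps power2_eq_square)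
  then show "P dvd quartic_J (Quartic b0 b1 b2 b3 b4) + 2 * b2 ^ 3"
    using dvd_add[OF dvd_mult2[OF assms(1)] dvd_mult2[OF assms(2)]] by (simp only:)
qed

text \<open>The form is divisible by \<open>(X - s Y)\<^sup>2 * (X - s' Y)\<^sup>2\<close>, which already has degree four.\<close>

lemma two_double_roots:
  assumes s: "double_root b0 b1 b2 b3 b4 s" and s': "double_root b0 b1 b2 b3 b4 s'"
    and ne: "\<not> P dvd s' - s" and nz: "\<not> (P dvd b0 \<and> P dvd b1 \<and> P dvd b2 \<and> P dvd b3 \<and> P dvd b4)"
  shows "scaled_square b0 b1 b2 b3 b4"
proof -
  define \<beta> where "\<beta> = b1 + 2 * s * b0"
  define \<gamma> where "\<gamma> = b2 + 2 * s * \<beta> - s\<^sup>2 * b0"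
  define e3 where "e3 = b3 - (s\<^sup>2 * \<beta> - 2 * s * \<gamma>)"
  define e4 where "e4 = b4 - s\<^sup>2 * \<gamma>"
  have e: "P dvd e3" "P dvd e4"
    using double_root_factor[OF s] unfolding e3_def e4_def \<beta>_def \<gamma>_def by auto
  have b: "b1 = \<beta> - 2 * s * b0" "b2 = \<gamma> - 2 * s * \<beta> + s\<^sup>2 * b0" "b3 = s\<^sup>2 * \<beta> - 2 * s * \<gamma> + e3"
      "b4 = s\<^sup>2 * \<gamma> + e4"
    unfolding e3_def e4_def \<beta>_def \<gamma>_def by simp_all
  let ?h = "b0 * s' ^ 4 + b1 * s' ^ 3 + b2 * s'\<^sup>2 + b3 * s' + b4"
  let ?h' = "4 * b0 * s' ^ 3 + 3 * b1 * s'\<^sup>2 + 2 * b2 * s' + b3"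
  have h: "P dvd ?h" "P dvd ?h'" using s' unfolding double_root_def by auto
  define q where "q = b0 * s'\<^sup>2 + \<beta> * s' + \<gamma>"
  define q' where "q' = 2 * b0 * s' + \<beta>"
  have "(s' - s)\<^sup>2 * q = ?h - (e3 * s' + e4)"
    unfolding b q_def by (simp add: algebra_simps power2_eq_square power3_eq_cube power4_eq_xxxx)
  then have "P dvd (s' - s)\<^sup>2 * q" using dvd_diff[OF h(1) dvd_add[OF dvd_mult2[OF e(1)] e(2)]] by (simp only:)
  then have q: "P dvd q" using ne dvd_mult_iff dvd_power_iff' by (metis zero_less_numeral)
  have "(s' - s)\<^sup>2 * q' = ?h' - e3 - q * (2 * (s' - s))"
    unfolding b q_def q'_def by (simp add: algebra_simps power2_eq_square power3_eq_cube)
  then have "P dvd (s' - s)\<^sup>2 * q'" using dvd_diff[OF dvd_diff[OF h(2) e(1)] dvd_mult2[OF q]] by (simp only:)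
  then have q': "P dvd q'" using ne dvd_mult_iff dvd_power_iff' by (metis zero_less_numeral)
  define g where "g = \<gamma> - b0 * s'\<^sup>2"
  have "g = q - q' * s'" unfolding g_def q_def q'_def by (simp add: algebra_simps power2_eq_square)
  then have g: "P dvd g" using q q' by simp
  have d0: "P dvd b0 - b0 * 1\<^sup>2" by simp
  have "b1 - 2 * b0 * 1 * (- (s + s')) = q'" unfolding q'_def b by (simp add: algebra_simps)
  then have d1: "P dvd b1 - 2 * b0 * 1 * (- (s + s'))" using q' by simp
  have "b2 - b0 * ((- (s + s'))\<^sup>2 + 2 * 1 * (s * s')) = g - q' * (2 * s)"
    unfolding b g_def q'_def by (simp add: algebra_simps power2_eq_square)
  then have d2: "P dvd b2 - b0 * ((- (s + s'))\<^sup>2 + 2 * 1 * (s * s'))" using g q' by simp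
  have "b3 - 2 * b0 * (- (s + s')) * (s * s') = e3 - g * (2 * s) + q' * s\<^sup>2"
    unfolding b g_def q'_def by (simp add: algebra_simps power2_eq_square)
  then have d3: "P dvd b3 - 2 * b0 * (- (s + s')) * (s * s')" using g q' e by simp
  have "b4 - b0 * (s * s')\<^sup>2 = e4 + g * s\<^sup>2"
    unfolding b g_def by (simp add: algebra_simps power2_eq_square)
  then have d4: "P dvd b4 - b0 * (s * s')\<^sup>2" using g e by simp
  have n0: "\<not> P dvd b0"
  proof
    assume *: "P dvd b0"
    have **: "P dvd x" if "P dvd x - b0 * k" for x k
      using dvd_add[OF that dvd_mult2[OF *, of k]] by simp
    have "P dvd b1" using **[of b1 "2 * 1 * (- (s + s'))"] d1 by (simp add: mult_ac)
    moreover have "P dvd b2" using **[OF d2] .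
    moreover have "P dvd b3" using **[of b3 "2 * (- (s + s')) * (s * s')"] d3 by (simp add: mult_ac)
    moreover have "P dvd b4" using **[OF d4] .
    ultimately show False using nz * by blast
  qed
  show ?thesis unfolding scaled_square_def using n0 d0 d1 d2 d3 d4 by blast
qed

lemma double_root_and_infinity:
  assumes s: "double_root b0 b1 b2 b3 b4 s" and inf: "P dvd b0" "P dvd b1"
    and nz: "\<not> (P dvd b0 \<and> P dvd b1 \<and> P dvd b2 \<and> P dvd b3 \<and> P dvd b4)"
  shows "scaled_square b0 b1 b2 b3 b4"
proof -
  define \<beta> where "\<beta> = b1 + 2 * s * b0"
  define \<gamma> where "\<gamma> = b2 + 2 * s * \<beta> - s\<^sup>2 * b0"
  have e: "P dvd b3 - (s\<^sup>2 * \<beta> - 2 * s * \<gamma>)" "P dvd b4 - s\<^sup>2 * \<gamma>"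
    using double_root_factor[OF s] unfolding \<beta>_def \<gamma>_def by auto
  have \<beta>: "P dvd \<beta>" unfolding \<beta>_def using inf by simp
  have \<gamma>: "P dvd \<gamma> - b2" unfolding \<gamma>_def using inf \<beta> by simp
  have d2: "P dvd b2 - b2 * (1\<^sup>2 + 2 * 0 * (- s))" by simp
  have "b3 - 2 * b2 * 1 * (- s) = (b3 - (s\<^sup>2 * \<beta> - 2 * s * \<gamma>)) + \<beta> * s\<^sup>2 - (\<gamma> - b2) * (2 * s)"
    by (simp add: algebra_simps)
  then have d3: "P dvd b3 - 2 * b2 * 1 * (- s)"
    using dvd_diff[OF dvd_add[OF e(1) dvd_mult2[OF \<beta>]] dvd_mult2[OF \<gamma>]] by (simp only:)
  have "b4 - b2 * (- s)\<^sup>2 = (b4 - s\<^sup>2 * \<gamma>) + (\<gamma> - b2) * s\<^sup>2"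
    by (simp add: algebra_simps)
  then have d4: "P dvd b4 - b2 * (- s)\<^sup>2" using dvd_add[OF e(2) dvd_mult2[OF \<gamma>]] by (simp only:)
  have "\<not> P dvd b2"
  proof
    assume *: "P dvd b2"
    have **: "P dvd x" if "P dvd x - b2 * k" for x k
      using dvd_add[OF that dvd_mult2[OF *, of k]] by simp
    have "P dvd b3" using **[of b3 "2 * 1 * (- s)"] d3 by (simp add: mult_ac)
    moreover have "P dvd b4" using **[OF d4] .
    ultimately show False using nz * inf by blast
  qed
  moreover have "P dvd b0 - b2 * 0\<^sup>2" "P dvd b1 - 2 * b2 * 0 * 1" using inf by simp_all
  ultimately show ?thesis unfolding scaled_square_def using d2 d3 d4 by blast
qed

text \<open>The discriminant locus \<open>4 I^3 = J\<^sup>2\<close> is a rational cuspidal cubic with parameter \<open>t = J / (2 * I)\<close> away from the cusp.\<close>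

lemma parametrize_cusp:
  assumes "P dvd 4 * I ^ 3 - J\<^sup>2"
  shows "\<exists>t. P dvd I - t\<^sup>2 \<and> P dvd J - 2 * t ^ 3"
proof (cases "P dvd I")
  case True
  then have "P dvd 4 * I ^ 3" by (simp add: power3_eq_cube)
  then have "P dvd J\<^sup>2" using assms by (metis dvd_diff_right_iff)
  then have "P dvd J" using dvd_power_iff' by (metis zero_less_numeral)
  then show ?thesis using True by (intro exI[of _ 0]) simp
next
  case False
  then have "\<not> P dvd 2 * I" using not_dvd_2 dvd_mult_iff by blast
  then obtain w where w: "[2 * I * w = 1] (mod P)" using inverse_exists by blast
  define k where "k = 2 * I * w - 1"
  have k: "P dvd k" using w unfolding k_def by (simp add: cong_iff_dvd_diff)
  define d where "d = 4 * I ^ 3 - J\<^sup>2"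
  have d: "P dvd d" using assms unfolding d_def .
  have "I - (J * w)\<^sup>2 = d * w\<^sup>2 - k * (I * (k + 2))"
    unfolding d_def k_def by (simp add: algebra_simps power2_eq_square power3_eq_cube)
  then have 1: "P dvd I - (J * w)\<^sup>2" using d k by simp
  have "J - 2 * (J * w) ^ 3 = d * (2 * J * w ^ 3) - k * (J * (k\<^sup>2 + 3 * k + 3))"
    unfolding d_def k_def by (simp add: algebra_simps power2_eq_square power3_eq_cube)
  then have "P dvd J - 2 * (J * w) ^ 3" using d k by simp
  then show ?thesis using 1 by blast
qed

text \<open>Let \<open>I = t\<^sup>2\<close> and \<open>J = 2 t^3\<close>. Then \<open>- t\<close> is a double root of the resolvent cubic, and the double root \<open>s\<close> of the
form is a rational function of \<open>t\<close> and the coefficients, in particular it lies in the prime field, unless the denominator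
vanishes. In terms of the leading coefficients \<open>H\<close> and \<open>R\<close> of the two covariants, which satisfy the classical syzygy
\<open>27 R\<^sup>2 = - 64 b0^3 J + 48 b0\<^sup>2 I H - H^3\<close>, the root is given by \<open>(4 b0 s + b1) D = 3 R\<close> with \<open>D = 4 b0 t - H\<close>. If \<open>D\<close>
vanishes, then so does \<open>R\<close>, and the form is a scaled square.\<close>

lemma singular_cases:
  assumes Disc: "P dvd Disc (Quartic b0 b1 b2 b3 b4)"
  shows "(P dvd b0 \<and> P dvd b1) \<or> (\<exists>s. double_root b0 b1 b2 b3 b4 s) \<or> scaled_square b0 b1 b2 b3 b4"
proof -
  define I where "I = quartic_I (Quartic b0 b1 b2 b3 b4)"
  define J where "J = quartic_J (Quartic b0 b1 b2 b3 b4)"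
  have "P dvd 27 * Disc (Quartic b0 b1 b2 b3 b4)" using Disc by simp
  then have "P dvd 4 * I ^ 3 - J\<^sup>2" unfolding Disc_mult_27 I_def J_def .
  then obtain t where t: "P dvd I - t\<^sup>2" "P dvd J - 2 * t ^ 3" using parametrize_cusp by blast
  have I: "I = 12 * b0 * b4 - 3 * b1 * b3 + b2\<^sup>2" unfolding I_def by simp
  have J: "J = 72 * b0 * b2 * b4 + 9 * b1 * b2 * b3 - 27 * (b0 * b3\<^sup>2 + b1\<^sup>2 * b4) - 2 * b2 ^ 3"
    unfolding J_def by simp
  define h where "h s = b0 * s ^ 4 + b1 * s ^ 3 + b2 * s\<^sup>2 + b3 * s + b4" for s
  define h' where "h' s = 4 * b0 * s ^ 3 + 3 * b1 * s\<^sup>2 + 2 * b2 * s + b3" for s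
  consider "P dvd b0" "P dvd b1" | "P dvd b0" "\<not> P dvd b1" | "\<not> P dvd b0" by blast
  then show ?thesis
  proof cases
    case 1 then show ?thesis by blast
  next
    case 2
    then have "\<not> P dvd 3 * b1" using not_dvd_3 dvd_mult_iff by blast
    then obtain v where v: "[3 * b1 * v = 1] (mod P)" using inverse_exists by blast
    \<comment> \<open>Here the form is Y times a cubic with leading coefficient b1, whose double root is - (t + b2) / (3 b1).\<close>
    define s where "s = (- t - b2) * v"
    define z where "z = 3 * b1 * s + b2"
    define e where "e = z + t"
    have "e = (3 * b1 * v - 1) * (- t - b2)" unfolding e_def z_def s_def by (simp add: algebra_simps)
    then have e: "P dvd e" using v by (simp add: cong_iff_dvd_diff)
    have "3 * b1 * h' s = e * (e - 2 * t) - (I - t\<^sup>2) + b0 * (12 * (b4 + b1 * s ^ 3))"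
      unfolding e_def z_def I h'_def by (simp add: algebra_simps power2_eq_square power3_eq_cube)
    then have "P dvd 3 * b1 * h' s"
      using dvd_add[OF dvd_diff[OF dvd_mult2[OF e] t(1)] dvd_mult2[OF 2(1)]] by (simp only:)
    then have 1: "P dvd h' s" using 2(2) not_dvd_3 dvd_mult_iff by blast
    have "27 * b1\<^sup>2 * h s = e * (z\<^sup>2 - z * t + t\<^sup>2 - 3 * I) + (I - t\<^sup>2) * (3 * t) - (J - 2 * t ^ 3)
        + b0 * (27 * b1\<^sup>2 * s ^ 4 + 36 * b4 * z + 72 * b2 * b4 - 27 * b3\<^sup>2)"
      unfolding e_def z_def I J h_def by (simp add: algebra_simps power2_eq_square power3_eq_cube power4_eq_xxxx)
    then have "P dvd 27 * b1\<^sup>2 * h s"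
      using dvd_add[OF dvd_diff[OF dvd_add[OF dvd_mult2[OF e] dvd_mult2[OF t(1)]] t(2)] dvd_mult2[OF 2(1)]]
      by (simp only:)
    then have "P dvd h s" using 2(2) not_dvd_smooth dvd_mult_iff dvd_power_iff' by (metis zero_less_numeral)
    then show ?thesis using 1 unfolding double_root_def h_def h'_def by blast
  next
    case 3
    define H where "H = 8 * b0 * b2 - 3 * b1\<^sup>2"
    define R where "R = b1 ^ 3 + 8 * b0\<^sup>2 * b3 - 4 * b0 * b1 * b2"
    define D where "D = 4 * b0 * t - H"
    have syz: "27 * R\<^sup>2 = - 64 * b0 ^ 3 * J + 48 * b0\<^sup>2 * I * H - H ^ 3"
      unfolding R_def H_def I J by (simp add: algebra_simps power2_eq_square power3_eq_cube)
    have "27 * R\<^sup>2 + (2 * D + 3 * H) * D\<^sup>2 = (I - t\<^sup>2) * (48 * b0\<^sup>2 * H) - (J - 2 * t ^ 3) * (64 * b0 ^ 3)"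
      unfolding syz D_def by (simp add: algebra_simps power2_eq_square power3_eq_cube)
    then have RD: "P dvd 27 * R\<^sup>2 + (2 * D + 3 * H) * D\<^sup>2"
      using dvd_diff[OF dvd_mult2[OF t(1)] dvd_mult2[OF t(2)]] by (simp only:)
    show ?thesis
    proof (cases "P dvd D")
      case False
      obtain v where v: "[4 * b0 * v = 1] (mod P)"
        using inverse_exists[of "4 * b0"] 3 not_dvd_smooth dvd_mult_iff by blast
      obtain D' where D': "[D * D' = 1] (mod P)" using inverse_exists[OF False] by blast
      define s where "s = (3 * R * D' - b1) * v"
      define z where "z = 4 * b0 * s + b1"
      define e where "e = z * D - 3 * R"
      have "e = (4 * b0 * v - 1) * ((3 * R * D' - b1) * D) + (D * D' - 1) * (3 * R)"
        unfolding e_def z_def s_def by (simp add: algebra_simps)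
      then have e: "P dvd e" using v D' by (simp add: cong_iff_dvd_diff)
      define k where "k = 3 * z\<^sup>2 + 2 * D + 3 * H"
      have "k * D\<^sup>2 = (27 * R\<^sup>2 + (2 * D + 3 * H) * D\<^sup>2) + e * (3 * (e + 6 * R))"
        unfolding k_def e_def by (simp add: algebra_simps power2_eq_square)
      then have "P dvd k * D\<^sup>2" using dvd_add[OF RD dvd_mult2[OF e]] by (simp only:)
      then have k: "P dvd k" using False dvd_mult_iff dvd_power_iff' by (metis zero_less_numeral)
      have "16 * b0\<^sup>2 * h' s = z ^ 3 + H * z + 2 * R"
        unfolding z_def H_def R_def h'_def by (simp add: algebra_simps power2_eq_square power3_eq_cube)
      then have "3 * (16 * b0\<^sup>2 * h' s) = k * z - e * 2"
        unfolding k_def e_def by (simp add: algebra_simps power2_eq_square power3_eq_cube)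
      then have "P dvd 3 * (16 * b0\<^sup>2 * h' s)" using k e by simp
      then have 1: "P dvd h' s"
        using 3 not_dvd_smooth not_dvd_3 dvd_mult_iff dvd_power_iff' by (metis zero_less_numeral)
      have "3072 * b0 ^ 3 * h s = 12 * z ^ 4 + 24 * H * z\<^sup>2 + 96 * R * z + 256 * b0\<^sup>2 * I - 4 * H\<^sup>2"
        unfolding z_def H_def R_def h_def I
        by (simp add: algebra_simps power2_eq_square power3_eq_cube power4_eq_xxxx)
      then have "3072 * b0 ^ 3 * h s = k * (4 * z\<^sup>2 + 8 * D + 4 * H) - e * (32 * z) + (I - t\<^sup>2) * (256 * b0\<^sup>2)"
        unfolding k_def e_def D_def by (simp add: algebra_simps power2_eq_square power4_eq_xxxx)
      then have "P dvd 3072 * b0 ^ 3 * h s"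
        using dvd_add[OF dvd_diff[OF dvd_mult2[OF k] dvd_mult2[OF e]] dvd_mult2[OF t(1)]] by (simp only:)
      then have "P dvd h s" using 3 not_dvd_smooth dvd_mult_iff dvd_power_iff' by (metis zero_less_numeral)
      then show ?thesis using 1 unfolding double_root_def h_def h'_def by blast
    next
      case True
      have "27 * R\<^sup>2 = (27 * R\<^sup>2 + (2 * D + 3 * H) * D\<^sup>2) - D * (D * (2 * D + 3 * H))"
        by (simp add: algebra_simps power2_eq_square)
      then have "P dvd 27 * R\<^sup>2"
        by (rule dvd_by_eq) (rule dvd_diff[OF RD dvd_mult2[OF True]])
      then have R: "P dvd R" using not_dvd_smooth dvd_mult_iff dvd_power_iff' by (metis zero_less_numeral)
      have "\<not> P dvd 64 * b0 ^ 3" using 3 not_dvd_smooth dvd_mult_iff dvd_power_iff' by (metis zero_less_numeral)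
      then obtain c where c: "[64 * b0 ^ 3 * c = 1] (mod P)" using inverse_exists by blast
      have c1: "P dvd 64 * b0 ^ 3 * c - 1" using c by (simp add: cong_iff_dvd_diff)
      have nc: "\<not> P dvd c" using c not_dvd_1 cong_dvd_iff dvd_mult by metis
      define m where "m = 64 * b0 ^ 3 * c - 1"
      have m: "P dvd m" using c1 unfolding m_def .
      define x where "x = 8 * b0\<^sup>2"
      define y where "y = 4 * b0 * b1"
      define z where "z = 4 * b0 * b2 - b1\<^sup>2"
      have "b0 - c * x\<^sup>2 = - m * b0"
        unfolding x_def m_def by (simp add: algebra_simps power2_eq_square power3_eq_cube)
      then have d0: "P dvd b0 - c * x\<^sup>2" using m by simp
      have "b1 - 2 * c * x * y = - m * b1"
        unfolding x_def y_def m_def by (simp add: algebra_simps power2_eq_square power3_eq_cube)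
      then have d1: "P dvd b1 - 2 * c * x * y" using m by simp
      have "b2 - c * (y\<^sup>2 + 2 * x * z) = - m * b2"
        unfolding x_def y_def z_def m_def by (simp add: algebra_simps power2_eq_square power3_eq_cube)
      then have d2: "P dvd b2 - c * (y\<^sup>2 + 2 * x * z)" using m by simp
      have "b3 - 2 * c * y * z = R * (8 * b0 * c) - m * b3"
        unfolding y_def z_def m_def R_def by (simp add: algebra_simps power2_eq_square power3_eq_cube)
      then have d3: "P dvd b3 - 2 * c * y * z" using m R by simp
      have "48 * (64 * b0 ^ 3 * b4 - z\<^sup>2) = R * (96 * b1) + (I - t\<^sup>2) * (256 * b0\<^sup>2) + D * (16 * (D + 2 * H))"
        unfolding z_def R_def I H_def D_def by (simp add: algebra_simps power2_eq_square power3_eq_cube power4_eq_xxxx)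
      then have "P dvd 48 * (64 * b0 ^ 3 * b4 - z\<^sup>2)"
        using dvd_add[OF dvd_add[OF dvd_mult2[OF R] dvd_mult2[OF t(1)]] dvd_mult2[OF True]] by (simp only:)
      then have z: "P dvd 64 * b0 ^ 3 * b4 - z\<^sup>2" using not_dvd_smooth dvd_mult_iff by blast
      have "b4 - c * z\<^sup>2 = (64 * b0 ^ 3 * b4 - z\<^sup>2) * c - m * b4"
        unfolding m_def by (simp add: algebra_simps)
      then have d4: "P dvd b4 - c * z\<^sup>2" using z m by simp
      show ?thesis unfolding scaled_square_def using nc d0 d1 d2 d3 d4 by blast
    qed
  qed
qed

end

section \<open>The singular indicator through double roots\<close>

context prime_ge_5
begin

lemma card_as_sum: "int (card {s \<in> Zp. Q s}) = (\<Sum>s\<in>Zp. if Q s then 1 else 0)"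
  by (simp add: sum.If_cases Int_def)

lemma card_reindex:
  assumes s: "\<And>x y. [\<sigma> x = \<sigma> y] (mod P) \<Longrightarrow> [x = y] (mod P)"
    and Q: "\<And>x y. [x = y] (mod P) \<Longrightarrow> Q x \<longleftrightarrow> Q y"
  shows "card {s \<in> Zp. Q (\<sigma> s)} = card {s \<in> Zp. Q s}"
proof -
  have "(\<Sum>s\<in>Zp. (if Q (\<sigma> s) then 1 else 0 :: int)) = (\<Sum>s\<in>Zp. if Q s then 1 else 0)"
    by (rule residue_sum_reindex[OF p0 _ s]) (use Q in presburger)
  then have "int (card {s \<in> Zp. Q (\<sigma> s)}) = int (card {s \<in> Zp. Q s})" by (simp only: card_as_sum)
  then show ?thesis by simp
qed

lemma affine_injective_mod:
  assumes "\<not> P dvd a" "[a * x + b = a * y + b] (mod P)" shows "[x = y] (mod P)"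
  using assms cong_mult_lcancel[of a P x y] coprime_iff[of a] by (simp add: cong_add_rcancel)

lemma card_multiples_Zp: "card {s \<in> Zp. P dvd s} = 1"
proof -
  have "{s \<in> Zp. P dvd s} = {0}" using p0 by (auto dest: zdvd_imp_le)
  then show ?thesis by (simp only:) simp
qed

lemma quadratic_root_count:
  assumes "\<not> (P dvd x \<and> P dvd y \<and> P dvd z)"
  shows "int (card {s \<in> Zp. P dvd x * s\<^sup>2 + y * s + z}) + (if P dvd x then 1 else 0)
    = 1 + Legendre (y\<^sup>2 - 4 * x * z) P"
proof -
  consider "\<not> P dvd x" | "P dvd x" "\<not> P dvd y" | "P dvd x" "P dvd y" "\<not> P dvd z" using assms by blast
  then show ?thesis
  proof cases
    case 1
    let ?d = "y\<^sup>2 - 4 * x * z"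
    have "P dvd x * s\<^sup>2 + y * s + z \<longleftrightarrow> [((2 * x) * s + y)\<^sup>2 = ?d] (mod P)" for s
    proof -
      have "((2 * x) * s + y)\<^sup>2 - ?d = 4 * x * (x * s\<^sup>2 + y * s + z)"
        by (simp add: algebra_simps power2_eq_square)
      then show ?thesis unfolding cong_iff_dvd_diff using 1 not_dvd_smooth dvd_mult_iff by metis
    qed
    then have "card {s \<in> Zp. P dvd x * s\<^sup>2 + y * s + z} = card {s \<in> Zp. [((2 * x) * s + y)\<^sup>2 = ?d] (mod P)}"
      by (simp only:)
    also have "\<dots> = card {s \<in> Zp. [s\<^sup>2 = ?d] (mod P)}"
    proof (rule card_reindex)
      show "[a = b] (mod P)" if "[(2 * x) * a + y = (2 * x) * b + y] (mod P)" for a b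
        by (rule affine_injective_mod[OF _ that]) (use 1 not_dvd_2 dvd_mult_iff in blast)
      show "[a\<^sup>2 = ?d] (mod P) \<longleftrightarrow> [b\<^sup>2 = ?d] (mod P)" if "[a = b] (mod P)" for a b
        using cong_pow[OF that, of 2] by (meson cong_sym cong_trans)
    qed
    finally show ?thesis using 1 card_square_roots[of ?d] by simp
  next
    case 2
    have "P dvd x * s\<^sup>2 + y * s + z \<longleftrightarrow> P dvd y * s + z" for s
      using 2(1) by (metis add.assoc dvd_add_right_iff dvd_mult2)
    then have "card {s \<in> Zp. P dvd x * s\<^sup>2 + y * s + z} = card {s \<in> Zp. P dvd y * s + z}"
      by (simp only:)
    also have "\<dots> = card {s \<in> Zp. P dvd s}"
    proof (rule card_reindex)
      show "[a = b] (mod P)" if "[y * a + z = y * b + z] (mod P)" for a b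
        by (rule affine_injective_mod[OF 2(2) that])
      show "P dvd a \<longleftrightarrow> P dvd b" if "[a = b] (mod P)" for a b
        using that by (rule cong_dvd_iff)
    qed
    also have "\<dots> = 1" by (rule card_multiples_Zp)
    finally have c: "card {s \<in> Zp. P dvd x * s\<^sup>2 + y * s + z} = 1" .
    have "[y\<^sup>2 - 4 * x * z = y\<^sup>2] (mod P)" using 2(1) by (simp add: cong_iff_dvd_diff)
    then have "Legendre (y\<^sup>2 - 4 * x * z) P = 1"
      using Legendre_cong Legendre_square[OF 2(2)] by metis
    then show ?thesis using 2(1) unfolding c by simp
  next
    case 3
    have "\<not> P dvd x * s\<^sup>2 + y * s + z" for s
      using 3 by (metis dvd_add dvd_add_right_iff dvd_mult2)
    then have c: "card {s \<in> Zp. P dvd x * s\<^sup>2 + y * s + z} = 0" by (simp only:) simp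
    have "P dvd y\<^sup>2 - 4 * x * z" using 3 by (simp add: power2_eq_square)
    then have "Legendre (y\<^sup>2 - 4 * x * z) P = 0" using Legendre_0_iff by blast
    then show ?thesis using 3(1) unfolding c by simp
  qed
qed

lemma scaled_square_double_root:
  assumes c: "\<not> P dvd c" and b: "P dvd b0 - c * x\<^sup>2" "P dvd b1 - 2 * c * x * y"
     "P dvd b2 - c * (y\<^sup>2 + 2 * x * z)" "P dvd b3 - 2 * c * y * z" "P dvd b4 - c * z\<^sup>2"
  shows "double_root b0 b1 b2 b3 b4 s \<longleftrightarrow> P dvd x * s\<^sup>2 + y * s + z"
proof -
  let ?q = "x * s\<^sup>2 + y * s + z"
  have 1: "(b0 * s ^ 4 + b1 * s ^ 3 + b2 * s\<^sup>2 + b3 * s + b4) - c * ?q\<^sup>2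
    = (b0 - c * x\<^sup>2) * s ^ 4 + (b1 - 2 * c * x * y) * s ^ 3 + (b2 - c * (y\<^sup>2 + 2 * x * z)) * s\<^sup>2
      + (b3 - 2 * c * y * z) * s + (b4 - c * z\<^sup>2)"
    by (simp add: algebra_simps power2_eq_square power3_eq_cube power4_eq_xxxx)
  have 2: "(4 * b0 * s ^ 3 + 3 * b1 * s\<^sup>2 + 2 * b2 * s + b3) - ?q * (2 * c * (2 * x * s + y))
    = (b0 - c * x\<^sup>2) * (4 * s ^ 3) + (b1 - 2 * c * x * y) * (3 * s\<^sup>2) + (b2 - c * (y\<^sup>2 + 2 * x * z)) * (2 * s)
      + (b3 - 2 * c * y * z)"
    by (simp add: algebra_simps power2_eq_square power3_eq_cube)
  have d1: "P dvd (b0 * s ^ 4 + b1 * s ^ 3 + b2 * s\<^sup>2 + b3 * s + b4) - c * ?q\<^sup>2"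
    unfolding 1 by (rule dvd_add[OF dvd_add[OF dvd_add[OF dvd_add[OF dvd_mult2[OF b(1)] dvd_mult2[OF b(2)]]
      dvd_mult2[OF b(3)]] dvd_mult2[OF b(4)]] b(5)])
  have d2: "P dvd (4 * b0 * s ^ 3 + 3 * b1 * s\<^sup>2 + 2 * b2 * s + b3) - ?q * (2 * c * (2 * x * s + y))"
    unfolding 2 by (rule dvd_add[OF dvd_add[OF dvd_add[OF dvd_mult2[OF b(1)] dvd_mult2[OF b(2)]]
      dvd_mult2[OF b(3)]] b(4)])
  have e1: "P dvd b0 * s ^ 4 + b1 * s ^ 3 + b2 * s\<^sup>2 + b3 * s + b4 \<longleftrightarrow> P dvd c * ?q\<^sup>2"
    using d1 by (metis cong_dvd_iff cong_iff_dvd_diff)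
  have e2: "P dvd 4 * b0 * s ^ 3 + 3 * b1 * s\<^sup>2 + 2 * b2 * s + b3 \<longleftrightarrow> P dvd ?q * (2 * c * (2 * x * s + y))"
    using d2 by (metis cong_dvd_iff cong_iff_dvd_diff)
  show ?thesis unfolding double_root_def e1 e2 using c dvd_mult_iff dvd_power_iff'
    by (metis dvd_mult2 zero_less_numeral)
qed

lemma scaled_square_infinity:
  assumes c: "\<not> P dvd c" and b: "P dvd b0 - c * x\<^sup>2" "P dvd b1 - 2 * c * x * y"
  shows "P dvd b0 \<and> P dvd b1 \<longleftrightarrow> P dvd x"
proof -
  have e0: "P dvd b0 \<longleftrightarrow> P dvd c * x\<^sup>2" using b(1) by (metis cong_dvd_iff cong_iff_dvd_diff)
  have e1: "P dvd b1 \<longleftrightarrow> P dvd 2 * c * x * y" using b(2) by (metis cong_dvd_iff cong_iff_dvd_diff)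
  show ?thesis unfolding e0 e1 using c dvd_mult_iff dvd_power_iff' by (metis zero_less_numeral)
qed

text \<open>The number of double roots on the projective line over the prime field.\<close>

definition nroots :: "int quartic \<Rightarrow> int" where
  "nroots h = int (card {s \<in> Zp. double_root (coeff0 h) (coeff1 h) (coeff2 h) (coeff3 h) (coeff4 h) s})
     + (if P dvd coeff0 h \<and> P dvd coeff1 h then 1 else 0)"

fun scaled_square_of :: "int \<times> int \<times> int \<times> int \<Rightarrow> int quartic" where
  "scaled_square_of (c, x, y, z) = Quartic ((c * x\<^sup>2) mod P) ((2 * c * x * y) mod P)
     ((c * (y\<^sup>2 + 2 * x * z)) mod P) ((2 * c * y * z) mod P) ((c * z\<^sup>2) mod P)"

definition "scaled_quadratics = {1..<P} \<times> Zp \<times> Zp \<times> Zp"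

fun disc_chi :: "int \<times> int \<times> int \<times> int \<Rightarrow> int" where
  "disc_chi (c, x, y, z) = Legendre (y\<^sup>2 - 4 * x * z) P"

definition "square_reps h = {w \<in> scaled_quadratics. scaled_square_of w = h}"

lemma finite_scaled_quadratics: "finite scaled_quadratics"
  unfolding scaled_quadratics_def by simp

lemma not_dvd_nonzero_residue: "c \<in> {1..<P} \<Longrightarrow> \<not> P dvd c"
  by (auto dest: zdvd_imp_le)

lemma square_reps_dvd:
  assumes "(c, x, y, z) \<in> square_reps (Quartic b0 b1 b2 b3 b4)"
  shows "\<not> P dvd c" "P dvd b0 - c * x\<^sup>2" "P dvd b1 - 2 * c * x * y"
     "P dvd b2 - c * (y\<^sup>2 + 2 * x * z)" "P dvd b3 - 2 * c * y * z" "P dvd b4 - c * z\<^sup>2"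
proof -
  have m: "P dvd m mod P - m" for m by (metis mod_mod_trivial mod_eq_dvd_iff)
  show "P dvd b0 - c * x\<^sup>2" "P dvd b1 - 2 * c * x * y"
     "P dvd b2 - c * (y\<^sup>2 + 2 * x * z)" "P dvd b3 - 2 * c * y * z" "P dvd b4 - c * z\<^sup>2"
    using assms m unfolding square_reps_def by auto
  show "\<not> P dvd c" using assms not_dvd_nonzero_residue unfolding square_reps_def scaled_quadratics_def by blast
qed

text \<open>Reducing \<open>c\<close>, \<open>x\<close>, \<open>y\<close>, \<open>z\<close> modulo \<open>p\<close> turns an abstract representation as a scaled square into one of the finite
set of parameters.\<close>

lemma square_reps_nonemptyI:
  assumes h: "Quartic b0 b1 b2 b3 b4 \<in> quartics_mod p" and sq: "scaled_square b0 b1 b2 b3 b4"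
  shows "square_reps (Quartic b0 b1 b2 b3 b4) \<noteq> {}"
proof -
  obtain c x y z where c: "\<not> P dvd c" and b: "P dvd b0 - c * x\<^sup>2" "P dvd b1 - 2 * c * x * y"
     "P dvd b2 - c * (y\<^sup>2 + 2 * x * z)" "P dvd b3 - 2 * c * y * z" "P dvd b4 - c * z\<^sup>2"
    using sq unfolding scaled_square_def by blast
  let ?w = "(c mod P, x mod P, y mod P, z mod P)"
  have m: "[c mod P = c] (mod P)" "[x mod P = x] (mod P)" "[y mod P = y] (mod P)" "[z mod P = z] (mod P)"
    by simp_all
  have V: "b0 \<in> Zp" "b1 \<in> Zp" "b2 \<in> Zp" "b3 \<in> Zp" "b4 \<in> Zp"
    using h unfolding quartics_mod_def by auto
  have red: "u mod P = b" if "b \<in> Zp" "P dvd b - v" "[u = v] (mod P)" for u v b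
  proof -
    have "b mod P = v mod P" using that(2) by (simp add: mod_eq_dvd_iff)
    then show ?thesis using that(1,3) unfolding cong_def by simp
  qed
  have "scaled_square_of ?w = Quartic b0 b1 b2 b3 b4"
    unfolding scaled_square_of.simps quartic.inject
    by (intro conjI red[OF V(1) b(1)] red[OF V(2) b(2)] red[OF V(3) b(3)] red[OF V(4) b(4)] red[OF V(5) b(5)]
        cong_mult cong_add cong_pow cong_refl m)
  moreover have "?w \<in> scaled_quadratics"
  proof -
    have "c mod P \<noteq> 0" using c by (simp add: dvd_eq_mod_eq_0)
    moreover have "c mod P \<ge> 0" "c mod P < P" using p0 by auto
    ultimately have "c mod P \<in> {1..<P}" by auto
    then show ?thesis unfolding scaled_quadratics_def using p0 by auto
  qed
  ultimately show ?thesis unfolding square_reps_def by blast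
qed

lemma common_scale:
  assumes c: "\<not> P dvd c" "\<not> P dvd c0" and a: "P dvd c * a\<^sup>2 - c0 * a0\<^sup>2" "\<not> P dvd a0"
  shows "\<exists>l. \<not> P dvd l \<and> P dvd a - l * a0 \<and> P dvd c * l\<^sup>2 - c0"
proof -
  obtain u where u: "[a0 * u = 1] (mod P)" using inverse_exists[OF a(2)] by blast
  have u1: "P dvd a0 * u - 1" using u by (simp add: cong_iff_dvd_diff)
  let ?l = "a * u"
  have "a - ?l * a0 = (a0 * u - 1) * (- a)" by (simp add: algebra_simps)
  then have 1: "P dvd a - ?l * a0" using u1 by simp
  have "(c * ?l\<^sup>2 - c0) * a0\<^sup>2 = (c * a\<^sup>2 - c0 * a0\<^sup>2) - (a - ?l * a0) * (c * (?l * a0 + a))"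
    by (simp add: algebra_simps power2_eq_square)
  then have "P dvd (c * ?l\<^sup>2 - c0) * a0\<^sup>2" using dvd_diff[OF a(1) dvd_mult2[OF 1]] by (simp only:)
  then have 2: "P dvd c * ?l\<^sup>2 - c0" using a(2) dvd_mult_iff dvd_power_iff' by (metis zero_less_numeral)
  have "\<not> P dvd ?l"
  proof
    assume "P dvd ?l"
    then have "P dvd c * ?l\<^sup>2" by (simp add: power2_eq_square del: mult.assoc)
    then have "P dvd c * ?l\<^sup>2 - (c * ?l\<^sup>2 - c0)" using 2 by (rule dvd_diff)
    then show False using c(2) by simp
  qed
  then show ?thesis using 1 2 by blast
qed

lemma common_scale_step:
  assumes c: "\<not> P dvd c" and l: "\<not> P dvd l" "P dvd a - l * a0" "P dvd c * l\<^sup>2 - c0" "\<not> P dvd a0"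
    and b: "P dvd c * a * b - c0 * a0 * b0"
  shows "P dvd b - l * b0"
proof -
  have "c * l * a0 * (b - l * b0) = (c * a * b - c0 * a0 * b0) - (a - l * a0) * (c * b) - (c * l\<^sup>2 - c0) * (a0 * b0)"
    by (simp add: algebra_simps power2_eq_square)
  then have "P dvd c * l * a0 * (b - l * b0)"
    using dvd_diff[OF dvd_diff[OF b dvd_mult2[OF l(2)]] dvd_mult2[OF l(3)]] by (simp only:)
  then show ?thesis using c l dvd_mult_iff by blast
qed

text \<open>Unique factorisation: \<open>c * g\<^sup>2\<close> determines the quadratic \<open>g\<close> up to a scalar. The scalar is read off at a
nonvanishing coefficient of \<open>g\<close> and transported to the others by \<open>common_scale_step\<close>.\<close>

lemma scaled_square_unique:
  assumes c: "\<not> P dvd c" "\<not> P dvd c0" and nz: "\<not> (P dvd x0 \<and> P dvd y0 \<and> P dvd z0)"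
    and d: "P dvd c * x\<^sup>2 - c0 * x0\<^sup>2" "P dvd 2 * c * x * y - 2 * c0 * x0 * y0"
      "P dvd c * (y\<^sup>2 + 2 * x * z) - c0 * (y0\<^sup>2 + 2 * x0 * z0)" "P dvd 2 * c * y * z - 2 * c0 * y0 * z0"
      "P dvd c * z\<^sup>2 - c0 * z0\<^sup>2"
  shows "\<exists>l. \<not> P dvd l \<and> P dvd x - l * x0 \<and> P dvd y - l * y0 \<and> P dvd z - l * z0 \<and> P dvd c * l\<^sup>2 - c0"
proof -
  have half: "P dvd m" if "P dvd 2 * m" for m using that not_dvd_2 dvd_mult_iff by blast
  have xy: "P dvd c * x * y - c0 * x0 * y0" by (rule half) (use d(2) in \<open>simp add: algebra_simps\<close>)
  have yz: "P dvd c * y * z - c0 * y0 * z0" by (rule half) (use d(4) in \<open>simp add: algebra_simps\<close>)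
  have zeroI: "P dvd a" if "P dvd c * a\<^sup>2 - c0 * a0\<^sup>2" "P dvd a0" for a a0
  proof -
    have "P dvd c0 * a0\<^sup>2" using that(2) by (simp add: power2_eq_square)
    then have "P dvd (c * a\<^sup>2 - c0 * a0\<^sup>2) + c0 * a0\<^sup>2" using that(1) by (rule dvd_add[rotated])
    then have "P dvd c * a\<^sup>2" by simp
    then show ?thesis using c dvd_mult_iff dvd_power_iff' by (metis zero_less_numeral)
  qed
  consider "\<not> P dvd x0" | "P dvd x0" "\<not> P dvd y0" | "P dvd x0" "P dvd y0" "\<not> P dvd z0" using nz by blast
  then show ?thesis
  proof cases
    case 1
    obtain l where l: "\<not> P dvd l" "P dvd x - l * x0" "P dvd c * l\<^sup>2 - c0"
      using common_scale[OF c d(1) 1] by blast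
    have y: "P dvd y - l * y0" by (rule common_scale_step[OF c(1) l 1 xy])
    have "2 * (c * x * z - c0 * x0 * z0) = (c * (y\<^sup>2 + 2 * x * z) - c0 * (y0\<^sup>2 + 2 * x0 * z0))
        - (y - l * y0) * (c * (y + l * y0)) - (c * l\<^sup>2 - c0) * y0\<^sup>2"
      by (simp add: algebra_simps power2_eq_square)
    then have "P dvd 2 * (c * x * z - c0 * x0 * z0)"
      using dvd_diff[OF dvd_diff[OF d(3) dvd_mult2[OF y]] dvd_mult2[OF l(3)]] by (simp only:)
    then have xz: "P dvd c * x * z - c0 * x0 * z0" by (rule half)
    have "P dvd z - l * z0" by (rule common_scale_step[OF c(1) l 1 xz])
    then show ?thesis using l y by blast
  next
    case 2
    have x: "P dvd x" by (rule zeroI[OF d(1) 2(1)])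
    have "c * y\<^sup>2 - c0 * y0\<^sup>2 = (c * (y\<^sup>2 + 2 * x * z) - c0 * (y0\<^sup>2 + 2 * x0 * z0)) - x * (2 * c * z) + x0 * (2 * c0 * z0)"
      by (simp add: algebra_simps)
    then have yy: "P dvd c * y\<^sup>2 - c0 * y0\<^sup>2"
      using dvd_add[OF dvd_diff[OF d(3) dvd_mult2[OF x]] dvd_mult2[OF 2(1)]] by (simp only:)
    obtain l where l: "\<not> P dvd l" "P dvd y - l * y0" "P dvd c * l\<^sup>2 - c0"
      using common_scale[OF c yy 2(2)] by blast
    have "P dvd z - l * z0" by (rule common_scale_step[OF c(1) l 2(2) yz])
    moreover have "P dvd x - l * x0" using x 2(1) by simp
    ultimately show ?thesis using l by blast
  next
    case 3
    have x: "P dvd x" by (rule zeroI[OF d(1) 3(1)])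
    have "c * y\<^sup>2 - c0 * y0\<^sup>2 = (c * (y\<^sup>2 + 2 * x * z) - c0 * (y0\<^sup>2 + 2 * x0 * z0)) - x * (2 * c * z) + x0 * (2 * c0 * z0)"
      by (simp add: algebra_simps)
    then have yy: "P dvd c * y\<^sup>2 - c0 * y0\<^sup>2"
      using dvd_add[OF dvd_diff[OF d(3) dvd_mult2[OF x]] dvd_mult2[OF 3(1)]] by (simp only:)
    have y: "P dvd y" by (rule zeroI[OF yy 3(2)])
    obtain l where l: "\<not> P dvd l" "P dvd z - l * z0" "P dvd c * l\<^sup>2 - c0"
      using common_scale[OF c d(5) 3(3)] by blast
    moreover have "P dvd x - l * x0" "P dvd y - l * y0" using x y 3 by simp_all
    ultimately show ?thesis by blast
  qed
qed

lemma residue_eqI: "a \<in> Zp \<Longrightarrow> b \<in> Zp \<Longrightarrow> P dvd a - b \<Longrightarrow> a = b"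
  by (simp add: mod_eq_dvd_iff[symmetric])

text \<open>The representations are \<open>(c0 / l\<^sup>2, l * g0)\<close> for the \<open>p - 1\<close> units \<open>l\<close>, and scaling a quadratic by \<open>l\<close> multiplies its
discriminant by a square.\<close>

lemma square_reps_sum:
  assumes w0: "(c0, x0, y0, z0) \<in> square_reps h" and nz: "\<not> (P dvd x0 \<and> P dvd y0 \<and> P dvd z0)"
  shows "(\<Sum>w\<in>square_reps h. disc_chi w) = (P - 1) * Legendre (y0\<^sup>2 - 4 * x0 * z0) P"
proof -
  obtain b0 b1 b2 b3 b4 where h: "h = Quartic b0 b1 b2 b3 b4" by (cases h)
  note r0 = square_reps_dvd[OF w0[unfolded h]]
  have scale: "\<exists>l. \<not> P dvd l \<and> P dvd x - l * x0 \<and> P dvd y - l * y0 \<and> P dvd z - l * z0 \<and> P dvd c * l\<^sup>2 - c0"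
    if "(c, x, y, z) \<in> square_reps h" for c x y z
  proof -
    note r = square_reps_dvd[OF that[unfolded h]]
    have sub: "P dvd u - v" if "P dvd b - u" "P dvd b - v" for u v b
      using dvd_diff[OF that(2,1)] by simp
    show ?thesis
      by (rule scaled_square_unique[OF r(1) r0(1) nz])
         (rule sub[OF r(2) r0(2)] sub[OF r(3) r0(3)] sub[OF r(4) r0(4)] sub[OF r(5) r0(5)] sub[OF r(6) r0(6)])+
  qed
  have chi: "disc_chi w = Legendre (y0\<^sup>2 - 4 * x0 * z0) P" if w: "w \<in> square_reps h" for w
  proof -
    obtain c x y z where w': "w = (c, x, y, z)" by (cases w)
    obtain l where l: "\<not> P dvd l" "P dvd x - l * x0" "P dvd y - l * y0" "P dvd z - l * z0"
      using scale w unfolding w' by blast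
    have "(y\<^sup>2 - 4 * x * z) - l\<^sup>2 * (y0\<^sup>2 - 4 * x0 * z0)
        = (y - l * y0) * (y + l * y0) - (x - l * x0) * (4 * z) - (z - l * z0) * (4 * l * x0)"
      by (simp add: algebra_simps power2_eq_square)
    then have "P dvd (y\<^sup>2 - 4 * x * z) - l\<^sup>2 * (y0\<^sup>2 - 4 * x0 * z0)"
      using dvd_diff[OF dvd_diff[OF dvd_mult2[OF l(3)] dvd_mult2[OF l(2)]] dvd_mult2[OF l(4)]] by (simp only:)
    then have "[y\<^sup>2 - 4 * x * z = l\<^sup>2 * (y0\<^sup>2 - 4 * x0 * z0)] (mod P)" by (simp only: cong_iff_dvd_diff)
    from Legendre_cong[OF this] show ?thesis
      unfolding w' disc_chi.simps Legendre_mult Legendre_square[OF l(1)] by simp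
  qed
  define \<phi> where "\<phi> l = ((c0 * (modular_inverse P l)\<^sup>2) mod P, (l * x0) mod P, (l * y0) mod P, (l * z0) mod P)" for l
  have inv: "P dvd l * modular_inverse P l - 1" if "\<not> P dvd l" for l
    using cong_modular_inverse1[of l P] coprime_iff[of l] that by (simp add: cong_iff_dvd_diff)
  have range: "0 \<le> u mod P" "u mod P < P" for u using p0 by auto
  have mdvd: "P dvd u mod P - u" for u by (metis mod_mod_trivial mod_eq_dvd_iff)
  have bij: "bij_betw \<phi> {1..<P} (square_reps h)"
    unfolding bij_betw_def
  proof
    show "inj_on \<phi> {1..<P}"
    proof (rule inj_onI)
      fix l m assume lm: "l \<in> {1..<P}" "m \<in> {1..<P}" "\<phi> l = \<phi> m"
      have "P dvd (l - m) * x0" "P dvd (l - m) * y0" "P dvd (l - m) * z0"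
        using lm(3) unfolding \<phi>_def by (simp_all add: mod_eq_dvd_iff algebra_simps)
      then have "P dvd l - m" using nz dvd_mult_iff by blast
      then show "l = m" using residue_eqI lm by auto
    qed
    show "\<phi> ` {1..<P} = square_reps h"
    proof
      show "\<phi> ` {1..<P} \<subseteq> square_reps h"
      proof
        fix w assume "w \<in> \<phi> ` {1..<P}"
        then obtain l where l: "l \<in> {1..<P}" "w = \<phi> l" by blast
        have nl: "\<not> P dvd l" by (rule not_dvd_nonzero_residue[OF l(1)])
        define u where "u = modular_inverse P l"
        have u: "P dvd l * u - 1" using inv[OF nl] unfolding u_def .
        have nu: "\<not> P dvd u"
        proof
          assume "P dvd u"
          then have "P dvd l * u" by simp
          then have "P dvd l * u - (l * u - 1)" using u by (rule dvd_diff)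
          then show False using not_dvd_1 by simp
        qed
        have lu: "[l\<^sup>2 * u\<^sup>2 = 1] (mod P)"
        proof -
          have "l\<^sup>2 * u\<^sup>2 - 1 = (l * u - 1) * (l * u + 1)" by (simp add: algebra_simps power2_eq_square)
          then show ?thesis using u by (simp add: cong_iff_dvd_diff)
        qed
        let ?c = "(c0 * u\<^sup>2) mod P" and ?x = "(l * x0) mod P" and ?y = "(l * y0) mod P" and ?z = "(l * z0) mod P"
        have m: "[?c = c0 * u\<^sup>2] (mod P)" "[?x = l * x0] (mod P)" "[?y = l * y0] (mod P)" "[?z = l * z0] (mod P)"
          by simp_all
        have tr: "[A = B * (l\<^sup>2 * u\<^sup>2)] (mod P) \<Longrightarrow> [A = B] (mod P)" for A B
          using cong_mult[OF cong_refl[of B] lu] by (metis cong_trans mult.right_neutral)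
        have e0: "(c0 * u\<^sup>2) * (l * x0)\<^sup>2 = c0 * x0\<^sup>2 * (l\<^sup>2 * u\<^sup>2)"
          by (simp add: power_mult_distrib)
        have e1: "2 * (c0 * u\<^sup>2) * (l * x0) * (l * y0) = 2 * c0 * x0 * y0 * (l\<^sup>2 * u\<^sup>2)"
          by (simp add: power2_eq_square)
        have e2: "(c0 * u\<^sup>2) * ((l * y0)\<^sup>2 + 2 * (l * x0) * (l * z0)) = c0 * (y0\<^sup>2 + 2 * x0 * z0) * (l\<^sup>2 * u\<^sup>2)"
          by (simp add: power2_eq_square algebra_simps)
        have e3: "2 * (c0 * u\<^sup>2) * (l * y0) * (l * z0) = 2 * c0 * y0 * z0 * (l\<^sup>2 * u\<^sup>2)"
          by (simp add: power2_eq_square)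
        have e4: "(c0 * u\<^sup>2) * (l * z0)\<^sup>2 = c0 * z0\<^sup>2 * (l\<^sup>2 * u\<^sup>2)"
          by (simp add: power_mult_distrib)
        have 0: "[?c * ?x\<^sup>2 = c0 * x0\<^sup>2] (mod P)"
          by (rule tr, fold e0) (intro cong_mult cong_pow m)
        have 1: "[2 * ?c * ?x * ?y = 2 * c0 * x0 * y0] (mod P)"
          by (rule tr, fold e1) (intro cong_mult cong_refl m)
        have 2: "[?c * (?y\<^sup>2 + 2 * ?x * ?z) = c0 * (y0\<^sup>2 + 2 * x0 * z0)] (mod P)"
          by (rule tr, fold e2) (intro cong_mult cong_add cong_pow cong_refl m)
        have 3: "[2 * ?c * ?y * ?z = 2 * c0 * y0 * z0] (mod P)"
          by (rule tr, fold e3) (intro cong_mult cong_refl m)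
        have 4: "[?c * ?z\<^sup>2 = c0 * z0\<^sup>2] (mod P)"
          by (rule tr, fold e4) (intro cong_mult cong_pow m)
        have "scaled_square_of (?c, ?x, ?y, ?z) = scaled_square_of (c0, x0, y0, z0)"
          unfolding scaled_square_of.simps quartic.inject using 0 1 2 3 4 unfolding cong_def by blast
        also have "\<dots> = h" using w0 unfolding square_reps_def by blast
        finally have "scaled_square_of w = h" unfolding l(2) \<phi>_def u_def .
        moreover have "w \<in> scaled_quadratics"
        proof -
          have "\<not> P dvd c0 * u\<^sup>2" using r0(1) nu dvd_mult_iff dvd_power_iff' by (metis zero_less_numeral)
          then have "?c \<noteq> 0" by (simp only: dvd_eq_mod_eq_0 not_False_eq_True)
          then have "?c \<in> {1..<P}" using range[of "c0 * u\<^sup>2"] by auto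
          then show ?thesis unfolding l(2) \<phi>_def scaled_quadratics_def u_def[symmetric] using range by auto
        qed
        ultimately show "w \<in> square_reps h" unfolding square_reps_def by blast
      qed
      show "square_reps h \<subseteq> \<phi> ` {1..<P}"
      proof
        fix w assume w: "w \<in> square_reps h"
        obtain c x y z where w': "w = (c, x, y, z)" by (cases w)
        have W: "c \<in> {1..<P}" "x \<in> Zp" "y \<in> Zp" "z \<in> Zp"
          using w unfolding w' square_reps_def scaled_quadratics_def by auto
        obtain l where l: "\<not> P dvd l" "P dvd x - l * x0" "P dvd y - l * y0" "P dvd z - l * z0" "P dvd c * l\<^sup>2 - c0"
          using scale w unfolding w' by blast
        define m where "m = l mod P"
        have ml: "P dvd m - l" unfolding m_def by (rule mdvd)
        have nm: "\<not> P dvd m" using l(1) unfolding m_def by (simp add: dvd_mod_iff)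
        have m1: "m \<in> {1..<P}"
        proof -
          have "m \<noteq> 0" using nm by auto
          then show ?thesis using range[of l] unfolding m_def by auto
        qed
        define u where "u = modular_inverse P m"
        have u: "P dvd m * u - 1" using inv[OF nm] unfolding u_def .
        have co: "b = (m * a) mod P" if "b \<in> Zp" "P dvd b - l * a" for a b
        proof (rule residue_eqI[OF that(1)])
          show "(m * a) mod P \<in> Zp" using range by auto
          have "b - (m * a) mod P = (b - l * a) - (m - l) * a - ((m * a) mod P - m * a)" by (simp add: algebra_simps)
          then show "P dvd b - (m * a) mod P"
            using dvd_diff[OF dvd_diff[OF that(2) dvd_mult2[OF ml]] mdvd] by (simp only:)
        qed
        have "c = (c0 * u\<^sup>2) mod P"
        proof (rule residue_eqI)
          show "c \<in> Zp" "(c0 * u\<^sup>2) mod P \<in> Zp" using W(1) range by auto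
          have "c - c0 * u\<^sup>2 = (c * l\<^sup>2 - c0) * u\<^sup>2 - (m * u - 1) * (c * (m * u + 1)) + (m - l) * (c * u\<^sup>2 * (m + l))"
            by (simp add: algebra_simps power2_eq_square)
          then have "P dvd c - c0 * u\<^sup>2"
            using dvd_add[OF dvd_diff[OF dvd_mult2[OF l(5)] dvd_mult2[OF u]] dvd_mult2[OF ml]] by (simp only:)
          then show "P dvd c - (c0 * u\<^sup>2) mod P" using mdvd[of "c0 * u\<^sup>2"]
            by (metis mod_eq_dvd_iff mod_mod_trivial)
        qed
        then have "w = \<phi> m" unfolding w' \<phi>_def u_def using co[OF W(2) l(2)] co[OF W(3) l(3)] co[OF W(4) l(4)] by simp
        then show "w \<in> \<phi> ` {1..<P}" using m1 by blast
      qed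
    qed
  qed
  have "card (square_reps h) = card {1..<P}" using bij_betw_same_card[OF bij] by simp
  then have "int (card (square_reps h)) = P - 1" using p0 by simp
  moreover have "(\<Sum>w\<in>square_reps h. disc_chi w) = (\<Sum>w\<in>square_reps h. Legendre (y0\<^sup>2 - 4 * x0 * z0) P)"
    by (rule sum.cong[OF refl chi])
  ultimately show ?thesis by simp
qed

text \<open>A nonzero singular form has exactly one double root, except that \<open>c * g\<^sup>2\<close> has as many as \<open>g\<close> has zeros,
that is \<open>1 + chi (disc g)\<close>, possibly none; the zero form has \<open>p + 1\<close>. Thus the indicator of the singular locus is the
number of double roots, minus \<open>p\<close> at the zero form, minus \<open>chi (disc g)\<close> at \<open>c * g\<^sup>2\<close>. The factor \<open>p - 1\<close> replaces the
choice of one representation by the sum over all of them, which is a sum over a product set.\<close>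

lemma singular_indicator_identity:
  assumes V: "h \<in> quartics_mod p"
  shows "(P - 1) * ((if P dvd Disc h then 1 else 0) - nroots h + (if h = 0 then P else 0))
     = - (\<Sum>w\<in>square_reps h. disc_chi w)"
proof -
  obtain b0 b1 b2 b3 b4 where h: "h = Quartic b0 b1 b2 b3 b4" by (cases h)
  have b: "b0 \<in> Zp" "b1 \<in> Zp" "b2 \<in> Zp" "b3 \<in> Zp" "b4 \<in> Zp"
    using V unfolding h quartics_mod_def by auto
  have z: "b = 0 \<longleftrightarrow> P dvd b" if "b \<in> Zp" for b using that by (auto dest: zdvd_imp_le)
  have h0: "h = 0 \<longleftrightarrow> P dvd b0 \<and> P dvd b1 \<and> P dvd b2 \<and> P dvd b3 \<and> P dvd b4"
    unfolding h zero_quartic_def quartic.inject using z b by blast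
  have n: "nroots h = int (card {s \<in> Zp. double_root b0 b1 b2 b3 b4 s}) + (if P dvd b0 \<and> P dvd b1 then 1 else 0)"
    unfolding nroots_def h by simp
  consider "h = 0" | "h \<noteq> 0" "square_reps h \<noteq> {}" | "h \<noteq> 0" "square_reps h = {}" by blast
  then show ?thesis
  proof cases
    case 1
    then have b00: "b0 = 0" "b1 = 0" "b2 = 0" "b3 = 0" "b4 = 0" unfolding h zero_quartic_def by auto
    have "disc_chi w = 0" if w: "w \<in> square_reps h" for w
    proof -
      obtain c x y z where w': "w = (c, x, y, z)" by (cases w)
      note r = square_reps_dvd[OF w[unfolded w' h b00]]
      have "P dvd c * x\<^sup>2" using r(2) by simp
      then have x: "P dvd x" using r(1) dvd_mult_iff dvd_power_iff' by (metis zero_less_numeral)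
      have "P dvd c * (y\<^sup>2 + 2 * x * z)" using r(4) by (simp only: diff_0 dvd_minus_iff)
      then have "P dvd y\<^sup>2 + 2 * x * z" using r(1) dvd_mult_iff by blast
      moreover have "P dvd x * (6 * z)" using x by simp
      ultimately have "P dvd (y\<^sup>2 + 2 * x * z) - x * (6 * z)" by (rule dvd_diff)
      moreover have "(y\<^sup>2 + 2 * x * z) - x * (6 * z) = y\<^sup>2 - 4 * x * z" by simp
      ultimately show ?thesis unfolding w' disc_chi.simps Legendre_0_iff by (simp only:)
    qed
    then have s0: "(\<Sum>w\<in>square_reps h. disc_chi w) = 0" by (intro sum.neutral ballI)
    have "{s \<in> Zp. double_root b0 b1 b2 b3 b4 s} = Zp" unfolding b00 double_root_def by auto
    then have "nroots h = P + 1" unfolding n b00 by simp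
    moreover have "P dvd Disc h" by (simp add: h b00 Disc_explicit)
    ultimately show ?thesis unfolding s0 using 1 by simp
  next
    case 2
    then obtain c x y z where w: "(c, x, y, z) \<in> square_reps h" by auto
    note r = square_reps_dvd[OF w[unfolded h]]
    have nz: "\<not> (P dvd x \<and> P dvd y \<and> P dvd z)"
    proof
      assume d: "P dvd x \<and> P dvd y \<and> P dvd z"
      have **: "P dvd u" if "P dvd u - v" "P dvd v" for u v
        using dvd_add[OF that] by simp
      have "P dvd b0" by (rule **[OF r(2)]) (use d in \<open>simp add: power2_eq_square\<close>)
      moreover have "P dvd b1" by (rule **[OF r(3)]) (use d in simp)
      moreover have "P dvd b2" by (rule **[OF r(4)]) (use d in \<open>simp add: power2_eq_square\<close>)
      moreover have "P dvd b3" by (rule **[OF r(5)]) (use d in simp)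
      moreover have "P dvd b4" by (rule **[OF r(6)]) (use d in \<open>simp add: power2_eq_square\<close>)
      ultimately show False using 2(1) h0 by blast
    qed
    have n1: "nroots h = 1 + Legendre (y\<^sup>2 - 4 * x * z) P"
      unfolding n scaled_square_double_root[OF r] scaled_square_infinity[OF r(1-3)]
      by (rule quadratic_root_count[OF nz])
    have "P dvd Disc h"
    proof -
      let ?g = "y\<^sup>2 - 4 * x * z"
      let ?s = "Quartic (c * x\<^sup>2) (2 * c * x * y) (c * (y\<^sup>2 + 2 * x * z)) (2 * c * y * z) (c * z\<^sup>2)"
      have "quartic_I ?s - (c * ?g)\<^sup>2 = 0" "quartic_J ?s + 2 * (c * ?g) ^ 3 = 0"
        by (simp_all add: algebra_simps power2_eq_square power3_eq_cube)
      then have "P dvd Disc ?s" by (intro Disc_dvdI[where g = "c * ?g"]) (simp_all del: quartic_I.simps quartic_J.simps)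
      moreover have "[Disc h = Disc ?s] (mod P)"
        by (rule Disc_cong) (use r in \<open>simp add: h cong_iff_dvd_diff\<close>)
      ultimately show ?thesis using cong_dvd_iff by blast
    qed
    then show ?thesis using 2 unfolding square_reps_sum[OF w nz] n1 by (simp add: algebra_simps)
  next
    case 3
    then have ns: "\<not> scaled_square b0 b1 b2 b3 b4" using square_reps_nonemptyI V unfolding h by blast
    have nzb: "\<not> (P dvd b0 \<and> P dvd b1 \<and> P dvd b2 \<and> P dvd b3 \<and> P dvd b4)" using 3(1) h0 by blast
    let ?R = "{s \<in> Zp. double_root b0 b1 b2 b3 b4 s}"
    have uniq: "s = s'" if "s \<in> ?R" "s' \<in> ?R" for s s'
    proof (rule ccontr)
      assume "s \<noteq> s'"
      then have "\<not> P dvd s' - s" using residue_eqI[of s' s] that by auto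
      then show False using two_double_roots[OF _ _ _ nzb, of s s'] that ns by blast
    qed
    have excl: "?R = {}" if "P dvd b0" "P dvd b1"
      using double_root_and_infinity[OF _ that nzb] ns by blast
    have "nroots h = (if P dvd Disc h then 1 else 0)"
    proof (cases "P dvd b0 \<and> P dvd b1")
      case True
      then have "P dvd Disc h" unfolding h using double_root_infinity_imp_Disc by blast
      moreover have "card ?R = 0" using True by (simp only: excl card.empty)
      ultimately show ?thesis unfolding n using True by simp
    next
      case F: False
      show ?thesis
      proof (cases "?R = {}")
        case True
        have "\<not> P dvd Disc h"
        proof
          assume "P dvd Disc h"
          then obtain s where s: "double_root b0 b1 b2 b3 b4 s"
            using singular_cases F ns unfolding h by blast
          have "double_root b0 b1 b2 b3 b4 (s mod P)"
          proof -
            have m: "[s mod P = s] (mod P)" by simp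
            have 1: "[b0 * (s mod P) ^ 4 + b1 * (s mod P) ^ 3 + b2 * (s mod P)\<^sup>2 + b3 * (s mod P) + b4
               = b0 * s ^ 4 + b1 * s ^ 3 + b2 * s\<^sup>2 + b3 * s + b4] (mod P)"
              by (intro cong_add cong_mult cong_pow cong_refl m)
            have 2: "[4 * b0 * (s mod P) ^ 3 + 3 * b1 * (s mod P)\<^sup>2 + 2 * b2 * (s mod P) + b3
               = 4 * b0 * s ^ 3 + 3 * b1 * s\<^sup>2 + 2 * b2 * s + b3] (mod P)"
              by (intro cong_add cong_mult cong_pow cong_refl m)
            show ?thesis using s unfolding double_root_def cong_dvd_iff[OF 1] cong_dvd_iff[OF 2] .
          qed
          then have "s mod P \<in> ?R" using p0 by simp
          then show False using True by blast
        qed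
        moreover have "card ?R = 0" by (simp only: True card.empty)
        ultimately show ?thesis unfolding n using F by simp
      next
        case False
        then obtain s where s: "s \<in> ?R" by blast
        then have "?R = {s}" using uniq by blast
        then have "card ?R = 1" by simp
        moreover have "P dvd Disc h" unfolding h by (rule double_root_imp_Disc[of _ _ _ _ _ s]) (use s in blast)
        ultimately show ?thesis unfolding n using F by simp
      qed
    qed
    then show ?thesis using 3 by simp
  qed
qed

end

section \<open>The Fourier transform of the singular locus modulo a prime\<close>

text \<open>Twelve times the pairing of the two spaces of forms. It has integer coefficients, and modulo \<open>q\<close>
prime to 6 it differs from the pairing by a unit.\<close>

fun pairing12 :: "int quartic \<Rightarrow> int quartic \<Rightarrow> int" where
  "pairing12 (Quartic b0 b1 b2 b3 b4) (Quartic a0 a1 a2 a3 a4) =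
     12 * b0 * a0 + 3 * b1 * a1 + 2 * b2 * a2 + 3 * b3 * a3 + 12 * b4 * a4"

definition singular_sum :: "nat \<Rightarrow> int quartic \<Rightarrow> complex" where
  "singular_sum q f = (\<Sum>h\<in>quartics_mod q. of_real (Phi q h) * add_char q (pairing12 h f))"

context prime_ge_5
begin

lemma triple_add_char_sum:
  "(\<Sum>(x, y, z)\<in>Zp \<times> Zp \<times> Zp. ee (x * L0 + y * L1 + z * L2))
    = (if P dvd L0 \<and> P dvd L1 \<and> P dvd L2 then of_nat p ^ 3 else 0)"
proof -
  have "(\<Sum>(x, y, z)\<in>Zp \<times> Zp \<times> Zp. ee (x * L0 + y * L1 + z * L2))
      = (\<Sum>x\<in>Zp. \<Sum>y\<in>Zp. \<Sum>z\<in>Zp. ee (L0 * x) * (ee (L1 * y) * ee (L2 * z)))"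
    by (simp add: sum.cartesian_product add_char_add mult_ac case_prod_unfold)
  also have "\<dots> = (\<Sum>x\<in>Zp. ee (L0 * x)) * ((\<Sum>y\<in>Zp. ee (L1 * y)) * (\<Sum>z\<in>Zp. ee (L2 * z)))"
    by (simp only: sum_distrib_left[symmetric] sum_distrib_right[symmetric])
  finally show ?thesis unfolding sum_add_char[OF p0] by (simp add: power3_eq_cube)
qed

text \<open>The forms with a double root at \<open>s\<close> are the multiples of \<open>(X - s Y)\<^sup>2\<close>, a space of dimension three on which the
pairing with the given form is the linear form with coefficients \<open>L0\<close>, \<open>L1\<close>, \<open>L2\<close>.\<close>

lemma sum_double_root_at:
  fixes a0 a1 a2 a3 a4 s :: int
  defines "L0 \<equiv> 12 * a0 - 6 * s * a1 + 2 * s\<^sup>2 * a2"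
    and "L1 \<equiv> 3 * a1 - 4 * s * a2 + 3 * s\<^sup>2 * a3"
    and "L2 \<equiv> 2 * a2 - 6 * s * a3 + 12 * s\<^sup>2 * a4"
  shows "(\<Sum>h\<in>{h \<in> quartics_mod p. double_root (coeff0 h) (coeff1 h) (coeff2 h) (coeff3 h) (coeff4 h) s}.
      ee (pairing12 h (Quartic a0 a1 a2 a3 a4)))
    = (if P dvd L0 \<and> P dvd L1 \<and> P dvd L2 then of_nat p ^ 3 else 0)"
proof -
  let ?f = "Quartic a0 a1 a2 a3 a4"
  let ?Vs = "{h \<in> quartics_mod p. double_root (coeff0 h) (coeff1 h) (coeff2 h) (coeff3 h) (coeff4 h) s}"
  define i where "i = (\<lambda>(x, y, z). Quartic x ((y - 2 * s * x) mod P) ((z - 2 * s * y + s\<^sup>2 * x) mod P)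
      ((s\<^sup>2 * y - 2 * s * z) mod P) ((s\<^sup>2 * z) mod P))"
  define j where "j h = (coeff0 h, (coeff1 h + 2 * s * coeff0 h) mod P,
      (coeff2 h + 2 * s * (coeff1 h + 2 * s * coeff0 h) - s\<^sup>2 * coeff0 h) mod P)" for h
  have range: "u mod P \<in> Zp" for u using p0 by auto
  have mdvd: "P dvd u - u mod P" for u by (metis mod_mod_trivial mod_eq_dvd_iff)
  have mdvd': "P dvd u mod P - u" for u by (metis mod_mod_trivial mod_eq_dvd_iff)
  have "(\<Sum>h\<in>?Vs. ee (pairing12 h ?f)) = (\<Sum>(x, y, z)\<in>Zp \<times> Zp \<times> Zp. ee (x * L0 + y * L1 + z * L2))"
  proof (rule sum.reindex_bij_witness[of _ i j])
    fix h assume h: "h \<in> ?Vs"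
    obtain b0 b1 b2 b3 b4 where hb: "h = Quartic b0 b1 b2 b3 b4" by (cases h)
    have b: "b0 \<in> Zp" "b1 \<in> Zp" "b2 \<in> Zp" "b3 \<in> Zp" "b4 \<in> Zp"
      using h unfolding hb quartics_mod_def by auto
    have dr: "double_root b0 b1 b2 b3 b4 s" using h unfolding hb by simp
    note fac = double_root_factor[OF dr]
    define y where "y = b1 + 2 * s * b0"
    define z where "z = b2 + 2 * s * y - s\<^sup>2 * b0"
    define y' where "y' = y mod P"
    define z' where "z' = z mod P"
    have yd: "P dvd y - y'" and zd: "P dvd z - z'" unfolding y'_def z'_def by (rule mdvd)+
    have jh: "j h = (b0, y', z')" unfolding j_def hb y'_def z'_def y_def z_def by simp
    show "j h \<in> Zp \<times> Zp \<times> Zp" unfolding jh y'_def z'_def using b range by simp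
    have e1: "P dvd b1 - (y' - 2 * s * b0)"
    proof -
      have "b1 - (y' - 2 * s * b0) = y - y'" unfolding y_def by simp
      then show ?thesis using yd by (simp only:)
    qed
    have e2: "P dvd b2 - (z' - 2 * s * y' + s\<^sup>2 * b0)"
    proof -
      have "b2 - (z' - 2 * s * y' + s\<^sup>2 * b0) = (z - z') - (y - y') * (2 * s)"
        unfolding z_def by (simp add: algebra_simps)
      then show ?thesis using dvd_diff[OF zd dvd_mult2[OF yd]] by (simp only:)
    qed
    have e3: "P dvd b3 - (s\<^sup>2 * y' - 2 * s * z')"
    proof -
      have "b3 - (s\<^sup>2 * y' - 2 * s * z') = (b3 - (s\<^sup>2 * y - 2 * s * z)) + (y - y') * s\<^sup>2 - (z - z') * (2 * s)"
        by (simp add: algebra_simps)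
      then show ?thesis
        using dvd_diff[OF dvd_add[OF fac(1)[folded y_def, folded z_def] dvd_mult2[OF yd]] dvd_mult2[OF zd]]
        by (simp only:)
    qed
    have e4: "P dvd b4 - s\<^sup>2 * z'"
    proof -
      have "b4 - s\<^sup>2 * z' = (b4 - s\<^sup>2 * z) + (z - z') * s\<^sup>2" by (simp add: algebra_simps)
      then show ?thesis
        using dvd_add[OF fac(2)[folded y_def, folded z_def] dvd_mult2[OF zd]] by (simp only:)
    qed
    have eqm: "v mod P = b" if "b \<in> Zp" "P dvd b - v" for b v
      using that by (metis mod_eq_dvd_iff mod_pos_pos_trivial atLeastLessThan_iff)
    show "i (j h) = h"
      unfolding jh unfolding i_def hb using eqm[OF b(2) e1] eqm[OF b(3) e2] eqm[OF b(4) e3] eqm[OF b(5) e4] by simp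
    have "b0 * L0 + y' * L1 + z' * L2 - pairing12 h ?f
      = - ((b1 - (y' - 2 * s * b0)) * (3 * a1)) - (b2 - (z' - 2 * s * y' + s\<^sup>2 * b0)) * (2 * a2)
        - (b3 - (s\<^sup>2 * y' - 2 * s * z')) * (3 * a3) - (b4 - s\<^sup>2 * z') * (12 * a4)"
      unfolding L0_def L1_def L2_def hb by (simp add: algebra_simps)
    also have "P dvd \<dots>"
      by (rule dvd_diff[OF dvd_diff[OF dvd_diff[OF dvd_minus_iff[THEN iffD2, OF dvd_mult2[OF e1]]
        dvd_mult2[OF e2]] dvd_mult2[OF e3]] dvd_mult2[OF e4]])
    finally have "[b0 * L0 + y' * L1 + z' * L2 = pairing12 h ?f] (mod P)" by (simp only: cong_iff_dvd_diff)
    from ee_cong[OF this] show "(case j h of (x, y, z) \<Rightarrow> ee (x * L0 + y * L1 + z * L2)) = ee (pairing12 h ?f)"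
      unfolding jh by simp
  next
    fix w assume "w \<in> Zp \<times> Zp \<times> Zp"
    then obtain x y z where w: "w = (x, y, z)" and xyz: "x \<in> Zp" "y \<in> Zp" "z \<in> Zp" by auto
    define b1 where "b1 = (y - 2 * s * x) mod P"
    define b2 where "b2 = (z - 2 * s * y + s\<^sup>2 * x) mod P"
    define b3 where "b3 = (s\<^sup>2 * y - 2 * s * z) mod P"
    define b4 where "b4 = (s\<^sup>2 * z) mod P"
    have d1: "P dvd b1 - (y - 2 * s * x)" unfolding b1_def by (rule mdvd')
    have d2: "P dvd b2 - (z - 2 * s * y + s\<^sup>2 * x)" unfolding b2_def by (rule mdvd')
    have d3: "P dvd b3 - (s\<^sup>2 * y - 2 * s * z)" unfolding b3_def by (rule mdvd')
    have d4: "P dvd b4 - s\<^sup>2 * z" unfolding b4_def by (rule mdvd')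
    have iw: "i w = Quartic x b1 b2 b3 b4" unfolding i_def w b1_def b2_def b3_def b4_def by simp
    have h1: "x * s ^ 4 + b1 * s ^ 3 + b2 * s\<^sup>2 + b3 * s + b4
       = (b1 - (y - 2 * s * x)) * s ^ 3 + (b2 - (z - 2 * s * y + s\<^sup>2 * x)) * s\<^sup>2
         + (b3 - (s\<^sup>2 * y - 2 * s * z)) * s + (b4 - s\<^sup>2 * z)"
      by (simp add: algebra_simps power2_eq_square power3_eq_cube power4_eq_xxxx)
    have h2: "4 * x * s ^ 3 + 3 * b1 * s\<^sup>2 + 2 * b2 * s + b3
       = (b1 - (y - 2 * s * x)) * (3 * s\<^sup>2) + (b2 - (z - 2 * s * y + s\<^sup>2 * x)) * (2 * s)
         + (b3 - (s\<^sup>2 * y - 2 * s * z))"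
      by (simp add: algebra_simps power2_eq_square power3_eq_cube)
    have "double_root x b1 b2 b3 b4 s"
      unfolding double_root_def h1 h2
      by (intro conjI dvd_add dvd_mult2 d1 d2 d3 d4)
    moreover have "Quartic x b1 b2 b3 b4 \<in> quartics_mod p"
      unfolding quartics_mod_def using xyz range b1_def b2_def b3_def b4_def by auto
    ultimately show "i w \<in> ?Vs" unfolding iw by simp
    have eqm: "v mod P = b" if "b \<in> Zp" "P dvd v - b" for b v
      using that by (metis mod_eq_dvd_iff mod_pos_pos_trivial atLeastLessThan_iff)
    have "P dvd b1 + 2 * s * x - y"
      by (rule dvd_by_eq[OF _ d1]) simp
    moreover have "P dvd b2 + 2 * s * (b1 + 2 * s * x) - s\<^sup>2 * x - z"
      by (rule dvd_by_eq[OF _ dvd_add[OF d2 dvd_mult2[OF d1, of "2 * s"]]]) (simp add: algebra_simps power2_eq_square)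
    ultimately show "j (i w) = w" unfolding iw unfolding j_def w using eqm xyz by simp
  qed
  then show ?thesis unfolding triple_add_char_sum .
qed

lemma sum_double_root_at_infinity:
  "(\<Sum>h\<in>{h \<in> quartics_mod p. P dvd coeff0 h \<and> P dvd coeff1 h}. ee (pairing12 h (Quartic a0 a1 a2 a3 a4)))
    = (if P dvd a2 \<and> P dvd a3 \<and> P dvd a4 then of_nat p ^ 3 else 0)"
proof -
  let ?f = "Quartic a0 a1 a2 a3 a4"
  have z: "b = 0 \<longleftrightarrow> P dvd b" if "b \<in> Zp" for b using that by (auto dest: zdvd_imp_le)
  have "(\<Sum>h\<in>{h \<in> quartics_mod p. P dvd coeff0 h \<and> P dvd coeff1 h}. ee (pairing12 h ?f))
     = (\<Sum>(x, y, z)\<in>Zp \<times> Zp \<times> Zp. ee (x * (2 * a2) + y * (3 * a3) + z * (12 * a4)))"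
  proof (rule sum.reindex_bij_witness[of _ "\<lambda>(x, y, z). Quartic 0 0 x y z" "\<lambda>h. (coeff2 h, coeff3 h, coeff4 h)"])
    fix h assume h: "h \<in> {h \<in> quartics_mod p. P dvd coeff0 h \<and> P dvd coeff1 h}"
    obtain b0 b1 b2 b3 b4 where hb: "h = Quartic b0 b1 b2 b3 b4" by (cases h)
    have b: "b0 \<in> Zp" "b1 \<in> Zp" "b2 \<in> Zp" "b3 \<in> Zp" "b4 \<in> Zp"
      using h unfolding hb quartics_mod_def by auto
    have "b0 = 0" "b1 = 0" using h z b unfolding hb by auto
    then show "(case (coeff2 h, coeff3 h, coeff4 h) of (x, y, z) \<Rightarrow> Quartic 0 0 x y z) = h"
      "(coeff2 h, coeff3 h, coeff4 h) \<in> Zp \<times> Zp \<times> Zp"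
      "(case (coeff2 h, coeff3 h, coeff4 h) of (x, y, z) \<Rightarrow> ee (x * (2 * a2) + y * (3 * a3) + z * (12 * a4)))
        = ee (pairing12 h ?f)"
      using b unfolding hb by (simp_all add: mult_ac)
  next
    fix w assume "w \<in> Zp \<times> Zp \<times> Zp"
    then show "(coeff2 (case w of (x, y, z) \<Rightarrow> Quartic 0 0 x y z), coeff3 (case w of (x, y, z) \<Rightarrow> Quartic 0 0 x y z),
         coeff4 (case w of (x, y, z) \<Rightarrow> Quartic 0 0 x y z)) = w"
      "(case w of (x, y, z) \<Rightarrow> Quartic 0 0 x y z) \<in> {h \<in> quartics_mod p. P dvd coeff0 h \<and> P dvd coeff1 h}"
      using p0 unfolding quartics_mod_def by auto
  qed
  also have "\<dots> = (if P dvd a2 \<and> P dvd a3 \<and> P dvd a4 then of_nat p ^ 3 else 0)"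
    unfolding triple_add_char_sum dvd_mult_iff using not_dvd_2 not_dvd_3 not_dvd_smooth(2) by simp
  finally show ?thesis .
qed

text \<open>The number of points \<open>s\<close> of the projective line for which pairing with the form kills all multiples of
\<open>(X - s Y)\<^sup>2\<close>. In characteristic at least five these correspond to the triple roots of the form.\<close>

definition triple_root_count :: "int \<Rightarrow> int \<Rightarrow> int \<Rightarrow> int \<Rightarrow> int \<Rightarrow> nat" where
  "triple_root_count a0 a1 a2 a3 a4 = card {s \<in> Zp. P dvd 12 * a0 - 6 * s * a1 + 2 * s\<^sup>2 * a2 \<and>
      P dvd 3 * a1 - 4 * s * a2 + 3 * s\<^sup>2 * a3 \<and> P dvd 2 * a2 - 6 * s * a3 + 12 * s\<^sup>2 * a4}
    + (if P dvd a2 \<and> P dvd a3 \<and> P dvd a4 then 1 else 0)"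

lemma sum_nroots:
  "(\<Sum>h\<in>quartics_mod p. of_int (nroots h) * ee (pairing12 h (Quartic a0 a1 a2 a3 a4)))
    = of_nat p ^ 3 * of_nat (triple_root_count a0 a1 a2 a3 a4)"
proof -
  let ?f = "Quartic a0 a1 a2 a3 a4"
  let ?dr = "\<lambda>h s. double_root (coeff0 h) (coeff1 h) (coeff2 h) (coeff3 h) (coeff4 h) s"
  let ?inf = "\<lambda>h. P dvd coeff0 h \<and> P dvd coeff1 h"
  let ?e = "\<lambda>h. ee (pairing12 h ?f)"
  have fin: "finite (quartics_mod p)" by (rule finite_quartics_mod)
  have "of_int (nroots h) = ((\<Sum>s\<in>Zp. if ?dr h s then 1 else 0) + (if ?inf h then 1 else 0) :: complex)" for h
    unfolding nroots_def card_as_sum of_int_add of_int_sum by (simp add: if_distrib cong: if_cong)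
  then have "(\<Sum>h\<in>quartics_mod p. of_int (nroots h) * ?e h)
      = (\<Sum>h\<in>quartics_mod p. \<Sum>s\<in>Zp. if ?dr h s then ?e h else 0) + (\<Sum>h\<in>quartics_mod p. if ?inf h then ?e h else 0)"
    by (simp only: ring_distribs sum_distrib_right if_distrib[of "\<lambda>x. x * _"] mult_1 mult_zero_left sum.distrib)
  also have "(\<Sum>h\<in>quartics_mod p. \<Sum>s\<in>Zp. if ?dr h s then ?e h else 0)
      = (\<Sum>s\<in>Zp. \<Sum>h\<in>{h \<in> quartics_mod p. ?dr h s}. ?e h)"
    by (subst sum.swap) (simp only: sum.inter_filter[OF fin])
  also have "(\<Sum>h\<in>quartics_mod p. if ?inf h then ?e h else 0) = (\<Sum>h\<in>{h \<in> quartics_mod p. ?inf h}. ?e h)"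
    by (simp only: sum.inter_filter[OF fin])
  finally show ?thesis
    unfolding sum_double_root_at sum_double_root_at_infinity triple_root_count_def
    by (simp add: sum.If_cases Int_def ring_distribs)
qed

lemma sum_square_reps:
  "(\<Sum>h\<in>quartics_mod p. of_int (\<Sum>w\<in>square_reps h. disc_chi w) * ee (pairing12 h (Quartic a0 a1 a2 a3 a4)))
    = (\<Sum>c\<in>{1..<P}. disc_twisted_sum (c * a0) (c * a1) (c * a2) (c * a3) (c * a4))"
proof -
  let ?f = "Quartic a0 a1 a2 a3 a4"
  let ?e = "\<lambda>h. ee (pairing12 h ?f)"
  have sub: "scaled_square_of ` scaled_quadratics \<subseteq> quartics_mod p"
    unfolding scaled_quadratics_def quartics_mod_def using p0 by auto
  have "(\<Sum>h\<in>quartics_mod p. of_int (\<Sum>w\<in>square_reps h. disc_chi w) * ?e h)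
     = (\<Sum>h\<in>quartics_mod p. \<Sum>w\<in>{w \<in> scaled_quadratics. scaled_square_of w = h}. of_int (disc_chi w) * ?e (scaled_square_of w))"
    unfolding square_reps_def of_int_sum sum_distrib_right by (intro sum.cong refl) auto
  also have "\<dots> = (\<Sum>w\<in>scaled_quadratics. of_int (disc_chi w) * ?e (scaled_square_of w))"
    by (rule sum.group[OF finite_scaled_quadratics finite_quartics_mod sub])
  also have "\<dots> = (\<Sum>w\<in>scaled_quadratics. case w of (c, x, y, z) \<Rightarrow>
      chi (y\<^sup>2 - 4 * x * z) * ee (conic_form (c * a0) (c * a1) (c * a2) (c * a3) (c * a4) x y z))"
  proof (rule sum.cong[OF refl])
    fix w assume "w \<in> scaled_quadratics"
    obtain c x y z where w: "w = (c, x, y, z)" by (cases w)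
    have "[12 * (c * x\<^sup>2 mod P) * a0 + 3 * (2 * c * x * y mod P) * a1 + 2 * (c * (y\<^sup>2 + 2 * x * z) mod P) * a2
       + 3 * (2 * c * y * z mod P) * a3 + 12 * (c * z\<^sup>2 mod P) * a4 =
       12 * (c * x\<^sup>2) * a0 + 3 * (2 * c * x * y) * a1 + 2 * (c * (y\<^sup>2 + 2 * x * z)) * a2
       + 3 * (2 * c * y * z) * a3 + 12 * (c * z\<^sup>2) * a4] (mod P)"
      by (intro cong_add cong_mult cong_refl cong_mod_left[THEN iffD2])
    then have "?e (scaled_square_of w) = ee (12 * (c * x\<^sup>2) * a0 + 3 * (2 * c * x * y) * a1 + 2 * (c * (y\<^sup>2 + 2 * x * z)) * a2
       + 3 * (2 * c * y * z) * a3 + 12 * (c * z\<^sup>2) * a4)"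
      unfolding w scaled_square_of.simps pairing12.simps by (rule ee_cong)
    also have "12 * (c * x\<^sup>2) * a0 + 3 * (2 * c * x * y) * a1 + 2 * (c * (y\<^sup>2 + 2 * x * z)) * a2
       + 3 * (2 * c * y * z) * a3 + 12 * (c * z\<^sup>2) * a4 = conic_form (c * a0) (c * a1) (c * a2) (c * a3) (c * a4) x y z"
      unfolding conic_form_def by (simp add: algebra_simps)
    finally show "of_int (disc_chi w) * ?e (scaled_square_of w) = (case w of (c, x, y, z) \<Rightarrow>
      chi (y\<^sup>2 - 4 * x * z) * ee (conic_form (c * a0) (c * a1) (c * a2) (c * a3) (c * a4) x y z))"
      unfolding w by simp
  qed
  also have "\<dots> = (\<Sum>c\<in>{1..<P}. disc_twisted_sum (c * a0) (c * a1) (c * a2) (c * a3) (c * a4))"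
    unfolding scaled_quadratics_def disc_twisted_sum_def
    by (simp add: sum.cartesian_product case_prod_unfold)
  finally show ?thesis .
qed

text \<open>Fourier transform of \<open>singular_indicator_identity\<close>, term by term.\<close>

lemma singular_sum_formula:
  "of_int (P - 1) * singular_sum p (Quartic a0 a1 a2 a3 a4)
    = of_int (P - 1) * (of_nat p ^ 3 * of_nat (triple_root_count a0 a1 a2 a3 a4) - of_nat p)
      - (\<Sum>c\<in>{1..<P}. disc_twisted_sum (c * a0) (c * a1) (c * a2) (c * a3) (c * a4))"
proof -
  let ?f = "Quartic a0 a1 a2 a3 a4"
  let ?e = "\<lambda>h. ee (pairing12 h ?f)"
  let ?V = "quartics_mod p"
  have key: "of_int (P - 1) * (of_real (Phi p h) * ?e h) = of_int (P - 1) * (of_int (nroots h) * ?e h)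
      - of_int (P - 1) * (if h = 0 then of_nat p else 0)
      - of_int (\<Sum>w\<in>square_reps h. disc_chi w) * ?e h" if h: "h \<in> ?V" for h
  proof -
    have P1: "of_real (Phi p h) = (of_int (if P dvd Disc h then 1 else 0) :: complex)"
      unfolding Phi_def by (simp add: cong_0_iff)
    have e0: "(if h = 0 then of_nat p else 0) = (of_int (if h = 0 then P else 0) :: complex) * ?e h"
      by (simp add: zero_quartic_def)
    have "(P - 1) * (if P dvd Disc h then 1 else 0) = (P - 1) * nroots h
        - (P - 1) * (if h = 0 then P else 0) - (\<Sum>w\<in>square_reps h. disc_chi w)"
      using singular_indicator_identity[OF h] by (simp only: ring_distribs)
    then have "(of_int ((P - 1) * (if P dvd Disc h then 1 else 0)) :: complex)
      = of_int ((P - 1) * nroots h - (P - 1) * (if h = 0 then P else 0) - (\<Sum>w\<in>square_reps h. disc_chi w))"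
      by (simp only:)
    then show ?thesis unfolding P1 e0 of_int_mult of_int_diff
      by (simp only: mult.assoc[symmetric] left_diff_distrib)
  qed
  have "0 \<in> ?V" unfolding quartics_mod_def zero_quartic_def using p0 by simp
  then have z: "(\<Sum>h\<in>?V. if h = 0 then of_nat p else (0 :: complex)) = of_nat p"
    using finite_quartics_mod by simp
  have "of_int (P - 1) * singular_sum p ?f = (\<Sum>h\<in>?V. of_int (P - 1) * (of_real (Phi p h) * ?e h))"
    unfolding singular_sum_def by (rule sum_distrib_left)
  also have "\<dots> = (\<Sum>h\<in>?V. of_int (P - 1) * (of_int (nroots h) * ?e h)
      - of_int (P - 1) * (if h = 0 then of_nat p else 0)
      - of_int (\<Sum>w\<in>square_reps h. disc_chi w) * ?e h)"
    by (rule sum.cong[OF refl key])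
  also have "\<dots> = of_int (P - 1) * (\<Sum>h\<in>?V. of_int (nroots h) * ?e h)
      - of_int (P - 1) * (\<Sum>h\<in>?V. if h = 0 then of_nat p else 0)
      - (\<Sum>h\<in>?V. of_int (\<Sum>w\<in>square_reps h. disc_chi w) * ?e h)"
    by (simp only: sum_subtractf sum_distrib_left)
  finally show ?thesis unfolding sum_nroots z sum_square_reps by (simp only: right_diff_distrib)
qed

end

section \<open>Bounds for prime moduli\<close>

context prime_ge_5
begin

lemma triple_root_count_le: "triple_root_count a0 a1 a2 a3 a4 \<le> p + 1"
proof -
  have c: "card {s \<in> Zp. Q s} \<le> p" for Q
  proof -
    have "card {s \<in> Zp. Q s} \<le> card Zp" by (rule card_mono) auto
    also have "card Zp = p" by simp
    finally show ?thesis .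
  qed
  show ?thesis unfolding triple_root_count_def by (rule add_mono[OF c]) simp
qed

text \<open>Two of the three conditions are quadratic equations for \<open>s\<close>, whose coefficients involve all of
\<open>a0,\<dots>,a4\<close>, so one of them is nontrivial; the point at infinity may be added.\<close>

lemma triple_root_count_le_3:
  assumes "\<not> (P dvd a0 \<and> P dvd a1 \<and> P dvd a2 \<and> P dvd a3 \<and> P dvd a4)"
  shows "triple_root_count a0 a1 a2 a3 a4 \<le> 3"
proof -
  let ?T = "{s \<in> Zp. P dvd 12 * a0 - 6 * s * a1 + 2 * s\<^sup>2 * a2 \<and>
      P dvd 3 * a1 - 4 * s * a2 + 3 * s\<^sup>2 * a3 \<and> P dvd 2 * a2 - 6 * s * a3 + 12 * s\<^sup>2 * a4}"
  have le2: "card ?T \<le> 2" if g: "\<not> [:P:] dvd [:u, v, w:]"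
    and sub: "\<And>s. s \<in> ?T \<Longrightarrow> P dvd u + s * v + s\<^sup>2 * w" for u v w
  proof -
    have "?T \<subseteq> {s \<in> Zp. P dvd poly [:u, v, w:] s}"
      using sub by (auto simp: algebra_simps power2_eq_square)
    then have "card ?T \<le> card {s \<in> Zp. P dvd poly [:u, v, w:] s}"
      by (rule card_mono[rotated]) (rule finite_subset[of _ Zp], auto)
    also have "\<dots> \<le> degree [:u, v, w:]" by (rule card_roots_mod_le[OF prime g])
    also have "\<dots> \<le> 2" by (simp add: degree_pCons_eq_if)
    finally show ?thesis .
  qed
  have nd: "\<not> [:P:] dvd [:u, v, w:]" if "\<not> (P dvd u \<and> P dvd v \<and> P dvd w)" for u v w
  proof
    assume "[:P:] dvd [:u, v, w:]"
    then have "P dvd coeff [:u, v, w:] 0" "P dvd coeff [:u, v, w:] 1" "P dvd coeff [:u, v, w:] 2"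
      unfolding const_dvd_iff by blast+
    then show False using that by (simp add: numeral_2_eq_2)
  qed
  have sm: "\<not> P dvd 12" "\<not> P dvd 6" "\<not> P dvd 2" "\<not> P dvd 3" "\<not> P dvd - 6"
    using not_dvd_smooth not_dvd_2 not_dvd_3 by auto
  consider "\<not> (P dvd 12 * a0 \<and> P dvd - 6 * a1 \<and> P dvd 2 * a2)" | "\<not> (P dvd 2 * a2 \<and> P dvd - 6 * a3 \<and> P dvd 12 * a4)"
    using assms sm unfolding dvd_mult_iff by blast
  then have "card ?T \<le> 2"
  proof cases
    case 1
    show ?thesis by (rule le2[OF nd[OF 1]]) (auto simp: algebra_simps)
  next
    case 2
    show ?thesis by (rule le2[OF nd[OF 2]]) (auto simp: algebra_simps)
  qed
  then have "triple_root_count a0 a1 a2 a3 a4 \<le> 2 + 1"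
    unfolding triple_root_count_def by (rule add_mono) simp
  then show ?thesis by simp
qed

text \<open>The conditions at \<open>s\<close> express \<open>a0\<close>, \<open>a1\<close>, \<open>a2\<close> through \<open>s\<close>, \<open>a3\<close>, \<open>a4\<close>, and both invariants vanish identically
on the family obtained: a form with a triple root has \<open>I = J = 0\<close>.\<close>

lemma triple_root_count_eq_0:
  assumes "\<not> (P dvd quartic_I (Quartic a0 a1 a2 a3 a4) \<and> P dvd quartic_J (Quartic a0 a1 a2 a3 a4))"
  shows "triple_root_count a0 a1 a2 a3 a4 = 0"
proof -
  have inv: "P dvd quartic_I (Quartic a0 a1 a2 a3 a4) \<and> P dvd quartic_J (Quartic a0 a1 a2 a3 a4)"
    if d: "P dvd 12 * a0 - 6 * s * a1 + 2 * s\<^sup>2 * a2" "P dvd 3 * a1 - 4 * s * a2 + 3 * s\<^sup>2 * a3"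
      "P dvd 2 * a2 - 6 * s * a3 + 12 * s\<^sup>2 * a4" for s
  proof -
    define A2 where "A2 = 3 * s * a3 - 6 * s\<^sup>2 * a4"
    define A1 where "A1 = 3 * s\<^sup>2 * a3 - 8 * s ^ 3 * a4"
    define A0 where "A0 = s ^ 3 * a3 - 3 * s ^ 4 * a4"
    have "2 * (a2 - A2) = 2 * a2 - 6 * s * a3 + 12 * s\<^sup>2 * a4" unfolding A2_def by simp
    then have "P dvd 2 * (a2 - A2)" using d(3) by (simp only:)
    then have c2: "P dvd a2 - A2" using not_dvd_2 dvd_mult_iff by blast
    have "3 * (a1 - A1) = (3 * a1 - 4 * s * a2 + 3 * s\<^sup>2 * a3) + (a2 - A2) * (4 * s)"
      unfolding A1_def A2_def by (simp add: algebra_simps power2_eq_square power3_eq_cube)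
    then have "P dvd 3 * (a1 - A1)" using dvd_add[OF d(2) dvd_mult2[OF c2]] by (simp only:)
    then have c1: "P dvd a1 - A1" using not_dvd_3 dvd_mult_iff by blast
    have "12 * (a0 - A0) = (12 * a0 - 6 * s * a1 + 2 * s\<^sup>2 * a2) + (a1 - A1) * (6 * s) - (a2 - A2) * (2 * s\<^sup>2)"
      unfolding A0_def A1_def A2_def by (simp add: algebra_simps power2_eq_square power3_eq_cube power4_eq_xxxx)
    then have "P dvd 12 * (a0 - A0)" using dvd_diff[OF dvd_add[OF d(1) dvd_mult2[OF c1]] dvd_mult2[OF c2]] by (simp only:)
    then have c0: "P dvd a0 - A0" using not_dvd_smooth dvd_mult_iff by blast
    have c: "[a0 = A0] (mod P)" "[a1 = A1] (mod P)" "[a2 = A2] (mod P)" using c0 c1 c2 by (simp_all add: cong_iff_dvd_diff)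
    have "[quartic_I (Quartic a0 a1 a2 a3 a4) = quartic_I (Quartic A0 A1 A2 a3 a4)] (mod P)"
      unfolding quartic_I.simps by (intro cong_add cong_diff cong_mult cong_pow cong_refl c)
    moreover have "quartic_I (Quartic A0 A1 A2 a3 a4) = 0"
      unfolding A0_def A1_def A2_def by (simp add: algebra_simps power2_eq_square power3_eq_cube power4_eq_xxxx)
    moreover have "[quartic_J (Quartic a0 a1 a2 a3 a4) = quartic_J (Quartic A0 A1 A2 a3 a4)] (mod P)"
      unfolding quartic_J.simps by (intro cong_add cong_diff cong_mult cong_pow cong_refl c)
    moreover have "quartic_J (Quartic A0 A1 A2 a3 a4) = 0"
      unfolding A0_def A1_def A2_def by (simp add: algebra_simps power2_eq_square power3_eq_cube power4_eq_xxxx)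
    ultimately show ?thesis by (simp only: cong_0_iff)
  qed
  have inf: "P dvd quartic_I (Quartic a0 a1 a2 a3 a4) \<and> P dvd quartic_J (Quartic a0 a1 a2 a3 a4)"
    if "P dvd a2" "P dvd a3" "P dvd a4"
    using that by (auto simp: power2_eq_square power3_eq_cube intro!: dvd_add dvd_diff)
  have "{s \<in> Zp. P dvd 12 * a0 - 6 * s * a1 + 2 * s\<^sup>2 * a2 \<and>
      P dvd 3 * a1 - 4 * s * a2 + 3 * s\<^sup>2 * a3 \<and> P dvd 2 * a2 - 6 * s * a3 + 12 * s\<^sup>2 * a4} = {}"
    using inv assms by blast
  moreover have "\<not> (P dvd a2 \<and> P dvd a3 \<and> P dvd a4)" using inf assms by blast
  ultimately show ?thesis unfolding triple_root_count_def by (simp only: card.empty if_False)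
qed

lemma norm_disc_twisted_sum_le: "cmod (disc_twisted_sum a0 a1 a2 a3 a4) \<le> real p ^ 3"
proof -
  have "cmod (disc_twisted_sum a0 a1 a2 a3 a4) \<le> real p * (real p * (real p * 1))"
    unfolding disc_twisted_sum_def
    by (intro norm_sum_Zp_le) (simp only: norm_mult norm_add_char mult_1_right norm_chi_le)
  then show ?thesis by (simp add: power3_eq_cube)
qed

lemma quadratic_zeros_le:
  assumes "\<not> P dvd a" shows "(\<Sum>x\<in>Zp. if P dvd a * x\<^sup>2 + b * x + c then 1 else 0) \<le> (2 :: real)"
proof -
  have "\<not> [:P:] dvd [:c, b, a:]"
  proof
    assume "[:P:] dvd [:c, b, a:]"
    then have "P dvd coeff [:c, b, a:] 2" unfolding const_dvd_iff by blast
    then show False using assms by (simp add: numeral_2_eq_2)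
  qed
  then have "card {x \<in> Zp. P dvd poly [:c, b, a:] x} \<le> degree [:c, b, a:]" by (rule card_roots_mod_le[OF prime])
  also have "\<dots> \<le> 2" by (simp add: degree_pCons_eq_if)
  finally have "card {x \<in> Zp. P dvd poly [:c, b, a:] x} \<le> 2" .
  moreover have "(\<Sum>x\<in>Zp. if P dvd a * x\<^sup>2 + b * x + c then 1 else 0) = real (card {x \<in> Zp. P dvd poly [:c, b, a:] x})"
    by (simp add: sum.If_cases Int_def algebra_simps power2_eq_square)
  ultimately show ?thesis by linarith
qed

lemma linear_zeros_le:
  assumes "\<not> P dvd a" shows "(\<Sum>x\<in>Zp. if P dvd a * x + c then 1 else 0) \<le> (1 :: real)"
proof -
  have "\<not> [:P:] dvd [:c, a:]"
  proof
    assume "[:P:] dvd [:c, a:]"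
    then have "P dvd coeff [:c, a:] 1" unfolding const_dvd_iff by blast
    then show False using assms by simp
  qed
  then have "card {x \<in> Zp. P dvd poly [:c, a:] x} \<le> degree [:c, a:]" by (rule card_roots_mod_le[OF prime])
  also have "\<dots> \<le> 1" by (simp add: degree_pCons_eq_if)
  finally have "card {x \<in> Zp. P dvd poly [:c, a:] x} \<le> 1" .
  moreover have "(\<Sum>x\<in>Zp. if P dvd a * x + c then 1 else 0) = real (card {x \<in> Zp. P dvd poly [:c, a:] x})"
    by (simp add: sum.If_cases Int_def algebra_simps)
  ultimately show ?thesis by linarith
qed

lemma sum_Zp_le:
  fixes F :: "int \<Rightarrow> real" and K :: real
  assumes "\<And>x. x \<in> Zp \<Longrightarrow> F x \<le> K" shows "(\<Sum>x\<in>Zp. F x) \<le> p * K"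
  using sum_bounded_above[of Zp F K] assms by simp

lemma zeros_of_product_le:
  assumes "\<not> P dvd a"
  shows "(\<Sum>y\<in>Zp. \<Sum>z\<in>Zp. \<Sum>x\<in>Zp. if P dvd 6 * y * (a * x + b * z) then 1 else 0) \<le> 2 * (real p)\<^sup>2"
proof -
  have inner: "(\<Sum>x\<in>Zp. if P dvd 6 * y * (a * x + b * z) then 1 else 0) \<le> 1 + (if y = 0 then real p else 0)"
    if y: "y \<in> Zp" for y z
  proof (cases "y = 0")
    case True
    then show ?thesis by simp
  next
    case False
    then have "\<not> P dvd y" using y by (auto dest: zdvd_imp_le)
    then have "\<not> P dvd 6 * y" using not_dvd_smooth dvd_mult_iff by blast
    then have e: "P dvd 6 * y * (a * x + b * z) \<longleftrightarrow> P dvd a * x + b * z" for x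
      using dvd_mult_iff by blast
    show ?thesis unfolding e using linear_zeros_le[OF assms, of "b * z"] False
      by (simp only: if_False add_0_right)
  qed
  have "(\<Sum>y\<in>Zp. \<Sum>z\<in>Zp. \<Sum>x\<in>Zp. if P dvd 6 * y * (a * x + b * z) then 1 else 0)
      \<le> (\<Sum>y\<in>Zp. \<Sum>z\<in>Zp. 1 + (if y = 0 then real p else 0))"
    by (rule sum_mono, rule sum_mono, rule inner)
  also have "\<dots> = (\<Sum>y\<in>Zp. real p + (if y = 0 then (real p)\<^sup>2 else 0))"
    by (rule sum.cong[OF refl]) (simp add: power2_eq_square algebra_simps)
  also have "\<dots> = 2 * (real p)\<^sup>2"
    unfolding sum.distrib using p0 by (simp add: power2_eq_square)
  finally show ?thesis .
qed

lemma conic_zeros_le: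
  assumes "\<not> (P dvd a0 \<and> P dvd a1 \<and> P dvd a2 \<and> P dvd a3 \<and> P dvd a4)"
  shows "(\<Sum>x\<in>Zp. \<Sum>y\<in>Zp. \<Sum>z\<in>Zp. if P dvd conic_form a0 a1 a2 a3 a4 x y z then 1 else 0) \<le> 2 * (real p)\<^sup>2"
proof -
  let ?Z = "\<lambda>x y z. if P dvd conic_form a0 a1 a2 a3 a4 x y z then 1 else (0 :: real)"
  have pp: "real p * (real p * 2) = 2 * (real p)\<^sup>2" by (simp add: power2_eq_square)
  have yzx: "(\<Sum>x\<in>Zp. \<Sum>y\<in>Zp. \<Sum>z\<in>Zp. ?Z x y z) = (\<Sum>y\<in>Zp. \<Sum>z\<in>Zp. \<Sum>x\<in>Zp. ?Z x y z)"
  proof -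
    have "(\<Sum>x\<in>Zp. \<Sum>y\<in>Zp. \<Sum>z\<in>Zp. ?Z x y z) = (\<Sum>y\<in>Zp. \<Sum>x\<in>Zp. \<Sum>z\<in>Zp. ?Z x y z)" by (rule sum.swap)
    also have "\<dots> = (\<Sum>y\<in>Zp. \<Sum>z\<in>Zp. \<Sum>x\<in>Zp. ?Z x y z)" by (rule sum.cong[OF refl], rule sum.swap)
    finally show ?thesis .
  qed
  have xzy: "(\<Sum>x\<in>Zp. \<Sum>y\<in>Zp. \<Sum>z\<in>Zp. ?Z x y z) = (\<Sum>x\<in>Zp. \<Sum>z\<in>Zp. \<Sum>y\<in>Zp. ?Z x y z)"
    by (rule sum.cong[OF refl], rule sum.swap)
  have yxz: "(\<Sum>x\<in>Zp. \<Sum>y\<in>Zp. \<Sum>z\<in>Zp. ?Z x y z) = (\<Sum>y\<in>Zp. \<Sum>x\<in>Zp. \<Sum>z\<in>Zp. ?Z x y z)"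
    by (rule sum.swap)
  consider "\<not> P dvd a0" | "\<not> P dvd a4" | "\<not> P dvd a2" | "P dvd a0" "P dvd a2" "P dvd a4" "\<not> P dvd a1"
    | "P dvd a0" "P dvd a2" "P dvd a4" "\<not> P dvd a3" using assms by blast
  then show ?thesis
  proof cases
    case 1
    have e: "conic_form a0 a1 a2 a3 a4 x y z = (12 * a0) * x\<^sup>2 + (6 * a1 * y + 4 * a2 * z) * x
        + (2 * a2 * y\<^sup>2 + 6 * a3 * y * z + 12 * a4 * z\<^sup>2)" for x y z
      unfolding conic_form_def by (simp add: algebra_simps)
    have n: "\<not> P dvd 12 * a0" using 1 not_dvd_smooth dvd_mult_iff by blast
    show ?thesis unfolding yzx unfolding pp[symmetric] e by (rule sum_Zp_le, rule sum_Zp_le, rule quadratic_zeros_le[OF n])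
  next
    case 2
    have e: "conic_form a0 a1 a2 a3 a4 x y z = (12 * a4) * z\<^sup>2 + (6 * a3 * y + 4 * a2 * x) * z
        + (2 * a2 * y\<^sup>2 + 6 * a1 * x * y + 12 * a0 * x\<^sup>2)" for x y z
      unfolding conic_form_def by (simp add: algebra_simps)
    have n: "\<not> P dvd 12 * a4" using 2 not_dvd_smooth dvd_mult_iff by blast
    show ?thesis unfolding pp[symmetric] e by (rule sum_Zp_le, rule sum_Zp_le, rule quadratic_zeros_le[OF n])
  next
    case 3
    have e: "conic_form a0 a1 a2 a3 a4 x y z = (2 * a2) * y\<^sup>2 + (6 * a1 * x + 6 * a3 * z) * y
        + (4 * a2 * x * z + 12 * a0 * x\<^sup>2 + 12 * a4 * z\<^sup>2)" for x y z
      unfolding conic_form_def by (simp add: algebra_simps)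
    have n: "\<not> P dvd 2 * a2" using 3 not_dvd_2 dvd_mult_iff by blast
    show ?thesis unfolding xzy unfolding pp[symmetric] e by (rule sum_Zp_le, rule sum_Zp_le, rule quadratic_zeros_le[OF n])
  next
    case 4
    have e: "P dvd conic_form a0 a1 a2 a3 a4 x y z \<longleftrightarrow> P dvd 6 * y * (a1 * x + a3 * z)" for x y z
    proof -
      have "conic_form a0 a1 a2 a3 a4 x y z - 6 * y * (a1 * x + a3 * z)
          = a0 * (12 * x\<^sup>2) + a2 * (2 * (y\<^sup>2 + 2 * x * z)) + a4 * (12 * z\<^sup>2)"
        unfolding conic_form_def by (simp add: algebra_simps)
      then have "P dvd conic_form a0 a1 a2 a3 a4 x y z - 6 * y * (a1 * x + a3 * z)"
        using dvd_add[OF dvd_add[OF dvd_mult2[OF 4(1)] dvd_mult2[OF 4(2)]] dvd_mult2[OF 4(3)]] by (simp only:)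
      then show ?thesis by (metis cong_dvd_iff cong_iff_dvd_diff)
    qed
    show ?thesis unfolding yzx unfolding e by (rule zeros_of_product_le[OF 4(4)])
  next
    case 5
    have e: "P dvd conic_form a0 a1 a2 a3 a4 x y z \<longleftrightarrow> P dvd 6 * y * (a3 * z + a1 * x)" for x y z
    proof -
      have "conic_form a0 a1 a2 a3 a4 x y z - 6 * y * (a3 * z + a1 * x)
          = a0 * (12 * x\<^sup>2) + a2 * (2 * (y\<^sup>2 + 2 * x * z)) + a4 * (12 * z\<^sup>2)"
        unfolding conic_form_def by (simp add: algebra_simps)
      then have "P dvd conic_form a0 a1 a2 a3 a4 x y z - 6 * y * (a3 * z + a1 * x)"
        using dvd_add[OF dvd_add[OF dvd_mult2[OF 5(1)] dvd_mult2[OF 5(2)]] dvd_mult2[OF 5(3)]] by (simp only:)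
      then show ?thesis by (metis cong_dvd_iff cong_iff_dvd_diff)
    qed
    show ?thesis unfolding yxz unfolding e by (rule zeros_of_product_le[OF 5(4)])
  qed
qed

text \<open>Summing over \<open>c\<close> first detects the zeros of \<open>conic_form\<close>, a set of size \<open>O(p\<^sup>2)\<close>. This saves a factor \<open>p\<close> over
the trivial bound with only the assumption that the form is not zero modulo \<open>p\<close>.\<close>

lemma sum_over_scalings_bound:
  assumes "\<not> (P dvd a0 \<and> P dvd a1 \<and> P dvd a2 \<and> P dvd a3 \<and> P dvd a4)"
  shows "cmod (\<Sum>c\<in>{1..<P}. disc_twisted_sum (c * a0) (c * a1) (c * a2) (c * a3) (c * a4)) \<le> 3 * real p ^ 3"
proof -
  let ?C = "conic_form a0 a1 a2 a3 a4"
  let ?chi = "\<lambda>x y z. chi (y\<^sup>2 - 4 * x * z)"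
  have Z: "Zp = insert 0 {1..<P}" using p0 by auto
  have scale: "conic_form (c * a0) (c * a1) (c * a2) (c * a3) (c * a4) x y z = ?C x y z * c" for c x y z
    unfolding conic_form_def by (simp add: algebra_simps)
  have csum: "(\<Sum>c\<in>{1..<P}. ee (t * c)) = (if P dvd t then of_nat p else 0) - 1" for t
    using sum_add_char[OF p0, of t] unfolding Z by (simp add: algebra_simps)
  have "(\<Sum>c\<in>{1..<P}. disc_twisted_sum (c * a0) (c * a1) (c * a2) (c * a3) (c * a4))
     = (\<Sum>c\<in>{1..<P}. \<Sum>x\<in>Zp. \<Sum>y\<in>Zp. \<Sum>z\<in>Zp. ?chi x y z * ee (?C x y z * c))"
    unfolding disc_twisted_sum_def scale ..
  also have "\<dots> = (\<Sum>x\<in>Zp. \<Sum>c\<in>{1..<P}. \<Sum>y\<in>Zp. \<Sum>z\<in>Zp. ?chi x y z * ee (?C x y z * c))"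
    by (rule sum.swap)
  also have "\<dots> = (\<Sum>x\<in>Zp. \<Sum>y\<in>Zp. \<Sum>c\<in>{1..<P}. \<Sum>z\<in>Zp. ?chi x y z * ee (?C x y z * c))"
    by (rule sum.cong[OF refl], rule sum.swap)
  also have "\<dots> = (\<Sum>x\<in>Zp. \<Sum>y\<in>Zp. \<Sum>z\<in>Zp. \<Sum>c\<in>{1..<P}. ?chi x y z * ee (?C x y z * c))"
    by (rule sum.cong[OF refl], rule sum.cong[OF refl], rule sum.swap)
  also have "\<dots> = (\<Sum>x\<in>Zp. \<Sum>y\<in>Zp. \<Sum>z\<in>Zp. ?chi x y z * ((if P dvd ?C x y z then of_nat p else 0) - 1))"
    unfolding sum_distrib_left[symmetric] csum ..
  finally have E: "(\<Sum>c\<in>{1..<P}. disc_twisted_sum (c * a0) (c * a1) (c * a2) (c * a3) (c * a4))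
     = (\<Sum>x\<in>Zp. \<Sum>y\<in>Zp. \<Sum>z\<in>Zp. ?chi x y z * ((if P dvd ?C x y z then of_nat p else 0) - 1))" .
  have "cmod (\<Sum>x\<in>Zp. \<Sum>y\<in>Zp. \<Sum>z\<in>Zp. ?chi x y z * ((if P dvd ?C x y z then of_nat p else 0) - 1)) \<le> (\<Sum>x\<in>Zp. \<Sum>y\<in>Zp. \<Sum>z\<in>Zp. 1 + real p * (if P dvd ?C x y z then 1 else 0))"
  proof (rule sum_norm_le, rule sum_norm_le, rule sum_norm_le)
    fix x y z
    have A: "cmod ((if D then of_nat p else 0) - 1) \<le> 1 + real p * (if D then 1 else 0)" for D
      using norm_triangle_ineq4[of "of_nat p" "1 :: complex"] by (cases D) simp_all
    have "cmod (?chi x y z) * cmod ((if P dvd ?C x y z then of_nat p else 0) - 1)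
        \<le> 1 * (1 + real p * (if P dvd ?C x y z then 1 else 0))"
      by (rule mult_mono[OF norm_chi_le A]) simp_all
    then show "cmod (?chi x y z * ((if P dvd ?C x y z then of_nat p else 0) - 1))
        \<le> 1 + real p * (if P dvd ?C x y z then 1 else 0)"
      unfolding norm_mult mult_1 .
  qed
  also have "\<dots> = real p ^ 3 + real p * (\<Sum>x\<in>Zp. \<Sum>y\<in>Zp. \<Sum>z\<in>Zp. if P dvd ?C x y z then 1 else 0)"
    unfolding sum.distrib sum_distrib_left[symmetric] by (simp add: power3_eq_cube)
  also have "\<dots> \<le> real p ^ 3 + real p * (2 * (real p)\<^sup>2)"
    using conic_zeros_le[OF assms] by (intro add_left_mono mult_left_mono) auto
  also have "\<dots> = 3 * real p ^ 3" by (simp add: power2_eq_square power3_eq_cube)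
  finally show ?thesis unfolding E .
qed

lemma singular_sum_le_of_scalings:
  assumes "cmod (\<Sum>c\<in>{1..<P}. disc_twisted_sum (c * a0) (c * a1) (c * a2) (c * a3) (c * a4)) \<le> (real p - 1) * K"
    and "triple_root_count a0 a1 a2 a3 a4 \<le> N"
  shows "cmod (singular_sum p (Quartic a0 a1 a2 a3 a4)) \<le> real p ^ 3 * real N + p + K"
proof -
  have p1: "real p - 1 > 0" using gt2 by simp
  have c1: "cmod (of_int (P - 1)) = real p - 1"
  proof -
    have "(of_int (P - 1) :: complex) = of_real (real p - 1)" by simp
    then show ?thesis using p1 by (simp only: norm_of_real abs_of_pos)
  qed
  let ?n = "triple_root_count a0 a1 a2 a3 a4"
  have "cmod (of_int (P - 1) * singular_sum p (Quartic a0 a1 a2 a3 a4))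
     \<le> cmod (of_int (P - 1) * (of_nat p ^ 3 * of_nat ?n - of_nat p))
       + cmod (\<Sum>c\<in>{1..<P}. disc_twisted_sum (c * a0) (c * a1) (c * a2) (c * a3) (c * a4))"
    unfolding singular_sum_formula by (rule norm_triangle_ineq4)
  then have "(real p - 1) * cmod (singular_sum p (Quartic a0 a1 a2 a3 a4))
     \<le> cmod (of_int (P - 1) * (of_nat p ^ 3 * of_nat ?n - of_nat p)) + (real p - 1) * K"
    using assms(1) unfolding norm_mult[of _ "singular_sum _ _"] c1 by linarith
  also have "cmod (of_int (P - 1) * (of_nat p ^ 3 * of_nat ?n - of_nat p)) \<le> (real p - 1) * (real p ^ 3 * real N + p)"
  proof -
    have "cmod (of_nat p ^ 3 * of_nat ?n - of_nat p) \<le> real p ^ 3 * real ?n + p"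
      using norm_triangle_ineq4[of "of_nat p ^ 3 * of_nat ?n :: complex" "of_nat p"]
      by (simp add: norm_mult norm_power)
    also have "\<dots> \<le> real p ^ 3 * real N + p" using assms(2) by (intro add_right_mono mult_left_mono) auto
    finally show ?thesis unfolding norm_mult c1 using p1 by (intro mult_left_mono) auto
  qed
  finally have "(real p - 1) * cmod (singular_sum p (Quartic a0 a1 a2 a3 a4))
      \<le> (real p - 1) * (real p ^ 3 * real N + p + K)" by (simp add: algebra_simps)
  then show ?thesis using p1 by simp
qed

lemma norm_sum_scalings_le:
  assumes "\<And>c. \<not> P dvd c \<Longrightarrow> cmod (disc_twisted_sum (c * a0) (c * a1) (c * a2) (c * a3) (c * a4)) \<le> K"
  shows "cmod (\<Sum>c\<in>{1..<P}. disc_twisted_sum (c * a0) (c * a1) (c * a2) (c * a3) (c * a4)) \<le> (real p - 1) * K"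
proof -
  have "cmod (\<Sum>c\<in>{1..<P}. disc_twisted_sum (c * a0) (c * a1) (c * a2) (c * a3) (c * a4))
      \<le> of_nat (card {1..<P}) * K"
    by (rule sum_norm_bound) (rule assms, rule not_dvd_nonzero_residue)
  then show ?thesis using p0 by (simp add: of_nat_diff)
qed

text \<open>Four regimes: every point may be a triple root of the form; at most three
are; none is and the average over scalings is used for the twisted sums; square-root cancellation
in the twisted sums.\<close>

lemma singular_sum_prime_bounds:
  fixes a0 a1 a2 a3 a4 :: int
  defines "f \<equiv> Quartic a0 a1 a2 a3 a4"
  shows "cmod (singular_sum p f) \<le> 35 * real p ^ 4"
    and "\<not> (P dvd a0 \<and> P dvd a1 \<and> P dvd a2 \<and> P dvd a3 \<and> P dvd a4) \<Longrightarrow> cmod (singular_sum p f) \<le> 35 * real p ^ 3"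
    and "\<not> (P dvd quartic_I f \<and> P dvd quartic_J f) \<Longrightarrow> cmod (singular_sum p f) \<le> 35 * (real p)\<^sup>2"
    and "\<not> P dvd a4 * quartic_J f * Disc f \<Longrightarrow> cmod (singular_sum p f) \<le> 35 * (p * sqrt p)"
proof -
  have p3: "real p > 2" using gt2 by simp
  have p1: "real p \<ge> 1" using p3 by linarith
  have p2: "real p \<le> 2 * (real p - 1)" using p3 unfolding right_diff_distrib by simp
  have pw: "real p ^ m \<le> real p ^ n" if "m \<le> n" for m n using that p1 by (rule power_increasing)
  have lin: "real p \<le> real p ^ n" if "n \<ge> 1" for n
    using pw[OF that] by (simp only: power_one_right)
  have triv: "cmod (\<Sum>c\<in>{1..<P}. disc_twisted_sum (c * a0) (c * a1) (c * a2) (c * a3) (c * a4)) \<le> (real p - 1) * real p ^ 3"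
    by (rule norm_sum_scalings_le) (rule norm_disc_twisted_sum_le)
  have "cmod (singular_sum p f) \<le> real p ^ 3 * real (p + 1) + p + real p ^ 3"
    unfolding f_def by (rule singular_sum_le_of_scalings[OF triv triple_root_count_le])
  also have "real p ^ 3 * real (p + 1) = real p ^ 4 + real p ^ 3" by (simp add: algebra_simps power4_eq_xxxx power3_eq_cube)
  finally show "cmod (singular_sum p f) \<le> 35 * real p ^ 4" using pw[of 3 4] lin[of 4] zero_le_power[of "real p" 4] by linarith
  show "cmod (singular_sum p f) \<le> 35 * real p ^ 3"
    if nz: "\<not> (P dvd a0 \<and> P dvd a1 \<and> P dvd a2 \<and> P dvd a3 \<and> P dvd a4)"
  proof -
    have "cmod (singular_sum p f) \<le> real p ^ 3 * real 3 + p + real p ^ 3"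
      unfolding f_def by (rule singular_sum_le_of_scalings[OF triv triple_root_count_le_3[OF nz]])
    then show ?thesis using lin[of 3] zero_le_power[of "real p" 3] unfolding of_nat_numeral by linarith
  qed
  show "cmod (singular_sum p f) \<le> 35 * (real p)\<^sup>2" if IJ: "\<not> (P dvd quartic_I f \<and> P dvd quartic_J f)"
  proof -
    have nz: "\<not> (P dvd a0 \<and> P dvd a1 \<and> P dvd a2 \<and> P dvd a3 \<and> P dvd a4)"
    proof
      assume d: "P dvd a0 \<and> P dvd a1 \<and> P dvd a2 \<and> P dvd a3 \<and> P dvd a4"
      then have "P dvd quartic_I f \<and> P dvd quartic_J f"
        unfolding f_def by (auto simp: power2_eq_square power3_eq_cube intro!: dvd_add dvd_diff)
      then show False using IJ by blast
    qed
    have "3 * real p ^ 3 = real p * (3 * (real p)\<^sup>2)" by (simp add: power2_eq_square power3_eq_cube)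
    also have "\<dots> \<le> (2 * (real p - 1)) * (3 * (real p)\<^sup>2)" using p2 by (rule mult_right_mono) simp
    also have "\<dots> = (real p - 1) * (6 * (real p)\<^sup>2)" by simp
    finally have "cmod (\<Sum>c\<in>{1..<P}. disc_twisted_sum (c * a0) (c * a1) (c * a2) (c * a3) (c * a4)) \<le> (real p - 1) * (6 * (real p)\<^sup>2)"
      using sum_over_scalings_bound[OF nz] by linarith
    then have "cmod (singular_sum p f) \<le> real p ^ 3 * real 0 + p + 6 * (real p)\<^sup>2"
      unfolding f_def by (rule singular_sum_le_of_scalings) (simp only: triple_root_count_eq_0[OF IJ[unfolded f_def]])
    then show ?thesis using lin[of 2] zero_le_power[of "real p" 2] unfolding of_nat_0 mult_zero_right by linarith
  qed
  show "cmod (singular_sum p f) \<le> 35 * (p * sqrt p)" if K: "\<not> P dvd a4 * quartic_J f * Disc f"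
  proof -
    have K': "\<not> P dvd a4" "\<not> P dvd quartic_J f" "\<not> P dvd Disc f" using K dvd_mult_iff by blast+
    have "cmod (\<Sum>c\<in>{1..<P}. disc_twisted_sum (c * a0) (c * a1) (c * a2) (c * a3) (c * a4)) \<le> (real p - 1) * (34 * (p * sqrt p))"
    proof (rule norm_sum_scalings_le)
      fix c assume c: "\<not> P dvd c"
      show "cmod (disc_twisted_sum (c * a0) (c * a1) (c * a2) (c * a3) (c * a4)) \<le> 34 * (p * sqrt p)"
      proof (rule disc_twisted_sum_bound[OF ge5])
        show "\<not> P dvd c * a4" using c K' dvd_mult_iff by blast
        show "\<not> P dvd quartic_J (Quartic (c * a0) (c * a1) (c * a2) (c * a3) (c * a4))"
          unfolding quartic_scale using c K'(2) dvd_mult_iff dvd_power_iff'[of 3] unfolding f_def by (metis zero_less_numeral)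
        show "\<not> P dvd Disc (Quartic (c * a0) (c * a1) (c * a2) (c * a3) (c * a4))"
          unfolding Disc_scale using c K'(3) dvd_mult_iff dvd_power_iff'[of 6] unfolding f_def by (metis zero_less_numeral)
      qed
    qed
    then have "cmod (singular_sum p f) \<le> real p ^ 3 * real 0 + p + 34 * (p * sqrt p)"
      unfolding f_def
      by (rule singular_sum_le_of_scalings) (use triple_root_count_eq_0 K'(2)[unfolded f_def] in auto)
    moreover have "real p * 1 \<le> real p * sqrt p" using p1 by (intro mult_left_mono) auto
    ultimately show ?thesis unfolding of_nat_0 mult_zero_right by linarith
  qed
qed

end

section \<open>Squarefree moduli\<close>

definition quartic_content :: "int quartic \<Rightarrow> int" where
  "quartic_content f = gcd (coeff0 f) (gcd (coeff1 f) (gcd (coeff2 f) (gcd (coeff3 f) (coeff4 f))))"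

definition quartic_IJ :: "int quartic \<Rightarrow> int" where
  "quartic_IJ f = gcd (quartic_I f) (quartic_J f)"

definition quartic_K :: "int quartic \<Rightarrow> int" where
  "quartic_K f = coeff4 f * quartic_J f * Disc f"

text \<open>The loss against the generic bound \<open>q powr (3/2)\<close>. A prime divisor \<open>p\<close> of \<open>q\<close> contributes \<open>p powr (1/2)\<close> if it divides
\<open>quartic_K f\<close>, \<open>p powr (3/2)\<close> if it divides both invariants, and \<open>p powr (5/2)\<close> if it divides all coefficients,
and each condition implies the previous ones.\<close>

definition weight :: "nat \<Rightarrow> int quartic \<Rightarrow> real" where
  "weight q f = of_int (gcd (int q) (quartic_content f)) * of_int (gcd (int q) (quartic_IJ f))
     * sqrt (of_int (gcd (int q) (quartic_K f)))"

lemma quartic_content_dvd_iff: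
  "c dvd quartic_content (Quartic a0 a1 a2 a3 a4) \<longleftrightarrow> c dvd a0 \<and> c dvd a1 \<and> c dvd a2 \<and> c dvd a3 \<and> c dvd a4"
  unfolding quartic_content_def by auto

lemma quartic_IJ_dvd_iff: "c dvd quartic_IJ f \<longleftrightarrow> c dvd quartic_I f \<and> c dvd quartic_J f"
  unfolding quartic_IJ_def by simp

lemma quartic_IJ_dvd_K: "quartic_IJ f dvd quartic_K f"
  unfolding quartic_IJ_def quartic_K_def by (simp add: dvd_mult dvd_mult2)

lemma content_dvd_IJ: "quartic_content f dvd quartic_IJ f"
proof (cases f)
  case (Quartic a0 a1 a2 a3 a4)
  let ?c = "quartic_content f"
  have d: "?c dvd a0" "?c dvd a1" "?c dvd a2" "?c dvd a3" "?c dvd a4"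
    using quartic_content_dvd_iff[of ?c a0 a1 a2 a3 a4] unfolding Quartic by auto
  show ?thesis
    unfolding quartic_IJ_dvd_iff Quartic
    using d[unfolded Quartic] by (auto simp: power2_eq_square power3_eq_cube intro!: dvd_add dvd_diff)
qed

lemma (in prime_ge_5) gcd_prime: "gcd P x = (if P dvd x then P else 1)"
proof (cases "P dvd x")
  case True
  then show ?thesis using p0 by simp
next
  case False
  then have "coprime P x" using primeP by (rule prime_imp_coprime[rotated])
  then show ?thesis using False by simp
qed

lemma (in prime_ge_5) singular_sum_prime_weight:
  "cmod (singular_sum p f) \<le> 35 * (p * sqrt p) * weight p f"
proof -
  obtain a0 a1 a2 a3 a4 where f: "f = Quartic a0 a1 a2 a3 a4" by (cases f)
  note b = singular_sum_prime_bounds[where ?a0.0 = a0 and ?a1.0 = a1 and ?a2.0 = a2 and ?a3.0 = a3 and ?a4.0 = a4,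
    folded f]
  have c: "P dvd quartic_content f \<longleftrightarrow> P dvd a0 \<and> P dvd a1 \<and> P dvd a2 \<and> P dvd a3 \<and> P dvd a4"
    unfolding f by (rule quartic_content_dvd_iff)
  have K: "quartic_K f = a4 * quartic_J f * Disc f" unfolding quartic_K_def f by simp
  have cIJ: "P dvd quartic_content f \<Longrightarrow> P dvd quartic_IJ f" using content_dvd_IJ dvd_trans by blast
  have IJK: "P dvd quartic_IJ f \<Longrightarrow> P dvd quartic_K f" using quartic_IJ_dvd_K dvd_trans by blast
  have s: "sqrt p * sqrt p = real p" by simp
  consider "P dvd quartic_content f" | "\<not> P dvd quartic_content f" "P dvd quartic_IJ f"
    | "\<not> P dvd quartic_content f" "\<not> P dvd quartic_IJ f" "P dvd quartic_K f"
    | "\<not> P dvd quartic_content f" "\<not> P dvd quartic_IJ f" "\<not> P dvd quartic_K f" by blast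
  then show ?thesis
  proof cases
    case 1
    then have w: "weight p f = p * p * sqrt p"
      unfolding weight_def gcd_prime using cIJ IJK by simp
    have "35 * (p * sqrt p) * weight p f = 35 * (p * p * p * (sqrt p * sqrt p))" unfolding w by simp
    also have "\<dots> = 35 * real p ^ 4" unfolding s by (simp add: power4_eq_xxxx)
    finally show ?thesis using b(1) by simp
  next
    case 2
    then have w: "weight p f = p * sqrt p" unfolding weight_def gcd_prime using IJK by simp
    have "35 * (p * sqrt p) * weight p f = 35 * (p * p * (sqrt p * sqrt p))" unfolding w by simp
    also have "\<dots> = 35 * real p ^ 3" unfolding s by (simp add: power3_eq_cube)
    finally show ?thesis using b(2) 2(1) c by simp
  next
    case 3
    then have w: "weight p f = sqrt p" unfolding weight_def gcd_prime by simp
    have "35 * (p * sqrt p) * weight p f = 35 * (p * (sqrt p * sqrt p))" unfolding w by simp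
    also have "\<dots> = 35 * (real p)\<^sup>2" unfolding s by (simp add: power2_eq_square)
    finally show ?thesis using b(3) 3(2) unfolding quartic_IJ_dvd_iff by simp
  next
    case 4
    then have w: "weight p f = 1" unfolding weight_def gcd_prime by simp
    have "cmod (singular_sum p f) \<le> 35 * (p * sqrt p)" by (rule b(4)) (rule 4(3)[unfolded K])
    then show ?thesis unfolding w by simp
  qed
qed

lemma gcd_mult_le:
  fixes x :: int
  assumes "coprime m n" "m > 0" "n > 0"
  shows "real_of_int (gcd (int m) x) * real_of_int (gcd (int n) x) \<le> real_of_int (gcd (int (m * n)) x)"
proof -
  have "coprime (int m) (int n)" using assms(1) by simp
  then have "coprime (gcd (int m) x) (gcd (int n) x)"
    by (meson coprime_divisors gcd_dvd1)
  then have "gcd (int m) x * gcd (int n) x dvd gcd (int (m * n)) x"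
    by (intro divides_mult gcd_greatest) auto
  then have "gcd (int m) x * gcd (int n) x \<le> gcd (int (m * n)) x"
    using assms by (intro zdvd_imp_le) auto
  then show ?thesis by (metis of_int_le_iff of_int_mult)
qed

lemma weight_nonneg: "weight q f \<ge> 0"
  unfolding weight_def by simp

lemma weight_mult_le:
  assumes "coprime m n" "m > 0" "n > 0"
  shows "weight m f * weight n f \<le> weight (m * n) f"
proof -
  let ?g = "\<lambda>k x. real_of_int (gcd (int k) x)"
  have "weight m f * weight n f = (?g m (quartic_content f) * ?g n (quartic_content f)) *
      (?g m (quartic_IJ f) * ?g n (quartic_IJ f)) * sqrt (?g m (quartic_K f) * ?g n (quartic_K f))"
    unfolding weight_def by (simp add: real_sqrt_mult)
  also have "\<dots> \<le> weight (m * n) f"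
    unfolding weight_def
    by (intro mult_mono real_sqrt_le_mono gcd_mult_le assms) auto
  finally show ?thesis .
qed

lemma add_char_factor: "m > 0 \<Longrightarrow> n > 0 \<Longrightarrow> add_char (m * n) (int n * x) = add_char m x"
  unfolding add_char_def by (simp add: field_simps)

lemma card_quartics_mod: "card (quartics_mod q) = q ^ 5"
proof -
  let ?Z = "{0..<int q}"
  have "bij_betw (\<lambda>(a, b, c, d, e). Quartic a b c d e) (?Z \<times> ?Z \<times> ?Z \<times> ?Z \<times> ?Z) (quartics_mod q)"
    by (rule bij_betw_byWitness[of _ "\<lambda>f. (coeff0 f, coeff1 f, coeff2 f, coeff3 f, coeff4 f)"])
       (auto simp: quartics_mod_def quartic.set_sel)
  from bij_betw_same_card[OF this] show ?thesis
    by (simp add: card_cartesian_product numeral_eq_Suc)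
qed

text \<open>By the Chinese remainder theorem the forms modulo \<open>m * n\<close> are \<open>n * h + m * k\<close> with \<open>h\<close> modulo \<open>m\<close> and \<open>k\<close> modulo \<open>n\<close>. The
character factors accordingly, and the discriminant, being homogeneous, vanishes modulo \<open>m\<close> exactly when that of
\<open>h\<close> does.\<close>

lemma singular_sum_mult:
  assumes cop: "coprime m n" and m: "m > 0" and n: "n > 0"
  shows "singular_sum (m * n) f = singular_sum m f * singular_sum n f"
proof -
  define c where "c x y = (int n * x + int m * y) mod (int m * int n)" for x y
  define C where "C = (\<lambda>(h, k). Quartic (c (coeff0 h) (coeff0 k)) (c (coeff1 h) (coeff1 k))
      (c (coeff2 h) (coeff2 k)) (c (coeff3 h) (coeff3 k)) (c (coeff4 h) (coeff4 k)))"
  have cop': "coprime (int m) (int n)" "coprime (int n) (int m)" using cop by (simp_all add: coprime_commute)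
  have mn: "int m * int n > 0" using m n by simp
  have cm: "[c x y = int n * x] (mod int m)" for x y
  proof -
    have "[c x y = int n * x + int m * y] (mod (int m * int n))" unfolding c_def by simp
    then have "[c x y = int n * x + int m * y] (mod int m)" by (rule cong_modulus_mult)
    moreover have "[int n * x + int m * y = int n * x] (mod int m)" by (simp add: cong_iff_dvd_diff)
    ultimately show ?thesis by (rule cong_trans)
  qed
  have cn: "[c x y = int m * y] (mod int n)" for x y
  proof -
    have "[c x y = int n * x + int m * y] (mod (int n * int m))" unfolding c_def by (simp add: mult.commute)
    then have "[c x y = int n * x + int m * y] (mod int n)" by (rule cong_modulus_mult)
    moreover have "[int n * x + int m * y = int m * y] (mod int n)" by (simp add: cong_iff_dvd_diff)
    ultimately show ?thesis by (rule cong_trans)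
  qed
  have cinj: "x = x' \<and> y = y'" if "c x y = c x' y'" "x \<in> {0..<int m}" "x' \<in> {0..<int m}" "y \<in> {0..<int n}" "y' \<in> {0..<int n}"
    for x y x' y'
  proof -
    have "[int n * x = int n * x'] (mod int m)" using cm[of x y] cm[of x' y'] that(1) by (metis cong_sym cong_trans)
    then have "[x = x'] (mod int m)" using cong_mult_lcancel[OF cop'(2)] by blast
    moreover have "[int m * y = int m * y'] (mod int n)" using cn[of x y] cn[of x' y'] that(1) by (metis cong_sym cong_trans)
    then have "[y = y'] (mod int n)" using cong_mult_lcancel[OF cop'(1)] by blast
    ultimately show ?thesis using that by (simp add: cong_def)
  qed
  let ?D = "quartics_mod m \<times> quartics_mod n"
  have inj: "inj_on C ?D"
  proof (rule inj_onI)
    fix u v assume uv: "u \<in> ?D" "v \<in> ?D" "C u = C v"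
    obtain a0 a1 a2 a3 a4 b0 b1 b2 b3 b4 where u: "u = (Quartic a0 a1 a2 a3 a4, Quartic b0 b1 b2 b3 b4)"
      by (metis prod.exhaust quartic.exhaust)
    obtain a0' a1' a2' a3' a4' b0' b1' b2' b3' b4' where v: "v = (Quartic a0' a1' a2' a3' a4', Quartic b0' b1' b2' b3' b4')"
      by (metis prod.exhaust quartic.exhaust)
    have e: "c a0 b0 = c a0' b0'" "c a1 b1 = c a1' b1'" "c a2 b2 = c a2' b2'" "c a3 b3 = c a3' b3'" "c a4 b4 = c a4' b4'"
      using uv(3) unfolding u v C_def by simp_all
    have r: "a0 \<in> {0..<int m}" "a1 \<in> {0..<int m}" "a2 \<in> {0..<int m}" "a3 \<in> {0..<int m}" "a4 \<in> {0..<int m}"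
      "b0 \<in> {0..<int n}" "b1 \<in> {0..<int n}" "b2 \<in> {0..<int n}" "b3 \<in> {0..<int n}" "b4 \<in> {0..<int n}"
      using uv(1) unfolding u quartics_mod_def by auto
    have r': "a0' \<in> {0..<int m}" "a1' \<in> {0..<int m}" "a2' \<in> {0..<int m}" "a3' \<in> {0..<int m}" "a4' \<in> {0..<int m}"
      "b0' \<in> {0..<int n}" "b1' \<in> {0..<int n}" "b2' \<in> {0..<int n}" "b3' \<in> {0..<int n}" "b4' \<in> {0..<int n}"
      using uv(2) unfolding v quartics_mod_def by auto
    show "u = v" unfolding u v
      using cinj[OF e(1) r(1) r'(1) r(6) r'(6)] cinj[OF e(2) r(2) r'(2) r(7) r'(7)] cinj[OF e(3) r(3) r'(3) r(8) r'(8)]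
        cinj[OF e(4) r(4) r'(4) r(9) r'(9)] cinj[OF e(5) r(5) r'(5) r(10) r'(10)] by simp
  qed
  have crange: "c x y \<in> {0..<int (m * n)}" for x y unfolding c_def using mn by simp
  have sub: "C ` ?D \<subseteq> quartics_mod (m * n)"
    unfolding C_def quartics_mod_def using crange by auto
  have "card (C ` ?D) = card (quartics_mod (m * n))"
    unfolding card_image[OF inj] by (simp add: card_cartesian_product card_quartics_mod power_mult_distrib)
  then have img: "C ` ?D = quartics_mod (m * n)" by (intro card_subset_eq finite_quartics_mod sub)
  have summand: "of_real (Phi (m * n) (C (h, k))) * add_char (m * n) (pairing12 (C (h, k)) f)
      = (of_real (Phi m h) * add_char m (pairing12 h f)) * (of_real (Phi n k) * add_char n (pairing12 k f))" for h k
  proof -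
    obtain a0 a1 a2 a3 a4 where h: "h = Quartic a0 a1 a2 a3 a4" by (cases h)
    obtain b0 b1 b2 b3 b4 where k: "k = Quartic b0 b1 b2 b3 b4" by (cases k)
    obtain f0 f1 f2 f3 f4 where f: "f = Quartic f0 f1 f2 f3 f4" by (cases f)
    have Chk: "C (h, k) = Quartic (c a0 b0) (c a1 b1) (c a2 b2) (c a3 b3) (c a4 b4)"
      unfolding C_def h k by simp
    have Dm: "[Disc (C (h, k)) = int n ^ 6 * Disc h] (mod int m)"
      unfolding Chk unfolding h Disc_scale[symmetric] by (rule Disc_cong) (simp add: cm)
    have Dn: "[Disc (C (h, k)) = int m ^ 6 * Disc k] (mod int n)"
      unfolding Chk unfolding k Disc_scale[symmetric] by (rule Disc_cong) (simp add: cn)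
    have 1: "int m dvd Disc (C (h, k)) \<longleftrightarrow> int m dvd Disc h"
      unfolding cong_dvd_iff[OF Dm] using cop'(1) by (simp add: coprime_dvd_mult_right_iff)
    have 2: "int n dvd Disc (C (h, k)) \<longleftrightarrow> int n dvd Disc k"
      unfolding cong_dvd_iff[OF Dn] using cop'(2) by (simp add: coprime_dvd_mult_right_iff)
    have "int (m * n) dvd Disc (C (h, k)) \<longleftrightarrow> int m dvd Disc (C (h, k)) \<and> int n dvd Disc (C (h, k))"
    proof
      assume "int (m * n) dvd Disc (C (h, k))"
      then show "int m dvd Disc (C (h, k)) \<and> int n dvd Disc (C (h, k))"
        unfolding of_nat_mult using dvd_mult_left dvd_mult_right by blast
    next
      assume "int m dvd Disc (C (h, k)) \<and> int n dvd Disc (C (h, k))"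
      then show "int (m * n) dvd Disc (C (h, k))"
        unfolding of_nat_mult using divides_mult[OF _ _ cop'(1)] by blast
    qed
    then have Ph: "Phi (m * n) (C (h, k)) = Phi m h * Phi n k"
      unfolding Phi_def cong_0_iff 1 2 by simp
    have "[pairing12 (C (h, k)) f = 12 * (int n * a0 + int m * b0) * f0 + 3 * (int n * a1 + int m * b1) * f1
       + 2 * (int n * a2 + int m * b2) * f2 + 3 * (int n * a3 + int m * b3) * f3 + 12 * (int n * a4 + int m * b4) * f4] (mod int (m * n))"
      unfolding Chk unfolding f pairing12.simps c_def of_nat_mult
      by (intro cong_add cong_mult cong_refl cong_mod_left[THEN iffD2])
    also have "12 * (int n * a0 + int m * b0) * f0 + 3 * (int n * a1 + int m * b1) * f1
       + 2 * (int n * a2 + int m * b2) * f2 + 3 * (int n * a3 + int m * b3) * f3 + 12 * (int n * a4 + int m * b4) * f4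
       = int n * pairing12 h f + int m * pairing12 k f"
      unfolding h k f by (simp add: algebra_simps)
    finally have "add_char (m * n) (pairing12 (C (h, k)) f) = add_char (m * n) (int n * pairing12 h f + int m * pairing12 k f)"
      using m n by (intro add_char_cong) auto
    also have "\<dots> = add_char m (pairing12 h f) * add_char n (pairing12 k f)"
      unfolding add_char_add add_char_factor[OF m n]
      using add_char_factor[OF n m, of "pairing12 k f"] unfolding mult.commute[of n m] by (simp only:)
    finally show ?thesis unfolding Ph by simp
  qed
  have "singular_sum (m * n) f = (\<Sum>w\<in>?D. of_real (Phi (m * n) (C w)) * add_char (m * n) (pairing12 (C w) f))"
    unfolding singular_sum_def img[symmetric] sum.reindex[OF inj] by (simp add: comp_def)
  also have "\<dots> = (\<Sum>(h, k)\<in>?D. (of_real (Phi m h) * add_char m (pairing12 h f)) * (of_real (Phi n k) * add_char n (pairing12 k f)))"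
    by (rule sum.cong[OF refl]) (simp only: split_paired_all prod.case summand)
  also have "\<dots> = singular_sum m f * singular_sum n f"
    unfolding singular_sum_def sum_product sum.cartesian_product ..
  finally show ?thesis .
qed

lemma singular_sum_1: "singular_sum 1 f = 1"
proof -
  have "quartics_mod 1 = {Quartic 0 0 0 0 0}"
  proof
    show "quartics_mod 1 \<subseteq> {Quartic 0 0 0 0 0}"
    proof
      fix h assume "h \<in> quartics_mod 1"
      then show "h \<in> {Quartic 0 0 0 0 0}" by (cases h) (auto simp: quartics_mod_def)
    qed
  qed (simp add: quartics_mod_def)
  then have "singular_sum 1 f = of_real (Phi 1 (Quartic 0 0 0 0 0)) * add_char 1 (pairing12 (Quartic 0 0 0 0 0) f)"
    unfolding singular_sum_def by (simp only:) simp
  moreover have "pairing12 (Quartic 0 0 0 0 0) f = 0" by (cases f) simp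
  ultimately show ?thesis by (simp add: Phi_def)
qed

lemma singular_sum_squarefree_bound:
  assumes "squarefree q" "coprime q 6"
  shows "cmod (singular_sum q f) \<le> 35 ^ card (prime_factors q) * (q * sqrt q) * weight q f"
  using assms
proof (induction q rule: less_induct)
  case (less q)
  have q0: "q > 0" using less.prems(1) by (auto intro: Nat.gr0I)
  show ?case
  proof (cases "q = 1")
    case True
    then show ?thesis by (simp add: singular_sum_1 weight_def del: One_nat_def)
  next
    case False
    then obtain p where p: "prime p" "p dvd q" using prime_factor_nat by blast
    then obtain m where m: "q = p * m" by (elim dvdE)
    have m0: "m > 0" and p0: "p > 0" using q0 m by auto
    have pm: "coprime p m"
    proof (rule ccontr)
      assume "\<not> coprime p m"
      then have "p dvd m" using p(1) prime_imp_coprime by blast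
      then have "p\<^sup>2 dvd q" unfolding m power2_eq_square by (rule mult_dvd_mono[OF dvd_refl])
      then have "p dvd 1" using less.prems(1) squarefreeD by blast
      then show False using p(1) by simp
    qed
    have sm: "squarefree m" using less.prems(1) squarefree_mono m by (metis dvd_triv_right)
    have cm: "coprime m 6" "coprime p 6" using less.prems(2) unfolding m by simp_all
    have "m < q" using m m0 p(1) prime_gt_1_nat by auto
    from less.IH[OF this sm cm(1)]
    have IH: "cmod (singular_sum m f) \<le> 35 ^ card (prime_factors m) * (m * sqrt m) * weight m f" .
    have p6: "\<not> p dvd 6" using cm(2) p(1) by (meson coprime_common_divisor dvd_refl not_prime_unit)
    have "p \<noteq> 2" using p6 by auto
    moreover have "p \<noteq> 3" using p6 by auto
    moreover have "p \<noteq> 4" using primes_dvd_imp_eq[OF two_is_prime_nat p(1)] by auto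
    moreover have "p \<ge> 2" using p(1) prime_ge_2_nat by blast
    ultimately have "p \<ge> 5" by linarith
    then interpret prime_ge_5 p by unfold_locales (use p(1) in auto)
    have pf: "prime_factors q = insert p (prime_factors m)"
      unfolding m using p(1) m0 p0 by (simp add: prime_factors_product prime_prime_factors)
    have "p \<notin> prime_factors m" using pm p(1) by (metis coprime_common_divisor dvd_refl in_prime_factors_iff not_prime_unit)
    then have card: "card (prime_factors q) = Suc (card (prime_factors m))" unfolding pf by simp
    have "cmod (singular_sum q f) = cmod (singular_sum p f) * cmod (singular_sum m f)"
      unfolding m singular_sum_mult[OF pm p0 m0] by (rule norm_mult)
    also have "\<dots> \<le> (35 * (p * sqrt p) * weight p f) * (35 ^ card (prime_factors m) * (m * sqrt m) * weight m f)"
      by (intro mult_mono singular_sum_prime_weight IH) (auto intro!: mult_nonneg_nonneg weight_nonneg)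
    also have "\<dots> = 35 ^ card (prime_factors q) * (q * sqrt q) * (weight p f * weight m f)"
      unfolding m card[unfolded m] by (simp add: real_sqrt_mult)
    also have "\<dots> \<le> 35 ^ card (prime_factors q) * (q * sqrt q) * weight q f"
      unfolding m by (intro mult_left_mono weight_mult_le pm p0 m0) auto
    finally show ?thesis .
  qed
qed

text \<open>The substitution of \<open>12 * h\<close> for \<open>h\<close> permutes the forms modulo \<open>q\<close>, preserves singularity and clears the
denominators 4 and 6 of the pairing.\<close>

lemma Phi_hat_coprime_eq:
  assumes q: "q > 0" "coprime q 6"
  shows "Phi_hat_coprime q f = singular_sum q f / of_nat q ^ 5"
proof -
  let ?q = "int q" and ?Z = "{0..<int q}"
  define t where "t = map_quartic (\<lambda>a. (12 * a) mod ?q)"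
  have q6: "coprime 6 ?q" using q(2) by (metis coprime_commute coprime_int_iff of_nat_numeral)
  have q2: "coprime 2 ?q" by (rule coprime_divisors[OF _ dvd_refl q6]) simp
  have q4: "coprime 4 ?q" using q2 coprime_mult_left_iff[of 2 2 ?q] by simp
  have q12: "coprime 12 ?q" using q2 q6 coprime_mult_left_iff[of 2 6 ?q] by simp
  have i4: "[4 * modular_inverse ?q 4 = 1] (mod ?q)" by (rule cong_modular_inverse1[OF q4])
  have i6: "[6 * modular_inverse ?q 6 = 1] (mod ?q)" by (rule cong_modular_inverse1[OF q6])
  have range: "u mod ?q \<in> ?Z" for u using q by auto
  have inj: "inj_on t (quartics_mod q)"
  proof (rule inj_onI)
    fix h k assume hk: "h \<in> quartics_mod q" "k \<in> quartics_mod q" "t h = t k"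
    have e: "a = b" if "(12 * a) mod ?q = (12 * b) mod ?q" "a \<in> ?Z" "b \<in> ?Z" for a b
      using that cong_mult_lcancel[OF q12, of a b] unfolding cong_def by simp
    show "h = k" using hk unfolding t_def quartics_mod_def by (cases h; cases k) (auto intro!: e)
  qed
  have "t ` quartics_mod q \<subseteq> quartics_mod q"
    unfolding t_def quartics_mod_def using range by (auto simp: quartic.set_map)
  then have img: "t ` quartics_mod q = quartics_mod q"
    by (intro endo_inj_surj finite_quartics_mod inj)
  have summand: "of_real (Phi q (t h)) * exp (2 * of_real pi * \<i> * of_int (pairing_mod q (t h) f) / of_nat q)
      = of_real (Phi q h) * add_char q (pairing12 h f)" for h
  proof -
    obtain a0 a1 a2 a3 a4 where h: "h = Quartic a0 a1 a2 a3 a4" by (cases h)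
    obtain f0 f1 f2 f3 f4 where f: "f = Quartic f0 f1 f2 f3 f4" by (cases f)
    have D: "[Disc (t h) = 12 ^ 6 * Disc h] (mod ?q)"
      unfolding h Disc_scale[symmetric] by (rule Disc_cong) (simp add: t_def)
    have "coprime ?q 12" using q12 by (simp only: coprime_commute)
    then have "coprime ?q (12 ^ 6)" by (rule coprime_power_right_iff[THEN iffD2, OF disjI1])
    then have "?q dvd Disc (t h) \<longleftrightarrow> ?q dvd Disc h"
      unfolding cong_dvd_iff[OF D] by (rule coprime_dvd_mult_right_iff)
    then have Ph: "Phi q (t h) = Phi q h" unfolding Phi_def cong_0_iff by simp
    let ?i4 = "modular_inverse ?q 4" and ?i6 = "modular_inverse ?q 6"
    have "[pairing_mod q (t h) f = (12 * a0) * f0 + (12 * a1) * f1 * ?i4 + (12 * a2) * f2 * ?i6 + (12 * a3) * f3 * ?i4 + (12 * a4) * f4] (mod ?q)"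
      unfolding t_def h f quartic.map pairing_mod.simps
      by (intro cong_mod_left[THEN iffD2] cong_add cong_mult cong_refl)
    also have "(12 * a0) * f0 + (12 * a1) * f1 * ?i4 + (12 * a2) * f2 * ?i6 + (12 * a3) * f3 * ?i4 + (12 * a4) * f4
       = 12 * a0 * f0 + (3 * a1 * f1) * (4 * ?i4) + (2 * a2 * f2) * (6 * ?i6) + (3 * a3 * f3) * (4 * ?i4) + 12 * a4 * f4"
      by simp
    also have "[\<dots> = 12 * a0 * f0 + (3 * a1 * f1) * 1 + (2 * a2 * f2) * 1 + (3 * a3 * f3) * 1 + 12 * a4 * f4] (mod ?q)"
      by (intro cong_add cong_mult cong_refl i4 i6)
    finally have "[pairing_mod q (t h) f = pairing12 h f] (mod ?q)" unfolding h f by simp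
    from add_char_cong[OF q(1) this] show ?thesis unfolding Ph add_char_def by simp
  qed
  have "(\<Sum>h\<in>quartics_mod q. of_real (Phi q h) * exp (2 * of_real pi * \<i> * of_int (pairing_mod q h f) / of_nat q))
      = (\<Sum>h\<in>t ` quartics_mod q. of_real (Phi q h) * exp (2 * of_real pi * \<i> * of_int (pairing_mod q h f) / of_nat q))"
    unfolding img ..
  also have "\<dots> = singular_sum q f"
    unfolding sum.reindex[OF inj] comp_def summand singular_sum_def ..
  finally show ?thesis unfolding Phi_hat_coprime_def by simp
qed

section \<open>The divisor bound\<close>

definition divisor_count :: "nat \<Rightarrow> nat" where
  "divisor_count n = card {d. d dvd n}"

lemma finite_divisors: "n > 0 \<Longrightarrow> finite {d :: nat. d dvd n}"
  by simp

lemma divisor_count_mult_le: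
  assumes "a > 0" "b > 0"
  shows "divisor_count (a * b) \<le> divisor_count a * divisor_count b"
proof -
  have "{d. d dvd a * b} \<subseteq> (\<lambda>(x, y). x * y) ` ({x. x dvd a} \<times> {y. y dvd b})"
  proof
    fix d assume "d \<in> {d. d dvd a * b}"
    then obtain b' c' where "d = b' * c'" "b' dvd a" "c' dvd b" using division_decomp[of d a b] by auto
    then show "d \<in> (\<lambda>(x, y). x * y) ` ({x. x dvd a} \<times> {y. y dvd b})" by auto
  qed
  then have "divisor_count (a * b) \<le> card ({x. x dvd a} \<times> {y. y dvd b})"
    unfolding divisor_count_def using assms by (intro surj_card_le) auto
  then show ?thesis unfolding divisor_count_def by (simp add: card_cartesian_product)
qed

lemma divisor_count_prime_power_le:
  assumes "prime p" shows "divisor_count (p ^ e) \<le> e + 1"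
proof -
  have "{d. d dvd p ^ e} \<subseteq> (\<lambda>i. p ^ i) ` {..e}"
    using divides_primepow_nat[OF assms] by auto
  then have "divisor_count (p ^ e) \<le> card {..e}"
    unfolding divisor_count_def by (rule surj_card_le[rotated]) simp
  then show ?thesis by simp
qed

text \<open>Multiplicativity: a prime power \<open>p ^ e\<close> contributes at most \<open>K * (e + 1)\<close> on the left. This is at most \<open>p ^ e powr \<epsilon>\<close> for
large \<open>p\<close>, and each of the finitely many small primes costs at most one factor \<open>M\<close>.\<close>

lemma divisor_count_aux:
  fixes K M \<epsilon> :: real
  assumes small: "\<And>p e. prime p \<Longrightarrow> K * real (e + 1) \<le> M * real (p ^ e) powr \<epsilon>"
    and large: "\<And>p e. prime p \<Longrightarrow> p \<ge> P0 \<Longrightarrow> e \<ge> 1 \<Longrightarrow> K * real (e + 1) \<le> real (p ^ e) powr \<epsilon>"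
    and K: "K \<ge> 1" and M: "M \<ge> 1" and n: "n > 0"
  shows "K ^ card (prime_factors n) * real (divisor_count n)
    \<le> M ^ card {p \<in> prime_factors n. p < P0} * real n powr \<epsilon>"
  using n
proof (induction n rule: less_induct)
  case (less n)
  show ?case
  proof (cases "n = 1")
    case True
    have "{d. d dvd (1::nat)} = {1}" by auto
    then show ?thesis unfolding True divisor_count_def by simp
  next
    case False
    then obtain p where p: "prime p" "p dvd n" using prime_factor_nat by blast
    define e where "e = multiplicity p n"
    obtain m where m: "n = p ^ e * m" "\<not> p dvd m"
      using multiplicity_decompose'[of n p] less.prems p(1) unfolding e_def by (metis not_prime_unit less_numeral_extra(3))
    have e1: "e \<ge> 1" using m p(2) by (cases e) auto
    have m0: "m > 0" using less.prems m by (auto intro: Nat.gr0I)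
    have pe: "p ^ e > 0" using p(1) prime_gt_0_nat by simp
    have pe1: "p ^ e > 1" using one_less_power[OF prime_gt_1_nat[OF p(1)], of e] e1 by simp
    have "m < n" unfolding m(1) using m0 pe1 by simp
    note IH = less.IH[OF this m0]
    have pf: "prime_factors n = insert p (prime_factors m)"
      unfolding m(1) using p(1) m0 e1 pe by (simp add: prime_factors_product prime_factors_power prime_prime_factors)
    have np: "p \<notin> prime_factors m" using m(2) by auto
    have c: "card (prime_factors n) = Suc (card (prime_factors m))" unfolding pf using np by simp
    have "real (divisor_count n) \<le> real ((e + 1) * divisor_count m)"
      using divisor_count_mult_le[OF pe m0] mult_le_mono1[OF divisor_count_prime_power_le[OF p(1), of e], of "divisor_count m"]
      unfolding m(1) by (simp only: of_nat_le_iff)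
    then have "K ^ card (prime_factors n) * real (divisor_count n)
        \<le> K ^ card (prime_factors n) * real ((e + 1) * divisor_count m)"
      using K by (intro mult_left_mono) auto
    also have "\<dots> = (K * real (e + 1)) * (K ^ card (prime_factors m) * real (divisor_count m))"
      unfolding c by (simp only: power_Suc of_nat_mult mult_ac)
    also have "\<dots> \<le> (K * real (e + 1)) * (M ^ card {p \<in> prime_factors m. p < P0} * real m powr \<epsilon>)"
      using K by (intro mult_left_mono IH) auto
    also have "\<dots> \<le> M ^ card {p \<in> prime_factors n. p < P0} * real n powr \<epsilon>"
    proof -
      have nm: "real n powr \<epsilon> = real (p ^ e) powr \<epsilon> * real m powr \<epsilon>"
        unfolding m(1) of_nat_mult by (rule powr_mult)
      show ?thesis
      proof (cases "p < P0")
        case True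
        then have "{q \<in> prime_factors n. q < P0} = insert p {q \<in> prime_factors m. q < P0}" unfolding pf by auto
        then have c2: "card {q \<in> prime_factors n. q < P0} = Suc (card {q \<in> prime_factors m. q < P0})" using np by simp
        have "(K * real (e + 1)) * (M ^ card {p \<in> prime_factors m. p < P0} * real m powr \<epsilon>)
            \<le> (M * real (p ^ e) powr \<epsilon>) * (M ^ card {p \<in> prime_factors m. p < P0} * real m powr \<epsilon>)"
          using M by (intro mult_right_mono small p(1)) auto
        then show ?thesis unfolding c2 nm by (simp add: mult_ac)
      next
        case False
        then have c2: "{q \<in> prime_factors n. q < P0} = {q \<in> prime_factors m. q < P0}" unfolding pf by auto
        have "(K * real (e + 1)) * (M ^ card {p \<in> prime_factors m. p < P0} * real m powr \<epsilon>)
            \<le> real (p ^ e) powr \<epsilon> * (M ^ card {p \<in> prime_factors m. p < P0} * real m powr \<epsilon>)"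
          using M False e1 by (intro mult_right_mono large p(1)) auto
        then show ?thesis unfolding c2 nm by (simp add: mult_ac)
      qed
    qed
    finally show ?thesis .
  qed
qed

text \<open>The factor \<open>K ^ card (prime_factors n)\<close> is included because the bound for \<open>singular_sum\<close> loses a constant at every
prime divisor of the modulus.\<close>

lemma divisor_bound:
  fixes K \<epsilon> :: real
  assumes K: "K \<ge> 1" and e: "\<epsilon> > 0"
  shows "\<exists>B \<ge> 1. \<forall>n > 0. K ^ card (prime_factors n) * real (divisor_count n) \<le> B * real n powr \<epsilon>"
proof -
  define b where "b = (2 :: real) powr \<epsilon>"
  have b1: "b > 1" unfolding b_def using e by simp
  define M where "M = K * (1 + 1 / (b - 1))"
  have "1 * 1 \<le> K * (1 + 1 / (b - 1))" using K b1 by (intro mult_mono) auto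
  then have M1: "M \<ge> 1" unfolding M_def by simp
  define P0 where "P0 = nat \<lceil>(2 * K) powr (1 / \<epsilon>)\<rceil>"
  have powe: "real (p ^ i) powr \<epsilon> = (real p powr \<epsilon>) ^ i" if "prime p" for p i
    using prime_gt_0_nat[OF that] by (simp add: powr_power powr_realpow[symmetric] powr_powr mult.commute)
  have small: "K * real (i + 1) \<le> M * real (p ^ i) powr \<epsilon>" if p: "prime p" for p i
  proof -
    have "b \<le> real p powr \<epsilon>" unfolding b_def using e prime_ge_2_nat[OF p] by (intro powr_mono2) auto
    then have bp: "b ^ i \<le> real (p ^ i) powr \<epsilon>" unfolding powe[OF p] using b1 by (intro power_mono) auto
    have "1 + real i * (b - 1) \<le> (1 + (b - 1)) ^ i" by (rule Bernoulli_inequality) (use b1 in simp)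
    then have ber: "1 + real i * (b - 1) \<le> b ^ i" by simp
    then have "real i * (b - 1) \<le> b ^ i" by linarith
    then have i1: "real i \<le> b ^ i / (b - 1)" using b1 by (simp add: pos_le_divide_eq)
    have "real (i + 1) \<le> b ^ i * (1 + 1 / (b - 1))"
    proof -
      have "b ^ i * (1 + 1 / (b - 1)) = b ^ i + b ^ i / (b - 1)" by (simp add: ring_distribs)
      moreover have "1 \<le> b ^ i" using b1 by (intro one_le_power) simp
      ultimately show ?thesis using i1 by simp
    qed
    then have "K * real (i + 1) \<le> K * (b ^ i * (1 + 1 / (b - 1)))" using K by (intro mult_left_mono) auto
    also have "\<dots> = M * b ^ i" unfolding M_def by simp
    also have "\<dots> \<le> M * real (p ^ i) powr \<epsilon>" using bp M1 by (intro mult_left_mono) auto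
    finally show ?thesis .
  qed
  have large: "K * real (i + 1) \<le> real (p ^ i) powr \<epsilon>" if p: "prime p" "p \<ge> P0" "i \<ge> 1" for p i
  proof -
    have "(2 * K) powr (1 / \<epsilon>) \<le> real p" using p(2) unfolding P0_def by linarith
    then have "((2 * K) powr (1 / \<epsilon>)) powr \<epsilon> \<le> real p powr \<epsilon>" using e by (intro powr_mono2) auto
    then have "2 * K \<le> real p powr \<epsilon>" using e K by (simp add: powr_powr)
    then have "(2 * K) ^ i \<le> real (p ^ i) powr \<epsilon>" unfolding powe[OF p(1)] using K by (intro power_mono) auto
    moreover have "real (i + 1) \<le> 2 ^ i"
    proof -
      have "i + 1 \<le> 2 ^ i" using less_exp[of i] by linarith
      then show ?thesis by (metis of_nat_le_iff of_nat_numeral of_nat_power)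
    qed
    moreover have "K \<le> K ^ i" using K p(3) by (simp add: self_le_power)
    ultimately have "real (i + 1) * K \<le> 2 ^ i * K ^ i" using K by (intro mult_mono) auto
    then show ?thesis using \<open>(2 * K) ^ i \<le> _\<close> by (simp add: power_mult_distrib mult_ac)
  qed
  have "K ^ card (prime_factors n) * real (divisor_count n) \<le> M ^ P0 * real n powr \<epsilon>" if n: "n > 0" for n
  proof -
    have "card {p \<in> prime_factors n. p < P0} \<le> card {..<P0}" by (rule card_mono) auto
    then have "M ^ card {p \<in> prime_factors n. p < P0} \<le> M ^ P0" using M1 by (intro power_increasing) auto
    then have "M ^ card {p \<in> prime_factors n. p < P0} * real n powr \<epsilon> \<le> M ^ P0 * real n powr \<epsilon>"
      by (intro mult_right_mono) auto
    moreover have "K ^ card (prime_factors n) * real (divisor_count n)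
        \<le> M ^ card {p \<in> prime_factors n. p < P0} * real n powr \<epsilon>"
      by (rule divisor_count_aux[OF _ _ K M1 n]) (blast intro: small large)+
    ultimately show ?thesis by (rule order_trans[rotated])
  qed
  moreover have "M ^ P0 \<ge> 1" using M1 by (rule one_le_power)
  ultimately show ?thesis by blast
qed

section \<open>Counting special forms in a box\<close>

definition form_box :: "nat \<Rightarrow> int quartic set" where
  "form_box N = {f. set_quartic f \<subseteq> {- int N..int N}}"

lemma finite_form_box: "finite (form_box N)"
  unfolding form_box_def by (rule finite_quartics_coeffs) simp

lemma form_box_coeffs:
  "Quartic a0 a1 a2 a3 a4 \<in> form_box N \<longleftrightarrow> a0 \<in> {- int N..int N} \<and> a1 \<in> {- int N..int N} \<and>
     a2 \<in> {- int N..int N} \<and> a3 \<in> {- int N..int N} \<and> a4 \<in> {- int N..int N}"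
  unfolding form_box_def by auto

lemma card_le_by_fibres:
  assumes "finite A" "\<And>f. f \<in> S \<Longrightarrow> \<pi> f \<in> A" "\<And>w. w \<in> A \<Longrightarrow> card {f \<in> S. \<pi> f = w} \<le> k"
  shows "card S \<le> k * card A"
proof -
  have "S = (\<Union>w\<in>A. {f \<in> S. \<pi> f = w})" using assms(2) by blast
  then have "card S \<le> (\<Sum>w\<in>A. card {f \<in> S. \<pi> f = w})" using card_UN_le[OF assms(1)] by metis
  also have "\<dots> \<le> (\<Sum>w\<in>A. k)" by (intro sum_mono assms(3))
  finally show ?thesis by (simp add: mult.commute)
qed

lemma card_fibre_roots:
  fixes g :: "int poly" and \<rho> :: "'b \<Rightarrow> int"
  assumes "g \<noteq> 0" "degree g \<le> k" "inj_on \<rho> F" "\<And>f. f \<in> F \<Longrightarrow> poly g (\<rho> f) = 0"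
  shows "card F \<le> k"
proof -
  have "card F = card (\<rho> ` F)" using assms(3) by (simp add: card_image)
  also have "\<dots> \<le> card {x. poly g x = 0}"
    using assms(4) poly_roots_finite[OF assms(1)] by (intro card_mono) auto
  also have "\<dots> \<le> degree g" using assms(1) by (rule card_poly_roots_bound)
  finally show ?thesis using assms(2) by linarith
qed

text \<open>The combination of \<open>quartic_I\<close> and \<open>quartic_J\<close> in which the coefficient \<open>a0\<close> cancels. A common divisor of the
invariants divides it, which bounds the number of such divisors before \<open>a0\<close> is chosen.\<close>

definition elim_R :: "int \<Rightarrow> int \<Rightarrow> int \<Rightarrow> int \<Rightarrow> int" where
  "elim_R a1 a2 a3 a4 = 324 * a4\<^sup>2 * a1\<^sup>2 + (81 * a3 ^ 3 - 324 * a2 * a3 * a4) * a1 + (96 * a2 ^ 3 * a4 - 27 * a2\<^sup>2 * a3\<^sup>2)"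

lemma elim_R_eq:
  "elim_R a1 a2 a3 a4 = 9 * (8 * a2 * a4 - 3 * a3\<^sup>2) * quartic_I (Quartic a0 a1 a2 a3 a4)
     - 12 * a4 * quartic_J (Quartic a0 a1 a2 a3 a4)"
  unfolding elim_R_def by (simp add: algebra_simps power2_eq_square power3_eq_cube)

text \<open>The forms for which one of the integers whose divisors are counted later is zero. They lie on
hypersurfaces and are too few to matter.\<close>

definition thin_forms :: "nat \<Rightarrow> int quartic set" where
  "thin_forms N = {f \<in> form_box N. coeff4 f = 0 \<or> quartic_J f = 0 \<or> Disc f = 0 \<or>
      elim_R (coeff1 f) (coeff2 f) (coeff3 f) (coeff4 f) = 0}"

text \<open>Each condition is a nontrivial polynomial equation of degree at most three for one coefficient when the
others are fixed; for \<open>Disc\<close> and \<open>elim_R\<close> the leading coefficient is a nonzero multiple of a power of \<open>a4\<close>.\<close>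

lemma card_thin_forms: "card (thin_forms N) \<le> 9 * (2 * N + 1) ^ 4"
proof -
  let ?B = "{- int N..int N}"
  let ?A = "?B \<times> ?B \<times> ?B \<times> ?B"
  have cA: "card ?A = (2 * N + 1) ^ 4"
    by (simp add: card_cartesian_product numeral_eq_Suc nat_add_distrib nat_mult_distrib)
  have finA: "finite ?A" by simp
  let ?S0 = "{f \<in> form_box N. coeff4 f = 0}"
  let ?SJ = "{f \<in> form_box N. quartic_J f = 0}"
  let ?SD = "{f \<in> form_box N. coeff4 f \<noteq> 0 \<and> Disc f = 0}"
  let ?SR = "{f \<in> form_box N. coeff4 f \<noteq> 0 \<and> elim_R (coeff1 f) (coeff2 f) (coeff3 f) (coeff4 f) = 0}"
  have S0: "card ?S0 \<le> 1 * card ?A"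
  proof (rule card_le_by_fibres[OF finA, where \<pi> = "\<lambda>f. (coeff0 f, coeff1 f, coeff2 f, coeff3 f)"])
    fix f assume "f \<in> ?S0"
    then show "(coeff0 f, coeff1 f, coeff2 f, coeff3 f) \<in> ?A" by (cases f) (auto simp: form_box_coeffs)
  next
    fix w
    show "card {f \<in> ?S0. (coeff0 f, coeff1 f, coeff2 f, coeff3 f) = w} \<le> 1"
      by (rule card_fibre_roots[of "[:0, 1:]" _ coeff4]) (auto intro!: inj_onI quartic.expand)
  qed
  have SJ: "card ?SJ \<le> 3 * card ?A"
  proof (rule card_le_by_fibres[OF finA, where \<pi> = "\<lambda>f. (coeff0 f, coeff1 f, coeff3 f, coeff4 f)"])
    fix f assume "f \<in> ?SJ"
    then show "(coeff0 f, coeff1 f, coeff3 f, coeff4 f) \<in> ?A" by (cases f) (auto simp: form_box_coeffs)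
  next
    fix w :: "int \<times> int \<times> int \<times> int"
    obtain a0 a1 a3 a4 where w: "w = (a0, a1, a3, a4)" by (cases w)
    let ?g = "[:- 27 * (a0 * a3\<^sup>2 + a1\<^sup>2 * a4), 72 * a0 * a4 + 9 * a1 * a3, 0, - 2:]"
    show "card {f \<in> ?SJ. (coeff0 f, coeff1 f, coeff3 f, coeff4 f) = w} \<le> 3"
    proof (rule card_fibre_roots[of ?g _ coeff2])
      show "inj_on coeff2 {f \<in> ?SJ. (coeff0 f, coeff1 f, coeff3 f, coeff4 f) = w}"
        unfolding w by (auto intro!: inj_onI quartic.expand)
      fix f assume "f \<in> {f \<in> ?SJ. (coeff0 f, coeff1 f, coeff3 f, coeff4 f) = w}"
      then show "poly ?g (coeff2 f) = 0" unfolding w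
        by (cases f) (auto simp: algebra_simps power2_eq_square power3_eq_cube)
    qed auto
  qed
  have SD: "card ?SD \<le> 3 * card ?A"
  proof (rule card_le_by_fibres[OF finA, where \<pi> = "\<lambda>f. (coeff1 f, coeff2 f, coeff3 f, coeff4 f)"])
    fix f assume "f \<in> ?SD"
    then show "(coeff1 f, coeff2 f, coeff3 f, coeff4 f) \<in> ?A" by (cases f) (auto simp: form_box_coeffs)
  next
    fix w :: "int \<times> int \<times> int \<times> int"
    obtain b c d e where w: "w = (b, c, d, e)" by (cases w)
    let ?g = "[:- 27*b^4*e^2 + 18*b^3*c*d*e - 4*b^3*d^3 - 4*b^2*c^3*e + b^2*c^2*d^2,
       144*b^2*c*e^2 - 6*b^2*d^2*e - 80*b*c^2*d*e + 18*b*c*d^3 + 16*c^4*e - 4*c^3*d^2,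
       - 192*b*d*e^2 - 128*c^2*e^2 + 144*c*d^2*e - 27*d^4, 256*e^3:]"
    show "card {f \<in> ?SD. (coeff1 f, coeff2 f, coeff3 f, coeff4 f) = w} \<le> 3"
    proof (cases "e = 0")
      case True
      then have "{f \<in> ?SD. (coeff1 f, coeff2 f, coeff3 f, coeff4 f) = w} = {}" unfolding w by auto
      then show ?thesis by (simp only: card.empty)
    next
      case False
      show ?thesis
      proof (rule card_fibre_roots[of ?g _ coeff0])
        show "?g \<noteq> 0" using False by simp
        show "inj_on coeff0 {f \<in> ?SD. (coeff1 f, coeff2 f, coeff3 f, coeff4 f) = w}"
          unfolding w by (auto intro!: inj_onI quartic.expand)
        fix f assume f: "f \<in> {f \<in> ?SD. (coeff1 f, coeff2 f, coeff3 f, coeff4 f) = w}"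
        obtain a where fa: "f = Quartic a b c d e" using f unfolding w by (cases f) auto
        have "Disc f = 0" using f by blast
        moreover have "poly ?g a = Disc f" unfolding fa Disc_explicit
          by (simp add: algebra_simps power2_eq_square power3_eq_cube)
        ultimately show "poly ?g (coeff0 f) = 0" unfolding fa by simp
      qed simp
    qed
  qed
  have SR: "card ?SR \<le> 2 * card ?A"
  proof (rule card_le_by_fibres[OF finA, where \<pi> = "\<lambda>f. (coeff0 f, coeff2 f, coeff3 f, coeff4 f)"])
    fix f assume "f \<in> ?SR"
    then show "(coeff0 f, coeff2 f, coeff3 f, coeff4 f) \<in> ?A" by (cases f) (auto simp: form_box_coeffs)
  next
    fix w :: "int \<times> int \<times> int \<times> int"
    obtain a0 a2 a3 a4 where w: "w = (a0, a2, a3, a4)" by (cases w)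
    let ?g = "[:96 * a2 ^ 3 * a4 - 27 * a2\<^sup>2 * a3\<^sup>2, 81 * a3 ^ 3 - 324 * a2 * a3 * a4, 324 * a4\<^sup>2:]"
    show "card {f \<in> ?SR. (coeff0 f, coeff2 f, coeff3 f, coeff4 f) = w} \<le> 2"
    proof (cases "a4 = 0")
      case True
      then have "{f \<in> ?SR. (coeff0 f, coeff2 f, coeff3 f, coeff4 f) = w} = {}" unfolding w by auto
      then show ?thesis by (simp only: card.empty)
    next
      case False
      show ?thesis
      proof (rule card_fibre_roots[of ?g _ coeff1])
        show "?g \<noteq> 0" using False by simp
        show "inj_on coeff1 {f \<in> ?SR. (coeff0 f, coeff2 f, coeff3 f, coeff4 f) = w}"
          unfolding w by (auto intro!: inj_onI quartic.expand)
        fix f assume f: "f \<in> {f \<in> ?SR. (coeff0 f, coeff2 f, coeff3 f, coeff4 f) = w}"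
        obtain a1 where fa: "f = Quartic a0 a1 a2 a3 a4" using f unfolding w by (cases f) auto
        have "elim_R a1 a2 a3 a4 = 0" using f unfolding fa by simp
        then show "poly ?g (coeff1 f) = 0" unfolding fa elim_R_def
          by (simp add: algebra_simps power2_eq_square)
      qed simp
    qed
  qed
  have "thin_forms N \<subseteq> (?S0 \<union> ?SJ) \<union> (?SD \<union> ?SR)" unfolding thin_forms_def by blast
  then have "card (thin_forms N) \<le> card ((?S0 \<union> ?SJ) \<union> (?SD \<union> ?SR))"
    by (rule card_mono[rotated]) (simp add: finite_form_box)
  also have "\<dots> \<le> (card ?S0 + card ?SJ) + (card ?SD + card ?SR)"
    by (meson card_Un_le add_mono order_trans)
  also have "\<dots> \<le> 9 * card ?A" using S0 SJ SD SR by linarith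
  finally show ?thesis unfolding cA .
qed

lemma square_eq_cube:
  fixes H R :: int
  assumes "27 * R\<^sup>2 = H ^ 3"
  shows "\<exists>n. H = 3 * n\<^sup>2 \<and> (R = n ^ 3 \<or> R = - (n ^ 3))"
proof -
  have "3 dvd H ^ 3" unfolding assms[symmetric] by simp
  then have "3 dvd H" using prime_dvd_power[of "3::int" H 3] by simp
  then obtain m where m: "H = 3 * m" by (elim dvdE)
  have R: "R\<^sup>2 = m ^ 3" using assms unfolding m by (simp add: power_mult_distrib)
  show ?thesis
  proof (cases "m = 0")
    case True
    then show ?thesis using R m by (intro exI[of _ 0]) simp
  next
    case False
    have "m\<^sup>2 dvd R\<^sup>2" unfolding R by (simp add: le_imp_power_dvd)
    then have "m dvd R" by (simp add: pow_divides_pow_iff)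
    then obtain n where n: "R = m * n" by (elim dvdE)
    have "m\<^sup>2 * n\<^sup>2 = m\<^sup>2 * m" using R unfolding n by (simp add: power_mult_distrib power2_eq_square power3_eq_cube)
    then have "n\<^sup>2 = m" using False by simp
    then have "R = n ^ 3" "H = 3 * n\<^sup>2" unfolding n m by (simp_all add: power2_eq_square power3_eq_cube)
    then show ?thesis by blast
  qed
qed

text \<open>If \<open>I = J = 0\<close>, the syzygy of the covariants reads \<open>27 R\<^sup>2 = H^3\<close> with \<open>H = 3 a1\<^sup>2 - 8 a0 a2\<close>, so \<open>H = 3 n\<^sup>2\<close> and \<open>R\<close> is
\<open>n^3\<close> or \<open>- n^3\<close>. Given nonzero \<open>a0\<close> and \<open>a2\<close>, the equation \<open>8 a0 a2 = 3 (a1 - n) (a1 + n)\<close> leaves a divisor function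
of choices for \<open>a1\<close> and \<open>n\<close>, and then \<open>R\<close> gives \<open>a3\<close> and \<open>I\<close> gives \<open>a4\<close>. So up to divisor functions only \<open>N\<^sup>2\<close> of the forms
have a triple root.\<close>

lemma card_triple_root_forms:
  assumes N: "N \<ge> 1" and T: "\<And>n. 0 < n \<Longrightarrow> n \<le> 8 * N\<^sup>2 \<Longrightarrow> divisor_count n \<le> T"
  shows "card {f \<in> form_box N. quartic_I f = 0 \<and> quartic_J f = 0} \<le> (4 + 4 * T) * (2 * N + 1)\<^sup>2"
proof -
  let ?B = "{- int N..int N}"
  let ?Z = "\<lambda>P. {f \<in> form_box N. quartic_I f = 0 \<and> quartic_J f = 0 \<and> P f}"
  have cB: "card ?B = 2 * N + 1" by (simp add: nat_add_distrib nat_mult_distrib)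
  have cBB: "card (?B \<times> ?B) = (2 * N + 1)\<^sup>2" unfolding card_cartesian_product cB power2_eq_square ..
  have finZ: "finite (?Z P)" for P by (rule finite_subset[OF _ finite_form_box[of N]]) auto
  have Za: "card (?Z (\<lambda>f. coeff0 f = 0 \<and> coeff1 f = 0)) \<le> card (?B \<times> ?B)"
  proof (rule card_inj_on_le[where f = "\<lambda>f. (coeff3 f, coeff4 f)"])
    show "inj_on (\<lambda>f. (coeff3 f, coeff4 f)) (?Z (\<lambda>f. coeff0 f = 0 \<and> coeff1 f = 0))"
    proof (rule inj_onI)
      fix f g assume "f \<in> ?Z (\<lambda>f. coeff0 f = 0 \<and> coeff1 f = 0)" "g \<in> ?Z (\<lambda>f. coeff0 f = 0 \<and> coeff1 f = 0)"
        "(coeff3 f, coeff4 f) = (coeff3 g, coeff4 g)"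
      then show "f = g" by (cases f; cases g) auto
    qed
    show "(\<lambda>f. (coeff3 f, coeff4 f)) ` ?Z (\<lambda>f. coeff0 f = 0 \<and> coeff1 f = 0) \<subseteq> ?B \<times> ?B"
    proof
      fix w assume "w \<in> (\<lambda>f. (coeff3 f, coeff4 f)) ` ?Z (\<lambda>f. coeff0 f = 0 \<and> coeff1 f = 0)"
      then obtain f where "w = (coeff3 f, coeff4 f)" "f \<in> form_box N" by blast
      then show "w \<in> ?B \<times> ?B" by (cases f) (auto simp: form_box_coeffs)
    qed
  qed simp
  have Zb: "card (?Z (\<lambda>f. coeff0 f = 0 \<and> coeff1 f \<noteq> 0)) \<le> card (?B \<times> ?B)"
  proof (rule card_inj_on_le[where f = "\<lambda>f. (coeff1 f, coeff2 f)"])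
    show "inj_on (\<lambda>f. (coeff1 f, coeff2 f)) (?Z (\<lambda>f. coeff0 f = 0 \<and> coeff1 f \<noteq> 0))"
    proof (rule inj_onI)
      fix f g assume fg: "f \<in> ?Z (\<lambda>f. coeff0 f = 0 \<and> coeff1 f \<noteq> 0)" "g \<in> ?Z (\<lambda>f. coeff0 f = 0 \<and> coeff1 f \<noteq> 0)"
        "(coeff1 f, coeff2 f) = (coeff1 g, coeff2 g)"
      obtain a1 a2 a3 a4 where f: "f = Quartic 0 a1 a2 a3 a4" using fg(1) by (cases f) auto
      obtain b3 b4 where g: "g = Quartic 0 a1 a2 b3 b4" using fg(2,3) unfolding f by (cases g) auto
      have a1: "a1 \<noteq> 0" using fg(1) unfolding f by simp
      have "3 * a1 * a3 = 3 * a1 * b3" using fg(1,2) unfolding f g by simp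
      then have e3: "a3 = b3" using a1 by simp
      have "quartic_J (Quartic 0 a1 a2 b3 a4) = quartic_J (Quartic 0 a1 a2 b3 b4)"
        using fg(1,2) unfolding f g e3 by auto
      then have "a4 = b4" using a1 by simp
      then show "f = g" unfolding f g e3 by simp
    qed
    show "(\<lambda>f. (coeff1 f, coeff2 f)) ` ?Z (\<lambda>f. coeff0 f = 0 \<and> coeff1 f \<noteq> 0) \<subseteq> ?B \<times> ?B"
    proof
      fix w assume "w \<in> (\<lambda>f. (coeff1 f, coeff2 f)) ` ?Z (\<lambda>f. coeff0 f = 0 \<and> coeff1 f \<noteq> 0)"
      then obtain f where "w = (coeff1 f, coeff2 f)" "f \<in> form_box N" by blast
      then show "w \<in> ?B \<times> ?B" by (cases f) (auto simp: form_box_coeffs)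
    qed
  qed simp
  have key: "\<exists>n. 3 * a1\<^sup>2 - 8 * a0 * a2 = 3 * n\<^sup>2 \<and>
      (a1 ^ 3 + 8 * a0\<^sup>2 * a3 - 4 * a0 * a1 * a2 = n ^ 3 \<or> a1 ^ 3 + 8 * a0\<^sup>2 * a3 - 4 * a0 * a1 * a2 = - (n ^ 3))"
    if "quartic_I (Quartic a0 a1 a2 a3 a4) = 0" "quartic_J (Quartic a0 a1 a2 a3 a4) = 0" for a0 a1 a2 a3 a4 :: int
  proof (rule square_eq_cube)
    have "27 * (a1 ^ 3 + 8 * a0\<^sup>2 * a3 - 4 * a0 * a1 * a2)\<^sup>2 - (3 * a1\<^sup>2 - 8 * a0 * a2) ^ 3
      = - 64 * a0 ^ 3 * quartic_J (Quartic a0 a1 a2 a3 a4) + 48 * a0\<^sup>2 * quartic_I (Quartic a0 a1 a2 a3 a4) * (8 * a0 * a2 - 3 * a1\<^sup>2)"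
      by (simp add: algebra_simps power2_eq_square power3_eq_cube)
    then show "27 * (a1 ^ 3 + 8 * a0\<^sup>2 * a3 - 4 * a0 * a1 * a2)\<^sup>2 = (3 * a1\<^sup>2 - 8 * a0 * a2) ^ 3"
      unfolding that by simp
  qed
  have tail: "a3 = b3 \<and> a4 = b4"
    if "a0 \<noteq> 0" "a1 ^ 3 + 8 * a0\<^sup>2 * a3 - 4 * a0 * a1 * a2 = a1 ^ 3 + 8 * a0\<^sup>2 * b3 - 4 * a0 * a1 * a2"
      "quartic_I (Quartic a0 a1 a2 a3 a4) = 0" "quartic_I (Quartic a0 a1 a2 b3 b4) = 0" for a0 a1 a2 a3 a4 b3 b4 :: int
  proof -
    have "8 * a0\<^sup>2 * a3 = 8 * a0\<^sup>2 * b3" using that(2) by linarith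
    then have e: "a3 = b3" using that(1) by simp
    have "quartic_I (Quartic a0 a1 a2 b3 a4) = quartic_I (Quartic a0 a1 a2 b3 b4)"
      using that(3,4) unfolding e by (simp only:)
    then have "12 * a0 * a4 = 12 * a0 * b4" unfolding quartic_I.simps by linarith
    then show ?thesis using e that(1) by simp
  qed
  let ?sg = "\<lambda>b n. if b then n ^ 3 else - (n ^ 3) :: int"
  let ?R = "\<lambda>f. coeff1 f ^ 3 + 8 * (coeff0 f)\<^sup>2 * coeff3 f - 4 * coeff0 f * coeff1 f * coeff2 f"
  have Zc: "card (?Z (\<lambda>f. coeff0 f \<noteq> 0 \<and> coeff2 f = 0)) \<le> card ((?B \<times> ?B) \<times> (UNIV :: bool set))"
  proof (rule card_le_if_inj_on_rel[where r = "\<lambda>f w. fst w = (coeff0 f, coeff1 f) \<and> ?R f = ?sg (snd w) (coeff1 f)"])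
    show "finite ((?B \<times> ?B) \<times> (UNIV :: bool set))" by simp
    fix f assume f: "f \<in> ?Z (\<lambda>f. coeff0 f \<noteq> 0 \<and> coeff2 f = 0)"
    obtain a0 a1 a3 a4 where fe: "f = Quartic a0 a1 0 a3 a4" using f by (cases f) auto
    obtain n where n: "3 * a1\<^sup>2 - 8 * a0 * 0 = 3 * n\<^sup>2" "?R f = n ^ 3 \<or> ?R f = - (n ^ 3)"
      using key[of a0 a1 0 a3 a4] f unfolding fe by auto
    have "n = a1 \<or> n = - a1" using n(1) by (auto simp: power2_eq_iff)
    then have "?R f = a1 ^ 3 \<or> ?R f = - (a1 ^ 3)" using n(2) by auto
    then obtain b where "?R f = ?sg b a1" by metis
    then show "\<exists>w. w \<in> (?B \<times> ?B) \<times> (UNIV :: bool set) \<and> fst w = (coeff0 f, coeff1 f) \<and> ?R f = ?sg (snd w) (coeff1 f)"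
      using f unfolding fe by (intro exI[of _ "((a0, a1), b)"]) (auto simp: form_box_coeffs)
  next
    fix f g :: "int quartic" and w :: "(int \<times> int) \<times> bool"
    assume f: "f \<in> ?Z (\<lambda>f. coeff0 f \<noteq> 0 \<and> coeff2 f = 0)" and g: "g \<in> ?Z (\<lambda>f. coeff0 f \<noteq> 0 \<and> coeff2 f = 0)"
      and rf: "fst w = (coeff0 f, coeff1 f) \<and> ?R f = ?sg (snd w) (coeff1 f)"
      and rg: "fst w = (coeff0 g, coeff1 g) \<and> ?R g = ?sg (snd w) (coeff1 g)"
    obtain a0 a1 a3 a4 where fe: "f = Quartic a0 a1 0 a3 a4" using f by (cases f) auto
    obtain b3 b4 where ge: "g = Quartic a0 a1 0 b3 b4" using g rf rg unfolding fe by (cases g) auto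
    have "a3 = b3 \<and> a4 = b4"
    proof (rule tail[of a0 a1 _ 0])
      show "a0 \<noteq> 0" using f unfolding fe by simp
      have "?R f = ?R g" using rf rg by simp
      then show "a1 ^ 3 + 8 * a0\<^sup>2 * a3 - 4 * a0 * a1 * 0 = a1 ^ 3 + 8 * a0\<^sup>2 * b3 - 4 * a0 * a1 * 0"
        unfolding fe ge by simp
      show "quartic_I (Quartic a0 a1 0 a3 a4) = 0" "quartic_I (Quartic a0 a1 0 b3 b4) = 0"
        using f g unfolding fe ge by blast+
    qed
    then show "f = g" unfolding fe ge by simp
  qed
  define Dv where "Dv a0 a2 = (\<lambda>(d, b). if b then int d else - int d) ` ({d. d dvd nat \<bar>8 * a0 * a2\<bar>} \<times> (UNIV :: bool set))" for a0 a2 :: int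
  define NZ where "NZ = {w \<in> ?B \<times> ?B. fst w \<noteq> 0 \<and> snd w \<noteq> 0}"
  define Ks where "Ks = (SIGMA w:NZ. Dv (fst w) (snd w) \<times> (UNIV :: bool set))"
  have finD: "finite {d. d dvd nat \<bar>8 * a0 * a2\<bar>}" if "a0 \<noteq> 0" "a2 \<noteq> 0" for a0 a2 :: int
    by (rule finite_divisors) (use that in simp)
  have finDv: "finite (Dv a0 a2)" if "a0 \<noteq> 0" "a2 \<noteq> 0" for a0 a2
    unfolding Dv_def by (intro finite_imageI finite_cartesian_product finD that) simp
  have finNZ: "finite NZ" unfolding NZ_def by simp
  have cDv: "card (Dv a0 a2) \<le> 2 * T" if "(a0, a2) \<in> NZ" for a0 a2
  proof -
    have nz: "a0 \<noteq> 0" "a2 \<noteq> 0" "\<bar>a0\<bar> \<le> int N" "\<bar>a2\<bar> \<le> int N" using that unfolding NZ_def by auto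
    have "\<bar>8 * a0 * a2\<bar> = 8 * (\<bar>a0\<bar> * \<bar>a2\<bar>)" by (simp add: abs_mult)
    also have "\<dots> \<le> 8 * (int N * int N)" using nz by (intro mult_left_mono mult_mono) auto
    finally have "nat \<bar>8 * a0 * a2\<bar> \<le> 8 * N\<^sup>2" by (simp add: power2_eq_square nat_le_iff)
    then have "divisor_count (nat \<bar>8 * a0 * a2\<bar>) \<le> T" using nz by (intro T) auto
    moreover have "card (Dv a0 a2) \<le> card ({d. d dvd nat \<bar>8 * a0 * a2\<bar>} \<times> (UNIV :: bool set))"
      unfolding Dv_def by (intro card_image_le finite_cartesian_product finD nz) simp
    moreover have "card ({d. d dvd nat \<bar>8 * a0 * a2\<bar>} \<times> (UNIV :: bool set)) = 2 * divisor_count (nat \<bar>8 * a0 * a2\<bar>)"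
      unfolding divisor_count_def by (simp add: card_cartesian_product)
    ultimately show ?thesis by linarith
  qed
  have finKs: "finite Ks" unfolding Ks_def by (intro finite_SigmaI finNZ) (auto simp: NZ_def finDv)
  have cKs: "card Ks \<le> 4 * T * card (?B \<times> ?B)"
  proof -
    have "card Ks = (\<Sum>w\<in>NZ. card (Dv (fst w) (snd w) \<times> (UNIV :: bool set)))"
      unfolding Ks_def by (rule card_SigmaI) (use finNZ finDv in \<open>auto simp: NZ_def\<close>)
    also have "\<dots> \<le> (\<Sum>w\<in>NZ. 4 * T)"
    proof (rule sum_mono)
      fix w assume "w \<in> NZ"
      then have "card (Dv (fst w) (snd w)) \<le> 2 * T" using cDv[of "fst w" "snd w"] by simp
      then show "card (Dv (fst w) (snd w) \<times> (UNIV :: bool set)) \<le> 4 * T" by (simp add: card_cartesian_product)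
    qed
    also have "\<dots> = card NZ * (4 * T)" by simp
    also have "\<dots> \<le> card (?B \<times> ?B) * (4 * T)"
      by (intro mult_le_mono1 card_mono) (auto simp: NZ_def)
    finally show ?thesis by (simp add: mult.commute)
  qed
  have Zd: "card (?Z (\<lambda>f. coeff0 f \<noteq> 0 \<and> coeff2 f \<noteq> 0)) \<le> card Ks"
  proof (rule card_le_if_inj_on_rel[where r = "\<lambda>f w. fst w = (coeff0 f, coeff2 f) \<and>
      (\<exists>n. fst (snd w) = coeff1 f - n \<and> 8 * coeff0 f * coeff2 f = 3 * (coeff1 f - n) * (coeff1 f + n) \<and> ?R f = ?sg (snd (snd w)) n)"])
    show "finite Ks" by (rule finKs)
    fix f assume f: "f \<in> ?Z (\<lambda>f. coeff0 f \<noteq> 0 \<and> coeff2 f \<noteq> 0)"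
    obtain a0 a1 a2 a3 a4 where fe: "f = Quartic a0 a1 a2 a3 a4" by (cases f)
    obtain n where n: "3 * a1\<^sup>2 - 8 * a0 * a2 = 3 * n\<^sup>2" "?R f = n ^ 3 \<or> ?R f = - (n ^ 3)"
      using key[of a0 a1 a2 a3 a4] f unfolding fe by auto
    obtain b where b: "?R f = ?sg b n" using n(2) by metis
    have uv: "8 * a0 * a2 = 3 * (a1 - n) * (a1 + n)" using n(1) by (simp add: algebra_simps power2_eq_square)
    have NZf: "(a0, a2) \<in> NZ" using f unfolding fe NZ_def by (auto simp: form_box_coeffs)
    have "a1 - n dvd 8 * a0 * a2" unfolding uv by (intro dvd_mult2 dvd_mult dvd_refl)
    then have "nat \<bar>a1 - n\<bar> dvd nat \<bar>8 * a0 * a2\<bar>" by (simp add: nat_abs_dvd_iff)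
    then have "a1 - n \<in> Dv a0 a2"
      unfolding Dv_def by (intro image_eqI[of _ _ "(nat \<bar>a1 - n\<bar>, a1 - n \<ge> 0)"]) auto
    then have "((a0, a2), (a1 - n, b)) \<in> Ks" unfolding Ks_def using NZf by simp
    then show "\<exists>w. w \<in> Ks \<and> fst w = (coeff0 f, coeff2 f) \<and> (\<exists>n. fst (snd w) = coeff1 f - n \<and>
        8 * coeff0 f * coeff2 f = 3 * (coeff1 f - n) * (coeff1 f + n) \<and> ?R f = ?sg (snd (snd w)) n)"
      using uv b unfolding fe by (intro exI[of _ "((a0, a2), (a1 - n, b))"]) auto
  next
    fix f g :: "int quartic" and w :: "(int \<times> int) \<times> (int \<times> bool)"
    assume f: "f \<in> ?Z (\<lambda>f. coeff0 f \<noteq> 0 \<and> coeff2 f \<noteq> 0)" and g: "g \<in> ?Z (\<lambda>f. coeff0 f \<noteq> 0 \<and> coeff2 f \<noteq> 0)"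
      and rf: "fst w = (coeff0 f, coeff2 f) \<and> (\<exists>n. fst (snd w) = coeff1 f - n \<and>
        8 * coeff0 f * coeff2 f = 3 * (coeff1 f - n) * (coeff1 f + n) \<and> ?R f = ?sg (snd (snd w)) n)"
      and rg: "fst w = (coeff0 g, coeff2 g) \<and> (\<exists>n. fst (snd w) = coeff1 g - n \<and>
        8 * coeff0 g * coeff2 g = 3 * (coeff1 g - n) * (coeff1 g + n) \<and> ?R g = ?sg (snd (snd w)) n)"
    obtain a0 a1 a2 a3 a4 where fe: "f = Quartic a0 a1 a2 a3 a4" by (cases f)
    obtain b1 b3 b4 where ge: "g = Quartic a0 b1 a2 b3 b4" using g rf rg unfolding fe by (cases g) auto
    obtain n where n: "fst (snd w) = a1 - n" "8 * a0 * a2 = 3 * (a1 - n) * (a1 + n)" "?R f = ?sg (snd (snd w)) n"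
      using rf unfolding fe by auto
    obtain n' where n': "fst (snd w) = b1 - n'" "8 * a0 * a2 = 3 * (b1 - n') * (b1 + n')" "?R g = ?sg (snd (snd w)) n'"
      using rg unfolding ge by auto
    have nz: "8 * a0 * a2 \<noteq> 0" using f unfolding fe by simp
    have u: "a1 - n = b1 - n'" using n(1) n'(1) by simp
    have "3 * (a1 - n) * (a1 + n) = 3 * (a1 - n) * (b1 + n')" 
      by (rule trans[OF n(2)[symmetric] n'(2)[folded u]])
    moreover have "3 * (a1 - n) \<noteq> 0" using nz n(2) by auto
    ultimately have v: "a1 + n = b1 + n'" by simp
    have e1: "a1 = b1" and en: "n = n'" using u v by linarith+
    have "a3 = b3 \<and> a4 = b4"
    proof (rule tail[of a0 a1 _ a2])
      show "a0 \<noteq> 0" using nz by simp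
      have "?R f = ?R g" using n(3) n'(3) en by simp
      then show "a1 ^ 3 + 8 * a0\<^sup>2 * a3 - 4 * a0 * a1 * a2 = a1 ^ 3 + 8 * a0\<^sup>2 * b3 - 4 * a0 * a1 * a2"
        unfolding fe ge e1 by simp
      show "quartic_I (Quartic a0 a1 a2 a3 a4) = 0" "quartic_I (Quartic a0 a1 a2 b3 b4) = 0"
        using f g unfolding fe ge e1 by blast+
    qed
    then show "f = g" unfolding fe ge e1 by simp
  qed
  have "{f \<in> form_box N. quartic_I f = 0 \<and> quartic_J f = 0} \<subseteq>
      (?Z (\<lambda>f. coeff0 f = 0 \<and> coeff1 f = 0) \<union> ?Z (\<lambda>f. coeff0 f = 0 \<and> coeff1 f \<noteq> 0)) \<union>
      (?Z (\<lambda>f. coeff0 f \<noteq> 0 \<and> coeff2 f = 0) \<union> ?Z (\<lambda>f. coeff0 f \<noteq> 0 \<and> coeff2 f \<noteq> 0))"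
    by blast
  then have "card {f \<in> form_box N. quartic_I f = 0 \<and> quartic_J f = 0} \<le>
      card ((?Z (\<lambda>f. coeff0 f = 0 \<and> coeff1 f = 0) \<union> ?Z (\<lambda>f. coeff0 f = 0 \<and> coeff1 f \<noteq> 0)) \<union>
      (?Z (\<lambda>f. coeff0 f \<noteq> 0 \<and> coeff2 f = 0) \<union> ?Z (\<lambda>f. coeff0 f \<noteq> 0 \<and> coeff2 f \<noteq> 0)))"
    by (rule card_mono[rotated]) (intro finite_UnI finZ)
  also have "\<dots> \<le> (card (?Z (\<lambda>f. coeff0 f = 0 \<and> coeff1 f = 0)) + card (?Z (\<lambda>f. coeff0 f = 0 \<and> coeff1 f \<noteq> 0))) +
      (card (?Z (\<lambda>f. coeff0 f \<noteq> 0 \<and> coeff2 f = 0)) + card (?Z (\<lambda>f. coeff0 f \<noteq> 0 \<and> coeff2 f \<noteq> 0)))"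
    by (meson card_Un_le add_mono order_trans)
  also have "\<dots> \<le> (card (?B \<times> ?B) + card (?B \<times> ?B)) + (2 * card (?B \<times> ?B) + 4 * T * card (?B \<times> ?B))"
    using Za Zb Zc order_trans[OF Zd cKs] by (simp add: card_cartesian_product)
  also have "\<dots> = (4 + 4 * T) * (2 * N + 1)\<^sup>2" unfolding cBB by (simp add: algebra_simps)
  finally show ?thesis .
qed

section \<open>Averages of greatest common divisors\<close>

definition moduli :: "nat \<Rightarrow> nat set" where
  "moduli M = {q. 1 \<le> q \<and> q \<le> M \<and> squarefree q \<and> coprime q 6}"

lemma finite_moduli [simp]: "finite (moduli M)"
  by (rule finite_subset[of _ "{..M}"]) (auto simp: moduli_def)

lemma gcd_int_nat_abs: "gcd (int q) x = int (gcd q (nat \<bar>x\<bar>))"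
  by (metis gcd_abs2_int gcd_int_int_eq int_nat_eq abs_ge_zero)

lemma card_multiples_le:
  assumes "e > 0" shows "card {q \<in> {1..M}. e dvd q} \<le> M div e"
proof -
  have "{q \<in> {1..M}. e dvd q} \<subseteq> (\<lambda>i. e * i) ` {1..M div e}"
  proof
    fix q assume "q \<in> {q \<in> {1..M}. e dvd q}"
    then obtain i where i: "q = e * i" "1 \<le> q" "q \<le> M" by (auto elim: dvdE)
    then have "i \<ge> 1" by (cases i) auto
    moreover have "i \<le> M div e" using i assms by (simp add: less_eq_div_iff_mult_less_eq mult.commute)
    ultimately show "q \<in> (\<lambda>i. e * i) ` {1..M div e}" using i by auto
  qed
  then have "card {q \<in> {1..M}. e dvd q} \<le> card {1..M div e}" by (rule surj_card_le[rotated]) simp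
  then show ?thesis by simp
qed

text \<open>A greatest common divisor is at most the sum of all common divisors, and a divisor \<open>e\<close> of \<open>x\<close> divides at most
\<open>M / e\<close> of the moduli.\<close>

lemma sum_gcd_le:
  assumes x: "x > 0"
  shows "(\<Sum>q\<in>moduli M. real (gcd q x)) \<le> real M * real (divisor_count x)"
proof -
  have fin: "finite {e. e dvd x}" using x by simp
  have "(\<Sum>q\<in>moduli M. real (gcd q x)) \<le> (\<Sum>q\<in>{1..M}. real (gcd q x))"
    by (rule sum_mono2) (auto simp: moduli_def)
  also have "\<dots> \<le> (\<Sum>q\<in>{1..M}. \<Sum>e | e dvd x. if e dvd q then real e else 0)"
  proof (rule sum_mono)
    fix q
    have "real (gcd q x) = (\<Sum>e\<in>{gcd q x}. if e dvd q then real e else 0)" by simp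
    also have "\<dots> \<le> (\<Sum>e | e dvd x. if e dvd q then real e else 0)"
      by (rule sum_mono2[OF fin]) auto
    finally show "real (gcd q x) \<le> (\<Sum>e | e dvd x. if e dvd q then real e else 0)" .
  qed
  also have "\<dots> = (\<Sum>e | e dvd x. \<Sum>q\<in>{1..M}. if e dvd q then real e else 0)" by (rule sum.swap)
  also have "\<dots> \<le> (\<Sum>e | e dvd x. real M)"
  proof (rule sum_mono)
    fix e assume "e \<in> {e. e dvd x}"
    then have e: "e > 0" using x by (auto intro: Nat.gr0I)
    have "(\<Sum>q\<in>{1..M}. if e dvd q then real e else 0) = (\<Sum>q\<in>{q \<in> {1..M}. e dvd q}. real e)"
      by (rule sum.inter_filter[symmetric]) simp
    also have "\<dots> = real (card {q \<in> {1..M}. e dvd q} * e)" by simp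
    also have "\<dots> \<le> real (M div e * e)"
      by (subst of_nat_le_iff, rule mult_le_mono1, rule card_multiples_le[OF e])
    also have "\<dots> \<le> real M" by (subst of_nat_le_iff) simp
    finally show "(\<Sum>q\<in>{1..M}. if e dvd q then real e else 0) \<le> real M" .
  qed
  also have "\<dots> = real M * real (divisor_count x)" unfolding divisor_count_def by simp
  finally show ?thesis .
qed

lemma card_spaced_le:
  fixes S :: "int set"
  assumes S: "S \<subseteq> {- int N..int N}" and m: "m \<ge> 1" and d: "\<And>x y. x \<in> S \<Longrightarrow> y \<in> S \<Longrightarrow> int m dvd x - y"
  shows "real (card S) \<le> 2 * real N / real m + 1"
proof (cases "S = {}")
  case True
  then show ?thesis using m by simp
next
  case False
  have fin: "finite S" by (rule finite_subset[OF S]) simp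
  define x0 where "x0 = Min S"
  have x0: "x0 \<in> S" "\<And>x. x \<in> S \<Longrightarrow> x0 \<le> x" unfolding x0_def using fin False by auto
  have sub: "S \<subseteq> (\<lambda>i. x0 + int m * int i) ` {..2 * N div m}"
  proof
    fix x assume x: "x \<in> S"
    obtain j where j: "x - x0 = int m * j" using d[OF x x0(1)] by (elim dvdE)
    have "x - x0 \<ge> 0" using x0(2)[OF x] by simp
    then have j0: "j \<ge> 0" using m unfolding j by (simp add: zero_le_mult_iff)
    have "x \<in> {- int N..int N}" "x0 \<in> {- int N..int N}" using S x x0(1) by blast+
    then have "x - x0 \<le> int (2 * N)" by simp
    then have "int m * int (nat j) \<le> int (2 * N)" using j j0 by simp
    then have "m * nat j \<le> 2 * N" by (simp only: of_nat_mult[symmetric] of_nat_le_iff)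
    then have "nat j \<le> 2 * N div m" using m by (simp add: less_eq_div_iff_mult_less_eq mult.commute)
    moreover have "x = x0 + int m * int (nat j)" using j j0 by simp
    ultimately show "x \<in> (\<lambda>i. x0 + int m * int i) ` {..2 * N div m}" by blast
  qed
  have "card S \<le> card {..2 * N div m}" by (rule surj_card_le[OF _ sub]) simp
  then have "card S \<le> 2 * N div m + 1" by simp
  then have "real (card S) \<le> real (2 * N div m) + 1" by linarith
  also have "real (2 * N div m) \<le> real (2 * N) / real m"
  proof -
    have "real (2 * N div m * m) \<le> real (2 * N)" by (subst of_nat_le_iff) simp
    then show ?thesis using m by (simp add: pos_le_divide_eq)
  qed
  finally show ?thesis by simp
qed

lemma squarefree_dvd_square:
  fixes j :: nat and a :: int
  assumes j: "squarefree j" "j > 0" and d: "int j dvd a\<^sup>2"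
  shows "int j dvd a"
proof -
  define g where "g = gcd (int j) a"
  have g0: "g > 0" unfolding g_def using j(2) by simp
  obtain j' where j': "int j = g * j'" unfolding g_def by (meson dvdE gcd_dvd1)
  obtain a' where a': "a = g * a'" unfolding g_def by (meson dvdE gcd_dvd2)
  have cop: "coprime j' a'"
    using gcd_coprime[of "int j" a j' a'] g0 j' a' unfolding g_def[symmetric] by (simp add: mult.commute)
  have "g * j' dvd g * (a' * a)" using d unfolding j' a' by (simp add: power2_eq_square mult_ac)
  then have "j' dvd a' * a" using g0 by simp
  then have ja: "j' dvd a" using cop by (simp add: coprime_dvd_mult_right_iff)
  then have "j' dvd g" unfolding g_def using j' by (intro gcd_greatest) auto
  then have "j' * j' dvd int j" unfolding j' by (rule mult_dvd_mono) simp
  moreover have "j' > 0" using j(2) g0 j' by (metis of_nat_0_less_iff zero_less_mult_pos)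
  then obtain n where n: "j' = int n" using zero_less_imp_eq_int by blast
  ultimately have "int (n * n) dvd int j" unfolding n by simp
  then have "n\<^sup>2 dvd j" unfolding int_dvd_int_iff power2_eq_square .
  then have "n dvd 1" using j(1) squarefreeD by blast
  then have "j' = 1" unfolding n by simp
  then have "int j = g" using j' by simp
  then show ?thesis unfolding g_def by (metis gcd_dvd2)
qed

lemma coprime_3_of_moduli: "k \<in> moduli M \<Longrightarrow> coprime (int k) 3"
proof -
  assume "k \<in> moduli M"
  then have "coprime k 6" unfolding moduli_def by simp
  then have "coprime k 3" by (rule coprime_divisors[OF dvd_refl, rotated]) simp
  then show ?thesis by (metis coprime_int_iff of_nat_numeral)
qed

lemma coprime_12_of_moduli: "k \<in> moduli M \<Longrightarrow> coprime (int k) 12"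
proof -
  assume "k \<in> moduli M"
  then have k6: "coprime k 6" unfolding moduli_def by simp
  then have "coprime k 2" by (rule coprime_divisors[OF dvd_refl, rotated]) simp
  then have "coprime k (2 * 6)" using k6 by (simp only: coprime_mult_right_iff)
  then have "coprime k 12" by simp
  then show ?thesis by (metis coprime_int_iff of_nat_numeral)
qed

lemma moduli_dvd: "k dvd g \<Longrightarrow> g \<in> moduli M \<Longrightarrow> k \<le> M' \<Longrightarrow> k \<in> moduli M'"
proof -
  assume k: "k dvd g" and g: "g \<in> moduli M" and le: "k \<le> M'"
  have g': "1 \<le> g" "squarefree g" "coprime g 6" using g unfolding moduli_def by auto
  have "k > 0" using k g'(1) by (auto intro: Nat.gr0I)
  moreover have "squarefree k" by (rule squarefree_mono[OF k g'(2)])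
  moreover have "coprime k 6" by (rule coprime_divisors[OF k dvd_refl g'(3)])
  ultimately show "k \<in> moduli M'" using le unfolding moduli_def by simp
qed

text \<open>Let \<open>j\<close> be the common divisor of \<open>k\<close> and \<open>a1\<close>. Since \<open>k\<close> is squarefree, the congruence forces \<open>j\<close> to divide \<open>a2\<close>, and
then \<open>a3\<close> is determined modulo \<open>k / j\<close>. The two conditions together save exactly \<open>k\<close>.\<close>

lemma conic_count_line:
  assumes k: "k \<in> moduli N" and a1: "a1 \<in> {- int N..int N}"
  shows "(\<Sum>a2\<in>{- int N..int N}. real (card {a3 \<in> {- int N..int N}. int k dvd a2\<^sup>2 - 3 * a1 * a3}))
     \<le> 9 * (real N)\<^sup>2 / real k"
proof -
  let ?B = "{- int N..int N}"
  have k0: "k \<ge> 1" "k \<le> N" "squarefree k" using k unfolding moduli_def by auto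
  define j where "j = gcd k (nat \<bar>a1\<bar>)"
  have jk: "j dvd k" unfolding j_def by (rule gcd_dvd1)
  have j0: "j > 0" using jk k0(1) by (auto intro: Nat.gr0I)
  have jint: "int j = gcd (int k) a1" unfolding j_def by (rule gcd_int_nat_abs[symmetric])
  obtain m where m: "k = j * m" using jk by (elim dvdE)
  have m0: "m \<ge> 1" using m k0 by (cases m) auto
  obtain b where b: "a1 = int j * b" unfolding jint by (meson dvdE gcd_dvd2)
  have cop: "coprime (int m) b"
    using gcd_coprime[of "int k" a1 "int m" b] j0 m b unfolding jint[symmetric] by (simp add: mult.commute)
  have m3: "coprime (int m) 3"
    using coprime_3_of_moduli[OF k] unfolding m by simp
  have sqj: "squarefree j" using squarefree_mono[OF jk k0(3)] .
  have card3: "real (card {a3 \<in> ?B. int k dvd a2\<^sup>2 - 3 * a1 * a3}) \<le> (if int j dvd a2 then 2 * real N / real m + 1 else 0)" for a2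
  proof (cases "int j dvd a2")
    case True
    have "int m dvd x - y" if "x \<in> {a3 \<in> ?B. int k dvd a2\<^sup>2 - 3 * a1 * a3}" "y \<in> {a3 \<in> ?B. int k dvd a2\<^sup>2 - 3 * a1 * a3}" for x y
    proof -
      have "int k dvd (a2\<^sup>2 - 3 * a1 * y) - (a2\<^sup>2 - 3 * a1 * x)" by (rule dvd_diff) (use that in blast)+
      also have "(a2\<^sup>2 - 3 * a1 * y) - (a2\<^sup>2 - 3 * a1 * x) = int j * (3 * (b * (x - y)))" unfolding b by (simp add: algebra_simps)
      finally have "int m dvd 3 * (b * (x - y))" unfolding m using j0 by simp
      then show ?thesis using cop m3 by (simp add: coprime_dvd_mult_right_iff)
    qed
    then have "real (card {a3 \<in> ?B. int k dvd a2\<^sup>2 - 3 * a1 * a3}) \<le> 2 * real N / real m + 1"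
      by (intro card_spaced_le m0) auto
    then show ?thesis using True by simp
  next
    case False
    have "\<not> int k dvd a2\<^sup>2 - 3 * a1 * a3" for a3
    proof
      assume "int k dvd a2\<^sup>2 - 3 * a1 * a3"
      then have "int j dvd a2\<^sup>2 - 3 * a1 * a3" using jk by (meson dvd_trans int_dvd_int_iff)
      moreover have "int j dvd 3 * a1 * a3" unfolding b by simp
      ultimately have "int j dvd a2\<^sup>2" by (metis diff_add_cancel dvd_add)
      then show False using squarefree_dvd_square[OF sqj j0] False by blast
    qed
    then have "{a3 \<in> ?B. int k dvd a2\<^sup>2 - 3 * a1 * a3} = {}" by blast
    then show ?thesis using False by (simp only: card.empty) simp
  qed
  have N0: "real N > 0" using k0 by simp
  have jN: "real j \<le> real N" using jk k0 dvd_imp_le[of j k] by simp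
  have mN: "real m \<le> real N" using m k0 j0 by (metis dvd_imp_le dvd_triv_right le_trans of_nat_mono order_less_le_trans zero_less_one)
  have "(\<Sum>a2\<in>?B. real (card {a3 \<in> ?B. int k dvd a2\<^sup>2 - 3 * a1 * a3}))
      \<le> (\<Sum>a2\<in>?B. if int j dvd a2 then 2 * real N / real m + 1 else 0)"
    by (rule sum_mono) (rule card3)
  also have "\<dots> = (\<Sum>a2\<in>{a2 \<in> ?B. int j dvd a2}. 2 * real N / real m + 1)"
    by (rule sum.inter_filter[symmetric]) simp
  also have "\<dots> = real (card {a2 \<in> ?B. int j dvd a2}) * (2 * real N / real m + 1)" by simp
  also have "\<dots> \<le> (2 * real N / real j + 1) * (2 * real N / real m + 1)"
    using j0 by (intro mult_right_mono card_spaced_le) (auto intro: dvd_diff)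
  also have "\<dots> \<le> (3 * real N / real j) * (3 * real N / real m)"
    using jN mN N0 j0 m0 by (intro mult_mono) (auto simp: field_simps)
  also have "\<dots> = 9 * (real N)\<^sup>2 / real k" unfolding m by (simp add: power2_eq_square)
  finally show ?thesis .
qed

lemma conic_count:
  assumes k: "k \<in> moduli N"
  shows "(\<Sum>a1\<in>{- int N..int N}. \<Sum>a2\<in>{- int N..int N}. real (card {a3 \<in> {- int N..int N}. int k dvd a2\<^sup>2 - 3 * a1 * a3}))
     \<le> 27 * real N ^ 3 / real k"
proof -
  have N1: "N \<ge> 1" "k \<ge> 1" using k unfolding moduli_def by auto
  have "(\<Sum>a1\<in>{- int N..int N}. \<Sum>a2\<in>{- int N..int N}. real (card {a3 \<in> {- int N..int N}. int k dvd a2\<^sup>2 - 3 * a1 * a3}))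
      \<le> (\<Sum>a1\<in>{- int N..int N}. 9 * (real N)\<^sup>2 / real k)"
    by (rule sum_mono) (rule conic_count_line[OF k])
  also have "\<dots> = (2 * real N + 1) * (9 * (real N)\<^sup>2 / real k)" by simp
  also have "\<dots> \<le> (3 * real N) * (9 * (real N)\<^sup>2 / real k)"
    using N1 by (intro mult_right_mono) auto
  also have "\<dots> = 27 * real N ^ 3 / real k" by (simp add: power2_eq_square power3_eq_cube)
  finally show ?thesis .
qed

text \<open>The congruence \<open>I = 0\<close> modulo \<open>g\<close> is linear in \<open>a0\<close> with coefficient \<open>12 * a4\<close>. It is solvable only if \<open>k\<close>, the common
divisor of \<open>g\<close> and \<open>a4\<close>, divides \<open>a2\<^sup>2 - 3 * a1 * a3\<close>, and it then fixes \<open>a0\<close> modulo \<open>g / k\<close>.\<close>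

lemma leading_coefficient_count:
  assumes g: "g \<in> moduli M" and a4: "a4 \<noteq> 0"
  defines "k \<equiv> gcd g (nat \<bar>a4\<bar>)"
  shows "sqrt (real g) * real (card {a0 \<in> {- int N..int N}. int g dvd 12 * a0 * a4 - 3 * a1 * a3 + a2\<^sup>2})
    \<le> (if int k dvd a2\<^sup>2 - 3 * a1 * a3 then 2 * real N * sqrt (real k) + sqrt (real M) else 0)"
proof (cases "int k dvd a2\<^sup>2 - 3 * a1 * a3")
  case True
  let ?S = "{a0 \<in> {- int N..int N}. int g dvd 12 * a0 * a4 - 3 * a1 * a3 + a2\<^sup>2}"
  have g0: "g \<ge> 1" "g \<le> M" "squarefree g" using g unfolding moduli_def by auto
  have kg: "k dvd g" unfolding k_def by (rule gcd_dvd1)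
  have k0: "k > 0" using kg g0(1) by (auto intro: Nat.gr0I)
  have kint: "int k = gcd (int g) a4" unfolding k_def by (rule gcd_int_nat_abs[symmetric])
  obtain m where m: "g = k * m" unfolding k_def by (meson dvdE gcd_dvd1)
  have m0: "m \<ge> 1" using m g0 by (cases m) auto
  obtain b where b: "a4 = int k * b" unfolding kint by (meson dvdE gcd_dvd2)
  have cop: "coprime (int m) b"
    using gcd_coprime[of "int g" a4 "int m" b] k0 m b unfolding kint[symmetric] by (simp add: mult.commute)
  have m12: "coprime (int m) 12" using coprime_12_of_moduli[OF g] unfolding m by simp
  have "int m dvd x - y" if "x \<in> ?S" "y \<in> ?S" for x y
  proof -
    have "int g dvd (12 * x * a4 - 3 * a1 * a3 + a2\<^sup>2) - (12 * y * a4 - 3 * a1 * a3 + a2\<^sup>2)"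
      by (rule dvd_diff) (use that in blast)+
    also have "(12 * x * a4 - 3 * a1 * a3 + a2\<^sup>2) - (12 * y * a4 - 3 * a1 * a3 + a2\<^sup>2) = int k * (12 * (b * (x - y)))"
      unfolding b by (simp add: algebra_simps)
    finally have "int m dvd 12 * (b * (x - y))" unfolding m using k0 by simp
    then show ?thesis using cop m12 by (simp add: coprime_dvd_mult_right_iff)
  qed
  then have c: "real (card ?S) \<le> 2 * real N / real m + 1" by (intro card_spaced_le m0) auto
  have "sqrt (real g) * real (card ?S) \<le> sqrt (real g) * (2 * real N / real m + 1)"
    using c by (rule mult_left_mono) simp
  also have "\<dots> = 2 * real N * (sqrt (real g) / real m) + sqrt (real g)" by (simp add: algebra_simps)
  also have "\<dots> \<le> 2 * real N * sqrt (real k) + sqrt (real M)"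
  proof (intro add_mono mult_left_mono)
    have "sqrt (real g) / real m = sqrt (real k) * (sqrt (real m) / real m)" unfolding m by (simp add: real_sqrt_mult)
    also have "\<dots> \<le> sqrt (real k) * 1"
    proof (rule mult_left_mono)
      have "sqrt (real m) * 1 \<le> sqrt (real m) * sqrt (real m)" using m0 by (intro mult_left_mono) auto
      then have "sqrt (real m) \<le> real m" by simp
      then show "sqrt (real m) / real m \<le> 1" using m0 by simp
    qed simp
    finally show "sqrt (real g) / real m \<le> sqrt (real k)" by simp
    show "sqrt (real g) \<le> sqrt (real M)" using g0 by simp
  qed simp
  finally show ?thesis using True by simp
next
  case False
  have "\<not> int g dvd 12 * a0 * a4 - 3 * a1 * a3 + a2\<^sup>2" for a0
  proof
    assume "int g dvd 12 * a0 * a4 - 3 * a1 * a3 + a2\<^sup>2"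
    moreover have "int k dvd int g" unfolding k_def int_dvd_int_iff by (rule gcd_dvd1)
    ultimately have "int k dvd 12 * a0 * a4 - 3 * a1 * a3 + a2\<^sup>2" by (rule dvd_trans[rotated])
    moreover have "int k dvd a4" unfolding k_def by (metis gcd_dvd2 gcd_int_nat_abs)
    then have "int k dvd 12 * a0 * a4" by simp
    ultimately have "int k dvd (12 * a0 * a4 - 3 * a1 * a3 + a2\<^sup>2) - 12 * a0 * a4" by (rule dvd_diff)
    then show False using False by (simp add: algebra_simps)
  qed
  then have "{a0 \<in> {- int N..int N}. int g dvd 12 * a0 * a4 - 3 * a1 * a3 + a2\<^sup>2} = {}" by blast
  then show ?thesis using False by (simp only: card.empty) simp
qed

text \<open>Every \<open>g\<close> in the sum divides \<open>elim_R\<close>, so at most \<open>T\<close> values of \<open>g\<close> occur, and for each of them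
\<open>leading_coefficient_count\<close> counts the \<open>a0\<close>.\<close>

lemma common_divisor_weight_fixed:
  assumes R: "elim_R a1 a2 a3 a4 \<noteq> 0" and a4: "a4 \<noteq> 0" "a4 \<in> {- int N..int N}"
    and T: "divisor_count (nat \<bar>elim_R a1 a2 a3 a4\<bar>) \<le> T"
  shows "(\<Sum>a0\<in>{- int N..int N}. \<Sum>g\<in>moduli M. if int g dvd quartic_I (Quartic a0 a1 a2 a3 a4) \<and>
       int g dvd quartic_J (Quartic a0 a1 a2 a3 a4) then sqrt (real g) else 0)
    \<le> real T * (sqrt (real M) + 2 * real N * (\<Sum>k\<in>moduli N. if int k dvd a4 \<and> int k dvd a2\<^sup>2 - 3 * a1 * a3 then sqrt (real k) else 0))"
proof -
  let ?B = "{- int N..int N}"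
  let ?S = "\<Sum>k\<in>moduli N. if int k dvd a4 \<and> int k dvd a2\<^sup>2 - 3 * a1 * a3 then sqrt (real k) else 0"
  let ?G = "{g \<in> moduli M. int g dvd elim_R a1 a2 a3 a4}"
  have S0: "?S \<ge> 0" by (intro sum_nonneg) auto
  have "(\<Sum>a0\<in>?B. \<Sum>g\<in>moduli M. if int g dvd quartic_I (Quartic a0 a1 a2 a3 a4) \<and>
       int g dvd quartic_J (Quartic a0 a1 a2 a3 a4) then sqrt (real g) else 0)
     = (\<Sum>g\<in>moduli M. \<Sum>a0\<in>?B. if int g dvd quartic_I (Quartic a0 a1 a2 a3 a4) \<and>
       int g dvd quartic_J (Quartic a0 a1 a2 a3 a4) then sqrt (real g) else 0)"
    by (rule sum.swap)
  also have "\<dots> \<le> (\<Sum>g\<in>moduli M. if int g dvd elim_R a1 a2 a3 a4 then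
      sqrt (real g) * real (card {a0 \<in> ?B. int g dvd 12 * a0 * a4 - 3 * a1 * a3 + a2\<^sup>2}) else 0)"
  proof (rule sum_mono)
    fix g
    have dR: "int g dvd elim_R a1 a2 a3 a4" if "int g dvd quartic_I (Quartic a0 a1 a2 a3 a4)" "int g dvd quartic_J (Quartic a0 a1 a2 a3 a4)" for a0
      unfolding elim_R_eq[of a1 a2 a3 a4 a0] using that by (intro dvd_diff dvd_mult) 
    show "(\<Sum>a0\<in>?B. if int g dvd quartic_I (Quartic a0 a1 a2 a3 a4) \<and>
       int g dvd quartic_J (Quartic a0 a1 a2 a3 a4) then sqrt (real g) else 0)
       \<le> (if int g dvd elim_R a1 a2 a3 a4 then
      sqrt (real g) * real (card {a0 \<in> ?B. int g dvd 12 * a0 * a4 - 3 * a1 * a3 + a2\<^sup>2}) else 0)"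
    proof (cases "int g dvd elim_R a1 a2 a3 a4")
      case True
      have "(\<Sum>a0\<in>?B. if int g dvd quartic_I (Quartic a0 a1 a2 a3 a4) \<and>
         int g dvd quartic_J (Quartic a0 a1 a2 a3 a4) then sqrt (real g) else 0)
         \<le> (\<Sum>a0\<in>?B. if int g dvd 12 * a0 * a4 - 3 * a1 * a3 + a2\<^sup>2 then sqrt (real g) else 0)"
        by (rule sum_mono) simp
      also have "\<dots> = (\<Sum>a0\<in>{a0 \<in> ?B. int g dvd 12 * a0 * a4 - 3 * a1 * a3 + a2\<^sup>2}. sqrt (real g))"
        by (rule sum.inter_filter[symmetric]) simp
      also have "\<dots> = sqrt (real g) * real (card {a0 \<in> ?B. int g dvd 12 * a0 * a4 - 3 * a1 * a3 + a2\<^sup>2})"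
        by (simp only: sum_constant mult.commute)
      finally show ?thesis using True by (simp only: if_True)
    next
      case False
      then have "(\<Sum>a0\<in>?B. if int g dvd quartic_I (Quartic a0 a1 a2 a3 a4) \<and>
         int g dvd quartic_J (Quartic a0 a1 a2 a3 a4) then sqrt (real g) else 0) = 0"
        using dR by (intro sum.neutral) (metis (no_types, lifting))
      then show ?thesis using False by (simp only: if_False order_refl)
    qed
  qed
  also have "\<dots> = (\<Sum>g\<in>?G. sqrt (real g) * real (card {a0 \<in> ?B. int g dvd 12 * a0 * a4 - 3 * a1 * a3 + a2\<^sup>2}))"
    by (rule sum.inter_filter[symmetric]) simp
  also have "\<dots> \<le> (\<Sum>g\<in>?G. sqrt (real M) + 2 * real N * ?S)"
  proof (rule sum_mono)
    fix g assume g: "g \<in> ?G"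
    define k where "k = gcd g (nat \<bar>a4\<bar>)"
    have kg: "k dvd g" unfolding k_def by (rule gcd_dvd1)
    have ka: "k dvd nat \<bar>a4\<bar>" unfolding k_def by (rule gcd_dvd2)
    have "k \<le> nat \<bar>a4\<bar>" using ka a4(1) by (intro dvd_imp_le) auto
    also have "\<dots> \<le> N" using a4(2) by auto
    finally have "k \<in> moduli N" using moduli_dvd[OF kg] g by blast
    moreover have "int k dvd a4" using ka by (metis dvd_abs_iff int_dvd_int_iff int_nat_eq abs_ge_zero)
    ultimately have kS: "sqrt (real k) \<le> ?S" if "int k dvd a2\<^sup>2 - 3 * a1 * a3"
      using member_le_sum[of k "moduli N" "\<lambda>k. if int k dvd a4 \<and> int k dvd a2\<^sup>2 - 3 * a1 * a3 then sqrt (real k) else 0"] that by simp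
    have "sqrt (real g) * real (card {a0 \<in> ?B. int g dvd 12 * a0 * a4 - 3 * a1 * a3 + a2\<^sup>2})
      \<le> (if int k dvd a2\<^sup>2 - 3 * a1 * a3 then 2 * real N * sqrt (real k) + sqrt (real M) else 0)"
      unfolding k_def by (rule leading_coefficient_count[OF _ a4(1)]) (use g in blast)
    also have "\<dots> \<le> sqrt (real M) + 2 * real N * ?S"
    proof (cases "int k dvd a2\<^sup>2 - 3 * a1 * a3")
      case True
      have "2 * real N * sqrt (real k) \<le> 2 * real N * ?S" by (rule mult_left_mono[OF kS[OF True]]) simp
      then show ?thesis using True by simp
    next
      case False
      have "0 \<le> sqrt (real M) + 2 * real N * ?S" using S0 by (intro add_nonneg_nonneg mult_nonneg_nonneg) auto
      then show ?thesis using False by simp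
    qed
    finally show "sqrt (real g) * real (card {a0 \<in> ?B. int g dvd 12 * a0 * a4 - 3 * a1 * a3 + a2\<^sup>2})
      \<le> sqrt (real M) + 2 * real N * ?S" .
  qed
  also have "\<dots> = real (card ?G) * (sqrt (real M) + 2 * real N * ?S)" by simp
  also have "\<dots> \<le> real T * (sqrt (real M) + 2 * real N * ?S)"
  proof (rule mult_right_mono)
    have "?G \<subseteq> {d. d dvd nat \<bar>elim_R a1 a2 a3 a4\<bar>}" by (auto simp: nat_dvd_iff)
    then have "card ?G \<le> divisor_count (nat \<bar>elim_R a1 a2 a3 a4\<bar>)"
      unfolding divisor_count_def by (rule card_mono[rotated]) (use R in \<open>intro finite_divisors, simp\<close>)
    then show "real (card ?G) \<le> real T" using T by linarith
    show "0 \<le> sqrt (real M) + 2 * real N * ?S" using S0 by (intro add_nonneg_nonneg mult_nonneg_nonneg) auto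
  qed
  finally show ?thesis .
qed

section \<open>The weighted count of forms\<close>

lemma form_box_in: "f \<in> form_box N \<longleftrightarrow> coeff0 f \<in> {- int N..int N} \<and> coeff1 f \<in> {- int N..int N} \<and>
    coeff2 f \<in> {- int N..int N} \<and> coeff3 f \<in> {- int N..int N} \<and> coeff4 f \<in> {- int N..int N}"
  by (cases f) (simp add: form_box_coeffs)

lemma sum_form_box:
  fixes F :: "int quartic \<Rightarrow> real"
  defines "B \<equiv> \<lambda>N. {- int N..int N}"
  shows "(\<Sum>f\<in>form_box N. F f) =
    (\<Sum>a4\<in>B N. \<Sum>a1\<in>B N. \<Sum>a2\<in>B N. \<Sum>a3\<in>B N. \<Sum>a0\<in>B N. F (Quartic a0 a1 a2 a3 a4))"
proof -
  let ?B = "{- int N..int N}"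
  have "(\<Sum>f\<in>form_box N. F f) = (\<Sum>(a4, a1, a2, a3, a0)\<in>?B \<times> ?B \<times> ?B \<times> ?B \<times> ?B. F (Quartic a0 a1 a2 a3 a4))"
    by (rule sum.reindex_bij_witness[of _ "\<lambda>(a4, a1, a2, a3, a0). Quartic a0 a1 a2 a3 a4"
          "\<lambda>f. (coeff4 f, coeff1 f, coeff2 f, coeff3 f, coeff0 f)"])
       (auto simp: form_box_in)
  then show ?thesis unfolding B_def by (simp add: sum.cartesian_product)
qed

text \<open>On average over the box, the square root of a common divisor of both invariants is bounded, up to
divisor functions, by \<open>1 + sqrt M / N\<close>: by \<open>common_divisor_weight_fixed\<close> only divisors of \<open>a4\<close> can make it large, and \<open>conic_count\<close>
shows that these impose further conditions on \<open>a1\<close>, \<open>a2\<close>, \<open>a3\<close> that outweigh the gain.\<close>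

lemma generic_forms_sum:
  assumes N: "N \<ge> 1" and T: "\<And>n. 0 < n \<Longrightarrow> n \<le> H \<Longrightarrow> divisor_count n \<le> T"
    and R: "\<And>a1 a2 a3 a4. a1 \<in> {- int N..int N} \<Longrightarrow> a2 \<in> {- int N..int N} \<Longrightarrow> a3 \<in> {- int N..int N} \<Longrightarrow>
        a4 \<in> {- int N..int N} \<Longrightarrow> nat \<bar>elim_R a1 a2 a3 a4\<bar> \<le> H"
    and NH: "N \<le> H"
  shows "(\<Sum>f\<in>form_box N. if coeff4 f \<noteq> 0 \<and> elim_R (coeff1 f) (coeff2 f) (coeff3 f) (coeff4 f) \<noteq> 0
      then (\<Sum>g\<in>moduli M. if int g dvd quartic_I f \<and> int g dvd quartic_J f then sqrt (real g) else 0) else 0)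
    \<le> 81 * real T * real N ^ 4 * sqrt (real M) + 162 * (real T)\<^sup>2 * real N ^ 5"
proof -
  let ?B = "{- int N..int N}"
  define S where "S a1 a2 a3 a4 = (\<Sum>k\<in>moduli N. if int k dvd a4 \<and> int k dvd a2\<^sup>2 - 3 * a1 * a3 then sqrt (real k) else 0)"
    for a1 a2 a3 a4 :: int
  have S0: "S a1 a2 a3 a4 \<ge> 0" for a1 a2 a3 a4 unfolding S_def by (intro sum_nonneg) auto
  define K where "K a1 a2 a3 a4 = real T * (sqrt (real M) + 2 * real N * S a1 a2 a3 a4)" for a1 a2 a3 a4
  have K0: "K a1 a2 a3 a4 \<ge> 0" for a1 a2 a3 a4
    unfolding K_def using S0 by (intro mult_nonneg_nonneg add_nonneg_nonneg) auto
  have cB: "real (card ?B) = 2 * real N + 1" by simp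
  have N3: "2 * real N + 1 \<le> 3 * real N" using N by simp
  have inner: "(\<Sum>a0\<in>?B. if a4 \<noteq> 0 \<and> elim_R a1 a2 a3 a4 \<noteq> 0
      then (\<Sum>g\<in>moduli M. if int g dvd quartic_I (Quartic a0 a1 a2 a3 a4) \<and> int g dvd quartic_J (Quartic a0 a1 a2 a3 a4)
         then sqrt (real g) else 0) else 0) \<le> (if a4 \<noteq> 0 then K a1 a2 a3 a4 else 0)"
    if a: "a1 \<in> ?B" "a2 \<in> ?B" "a3 \<in> ?B" "a4 \<in> ?B" for a1 a2 a3 a4
  proof (cases "a4 \<noteq> 0 \<and> elim_R a1 a2 a3 a4 \<noteq> 0")
    case True
    have t: "divisor_count (nat \<bar>elim_R a1 a2 a3 a4\<bar>) \<le> T"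
      by (rule T[OF _ R[OF a]]) (use True in simp)
    have R0: "elim_R a1 a2 a3 a4 \<noteq> 0" and a40: "a4 \<noteq> 0" using True by blast+
    have e: "(a4 \<noteq> 0 \<and> elim_R a1 a2 a3 a4 \<noteq> 0) = True" using True by simp
    have e': "(a4 \<noteq> 0) = True" using True by simp
    show ?thesis unfolding e unfolding e' if_True K_def S_def
      by (rule common_divisor_weight_fixed[OF R0 a40 a(4) t])
  next
    case False
    then have e: "(a4 \<noteq> 0 \<and> elim_R a1 a2 a3 a4 \<noteq> 0) = False" by simp
    show ?thesis unfolding e using K0[of a1 a2 a3 a4] by simp
  qed
  have Ssum: "(\<Sum>a1\<in>?B. \<Sum>a2\<in>?B. \<Sum>a3\<in>?B. S a1 a2 a3 a4) \<le> real T * (27 * real N ^ 3)" if a4: "a4 \<in> ?B" "a4 \<noteq> 0" for a4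
  proof -
    let ?c = "\<lambda>k. \<Sum>a1\<in>?B. \<Sum>a2\<in>?B. real (card {a3 \<in> ?B. int k dvd a2\<^sup>2 - 3 * a1 * a3})"
    have one: "(\<Sum>a3\<in>?B. if int k dvd a4 \<and> int k dvd a2\<^sup>2 - 3 * a1 * a3 then sqrt (real k) else 0)
        = (if int k dvd a4 then sqrt (real k) else 0) * real (card {a3 \<in> ?B. int k dvd a2\<^sup>2 - 3 * a1 * a3})" for k a1 a2
    proof (cases "int k dvd a4")
      case True
      have "(\<Sum>a3\<in>?B. if int k dvd a2\<^sup>2 - 3 * a1 * a3 then sqrt (real k) else 0)
          = (\<Sum>a3\<in>{a3 \<in> ?B. int k dvd a2\<^sup>2 - 3 * a1 * a3}. sqrt (real k))"
        by (rule sum.inter_filter[symmetric]) simp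
      then show ?thesis using True by simp
    qed simp
    have "(\<Sum>a1\<in>?B. \<Sum>a2\<in>?B. \<Sum>a3\<in>?B. S a1 a2 a3 a4)
       = (\<Sum>a1\<in>?B. \<Sum>a2\<in>?B. \<Sum>k\<in>moduli N. \<Sum>a3\<in>?B. if int k dvd a4 \<and> int k dvd a2\<^sup>2 - 3 * a1 * a3 then sqrt (real k) else 0)"
      unfolding S_def by (rule sum.cong[OF refl], rule sum.cong[OF refl], rule sum.swap)
    also have "\<dots> = (\<Sum>a1\<in>?B. \<Sum>k\<in>moduli N. \<Sum>a2\<in>?B. \<Sum>a3\<in>?B. if int k dvd a4 \<and> int k dvd a2\<^sup>2 - 3 * a1 * a3 then sqrt (real k) else 0)"
      by (rule sum.cong[OF refl], rule sum.swap)
    also have "\<dots> = (\<Sum>k\<in>moduli N. \<Sum>a1\<in>?B. \<Sum>a2\<in>?B. \<Sum>a3\<in>?B. if int k dvd a4 \<and> int k dvd a2\<^sup>2 - 3 * a1 * a3 then sqrt (real k) else 0)"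
      by (rule sum.swap)
    also have "\<dots> = (\<Sum>k\<in>moduli N. (if int k dvd a4 then sqrt (real k) else 0) * ?c k)"
      unfolding one sum_distrib_left ..
    also have "\<dots> \<le> (\<Sum>k\<in>moduli N. if int k dvd a4 then 27 * real N ^ 3 else 0)"
    proof (rule sum_mono)
      fix k assume k: "k \<in> moduli N"
      then have k1: "real k \<ge> 1" unfolding moduli_def by simp
      have "sqrt (real k) * ?c k \<le> sqrt (real k) * (27 * real N ^ 3 / real k)"
        by (rule mult_left_mono[OF conic_count[OF k]]) simp
      also have "\<dots> = 27 * real N ^ 3 * (sqrt (real k) / real k)" by simp
      also have "\<dots> \<le> 27 * real N ^ 3 * 1"
      proof (rule mult_left_mono)
        have "sqrt (real k) * 1 \<le> sqrt (real k) * sqrt (real k)" using k1 by (intro mult_left_mono) auto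
        then show "sqrt (real k) / real k \<le> 1" using k1 by simp
      qed simp
      finally show "(if int k dvd a4 then sqrt (real k) else 0) * ?c k \<le> (if int k dvd a4 then 27 * real N ^ 3 else 0)"
        by simp
    qed
    also have "\<dots> = (\<Sum>k\<in>{k \<in> moduli N. int k dvd a4}. 27 * real N ^ 3)"
      by (rule sum.inter_filter[symmetric]) simp
    also have "\<dots> = real (card {k \<in> moduli N. int k dvd a4}) * (27 * real N ^ 3)" by simp
    also have "\<dots> \<le> real T * (27 * real N ^ 3)"
    proof (rule mult_right_mono)
      have "{k \<in> moduli N. int k dvd a4} \<subseteq> {d. d dvd nat \<bar>a4\<bar>}" by (auto simp: nat_dvd_iff)
      then have "card {k \<in> moduli N. int k dvd a4} \<le> divisor_count (nat \<bar>a4\<bar>)"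
        unfolding divisor_count_def by (rule card_mono[rotated]) (use a4 in \<open>intro finite_divisors, simp\<close>)
      also have "\<dots> \<le> T" by (rule T) (use a4 NH in auto)
      finally show "real (card {k \<in> moduli N. int k dvd a4}) \<le> real T" by simp
    qed simp
    finally show ?thesis .
  qed
  have outer: "(\<Sum>a1\<in>?B. \<Sum>a2\<in>?B. \<Sum>a3\<in>?B. if a4 \<noteq> 0 then K a1 a2 a3 a4 else 0)
      \<le> 27 * real N ^ 3 * (real T * sqrt (real M)) + 54 * (real T)\<^sup>2 * real N ^ 4" if a4: "a4 \<in> ?B" for a4
  proof (cases "a4 = 0")
    case True
    then show ?thesis by simp
  next
    case False
    have "(\<Sum>a1\<in>?B. \<Sum>a2\<in>?B. \<Sum>a3\<in>?B. if a4 \<noteq> 0 then K a1 a2 a3 a4 else 0)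
       = (\<Sum>a1\<in>?B. \<Sum>a2\<in>?B. \<Sum>a3\<in>?B. real T * sqrt (real M) + 2 * real N * real T * S a1 a2 a3 a4)"
      using False unfolding K_def by (simp add: algebra_simps)
    also have "\<dots> = (2 * real N + 1) ^ 3 * (real T * sqrt (real M))
        + 2 * real N * real T * (\<Sum>a1\<in>?B. \<Sum>a2\<in>?B. \<Sum>a3\<in>?B. S a1 a2 a3 a4)"
      unfolding sum.distrib sum_distrib_left[symmetric] sum_constant cB by (simp add: power3_eq_cube)
    also have "\<dots> \<le> (3 * real N) ^ 3 * (real T * sqrt (real M)) + 2 * real N * real T * (real T * (27 * real N ^ 3))"
      using Ssum[OF a4 False] N3 by (intro add_mono mult_right_mono mult_left_mono power_mono) auto
    also have "\<dots> = 27 * real N ^ 3 * (real T * sqrt (real M)) + 54 * (real T)\<^sup>2 * real N ^ 4"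
      by (simp add: power_mult_distrib power2_eq_square power3_eq_cube power4_eq_xxxx)
    finally show ?thesis .
  qed
  have "(\<Sum>f\<in>form_box N. if coeff4 f \<noteq> 0 \<and> elim_R (coeff1 f) (coeff2 f) (coeff3 f) (coeff4 f) \<noteq> 0
      then (\<Sum>g\<in>moduli M. if int g dvd quartic_I f \<and> int g dvd quartic_J f then sqrt (real g) else 0) else 0)
     \<le> (\<Sum>a4\<in>?B. \<Sum>a1\<in>?B. \<Sum>a2\<in>?B. \<Sum>a3\<in>?B. if a4 \<noteq> 0 then K a1 a2 a3 a4 else 0)"
    unfolding sum_form_box quartic.sel
    by (rule sum_mono, rule sum_mono, rule sum_mono, rule sum_mono, rule inner)
  also have "\<dots> \<le> (\<Sum>a4\<in>?B. 27 * real N ^ 3 * (real T * sqrt (real M)) + 54 * (real T)\<^sup>2 * real N ^ 4)"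
    by (rule sum_mono) (rule outer)
  also have "\<dots> = (2 * real N + 1) * (27 * real N ^ 3 * (real T * sqrt (real M)) + 54 * (real T)\<^sup>2 * real N ^ 4)"
    unfolding sum_constant cB ..
  also have "\<dots> \<le> (3 * real N) * (27 * real N ^ 3 * (real T * sqrt (real M)) + 54 * (real T)\<^sup>2 * real N ^ 4)"
    using N3 by (intro mult_right_mono) auto
  also have "\<dots> = 81 * real T * real N ^ 4 * sqrt (real M) + 162 * (real T)\<^sup>2 * real N ^ 5"
    by (simp add: algebra_simps numeral_eq_Suc)
  finally show ?thesis .
qed

lemma abs_mult_le: "\<bar>a\<bar> \<le> A \<Longrightarrow> \<bar>b\<bar> \<le> B \<Longrightarrow> \<bar>a * b\<bar> \<le> A * B" for a b A B :: int
  unfolding abs_mult by (intro mult_mono) auto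

lemma abs_sum5_le:
  fixes m :: int
  assumes "\<bar>x1\<bar> \<le> m" "\<bar>x2\<bar> \<le> m" "\<bar>x3\<bar> \<le> m" "\<bar>x4\<bar> \<le> m" "\<bar>x5\<bar> \<le> m"
  shows "\<bar>c1 * x1 + c2 * x2 + c3 * x3 + c4 * x4 + c5 * x5\<bar> \<le> (\<bar>c1\<bar> + \<bar>c2\<bar> + \<bar>c3\<bar> + \<bar>c4\<bar> + \<bar>c5\<bar>) * m"
proof -
  have "\<bar>c * x\<bar> \<le> \<bar>c\<bar> * m" if "\<bar>x\<bar> \<le> m" for c x
    unfolding abs_mult using that by (intro mult_left_mono) auto
  note t = this[OF assms(1), of c1] this[OF assms(2), of c2] this[OF assms(3), of c3] this[OF assms(4), of c4] this[OF assms(5), of c5]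
  show ?thesis unfolding distrib_right by (intro order_trans[OF abs_triangle_ineq add_mono] t)
qed

lemma invariants_size:
  fixes n :: int
  assumes a: "\<bar>a0\<bar> \<le> n" "\<bar>a1\<bar> \<le> n" "\<bar>a2\<bar> \<le> n" "\<bar>a3\<bar> \<le> n" "\<bar>a4\<bar> \<le> n"
  shows "\<bar>quartic_I (Quartic a0 a1 a2 a3 a4)\<bar> \<le> 16 * n\<^sup>2"
    "\<bar>quartic_J (Quartic a0 a1 a2 a3 a4)\<bar> \<le> 137 * n ^ 3"
    "\<bar>elim_R a1 a2 a3 a4\<bar> \<le> 852 * n ^ 4"
proof -
  note m = abs_mult_le
  have "\<bar>a0 * a4\<bar> \<le> n * n" "\<bar>a1 * a3\<bar> \<le> n * n" "\<bar>a2 * a2\<bar> \<le> n * n" by (intro m a)+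
  then show "\<bar>quartic_I (Quartic a0 a1 a2 a3 a4)\<bar> \<le> 16 * n\<^sup>2"
    unfolding quartic_I.simps power2_eq_square mult.assoc abs_le_iff by (intro conjI; linarith)
  have "\<bar>a0 * (a2 * a4)\<bar> \<le> n * (n * n)" "\<bar>a1 * (a2 * a3)\<bar> \<le> n * (n * n)" "\<bar>a0 * (a3 * a3)\<bar> \<le> n * (n * n)"
    "\<bar>a1 * (a1 * a4)\<bar> \<le> n * (n * n)" "\<bar>a2 * (a2 * a2)\<bar> \<le> n * (n * n)" by (intro m a)+
  from abs_sum5_le[OF this, of 72 9 "-27" "-27" "-2"]
  show "\<bar>quartic_J (Quartic a0 a1 a2 a3 a4)\<bar> \<le> 137 * n ^ 3"
    by (simp add: algebra_simps power2_eq_square power3_eq_cube)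
  have "\<bar>a4 * (a4 * (a1 * a1))\<bar> \<le> n * (n * (n * n))" "\<bar>a3 * (a3 * (a3 * a1))\<bar> \<le> n * (n * (n * n))"
    "\<bar>a2 * (a3 * (a4 * a1))\<bar> \<le> n * (n * (n * n))" "\<bar>a2 * (a2 * (a2 * a4))\<bar> \<le> n * (n * (n * n))"
    "\<bar>a2 * (a2 * (a3 * a3))\<bar> \<le> n * (n * (n * n))" by (intro m a)+
  note b = abs_sum5_le[OF this, of 324 81 "-324" 96 "-27"]
  have e: "elim_R a1 a2 a3 a4 = 324 * (a4 * (a4 * (a1 * a1))) + 81 * (a3 * (a3 * (a3 * a1))) + - 324 * (a2 * (a3 * (a4 * a1)))
      + 96 * (a2 * (a2 * (a2 * a4))) + - 27 * (a2 * (a2 * (a3 * a3)))"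
    unfolding elim_R_def power2_eq_square power3_eq_cube by (simp add: algebra_simps)
  have n4: "(\<bar>324\<bar> + \<bar>81\<bar> + \<bar>- 324\<bar> + \<bar>96\<bar> + \<bar>- 27\<bar>) * (n * (n * (n * n))) = 852 * n ^ 4"
    unfolding power4_eq_xxxx mult.assoc by simp
  show "\<bar>elim_R a1 a2 a3 a4\<bar> \<le> 852 * n ^ 4"
    using b unfolding e n4 .
qed

lemma Disc_size:
  fixes n :: int
  assumes a: "\<bar>a0\<bar> \<le> n" "\<bar>a1\<bar> \<le> n" "\<bar>a2\<bar> \<le> n" "\<bar>a3\<bar> \<le> n" "\<bar>a4\<bar> \<le> n"
  shows "\<bar>Disc (Quartic a0 a1 a2 a3 a4)\<bar> \<le> 1302 * n ^ 6"
proof -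
  let ?f = "Quartic a0 a1 a2 a3 a4"
  note s = invariants_size[OF a]
  have "\<bar>quartic_I ?f ^ 3\<bar> \<le> (16 * n\<^sup>2) ^ 3" unfolding power_abs by (rule power_mono[OF s(1)]) simp
  also have "(16 * n\<^sup>2) ^ 3 = 4096 * n ^ 6" by (simp add: power_mult_distrib flip: power_mult)
  finally have i: "\<bar>quartic_I ?f ^ 3\<bar> \<le> 4096 * n ^ 6" .
  have "\<bar>quartic_J ?f ^ 2\<bar> \<le> (137 * n ^ 3)\<^sup>2" unfolding power_abs by (rule power_mono[OF s(2)]) simp
  also have "(137 * n ^ 3)\<^sup>2 = 18769 * n ^ 6" by (simp add: power_mult_distrib flip: power_mult)
  finally have j: "\<bar>quartic_J ?f ^ 2\<bar> \<le> 18769 * n ^ 6" .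
  have "0 \<le> n ^ 6" using a(1) by simp
  then show ?thesis using Disc_mult_27[of ?f] i j by linarith
qed

text \<open>A common bound for the absolute values of all the integers attached to a form of \<open>form_box N\<close>
whose divisors are counted; \<open>quartic_K\<close>, of degree ten, is the largest.\<close>

definition size_bound :: "nat \<Rightarrow> nat" where
  "size_bound N = 10 ^ 6 * N ^ 10"

lemma invariants_size_bound:
  assumes N: "N \<ge> 1" and f: "f \<in> form_box N"
  shows "nat \<bar>quartic_I f\<bar> \<le> size_bound N" "nat \<bar>quartic_J f\<bar> \<le> size_bound N"
    "nat \<bar>quartic_K f\<bar> \<le> size_bound N"
    "nat \<bar>elim_R (coeff1 f) (coeff2 f) (coeff3 f) (coeff4 f)\<bar> \<le> size_bound N"
proof -
  obtain a0 a1 a2 a3 a4 where fe: "f = Quartic a0 a1 a2 a3 a4" by (cases f)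
  let ?n = "int N"
  have a: "\<bar>a0\<bar> \<le> ?n" "\<bar>a1\<bar> \<le> ?n" "\<bar>a2\<bar> \<le> ?n" "\<bar>a3\<bar> \<le> ?n" "\<bar>a4\<bar> \<le> ?n"
    using f unfolding fe form_box_coeffs by auto
  have pw: "?n ^ i \<le> ?n ^ 10" if "i \<le> 10" for i using that N by (intro power_increasing) auto
  have to: "nat \<bar>x\<bar> \<le> size_bound N" if "\<bar>x\<bar> \<le> c * ?n ^ i" "i \<le> 10" "0 \<le> c" "c \<le> 10 ^ 6" for x c i
  proof -
    have "c * ?n ^ i \<le> 10 ^ 6 * ?n ^ 10" using that pw[OF that(2)] by (intro mult_mono) auto
    then have "\<bar>x\<bar> \<le> int (size_bound N)" using that(1) unfolding size_bound_def by simp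
    then show ?thesis by simp
  qed
  note s = invariants_size[OF a]
  show "nat \<bar>quartic_I f\<bar> \<le> size_bound N" unfolding fe by (rule to[OF s(1)]) auto
  show "nat \<bar>quartic_J f\<bar> \<le> size_bound N" unfolding fe by (rule to[OF s(2)]) auto
  show "nat \<bar>elim_R (coeff1 f) (coeff2 f) (coeff3 f) (coeff4 f)\<bar> \<le> size_bound N"
    unfolding fe quartic.sel by (rule to[OF s(3)]) auto
  have "\<bar>quartic_K f\<bar> \<le> (?n * (137 * ?n ^ 3)) * (1302 * ?n ^ 6)"
    unfolding quartic_K_def fe quartic.sel by (intro abs_mult_le a s Disc_size)
  also have "\<dots> = 178374 * ?n ^ 10" by (simp add: numeral_eq_Suc)
  finally show "nat \<bar>quartic_K f\<bar> \<le> size_bound N" by (rule to) auto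
qed

text \<open>The factors of \<open>weight\<close> that remain when the modulus is prime to the content of the form.\<close>

definition core_weight :: "nat \<Rightarrow> int quartic \<Rightarrow> real" where
  "core_weight q f = of_int (gcd (int q) (quartic_IJ f)) * sqrt (of_int (gcd (int q) (quartic_K f)))"

text \<open>Three cases. If both invariants vanish, every gcd is the whole modulus. If the form is thin, only the
second gcd is estimated by \<open>q\<close>, and the first one is small on average. Otherwise, with \<open>g\<close> the gcd with the invariants
and \<open>e\<close> the gcd with \<open>quartic_K\<close>, \<open>g\<close> divides \<open>e\<close>, so that \<open>g * sqrt e \<le> e * sqrt g\<close>; here \<open>e\<close> is bounded on average
over the moduli, and \<open>sqrt g\<close> is left for the average over the forms.\<close>

lemma core_weight_sum_form:
  assumes N: "N \<ge> 1" and T: "\<And>n. 0 < n \<Longrightarrow> n \<le> size_bound N \<Longrightarrow> divisor_count n \<le> T" and f: "f \<in> form_box N"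
  shows "(\<Sum>q\<in>moduli M. core_weight q f) \<le>
      (if quartic_I f = 0 \<and> quartic_J f = 0 then (real M)\<^sup>2 * sqrt M else 0)
    + (if f \<in> thin_forms N then real T * (M * sqrt M) else 0)
    + M * real T * (if coeff4 f \<noteq> 0 \<and> elim_R (coeff1 f) (coeff2 f) (coeff3 f) (coeff4 f) \<noteq> 0
      then (\<Sum>g\<in>moduli M. if int g dvd quartic_I f \<and> int g dvd quartic_J f then sqrt (real g) else 0) else 0)"
    (is "?L \<le> ?Z + ?T + M * real T * ?G")
proof -
  have Z0: "?Z \<ge> 0" and T0: "?T \<ge> 0" and G0: "?G \<ge> 0" by (auto intro!: sum_nonneg)
  then have MG0: "M * real T * ?G \<ge> 0" by (intro mult_nonneg_nonneg) auto
  define x where "x = nat \<bar>quartic_IJ f\<bar>"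
  define y where "y = nat \<bar>quartic_K f\<bar>"
  have w: "core_weight q f = real (gcd q x) * sqrt (real (gcd q y))" for q
    unfolding core_weight_def gcd_int_nat_abs x_def y_def by simp
  have qM: "gcd q z \<le> M" if "q \<in> moduli M" for q z
    using order_trans[OF gcd_le1_nat[of q z], of M] that unfolding moduli_def by simp
  consider (zero) "quartic_I f = 0 \<and> quartic_J f = 0" | (thin) "\<not> (quartic_I f = 0 \<and> quartic_J f = 0)" "f \<in> thin_forms N"
    | (gen) "f \<notin> thin_forms N" by blast
  then show ?thesis
  proof cases
    case zero
    have "?L \<le> (\<Sum>q\<in>moduli M. M * sqrt M)"
      unfolding w by (intro sum_mono mult_mono real_sqrt_le_mono) (auto intro: qM)
    also have "\<dots> = real (card (moduli M)) * (M * sqrt M)" by simp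
    also have "\<dots> \<le> real M * (M * sqrt M)"
    proof (intro mult_right_mono)
      have "card (moduli M) \<le> card {1..M}" by (rule card_mono) (auto simp: moduli_def)
      then show "real (card (moduli M)) \<le> real M" by simp
    qed auto
    also have "\<dots> = ?Z" using zero by (simp add: power2_eq_square)
    finally show ?thesis using T0 MG0 by linarith
  next
    case thin
    have x0: "x > 0" using thin(1) unfolding x_def quartic_IJ_def by auto
    have "x \<le> size_bound N"
    proof (cases "quartic_I f = 0")
      case True
      then have "x = nat \<bar>quartic_J f\<bar>" unfolding x_def quartic_IJ_def by simp
      then show ?thesis using invariants_size_bound(2)[OF N f] by simp
    next
      case False
      have "x dvd nat \<bar>quartic_I f\<bar>" unfolding x_def quartic_IJ_def by (simp add: nat_abs_dvd_iff)
      then have "x \<le> nat \<bar>quartic_I f\<bar>" using False by (intro dvd_imp_le) auto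
      then show ?thesis using invariants_size_bound(1)[OF N f] by linarith
    qed
    then have Dx: "divisor_count x \<le> T" using x0 T by blast
    have "?L \<le> (\<Sum>q\<in>moduli M. real (gcd q x) * sqrt M)"
      unfolding w by (intro sum_mono mult_left_mono real_sqrt_le_mono) (auto intro: qM)
    also have "\<dots> = (\<Sum>q\<in>moduli M. real (gcd q x)) * sqrt M" by (rule sum_distrib_right[symmetric])
    also have "\<dots> \<le> (real M * real T) * sqrt M"
      using order_trans[OF sum_gcd_le[OF x0, of M] mult_left_mono[of "real (divisor_count x)" "real T" "real M"]] Dx
      by (intro mult_right_mono) auto
    also have "\<dots> = ?T" using thin(2) by simp
    finally show ?thesis using Z0 MG0 by linarith
  next
    case gen
    then have nz: "coeff4 f \<noteq> 0" "quartic_J f \<noteq> 0" "Disc f \<noteq> 0" "elim_R (coeff1 f) (coeff2 f) (coeff3 f) (coeff4 f) \<noteq> 0"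
      using f unfolding thin_forms_def by auto
    have y0: "y > 0" unfolding y_def quartic_K_def using nz by simp
    have Dy: "divisor_count y \<le> T" by (rule T[OF y0]) (use invariants_size_bound(3)[OF N f] in \<open>simp add: y_def\<close>)
    have Geq: "?G = (\<Sum>g\<in>moduli M. if int g dvd quartic_I f \<and> int g dvd quartic_J f then sqrt (real g) else 0)"
      using nz by simp
    have "?L \<le> (\<Sum>q\<in>moduli M. real (gcd q y) * ?G)"
    proof (rule sum_mono)
      fix q assume q: "q \<in> moduli M"
      define g where "g = gcd q x"
      define e where "e = gcd q y"
      have "x dvd y" unfolding x_def y_def using quartic_IJ_dvd_K[of f] by (simp add: nat_abs_dvd_iff)
      then have ge: "g dvd e" unfolding g_def e_def by (meson dvd_trans gcd_dvd1 gcd_dvd2 gcd_greatest)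
      have e0: "e > 0" unfolding e_def using y0 by simp
      have gle: "real g \<le> real e" using dvd_imp_le[OF ge e0] by simp
      have gm: "g \<in> moduli M" by (rule moduli_dvd[OF _ q]) (auto simp: g_def intro: qM q)
      have "int g dvd quartic_IJ f" unfolding g_def x_def by (metis gcd_dvd2 gcd_int_nat_abs)
      then have gd: "int g dvd quartic_I f \<and> int g dvd quartic_J f" unfolding quartic_IJ_dvd_iff .
      have "sqrt (real g) \<le> ?G"
        unfolding Geq
        using member_le_sum[OF gm, of "\<lambda>g. if int g dvd quartic_I f \<and> int g dvd quartic_J f then sqrt (real g) else 0"] gd by simp
      then have sG: "real e * sqrt (real g) \<le> real e * ?G" by (intro mult_left_mono) auto
      have "real g * sqrt (real e) = sqrt (real g) * (sqrt (real g) * sqrt (real e))" by simp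
      also have "\<dots> \<le> sqrt (real g) * (sqrt (real e) * sqrt (real e))"
        using gle by (intro mult_left_mono mult_right_mono real_sqrt_le_mono) auto
      also have "\<dots> = real e * sqrt (real g)" by simp
      finally show "core_weight q f \<le> real (gcd q y) * ?G" using sG unfolding w g_def[symmetric] e_def[symmetric] by linarith
    qed
    also have "\<dots> = (\<Sum>q\<in>moduli M. real (gcd q y)) * ?G" by (rule sum_distrib_right[symmetric])
    also have "\<dots> \<le> (real M * real T) * ?G"
      using order_trans[OF sum_gcd_le[OF y0, of M] mult_left_mono[of "real (divisor_count y)" "real T" "real M"]] Dy G0
      by (intro mult_right_mono) auto
    finally show ?thesis using Z0 T0 by linarith
  qed
qed

text \<open>The contributions of the generic forms, of the thin forms and of the forms with a triple root, up to
divisor functions, for boxes of size \<open>n\<close> and moduli up to \<open>m\<close>.\<close>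

definition main_size :: "real \<Rightarrow> real \<Rightarrow> real" where
  "main_size n m = n ^ 5 * m + n ^ 4 * (m * sqrt m) + n\<^sup>2 * (m\<^sup>2 * sqrt m)"

lemma core_weight_sum:
  assumes N: "N \<ge> 1" and T1: "T \<ge> 1" and T: "\<And>n. 0 < n \<Longrightarrow> n \<le> size_bound N \<Longrightarrow> divisor_count n \<le> T"
  shows "(\<Sum>f\<in>form_box N. \<Sum>q\<in>moduli M. core_weight q f) \<le> 1000 * real T ^ 3 * main_size (real N) (real M)"
proof -
  let ?G = "\<lambda>f. if coeff4 f \<noteq> 0 \<and> elim_R (coeff1 f) (coeff2 f) (coeff3 f) (coeff4 f) \<noteq> 0
      then (\<Sum>g\<in>moduli M. if int g dvd quartic_I f \<and> int g dvd quartic_J f then sqrt (real g) else 0) else 0"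
  let ?n = "real N" and ?m = "real M" and ?t = "real T"
  have t1: "?t \<ge> 1" using T1 by simp
  have n1: "?n \<ge> 1" using N by simp
  have sb: "size_bound N \<ge> 8 * N\<^sup>2" "size_bound N \<ge> N"
  proof -
    have "N\<^sup>2 \<le> N ^ 10" "N ^ 1 \<le> N ^ 10" using N by (intro power_increasing; simp)+
    then show "size_bound N \<ge> 8 * N\<^sup>2" "size_bound N \<ge> N" unfolding size_bound_def by auto
  qed
  have "(\<Sum>f\<in>form_box N. \<Sum>q\<in>moduli M. core_weight q f) \<le>
     (\<Sum>f\<in>form_box N. (if quartic_I f = 0 \<and> quartic_J f = 0 then ?m\<^sup>2 * sqrt M else 0)
       + (if f \<in> thin_forms N then ?t * (M * sqrt M) else 0) + M * ?t * ?G f)"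
    by (rule sum_mono) (rule core_weight_sum_form[OF N T])
  also have "\<dots> = (\<Sum>f\<in>form_box N. if quartic_I f = 0 \<and> quartic_J f = 0 then ?m\<^sup>2 * sqrt M else 0)
      + (\<Sum>f\<in>form_box N. if f \<in> thin_forms N then ?t * (M * sqrt M) else 0) + M * ?t * (\<Sum>f\<in>form_box N. ?G f)"
    unfolding sum.distrib sum_distrib_left ..
  also have "(\<Sum>f\<in>form_box N. if quartic_I f = 0 \<and> quartic_J f = 0 then ?m\<^sup>2 * sqrt M else 0) \<le> 72 * ?t * ?n\<^sup>2 * (?m\<^sup>2 * sqrt M)"
  proof -
    have "(\<Sum>f\<in>form_box N. if quartic_I f = 0 \<and> quartic_J f = 0 then ?m\<^sup>2 * sqrt M else 0)
       = (\<Sum>f\<in>{f \<in> form_box N. quartic_I f = 0 \<and> quartic_J f = 0}. ?m\<^sup>2 * sqrt M)"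
      by (rule sum.inter_filter[OF finite_form_box, symmetric])
    also have "\<dots> = real (card {f \<in> form_box N. quartic_I f = 0 \<and> quartic_J f = 0}) * (?m\<^sup>2 * sqrt M)" by simp
    also have "\<dots> \<le> (8 * ?t * (3 * ?n)\<^sup>2) * (?m\<^sup>2 * sqrt M)"
    proof (rule mult_right_mono)
      have "card {f \<in> form_box N. quartic_I f = 0 \<and> quartic_J f = 0} \<le> (4 + 4 * T) * (2 * N + 1)\<^sup>2"
        by (rule card_triple_root_forms[OF N T]) (use sb in linarith)+
      then have "real (card {f \<in> form_box N. quartic_I f = 0 \<and> quartic_J f = 0}) \<le> real ((4 + 4 * T) * (2 * N + 1)\<^sup>2)"
        by (simp only: of_nat_le_iff)
      also have "\<dots> = (4 + 4 * ?t) * (2 * ?n + 1)\<^sup>2" by simp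
      also have "\<dots> \<le> (8 * ?t) * (3 * ?n)\<^sup>2" using t1 n1 by (intro mult_mono power_mono) auto
      finally show "real (card {f \<in> form_box N. quartic_I f = 0 \<and> quartic_J f = 0}) \<le> 8 * ?t * (3 * ?n)\<^sup>2" .
    qed simp
    also have "\<dots> = 72 * ?t * ?n\<^sup>2 * (?m\<^sup>2 * sqrt M)" by (simp add: power_mult_distrib)
    finally show ?thesis .
  qed
  also have "(\<Sum>f\<in>form_box N. if f \<in> thin_forms N then ?t * (M * sqrt M) else 0) \<le> 729 * ?t * ?n ^ 4 * (?m * sqrt M)"
  proof -
    have "(\<Sum>f\<in>form_box N. if f \<in> thin_forms N then ?t * (M * sqrt M) else 0)
       = (\<Sum>f\<in>{f \<in> form_box N. f \<in> thin_forms N}. ?t * (M * sqrt M))"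
      by (rule sum.inter_filter[OF finite_form_box, symmetric])
    also have "{f \<in> form_box N. f \<in> thin_forms N} = thin_forms N" unfolding thin_forms_def by blast
    also have "(\<Sum>f\<in>thin_forms N. ?t * (M * sqrt M)) = real (card (thin_forms N)) * (?t * (M * sqrt M))" by simp
    also have "\<dots> \<le> (9 * (3 * ?n) ^ 4) * (?t * (M * sqrt M))"
    proof (rule mult_right_mono)
      have "real (card (thin_forms N)) \<le> real (9 * (2 * N + 1) ^ 4)" using card_thin_forms[of N] by (simp only: of_nat_le_iff)
      also have "\<dots> = 9 * (2 * ?n + 1) ^ 4" by (simp add: add.commute)
      also have "\<dots> \<le> 9 * (3 * ?n) ^ 4" using n1 by (intro mult_left_mono power_mono) auto
      finally show "real (card (thin_forms N)) \<le> 9 * (3 * ?n) ^ 4" .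
    qed simp
    also have "\<dots> = 729 * ?t * ?n ^ 4 * (?m * sqrt M)" by (simp add: power_mult_distrib)
    finally show ?thesis .
  qed
  also have "M * ?t * (\<Sum>f\<in>form_box N. ?G f) \<le> M * ?t * (81 * ?t * ?n ^ 4 * sqrt M + 162 * ?t\<^sup>2 * ?n ^ 5)"
  proof (rule mult_left_mono)
    have R: "nat \<bar>elim_R a1 a2 a3 a4\<bar> \<le> size_bound N"
      if "a1 \<in> {- int N..int N}" "a2 \<in> {- int N..int N}" "a3 \<in> {- int N..int N}" "a4 \<in> {- int N..int N}" for a1 a2 a3 a4
      using invariants_size_bound(4)[OF N, of "Quartic 0 a1 a2 a3 a4"] that by (simp add: form_box_coeffs)
    show "(\<Sum>f\<in>form_box N. ?G f) \<le> 81 * ?t * ?n ^ 4 * sqrt M + 162 * ?t\<^sup>2 * ?n ^ 5"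
      by (rule generic_forms_sum[OF N T R sb(2)])
  qed simp
  finally have "(\<Sum>f\<in>form_box N. \<Sum>q\<in>moduli M. core_weight q f)
      \<le> 72 * ?t * ?n\<^sup>2 * (?m\<^sup>2 * sqrt M) + 729 * ?t * ?n ^ 4 * (?m * sqrt M)
        + M * ?t * (81 * ?t * ?n ^ 4 * sqrt M + 162 * ?t\<^sup>2 * ?n ^ 5)"
    by linarith
  also have "\<dots> = 72 * ?t * (?n\<^sup>2 * (?m\<^sup>2 * sqrt M)) + 729 * ?t * (?n ^ 4 * (?m * sqrt M))
      + 81 * ?t\<^sup>2 * (?n ^ 4 * (?m * sqrt M)) + 162 * ?t ^ 3 * (?n ^ 5 * ?m)"
    by (simp add: algebra_simps power2_eq_square power3_eq_cube)
  also have "\<dots> \<le> 72 * ?t ^ 3 * (?n\<^sup>2 * (?m\<^sup>2 * sqrt M)) + 729 * ?t ^ 3 * (?n ^ 4 * (?m * sqrt M))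
      + 81 * ?t ^ 3 * (?n ^ 4 * (?m * sqrt M)) + 162 * ?t ^ 3 * (?n ^ 5 * ?m)"
  proof -
    have p1: "?t \<le> ?t ^ 3" using t1 by (simp add: self_le_power)
    have p2: "?t\<^sup>2 \<le> ?t ^ 3" using t1 by (intro power_increasing) auto
    show ?thesis by (intro add_mono mult_right_mono mult_left_mono p1 p2) auto
  qed
  also have "\<dots> \<le> 1000 * ?t ^ 3 * main_size ?n ?m"
  proof -
    let ?a = "?t ^ 3 * (?n\<^sup>2 * (?m\<^sup>2 * sqrt M))" and ?b = "?t ^ 3 * (?n ^ 4 * (?m * sqrt M))" and ?c = "?t ^ 3 * (?n ^ 5 * ?m)"
    have "?a \<ge> 0" "?b \<ge> 0" "?c \<ge> 0" by auto
    moreover have "1000 * ?t ^ 3 * main_size ?n ?m = 1000 * ?c + 1000 * ?b + 1000 * ?a"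
      unfolding main_size_def by (simp add: algebra_simps)
    ultimately show ?thesis unfolding mult.assoc by linarith
  qed
  finally show ?thesis .
qed

section \<open>Removing common factors of the coefficients\<close>

lemma gcd_scale_le:
  fixes d q x x' :: int
  assumes d: "d > 0" and q: "q > 0" and x: "\<And>g. g dvd q \<Longrightarrow> g dvd x \<Longrightarrow> g dvd x'"
  shows "gcd (d * q) x \<le> d * gcd q x'"
proof -
  have "gcd (d * q) x dvd gcd (d * q) (d * x)" by (intro gcd_greatest) auto
  also have "gcd (d * q) (d * x) = d * gcd q x" using d by (simp add: gcd_mult_left)
  also have "d * gcd q x dvd d * gcd q x'"
    by (intro mult_dvd_mono dvd_refl gcd_greatest) (auto intro: x)
  finally show ?thesis using d q by (intro zdvd_imp_le) auto
qed

lemma quartic_map_scale: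
  "quartic_I (map_quartic ((*) c) f) = c\<^sup>2 * quartic_I f"
  "quartic_J (map_quartic ((*) c) f) = c ^ 3 * quartic_J f"
  "quartic_K (map_quartic ((*) c) f) = c ^ 10 * quartic_K f"
  for c :: int
proof -
  show "quartic_I (map_quartic ((*) c) f) = c\<^sup>2 * quartic_I f"
    by (cases f) (simp add: algebra_simps power2_eq_square)
  show J: "quartic_J (map_quartic ((*) c) f) = c ^ 3 * quartic_J f"
    by (cases f) (simp add: algebra_simps power2_eq_square power3_eq_cube)
  have D: "Disc (map_quartic ((*) c) f) = c ^ 6 * Disc f"
    by (cases f) (simp only: quartic.map Disc_scale)
  have c4: "coeff4 (map_quartic ((*) c) f) = c * coeff4 f" by (cases f) simp
  have c10: "c ^ 10 = c * c ^ 3 * c ^ 6" by (simp add: numeral_eq_Suc)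
  show "quartic_K (map_quartic ((*) c) f) = c ^ 10 * quartic_K f"
    unfolding quartic_K_def J D c4 c10 by (simp only: mult_ac)
qed

text \<open>A common factor \<open>d\<close> of the modulus and the form is split off from both. As \<open>d\<close> is prime to the
remaining modulus, it multiplies each of the three gcds by at most \<open>d\<close>.\<close>

lemma weight_scale_le:
  assumes d: "d > 0" and q: "q > 0" and cop: "coprime d q"
    and c: "gcd (int (d * q)) (quartic_content (map_quartic ((*) (int d)) f)) = int d"
  shows "weight (d * q) (map_quartic ((*) (int d)) f) \<le> (real d)\<^sup>2 * sqrt (real d) * core_weight q f"
proof -
  let ?F = "map_quartic ((*) (int d)) f"
  have strip: "g dvd y" if "g dvd int q" "g dvd int d ^ i * y" for g y :: int and i
  proof -
    have "coprime (int q) (int d)" using cop by (simp add: coprime_commute)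
    then have "coprime g (int d)" by (rule coprime_divisors[OF that(1) dvd_refl])
    then have "coprime g (int d ^ i)" by simp
    then show ?thesis using that(2) by (simp only: coprime_dvd_mult_right_iff)
  qed
  have IJ: "gcd (int d * int q) (quartic_IJ ?F) \<le> int d * gcd (int q) (quartic_IJ f)"
    by (rule gcd_scale_le) (use d q in \<open>auto simp: quartic_IJ_dvd_iff quartic_map_scale intro: strip\<close>)
  have K: "gcd (int d * int q) (quartic_K ?F) \<le> int d * gcd (int q) (quartic_K f)"
    by (rule gcd_scale_le) (use d q in \<open>auto simp: quartic_map_scale intro: strip\<close>)
  have "weight (d * q) ?F = real d * real_of_int (gcd (int d * int q) (quartic_IJ ?F))
      * sqrt (real_of_int (gcd (int d * int q) (quartic_K ?F)))"
    unfolding weight_def c by simp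
  also have "\<dots> \<le> real d * real_of_int (int d * gcd (int q) (quartic_IJ f))
      * sqrt (real_of_int (int d * gcd (int q) (quartic_K f)))"
    using IJ K by (intro mult_mono mult_left_mono real_sqrt_le_mono) (auto simp del: of_int_mult)
  also have "\<dots> = (real d)\<^sup>2 * sqrt (real d) * core_weight q f"
    unfolding core_weight_def by (simp add: real_sqrt_mult power2_eq_square)
  finally show ?thesis .
qed

text \<open>Every term of \<open>main_size\<close> has total degree at least \<open>9/2\<close>, so passing from \<open>(N, M)\<close> to \<open>(N/d, M/d)\<close> gains more
than the factor \<open>d powr (5/2)\<close> that is lost to the content, by at least \<open>d\<^sup>2\<close>.\<close>

lemma main_size_scale:
  assumes d: "d \<ge> 1" and n: "0 \<le> n" "n \<le> N / d" and m: "0 \<le> m" "m \<le> M / d"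
  shows "d\<^sup>2 * sqrt d * main_size n m \<le> main_size N M / d\<^sup>2"
proof -
  have "0 \<le> N / d" "0 \<le> M / d" using n m by linarith+
  then have N0: "N \<ge> 0" "M \<ge> 0" using d by (simp_all add: zero_le_divide_iff)
  define s where "s = sqrt d"
  have s: "s \<ge> 1" "d = s * s" unfolding s_def using d by auto
  have "main_size n m \<le> main_size (N / d) (M / d)"
    unfolding main_size_def using n m
    by (intro add_mono mult_mono power_mono real_sqrt_le_mono mult_nonneg_nonneg) auto
  then have "d\<^sup>2 * s * main_size n m \<le> d\<^sup>2 * s * main_size (N / d) (M / d)"
    using s d by (intro mult_left_mono) auto
  also have "\<dots> = N ^ 5 * M / d\<^sup>2 * (s / d\<^sup>2) + N ^ 4 * (M * sqrt M) / d\<^sup>2 * (1 / d) + N\<^sup>2 * (M\<^sup>2 * sqrt M) / d\<^sup>2"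
  proof -
    have r: "sqrt (M / d) = sqrt M / s" unfolding s_def by (rule real_sqrt_divide)
    show ?thesis unfolding main_size_def r unfolding s(2)
      using s(1) by (simp add: field_simps power2_eq_square numeral_eq_Suc)
  qed
  also have "\<dots> \<le> N ^ 5 * M / d\<^sup>2 * 1 + N ^ 4 * (M * sqrt M) / d\<^sup>2 * 1 + N\<^sup>2 * (M\<^sup>2 * sqrt M) / d\<^sup>2"
  proof -
    have "s * 1 \<le> s * s ^ 3" using s(1) by (intro mult_left_mono one_le_power) auto
    then have "s / d\<^sup>2 \<le> 1" using s(1) unfolding s(2) by (simp add: power2_eq_square power3_eq_cube mult_ac)
    moreover have "1 / d \<le> 1" using d by simp
    ultimately show ?thesis using N0 d by (intro add_mono mult_left_mono order_refl) auto
  qed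
  also have "\<dots> = main_size N M / d\<^sup>2" unfolding main_size_def by (simp add: add_divide_distrib)
  finally show ?thesis unfolding s_def .
qed

lemma real_div_le: "d \<in> {1..N} \<Longrightarrow> real (x div d) \<le> real x / real d"
proof -
  assume d: "d \<in> {1..N}"
  have "real (x div d * d) \<le> real x" by (subst of_nat_le_iff) simp
  then show "real (x div d) \<le> real x / real d" using d by (simp add: pos_le_divide_eq)
qed

lemma sum_inverse_squares_le: "(\<Sum>d\<in>{1..N}. 1 / (real d)\<^sup>2) \<le> 2"
proof -
  have "(\<Sum>d\<in>{1..N}. 1 / (real d)\<^sup>2) \<le> 2 - 1 / real N" if "N \<ge> 1" for N
    using that
  proof (induction N rule: nat_induct_at_least)
    case base
    then show ?case by simp
  next
    case (Suc n)
    have n: "real n > 0" using Suc.hyps by simp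
    have "1 / (real (Suc n))\<^sup>2 \<le> 1 / (real n * real (Suc n))"
      using n unfolding power2_eq_square by (intro divide_left_mono mult_right_mono) auto
    also have "\<dots> = 1 / real n - 1 / real (Suc n)" using n by (simp add: field_simps)
    finally have "1 / (real (Suc n))\<^sup>2 \<le> 1 / real n - 1 / real (Suc n)" .
    then show ?case using Suc.IH by simp
  qed
  from this[of N] show ?thesis by (cases "N = 0") (auto intro: order_trans)
qed

text \<open>Pairs \<open>(f, q)\<close> are sorted by the gcd \<open>d\<close> of \<open>q\<close> with the content of \<open>f\<close>. For \<open>f \<noteq> 0\<close> this is at most \<open>N\<close>, and the
series over \<open>d\<close> converges.\<close>

lemma weight_sum:
  assumes T1: "T \<ge> 1" and T: "\<And>n. 0 < n \<Longrightarrow> n \<le> size_bound N \<Longrightarrow> divisor_count n \<le> T"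
  shows "(\<Sum>f\<in>form_box N - {0}. \<Sum>q\<in>moduli M. weight q f) \<le> 2000 * real T ^ 3 * main_size (real N) (real M)"
proof -
  let ?S = "(form_box N - {0}) \<times> moduli M"
  let ?B = "\<lambda>d. form_box (N div d) \<times> moduli (M div d)"
  let ?T = "SIGMA d:{1..N}. ?B d"
  let ?i = "\<lambda>(d, f, q). (map_quartic ((*) (int d)) f, d * q)"
  let ?g = "\<lambda>(d, f, q). (real d)\<^sup>2 * sqrt (real d) * core_weight q f"
  have cw0: "core_weight q f \<ge> 0" for q f unfolding core_weight_def by simp
  have ms0: "main_size n m \<ge> 0" if "n \<ge> 0" "m \<ge> 0" for n m unfolding main_size_def using that by simp
  have "(\<Sum>f\<in>form_box N - {0}. \<Sum>q\<in>moduli M. weight q f) = (\<Sum>(f, q)\<in>?S. weight q f)"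
    by (rule sum.cartesian_product)
  also have "\<dots> \<le> sum ?g ?T"
  proof (rule sum_le_included[where i = ?i])
    show "finite ?S" by (simp add: finite_form_box)
    show "finite ?T" by (intro finite_SigmaI) (auto simp: finite_form_box)
    show "\<forall>y\<in>?T. 0 \<le> ?g y" using cw0 by (auto intro!: mult_nonneg_nonneg)
    show "\<forall>x\<in>?S. \<exists>y\<in>?T. ?i y = x \<and> (case x of (f, q) \<Rightarrow> weight q f) \<le> ?g y"
    proof
      fix x assume "x \<in> ?S"
      then obtain f q where x: "x = (f, q)" and f: "f \<in> form_box N" "f \<noteq> 0" and q: "q \<in> moduli M" by auto
      have q1: "q \<ge> 1" "q \<le> M" "squarefree q" using q unfolding moduli_def by auto
      obtain a0 a1 a2 a3 a4 where fe: "f = Quartic a0 a1 a2 a3 a4" by (cases f)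
      define d where "d = gcd q (nat \<bar>quartic_content f\<bar>)"
      have dint: "int d = gcd (int q) (quartic_content f)" unfolding d_def by (rule gcd_int_nat_abs[symmetric])
      have dq: "d dvd q" unfolding d_def by (rule gcd_dvd1)
      have d0: "d > 0" using dq q1(1) by (auto intro: Nat.gr0I)
      obtain q' where q': "q = d * q'" using dq by (elim dvdE)
      have q'0: "q' > 0" using q' q1(1) by (auto intro: Nat.gr0I)
      have cop: "coprime d q'"
      proof (rule coprimeI)
        fix e assume "e dvd d" "e dvd q'"
        then have "e\<^sup>2 dvd q" unfolding q' power2_eq_square by (rule mult_dvd_mono)
        then show "is_unit e" using q1(3) squarefreeD by blast
      qed
      have "int d dvd quartic_content f" unfolding dint by (rule gcd_dvd2)
      then have "int d dvd a0 \<and> int d dvd a1 \<and> int d dvd a2 \<and> int d dvd a3 \<and> int d dvd a4"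
        unfolding fe quartic_content_dvd_iff .
      then obtain b0 b1 b2 b3 b4 where b: "a0 = int d * b0" "a1 = int d * b1" "a2 = int d * b2" "a3 = int d * b3" "a4 = int d * b4"
        by (elim conjE dvdE)
      let ?f = "Quartic b0 b1 b2 b3 b4"
      have ff: "map_quartic ((*) (int d)) ?f = f" unfolding fe b by simp
      have box: "b \<in> {- int (N div d)..int (N div d)}" if "int d * b \<in> {- int N..int N}" for b
      proof -
        have "int d * \<bar>b\<bar> \<le> int N" using that d0 by (simp add: abs_if)
        then have "int (d * nat \<bar>b\<bar>) \<le> int N" by simp
        then have "d * nat \<bar>b\<bar> \<le> N" by (simp only: of_nat_le_iff)
        then have "nat \<bar>b\<bar> \<le> N div d" using d0 by (simp add: less_eq_div_iff_mult_less_eq mult.commute)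
        then show ?thesis by auto
      qed
      have fb: "?f \<in> form_box (N div d)"
        using f(1) unfolding fe b form_box_coeffs using box by blast
      have "?f \<noteq> 0" using f(2) unfolding fe b zero_quartic_def by auto
      then have "N div d \<noteq> 0" using fb unfolding form_box_coeffs zero_quartic_def by auto
      then have dN: "d \<in> {1..N}" using d0 by (auto simp: div_eq_0_iff not_less)
      have "q' dvd q" unfolding q' by simp
      moreover have "q' \<le> M div d" using q1(2) d0 unfolding q' by (simp add: less_eq_div_iff_mult_less_eq mult.commute)
      ultimately have qm: "q' \<in> moduli (M div d)" using moduli_dvd q by blast
      have "weight (d * q') (map_quartic ((*) (int d)) ?f) \<le> (real d)\<^sup>2 * sqrt (real d) * core_weight q' ?f"
        by (rule weight_scale_le[OF d0 q'0 cop]) (unfold ff q'[symmetric], rule dint[symmetric])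
      then have le: "weight q f \<le> (real d)\<^sup>2 * sqrt (real d) * core_weight q' ?f" unfolding ff q'[symmetric] .
      have mem: "(d, ?f, q') \<in> ?T" by (intro SigmaI dN fb qm)
      show "\<exists>y\<in>?T. ?i y = x \<and> (case x of (f, q) \<Rightarrow> weight q f) \<le> ?g y"
      proof (rule bexI[OF _ mem], rule conjI)
        show "?i (d, ?f, q') = x" unfolding prod.case ff q'[symmetric] x ..
        show "(case x of (f, q) \<Rightarrow> weight q f) \<le> ?g (d, ?f, q')" unfolding x prod.case by (rule le)
      qed
    qed
  qed
  also have "\<dots> = (\<Sum>d\<in>{1..N}. \<Sum>(f, q)\<in>?B d. (real d)\<^sup>2 * sqrt (real d) * core_weight q f)"
    by (subst sum.Sigma[symmetric]) (auto simp: finite_form_box)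
  also have "\<dots> = (\<Sum>d\<in>{1..N}. (real d)\<^sup>2 * sqrt (real d) * (\<Sum>f\<in>form_box (N div d). \<Sum>q\<in>moduli (M div d). core_weight q f))"
    unfolding sum_distrib_left by (simp add: sum.cartesian_product)
  also have "\<dots> \<le> (\<Sum>d\<in>{1..N}. 1000 * real T ^ 3 * main_size (real N) (real M) * (1 / (real d)\<^sup>2))"
  proof (rule sum_mono)
    fix d assume d: "d \<in> {1..N}"
    then have N1: "N div d \<ge> 1" by (simp add: less_eq_div_iff_mult_less_eq)
    have sbm: "size_bound (N div d) \<le> size_bound N" unfolding size_bound_def by (intro mult_left_mono power_mono) auto
    have "(\<Sum>f\<in>form_box (N div d). \<Sum>q\<in>moduli (M div d). core_weight q f)
        \<le> 1000 * real T ^ 3 * main_size (real (N div d)) (real (M div d))"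
      by (rule core_weight_sum[OF N1 T1 T]) (use sbm in auto)
    then have "(real d)\<^sup>2 * sqrt (real d) * (\<Sum>f\<in>form_box (N div d). \<Sum>q\<in>moduli (M div d). core_weight q f)
        \<le> (real d)\<^sup>2 * sqrt (real d) * (1000 * real T ^ 3 * main_size (real (N div d)) (real (M div d)))"
      by (intro mult_left_mono) auto
    also have "\<dots> = 1000 * real T ^ 3 * ((real d)\<^sup>2 * sqrt (real d) * main_size (real (N div d)) (real (M div d)))"
      by (simp only: mult_ac)
    also have "\<dots> \<le> 1000 * real T ^ 3 * (main_size (real N) (real M) / (real d)\<^sup>2)"
      using d by (intro mult_left_mono main_size_scale real_div_le) auto
    finally show "(real d)\<^sup>2 * sqrt (real d) * (\<Sum>f\<in>form_box (N div d). \<Sum>q\<in>moduli (M div d). core_weight q f)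
        \<le> 1000 * real T ^ 3 * main_size (real N) (real M) * (1 / (real d)\<^sup>2)" by simp
  qed
  also have "\<dots> = 1000 * real T ^ 3 * main_size (real N) (real M) * (\<Sum>d\<in>{1..N}. 1 / (real d)\<^sup>2)"
    by (rule sum_distrib_left[symmetric])
  also have "\<dots> \<le> 1000 * real T ^ 3 * main_size (real N) (real M) * 2"
    by (intro mult_left_mono sum_inverse_squares_le mult_nonneg_nonneg ms0) auto
  finally show ?thesis by simp
qed

section \<open>From exponential sums to the estimate\<close>

lemma squarefree_div_gcd_6:
  assumes q: "squarefree q" "q \<le> M"
  shows "q div gcd q 6 \<in> moduli M" "gcd q 6 \<in> {1, 2, 3, 6}" "q = (q div gcd q 6) * gcd q 6"
proof -
  have q0: "q > 0" using q(1) by (auto intro: Nat.gr0I)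
  show qe: "q = (q div gcd q 6) * gcd q 6" by simp
  have qd: "q div gcd q 6 dvd q" by (rule dvdI[of _ _ "gcd q 6"]) (rule qe)
  have "{e. e dvd (6::nat)} = {1, 2, 3, 6}"
  proof -
    have "e \<in> {1, 2, 3, 6}" if "e dvd 6" for e :: nat
    proof -
      have "e \<le> 6" using that by (rule dvd_imp_le) simp
      moreover have "e \<noteq> 0" using that by (cases "e = 0") auto
      ultimately have "e = 1 \<or> e = 2 \<or> e = 3 \<or> e = 4 \<or> e = 5 \<or> e = 6" by arith
      then show ?thesis using that by auto
    qed
    then show ?thesis by auto
  qed
  then show "gcd q 6 \<in> {1, 2, 3, 6}" by blast
  have "coprime (q div gcd q 6) 6"
  proof (rule coprimeI)
    fix e assume e: "e dvd q div gcd q 6" "e dvd 6"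
    have "e dvd gcd q 6" using e qd by (meson dvd_trans gcd_greatest)
    then have "e\<^sup>2 dvd q" using e(1) by (subst qe, unfold power2_eq_square) (rule mult_dvd_mono)
    then show "is_unit e" using q(1) squarefreeD by blast
  qed
  moreover have "q div gcd q 6 > 0" using q0 by (simp add: div_greater_zero_iff gcd_le1_nat)
  moreover have "q div gcd q 6 \<le> M" using q(2) by (meson div_le_dividend le_trans)
  moreover have "squarefree (q div gcd q 6)" by (rule squarefree_mono[OF qd q(1)])
  ultimately show "q div gcd q 6 \<in> moduli M" unfolding moduli_def by simp
qed

text \<open>The normalisation \<open>q powr (-5)\<close> and the generic bound \<open>q powr (3/2)\<close> leave \<open>Q powr (-7/2)\<close>. The constant 648
bounds \<open>6 powr (7/2)\<close>, since removing the part of \<open>q\<close> that divides 6 makes the modulus at most six times smaller.\<close>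

lemma cmod_Phi_hat_le:
  assumes B: "B \<ge> 0" "\<And>n. n > 0 \<Longrightarrow> 35 ^ card (prime_factors n) * real (divisor_count n) \<le> B * real n powr \<epsilon>"
    and e: "\<epsilon> > 0" and Q: "Q > 0" and q: "squarefree q" "Q \<le> real q" "real q \<le> 2 * Q"
  shows "cmod (Phi_hat q f) \<le> B * (2 * Q) powr \<epsilon> * (648 / (Q ^ 3 * sqrt Q)) * weight (q div gcd q 6) f"
proof -
  define q' where "q' = q div gcd q 6"
  have qM: "q \<le> nat \<lfloor>2 * Q\<rfloor>" using q(3) by (rule le_nat_floor)
  note s = squarefree_div_gcd_6[OF q(1) qM, folded q'_def]
  have q': "q' > 0" "squarefree q'" "coprime q' 6" using s(1) unfolding moduli_def by auto
  have "gcd q 6 \<le> 6" using s(2) by auto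
  then have "q \<le> q' * 6" using s(3) by (metis mult_le_mono2)
  then have Qq: "Q / 6 \<le> real q'" using q(2) by linarith
  have "q' \<le> q" unfolding q'_def by simp
  then have q2: "real q' \<le> 2 * Q" using q(3) by linarith
  have r0: "real q' > 0" using q'(1) by simp
  have w0: "weight q' f \<ge> 0" by (rule weight_nonneg)
  have "{d. d dvd q'} \<noteq> {}" by auto
  then have "divisor_count q' \<ge> 1" unfolding divisor_count_def using q'(1) by (simp add: Suc_leI card_gt_0_iff)
  then have "35 ^ card (prime_factors q') * 1 \<le> 35 ^ card (prime_factors q') * real (divisor_count q')"
    by (intro mult_left_mono) auto
  also have "\<dots> \<le> B * real q' powr \<epsilon>" by (rule B(2)[OF q'(1)])
  also have "\<dots> \<le> B * (2 * Q) powr \<epsilon>" using q2 e B(1) by (intro mult_left_mono powr_mono2) auto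
  finally have om: "35 ^ card (prime_factors q') \<le> B * (2 * Q) powr \<epsilon>" by simp
  have "cmod (Phi_hat q f) = cmod (singular_sum q' f) / real q' ^ 5"
    unfolding Phi_hat_def q'_def[symmetric] Phi_hat_coprime_eq[OF q'(1,3)] by (simp add: norm_divide norm_power)
  also have "\<dots> \<le> 35 ^ card (prime_factors q') * (q' * sqrt q') * weight q' f / real q' ^ 5"
    by (intro divide_right_mono singular_sum_squarefree_bound q') auto
  also have "\<dots> = 35 ^ card (prime_factors q') * (1 / (real q' ^ 3 * sqrt q')) * weight q' f"
  proof -
    have s2: "real q' = sqrt q' * sqrt q'" by simp
    have "real q' * sqrt q' / real q' ^ 5 = 1 / (real q' ^ 3 * sqrt q')"
      using r0 s2 by (simp add: divide_simps power_eq_if)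
    then show ?thesis by (metis times_divide_eq_left times_divide_eq_right)
  qed
  also have "\<dots> \<le> (B * (2 * Q) powr \<epsilon>) * (648 / (Q ^ 3 * sqrt Q)) * weight q' f"
  proof (intro mult_right_mono mult_mono om w0)
    have "sqrt 6 \<le> sqrt (3\<^sup>2)" by (rule real_sqrt_le_mono) simp
    then have s6: "sqrt 6 \<le> 3" by simp
    have "(Q / 6) ^ 3 * sqrt (Q / 6) \<le> real q' ^ 3 * sqrt q'"
      using Qq Q by (intro mult_mono power_mono real_sqrt_le_mono) auto
    then have "1 / (real q' ^ 3 * sqrt q') \<le> 1 / ((Q / 6) ^ 3 * sqrt (Q / 6))"
      using Q r0 by (intro divide_left_mono) auto
    also have "\<dots> = 216 * sqrt 6 / (Q ^ 3 * sqrt Q)"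
      using Q by (simp add: real_sqrt_divide power_divide)
    also have "\<dots> \<le> 648 / (Q ^ 3 * sqrt Q)"
      using s6 Q by (intro divide_right_mono) auto
    finally show "1 / (real q' ^ 3 * sqrt q') \<le> 648 / (Q ^ 3 * sqrt Q)" .
  qed (use B(1) in auto)
  finally show ?thesis unfolding q'_def .
qed

text \<open>The map from \<open>q\<close> to its part prime to 6 has at most four preimages, one for each divisor of 6.\<close>

lemma Phi_hat_sum_le:
  assumes B: "B \<ge> 0" "\<And>n. n > 0 \<Longrightarrow> 35 ^ card (prime_factors n) * real (divisor_count n) \<le> B * real n powr \<epsilon>"
    and e: "\<epsilon> > 0" and Q: "Q > 0"
    and T1: "T \<ge> 1" and T: "\<And>n. 0 < n \<Longrightarrow> n \<le> size_bound N \<Longrightarrow> divisor_count n \<le> T"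
  shows "(\<Sum>q | squarefree q \<and> Q \<le> real q \<and> real q \<le> 2 * Q. \<Sum>f\<in>form_box N - {0}. cmod (Phi_hat q f))
    \<le> B * (2 * Q) powr \<epsilon> * (648 / (Q ^ 3 * sqrt Q)) * (8000 * real T ^ 3 * main_size (real N) (2 * Q))"
proof -
  let ?M = "nat \<lfloor>2 * Q\<rfloor>"
  let ?S = "{q. squarefree q \<and> Q \<le> real q \<and> real q \<le> 2 * Q}"
  let ?A = "B * (2 * Q) powr \<epsilon> * (648 / (Q ^ 3 * sqrt Q))"
  define F where "F q = (\<Sum>f\<in>form_box N - {0}. weight q f)" for q
  have F0: "F q \<ge> 0" for q unfolding F_def by (intro sum_nonneg weight_nonneg)
  have A0: "?A \<ge> 0" using B(1) Q by (intro mult_nonneg_nonneg) auto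
  have "(\<Sum>q\<in>?S. \<Sum>f\<in>form_box N - {0}. cmod (Phi_hat q f)) \<le> (\<Sum>q\<in>?S. ?A * F (q div gcd q 6))"
    unfolding F_def sum_distrib_left
    by (intro sum_mono cmod_Phi_hat_le[OF B e Q]) auto
  also have "\<dots> = ?A * (\<Sum>q\<in>?S. F (q div gcd q 6))" by (rule sum_distrib_left[symmetric])
  finally have h: "(\<Sum>q\<in>?S. \<Sum>f\<in>form_box N - {0}. cmod (Phi_hat q f)) \<le> ?A * (\<Sum>q\<in>?S. F (q div gcd q 6))" .
  have "(\<Sum>q\<in>?S. F (q div gcd q 6)) \<le> (\<Sum>(q, g)\<in>moduli ?M \<times> {1, 2, 3, 6 :: nat}. F q)"
  proof (rule sum_le_included[where i = "\<lambda>(q, g). q * g"])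
    show "finite ?S" by (rule finite_modulus_range)
    show "\<forall>x\<in>?S. \<exists>y\<in>moduli ?M \<times> {1, 2, 3, 6}. (case y of (q, g) \<Rightarrow> q * g) = x \<and>
        F (x div gcd x 6) \<le> (case y of (q, g) \<Rightarrow> F q)"
    proof
      fix q assume "q \<in> ?S"
      then have q: "squarefree q" "q \<le> ?M" by (auto intro: le_nat_floor)
      note s = squarefree_div_gcd_6[OF q]
      show "\<exists>y\<in>moduli ?M \<times> {1, 2, 3, 6}. (case y of (q, g) \<Rightarrow> q * g) = q \<and>
        F (q div gcd q 6) \<le> (case y of (q, g) \<Rightarrow> F q)"
        by (rule bexI[of _ "(q div gcd q 6, gcd q 6)"]) (use s in auto)
    qed
  qed (use F0 in auto)
  also have "\<dots> = 4 * (\<Sum>q\<in>moduli ?M. F q)"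
    unfolding sum.cartesian_product[symmetric] by (simp add: sum_distrib_left)
  finally have h4: "(\<Sum>q\<in>?S. F (q div gcd q 6)) \<le> 4 * (\<Sum>q\<in>moduli ?M. F q)" .
  have "(\<Sum>q\<in>moduli ?M. F q) = (\<Sum>f\<in>form_box N - {0}. \<Sum>q\<in>moduli ?M. weight q f)"
    unfolding F_def by (rule sum.swap)
  also have "\<dots> \<le> 2000 * real T ^ 3 * main_size (real N) (real ?M)" by (rule weight_sum[OF T1 T])
  finally have hF: "(\<Sum>q\<in>moduli ?M. F q) \<le> 2000 * real T ^ 3 * main_size (real N) (real ?M)" .
  have "main_size (real N) (real ?M) \<le> main_size (real N) (2 * Q)"
  proof -
    have "real ?M \<le> 2 * Q" using Q by simp
    then show ?thesis unfolding main_size_def using Q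
      by (intro add_mono mult_mono power_mono real_sqrt_le_mono mult_nonneg_nonneg order_refl) auto
  qed
  then have "2000 * real T ^ 3 * main_size (real N) (real ?M) \<le> 2000 * real T ^ 3 * main_size (real N) (2 * Q)"
    by (intro mult_left_mono) auto
  then have "(\<Sum>q\<in>?S. F (q div gcd q 6)) \<le> 8000 * real T ^ 3 * main_size (real N) (2 * Q)"
    using h4 hF by linarith
  then show ?thesis by (intro order_trans[OF h] mult_left_mono A0)
qed

text \<open>Since \<open>n \<le> sqrt Q\<close>, each of the three terms is at most a constant times \<open>n\<^sup>2 * Q powr (5/2)\<close>.\<close>

lemma main_size_le:
  assumes Q: "Q \<ge> 1" and y: "y \<le> 1" and n: "n \<ge> 0" "n\<^sup>2 \<le> Q * y"
  shows "main_size n (2 * Q) \<le> 11 * y * (Q ^ 3 * sqrt Q)"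
proof -
  have "0 \<le> Q * y" using n(2) zero_le_power2[of n] by linarith
  then have y0: "y \<ge> 0" using Q by (simp add: zero_le_mult_iff)
  have "Q * y \<le> Q * 1" using Q y by (intro mult_left_mono) auto
  then have nQ: "n\<^sup>2 \<le> Q" using n(2) by simp
  then have ns: "n \<le> sqrt Q" using n(1) by (simp add: real_le_rsqrt)
  have s2: "sqrt (2 * Q) \<le> 3 / 2 * sqrt Q"
  proof -
    have "sqrt 2 \<le> sqrt ((3 / 2)\<^sup>2)" by (rule real_sqrt_le_mono) (simp add: power2_eq_square)
    then have "sqrt 2 \<le> 3 / 2" by simp
    then show ?thesis unfolding real_sqrt_mult using Q by (intro mult_right_mono) auto
  qed
  have n4: "n ^ 4 \<le> (Q * y) * Q"
  proof -
    have "n ^ 4 = n\<^sup>2 * n\<^sup>2" by (simp add: numeral_eq_Suc)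
    also have "\<dots> \<le> (Q * y) * Q" using n nQ Q y0 by (intro mult_mono) auto
    finally show ?thesis .
  qed
  have "n ^ 5 * (2 * Q) \<le> ((Q * y) * Q * sqrt Q) * (2 * Q)"
  proof -
    have "n ^ 5 = n ^ 4 * n" by (simp add: numeral_eq_Suc)
    also have "\<dots> \<le> ((Q * y) * Q) * sqrt Q" using n4 ns n Q y0 by (intro mult_mono) auto
    finally show ?thesis using Q by (intro mult_right_mono) auto
  qed
  moreover have "n ^ 4 * (2 * Q * sqrt (2 * Q)) \<le> ((Q * y) * Q) * (2 * Q * (3 / 2 * sqrt Q))"
  proof (rule mult_mono[OF n4])
    show "2 * Q * sqrt (2 * Q) \<le> 2 * Q * (3 / 2 * sqrt Q)" using Q by (intro mult_left_mono[OF s2]) auto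
    show "0 \<le> Q * y * Q" "0 \<le> 2 * Q * sqrt (2 * Q)" using Q y0 by simp_all
  qed
  moreover have "n\<^sup>2 * ((2 * Q)\<^sup>2 * sqrt (2 * Q)) \<le> (Q * y) * ((2 * Q)\<^sup>2 * (3 / 2 * sqrt Q))"
  proof (rule mult_mono[OF n(2)])
    show "(2 * Q)\<^sup>2 * sqrt (2 * Q) \<le> (2 * Q)\<^sup>2 * (3 / 2 * sqrt Q)" by (intro mult_left_mono[OF s2]) auto
    show "0 \<le> Q * y" "0 \<le> (2 * Q)\<^sup>2 * sqrt (2 * Q)" using Q y0 by simp_all
  qed
  ultimately have "main_size n (2 * Q) \<le> ((Q * y) * Q * sqrt Q) * (2 * Q) + ((Q * y) * Q) * (2 * Q * (3 / 2 * sqrt Q))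
      + (Q * y) * ((2 * Q)\<^sup>2 * (3 / 2 * sqrt Q))" unfolding main_size_def by linarith
  also have "\<dots> = 11 * y * (Q ^ 3 * sqrt Q)" by (simp add: power2_eq_square power3_eq_cube)
  finally show ?thesis .
qed

lemma quartic_box_eq_form_box:
  assumes "r \<ge> 0" shows "quartic_box r = form_box (nat \<lfloor>r\<rfloor>)"
proof -
  have "\<bar>real_of_int a\<bar> \<le> r \<longleftrightarrow> a \<in> {- int (nat \<lfloor>r\<rfloor>)..int (nat \<lfloor>r\<rfloor>)}" for a
  proof -
    have "\<bar>real_of_int a\<bar> \<le> r \<longleftrightarrow> \<bar>a\<bar> \<le> \<lfloor>r\<rfloor>" by (simp add: le_floor_iff)
    also have "\<dots> \<longleftrightarrow> a \<in> {- int (nat \<lfloor>r\<rfloor>)..int (nat \<lfloor>r\<rfloor>)}" using assms by auto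
    finally show ?thesis .
  qed
  then show ?thesis unfolding quartic_box_def form_box_def by blast
qed

theorem corollary4p1:
  fixes \<alpha> :: real
  assumes "\<alpha> < 1 / 3"
  shows "\<exists>c \<eta> :: real. c < 5 / 6 \<and> \<eta> > 0 \<and>
    (\<exists>C :: real. \<forall>\<^sub>F X :: real in at_top. \<forall>Q :: real. 0 < Q \<and> Q < X powr \<alpha> \<longrightarrow>
      X powr (5 / 6) *
        (\<Sum>q | squarefree q \<and> Q \<le> real q \<and> real q \<le> 2 * Q.
          \<Sum>f \<in> quartic_box (Q * X powr (\<eta> - 1 / 6)) - {0}. cmod (Phi_hat q f))
      \<le> C * X powr c)"
proof -
  \<comment> \<open>With this choice r^2 / Q = Q * X powr (2 * \<eta> - 1 / 3) is at most X powr (- 2 * \<eta>).\<close>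
  define \<eta> where "\<eta> = (1 / 3 - \<alpha>) / 4"
  have "\<eta> > 0" unfolding \<eta>_def using assms by simp
  moreover have "\<alpha> = 1 / 3 - 4 * \<eta>" unfolding \<eta>_def by (simp add: field_simps)
  ultimately have \<eta>: "\<eta> > 0" "\<alpha> = 1 / 3 - 4 * \<eta>" .
  \<comment> \<open>The divisor bound is used once for the modulus and, for numbers of size X powr 10, in a third power.\<close>
  define \<epsilon> where "\<epsilon> = \<eta> / 31"
  have \<epsilon>: "\<epsilon> > 0" "31 * \<epsilon> = \<eta>" unfolding \<epsilon>_def using \<eta> by auto
  obtain B where B1: "B \<ge> 1" and B: "\<And>n. n > 0 \<Longrightarrow> 35 ^ card (prime_factors n) * real (divisor_count n) \<le> B * real n powr \<epsilon>"
    using divisor_bound[of 35 \<epsilon>] \<epsilon>(1) by auto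
  have dc: "real (divisor_count n) \<le> B * real n powr \<epsilon>" if "n > 0" for n
  proof -
    have "1 * real (divisor_count n) \<le> 35 ^ card (prime_factors n) * real (divisor_count n)"
      by (intro mult_right_mono one_le_power) auto
    then show ?thesis using B[OF that] by linarith
  qed
  define b where "b = B * (10 ^ 6) powr \<epsilon>"
  have b0: "b \<ge> 0" unfolding b_def using B1 by simp
  define C where "C = B * 2 powr \<epsilon> * 648 * (8000 * b ^ 3 * 11)"
  have C0: "C \<ge> 0" unfolding C_def using B1 b0 by simp
  have main: "X powr (5 / 6) * (\<Sum>q | squarefree q \<and> Q \<le> real q \<and> real q \<le> 2 * Q.
      \<Sum>f \<in> quartic_box (Q * X powr (\<eta> - 1 / 6)) - {0}. cmod (Phi_hat q f)) \<le> C * X powr (5 / 6 - \<eta>)"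
    if X: "X \<ge> 1" and Q: "0 < Q" "Q < X powr \<alpha>" for X Q
  proof -
    define r where "r = Q * X powr (\<eta> - 1 / 6)"
    define N where "N = nat \<lfloor>r\<rfloor>"
    have r0: "r \<ge> 0" unfolding r_def using Q by simp
    have box: "quartic_box r = form_box N" unfolding N_def by (rule quartic_box_eq_form_box[OF r0])
    let ?s = "\<Sum>q | squarefree q \<and> Q \<le> real q \<and> real q \<le> 2 * Q. \<Sum>f\<in>form_box N - {0}. cmod (Phi_hat q f)"
    have "?s \<le> C * X powr (- \<eta>)"
    \<comment> \<open>For r < 1 the box contains only the zero form, and the sum is empty.\<close>
    proof (cases "N = 0")
      case True
      have "f = 0" if "f \<in> form_box N" for f
        using that unfolding True by (cases f) (auto simp: form_box_coeffs zero_quartic_def)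
      then have e: "form_box N - {0} = {}" by blast
      show ?thesis unfolding e using C0 by simp
    next
      case False
      let ?y = "X powr (- 2 * \<eta>)"
      have Nr: "real N \<le> r" unfolding N_def using r0 by simp
      have N1: "real N \<ge> 1" using False by simp
      have y1: "?y \<le> 1" using X \<eta>(1) powr_mono[of "- 2 * \<eta>" 0 X] by simp
      have "r\<^sup>2 = Q * (Q * (X powr (\<eta> - 1 / 6) * X powr (\<eta> - 1 / 6)))" unfolding r_def power2_eq_square by (simp only: mult_ac)
      also have "X powr (\<eta> - 1 / 6) * X powr (\<eta> - 1 / 6) = X powr (2 * \<eta> - 1 / 3)" by (simp add: powr_add[symmetric])
      also have "Q * (Q * X powr (2 * \<eta> - 1 / 3)) \<le> Q * (X powr \<alpha> * X powr (2 * \<eta> - 1 / 3))"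
        using Q by (intro mult_left_mono mult_right_mono) auto
      also have "X powr \<alpha> * X powr (2 * \<eta> - 1 / 3) = ?y" unfolding \<eta>(2) by (simp add: powr_add[symmetric])
      finally have r2: "r\<^sup>2 \<le> Q * ?y" .
      have "(real N)\<^sup>2 \<le> r\<^sup>2" using Nr by (intro power_mono) auto
      then have N2: "(real N)\<^sup>2 \<le> Q * ?y" using r2 by linarith
      have "Q * ?y \<le> Q * 1" using y1 Q(1) by (intro mult_left_mono) auto
      then have NQ: "(real N)\<^sup>2 \<le> Q" using N2 by linarith
      have "1 \<le> (real N)\<^sup>2" using N1 by (rule one_le_power)
      then have Q1: "Q \<ge> 1" using NQ by linarith
      have QX: "Q \<le> X" using Q(2) X assms powr_mono[of \<alpha> 1 X] by simp
      have "real N * 1 \<le> real N * real N" using N1 by (intro mult_left_mono) auto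
      then have NX: "real N \<le> X" using NQ QX by (simp add: power2_eq_square)
      \<comment> \<open>A bound for the number of divisors of all integers attached to forms of the box.\<close>
      define T where "T = nat \<lfloor>B * real (size_bound N) powr \<epsilon>\<rfloor>"
      have T: "divisor_count n \<le> T" if "0 < n" "n \<le> size_bound N" for n
        unfolding T_def
      proof (rule le_nat_floor)
        have "real (divisor_count n) \<le> B * real n powr \<epsilon>" by (rule dc[OF that(1)])
        also have "\<dots> \<le> B * real (size_bound N) powr \<epsilon>" using that(2) \<epsilon>(1) B1 by (intro mult_left_mono powr_mono2) auto
        finally show "real (divisor_count n) \<le> B * real (size_bound N) powr \<epsilon>" .
      qed
      have "1 \<le> size_bound N" unfolding size_bound_def using False by simp
      moreover have "divisor_count 1 = 1" unfolding divisor_count_def by simp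
      ultimately have T1: "T \<ge> 1" using T[of 1] by simp
      have Tb: "real T \<le> b * X powr (10 * \<epsilon>)"
      proof -
        have "real T \<le> B * real (size_bound N) powr \<epsilon>" unfolding T_def using B1 by simp
        also have "\<dots> \<le> B * (10 ^ 6 * X ^ 10) powr \<epsilon>"
        proof (intro mult_left_mono powr_mono2)
          have "real N ^ 10 \<le> X ^ 10" using NX by (intro power_mono) auto
          then show "real (size_bound N) \<le> 10 ^ 6 * X ^ 10" unfolding size_bound_def by simp
        qed (use \<epsilon> B1 in auto)
        also have "\<dots> = b * X powr (10 * \<epsilon>)"
        proof -
          have "X ^ 10 = X powr 10" using X by (simp add: powr_numeral)
          then have "(X ^ 10) powr \<epsilon> = (X powr 10) powr \<epsilon>" by (simp only:)
          then have x: "(X ^ 10) powr \<epsilon> = X powr (10 * \<epsilon>)" by (simp only: powr_powr)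
          show ?thesis unfolding b_def powr_mult x by (simp only: mult.assoc)
        qed
        finally show ?thesis .
      qed
      have T3: "real T ^ 3 \<le> b ^ 3 * X powr (30 * \<epsilon>)"
      proof -
        have "real T ^ 3 \<le> (b * X powr (10 * \<epsilon>)) ^ 3" using Tb by (rule power_mono) simp
        also have "\<dots> = b ^ 3 * X powr (30 * \<epsilon>)" using X by (simp add: power_mult_distrib powr_power mult.commute)
        finally show ?thesis .
      qed
      have Q0: "Q ^ 3 * sqrt Q > 0" using Q(1) by simp
      have "?s \<le> B * (2 * Q) powr \<epsilon> * (648 / (Q ^ 3 * sqrt Q)) * (8000 * real T ^ 3 * main_size (real N) (2 * Q))"
        using B1 by (intro Phi_hat_sum_le B \<epsilon> Q T1 T) auto
      also have "\<dots> \<le> B * (2 powr \<epsilon> * X powr \<epsilon>) * (648 / (Q ^ 3 * sqrt Q))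
          * (8000 * (b ^ 3 * X powr (30 * \<epsilon>)) * (11 * ?y * (Q ^ 3 * sqrt Q)))"
      proof (rule mult_mono)
        have "(2 * Q) powr \<epsilon> \<le> (2 * X) powr \<epsilon>" using Q(1) QX \<epsilon>(1) by (intro powr_mono2) auto
        then have "(2 * Q) powr \<epsilon> \<le> 2 powr \<epsilon> * X powr \<epsilon>" using X by (simp add: powr_mult)
        then show "B * (2 * Q) powr \<epsilon> * (648 / (Q ^ 3 * sqrt Q)) \<le> B * (2 powr \<epsilon> * X powr \<epsilon>) * (648 / (Q ^ 3 * sqrt Q))"
          using B1 Q0 by (intro mult_right_mono mult_left_mono) auto
        show "8000 * real T ^ 3 * main_size (real N) (2 * Q)
            \<le> 8000 * (b ^ 3 * X powr (30 * \<epsilon>)) * (11 * ?y * (Q ^ 3 * sqrt Q))"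
        proof (rule mult_mono)
          show "8000 * real T ^ 3 \<le> 8000 * (b ^ 3 * X powr (30 * \<epsilon>))" using T3 by simp
          show "main_size (real N) (2 * Q) \<le> 11 * ?y * (Q ^ 3 * sqrt Q)"
            by (rule main_size_le[OF Q1 y1 _ N2]) simp
          show "0 \<le> 8000 * (b ^ 3 * X powr (30 * \<epsilon>))" using b0 by simp
          show "0 \<le> main_size (real N) (2 * Q)" unfolding main_size_def using Q(1) by simp
        qed
        show "0 \<le> B * (2 powr \<epsilon> * X powr \<epsilon>) * (648 / (Q ^ 3 * sqrt Q))" using B1 Q0 by simp
        show "0 \<le> 8000 * real T ^ 3 * main_size (real N) (2 * Q)" unfolding main_size_def using Q(1) by simp
      qed
      also have "\<dots> = C * (X powr \<epsilon> * X powr (30 * \<epsilon>) * ?y)" unfolding C_def using Q(1) by simp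
      also have "X powr \<epsilon> * X powr (30 * \<epsilon>) * ?y = X powr (- \<eta>)"
        unfolding powr_add[symmetric] by (rule arg_cong[where f = "(powr) X"]) (use \<epsilon>(2) in linarith)
      finally show ?thesis .
    qed
    then have "X powr (5 / 6) * ?s \<le> X powr (5 / 6) * (C * X powr (- \<eta>))" by (intro mult_left_mono) auto
    also have "\<dots> = C * X powr (5 / 6 - \<eta>)"
    proof -
      have "X powr (5 / 6 - \<eta>) = X powr (5 / 6) * X powr (- \<eta>)" unfolding powr_add[symmetric] by simp
      then show ?thesis by simp
    qed
    finally show ?thesis unfolding r_def[symmetric] box .
  qed
  have "\<forall>\<^sub>F X :: real in at_top. \<forall>Q :: real. 0 < Q \<and> Q < X powr \<alpha> \<longrightarrow>
      X powr (5 / 6) *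
        (\<Sum>q | squarefree q \<and> Q \<le> real q \<and> real q \<le> 2 * Q.
          \<Sum>f \<in> quartic_box (Q * X powr (\<eta> - 1 / 6)) - {0}. cmod (Phi_hat q f))
      \<le> C * X powr (5 / 6 - \<eta>)"
    by (rule eventually_at_top_linorderI[of 1]) (use main in blast)
  then have ex: "\<exists>C :: real. \<forall>\<^sub>F X :: real in at_top. \<forall>Q :: real. 0 < Q \<and> Q < X powr \<alpha> \<longrightarrow>
      X powr (5 / 6) *
        (\<Sum>q | squarefree q \<and> Q \<le> real q \<and> real q \<le> 2 * Q.
          \<Sum>f \<in> quartic_box (Q * X powr (\<eta> - 1 / 6)) - {0}. cmod (Phi_hat q f))
      \<le> C * X powr (5 / 6 - \<eta>)" by (rule exI[of _ C])
  have lt: "5 / 6 - \<eta> < 5 / 6" using \<eta>(1) by simp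
  show ?thesis by (rule exI[of _ "5 / 6 - \<eta>"], rule exI[of _ \<eta>], intro conjI lt \<eta>(1) ex)
qed

end
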